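(* Let $H$ be a finite-dimensional Hopf algebra. The functor $$\mathfrak E'_M:\mathfrak{YD}^{lr}(H,\widehat H)\to\mathfrak{Alg}^{\mathcal T_M(H)},\qquad(X,\alpha,\beta)\mapsto(X,\gamma=(\Sigma\alpha\otimes\mathrm{id})\beta),\qquad f\mapsto f,$$ is an equivalence of categories. Moreover, the following assignments, all acting as the identity on morphisms, form a commutative square of equivalences of categories: $\mathfrak{YD}^{lr}(H,\widehat H)\to\mathfrak{Alg}^{\mathcal T_M(H)}$, $(X,\alpha,\beta)\mapsto(X,\gamma)$; $\mathfrak{Alg}^{\mathcal T_M(H)}\to{}_{\mathcal D_M(H)}\mathfrak{Alg}$, $(X,\gamma)\mapsto(X,\rhd_\gamma)$; $\mathfrak{YD}^{lr}(H,\widehat H)\to{}^H_H\mathfrak{YD}$, $(X,\alpha,\beta)\mapsto(X,\rhd_\beta,\alpha)$; and ${}^H_H\mathfrak{YD}\to{}_{\mathcal D_M(H)}\mathfrak{Alg}$, $(X,\rhd,\alpha)\mapsto(X,\cdot)$ with $(\omega^{\mathrm{op}}\bowtie h)\cdot x=(\mathbf p(\cdot,\omega)\otimes\mathrm{id})(\alpha(h\rhd x))$.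
   Context: $\Bbbk$ is a field, algebras are unital $\Bbbk$-algebras. $H$ has structure maps $\Delta,\varepsilon,S$ ($S$ bijective), with Sweedler notation; $\widehat H$ is the dual Hopf algebra (coproduct $\widehat\Delta$) and $\mathbf p(h,\theta)=\theta(h)$, with $\mathbf p(h,\theta\theta')=\mathbf p(h_{(1)},\theta)\mathbf p(h_{(2)},\theta')$, $\mathbf p(hh',\theta)=\mathbf p(h,\theta_{(1)})\mathbf p(h',\theta_{(2)})$. $U=\sum_ih_i\otimes\widehat h_i\in H\otimes\widehat H$ (dual bases), invertible with $U^{-1}=(S\otimes\mathrm{id})(U)$; $U_{13}$ is $U$ in legs 1 and 3; $\mathrm{Ad}(W)(z)=WzW^{-1}$; $\Sigma$ is the flip. Left/right coactions of a Hopf algebra $K$ on an algebra $X$ are algebra homomorphisms $X\to K\otimes X$ / $X\to X\otimes K$ that are coassociative and counital; left actions are left $K$-module algebra structures. ${}_K\mathfrak{Alg}$ is the category of left $K$-module algebras and $\mathfrak{Alg}^K$ that of right $K$-comodule algebras, with morphisms the algebra homomorphisms commuting with the (co)actions. Every right coaction $\gamma$ of $K$ induces the left action $\omega\rhd_\gamma x=(\mathrm{id}\otimes\omega)(\gamma(x))$ of the dual Hopf algebra of $K$. $\mathfrak{YD}^{lr}(H,\widehat H)$: objects are triples $(X,\alpha,\beta)$, with $\alpha:X\to H\otimes X$ a left coaction of $H$ and $\beta:X\to X\otimes\widehat H$ a right coaction of $\widehat H$ on an algebra $X$ such that $(\alpha\otimes\mathrm{id})\beta=\mathrm{Ad}(U_{13})(\mathrm{id}\otimes\beta)\alpha$;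 morphisms are algebra homomorphisms intertwining both coactions. ${}^H_H\mathfrak{YD}$: objects are triples $(X,\rhd,\alpha)$, with $\rhd$ a left action and $\alpha(x)=x_{[-1]}\otimes x_{[0]}$ a left coaction of $H$ on an algebra $X$ such that $h_{(1)}x_{[-1]}\otimes(h_{(2)}\rhd x_{[0]})=(h_{(1)}\rhd x)_{[-1]}h_{(2)}\otimes(h_{(1)}\rhd x)_{[0]}$; morphisms are algebra homomorphisms intertwining action and coaction. $h\rhd_\beta x=(\mathrm{id}\otimes\mathbf p(h,\cdot))(\beta(x))$. $\mathcal T_M(H)=H^{\mathrm{co}}\otimes\widehat H$ ($H^{\mathrm{co}}$: co-opposite Hopf algebra, coproduct $\Delta^{\mathrm{co}}=\Sigma\Delta$) is the Hopf algebra with the tensor product algebra structure and coproduct $(\mathrm{id}\otimes\Sigma\,\mathrm{Ad}(U^{-1})\otimes\mathrm{id})(\Delta^{\mathrm{co}}\otimes\widehat\Delta)$. $\mathcal D_M(H)=\widehat H^{\mathrm{op}}\bowtie H$ (Majid's form of the Drinfeld double) is its dual Hopf algebra, with underlying space $\widehat H^{\mathrm{op}}\otimes H$ and pairing $(\omega^{\mathrm{op}}\bowtie h,\ g\otimes\theta)\mapsto\mathbf p(g,\omega)\mathbf p(h,\theta)$. *)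

theory Defs
  imports "HOL-Algebra.Module"
begin

section \<open>Linear maps, bases, algebras\<close>

definition linear_map ::
    "('k,'l) ring_scheme \<Rightarrow> ('k,'a,'m) module_scheme \<Rightarrow> ('k,'b,'n) module_scheme \<Rightarrow> ('a \<Rightarrow> 'b) \<Rightarrow> bool"
  where "linear_map k V W f \<longleftrightarrow>
    f \<in> carrier V \<rightarrow> carrier W \<and>
    (\<forall>x\<in>carrier V. \<forall>y\<in>carrier V. f (x \<oplus>\<^bsub>V\<^esub> y) = f x \<oplus>\<^bsub>W\<^esub> f y) \<and>
    (\<forall>c\<in>carrier k. \<forall>x\<in>carrier V. f (c \<odot>\<^bsub>V\<^esub> x) = c \<odot>\<^bsub>W\<^esub> f x)"

definition linear_form ::
    "('k,'l) ring_scheme \<Rightarrow> ('k,'a,'m) module_scheme \<Rightarrow> ('a \<Rightarrow> 'k) \<Rightarrow> bool"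
  where "linear_form k V f \<longleftrightarrow>
    f \<in> carrier V \<rightarrow> carrier k \<and>
    (\<forall>x\<in>carrier V. \<forall>y\<in>carrier V. f (x \<oplus>\<^bsub>V\<^esub> y) = f x \<oplus>\<^bsub>k\<^esub> f y) \<and>
    (\<forall>c\<in>carrier k. \<forall>x\<in>carrier V. f (c \<odot>\<^bsub>V\<^esub> x) = c \<otimes>\<^bsub>k\<^esub> f x)"

definition bilinear_map ::
    "('k,'l) ring_scheme \<Rightarrow> ('k,'a,'m) module_scheme \<Rightarrow> ('k,'b,'n) module_scheme
      \<Rightarrow> ('k,'c,'o) module_scheme \<Rightarrow> ('a \<Rightarrow> 'b \<Rightarrow> 'c) \<Rightarrow> bool"
  where "bilinear_map k V W Z f \<longleftrightarrow>
    (\<forall>v\<in>carrier V. linear_map k W Z (f v)) \<and>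
    (\<forall>w\<in>carrier W. linear_map k V Z (\<lambda>v. f v w))"

definition basis ::
    "('k,'l) ring_scheme \<Rightarrow> ('k,'a,'m) module_scheme \<Rightarrow> nat \<Rightarrow> (nat \<Rightarrow> 'a) \<Rightarrow> bool"
  where "basis k V n h \<longleftrightarrow>
    h \<in> {..<n} \<rightarrow> carrier V \<and>
    (\<forall>x\<in>carrier V. \<exists>!c. c \<in> {..<n} \<rightarrow>\<^sub>E carrier k \<and> x = (\<Oplus>\<^bsub>V\<^esub>i\<in>{..<n}. c i \<odot>\<^bsub>V\<^esub> h i))"

definition finite_dimensional :: "('k,'l) ring_scheme \<Rightarrow> ('k,'a,'m) module_scheme \<Rightarrow> bool"
  where "finite_dimensional k V \<longleftrightarrow> (\<exists>n h. basis k V n h)"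

text \<open>The locale \<^locale>\<open>algebra\<close> of the library is about commutative algebras.\<close>

definition k_algebra :: "('k,'l) ring_scheme \<Rightarrow> ('k,'a,'m) module_scheme \<Rightarrow> bool"
  where "k_algebra k A \<longleftrightarrow> module k A \<and> ring A \<and>
    (\<forall>c\<in>carrier k. \<forall>x\<in>carrier A. \<forall>y\<in>carrier A.
      (c \<odot>\<^bsub>A\<^esub> x) \<otimes>\<^bsub>A\<^esub> y = c \<odot>\<^bsub>A\<^esub> (x \<otimes>\<^bsub>A\<^esub> y) \<and>
      x \<otimes>\<^bsub>A\<^esub> (c \<odot>\<^bsub>A\<^esub> y) = c \<odot>\<^bsub>A\<^esub> (x \<otimes>\<^bsub>A\<^esub> y))"

definition alg_hom ::
    "('k,'l) ring_scheme \<Rightarrow> ('k,'a,'m) module_scheme \<Rightarrow> ('k,'b,'n) module_scheme \<Rightarrow> ('a \<Rightarrow> 'b) set"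
  where "alg_hom k A B = {f \<in> ring_hom A B. linear_map k A B f}"

definition Ad :: "('a,'m) ring_scheme \<Rightarrow> 'a \<Rightarrow> 'a \<Rightarrow> 'a"
  where "Ad A w z = w \<otimes>\<^bsub>A\<^esub> z \<otimes>\<^bsub>A\<^esub> inv\<^bsub>A\<^esub> w"


section \<open>Tensor products\<close>

text \<open>
  A list \<open>[(v\<^sub>1, w\<^sub>1), \<dots>, (v\<^sub>n, w\<^sub>n)]\<close> stands for the formal sum of the
  \<open>v\<^sub>i \<otimes> w\<^sub>i\<close>; the tensor product consists of the formal sums modulo the congruence
  generated by commutativity and bilinearity.  Additive inverses and scalar multiples need no
  separate generators since they can be absorbed into one factor.  The universal property is
  proved below.
\<close>

type_synonym ('a, 'b) tensor = "('a \<times> 'b) list set"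

inductive_set tensor_rel ::
    "('k,'l) ring_scheme \<Rightarrow> ('k,'a,'m) module_scheme \<Rightarrow> ('k,'b,'n) module_scheme
      \<Rightarrow> (('a \<times> 'b) list \<times> ('a \<times> 'b) list) set"
  for k V W where
  refl: "l \<in> lists (carrier V \<times> carrier W) \<Longrightarrow> (l, l) \<in> tensor_rel k V W"
| sym: "(l, l') \<in> tensor_rel k V W \<Longrightarrow> (l', l) \<in> tensor_rel k V W"
| trans: "(l, l') \<in> tensor_rel k V W \<Longrightarrow> (l', l'') \<in> tensor_rel k V W \<Longrightarrow> (l, l'') \<in> tensor_rel k V W"
| app: "(l, l') \<in> tensor_rel k V W \<Longrightarrow> m \<in> lists (carrier V \<times> carrier W)
    \<Longrightarrow> (l @ m, l' @ m) \<in> tensor_rel k V W"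
| comm: "l \<in> lists (carrier V \<times> carrier W) \<Longrightarrow> m \<in> lists (carrier V \<times> carrier W)
    \<Longrightarrow> (l @ m, m @ l) \<in> tensor_rel k V W"
| zero: "w \<in> carrier W \<Longrightarrow> ([(\<zero>\<^bsub>V\<^esub>, w)], []) \<in> tensor_rel k V W"
| add_left: "v \<in> carrier V \<Longrightarrow> v' \<in> carrier V \<Longrightarrow> w \<in> carrier W
    \<Longrightarrow> ([(v \<oplus>\<^bsub>V\<^esub> v', w)], [(v, w), (v', w)]) \<in> tensor_rel k V W"
| add_right: "v \<in> carrier V \<Longrightarrow> w \<in> carrier W \<Longrightarrow> w' \<in> carrier W
    \<Longrightarrow> ([(v, w \<oplus>\<^bsub>W\<^esub> w')], [(v, w), (v, w')]) \<in> tensor_rel k V W"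
| scalar: "c \<in> carrier k \<Longrightarrow> v \<in> carrier V \<Longrightarrow> w \<in> carrier W
    \<Longrightarrow> ([(c \<odot>\<^bsub>V\<^esub> v, w)], [(v, c \<odot>\<^bsub>W\<^esub> w)]) \<in> tensor_rel k V W"

definition tclass ::
    "('k,'l) ring_scheme \<Rightarrow> ('k,'a,'m) module_scheme \<Rightarrow> ('k,'b,'n) module_scheme
      \<Rightarrow> ('a \<times> 'b) list \<Rightarrow> ('a, 'b) tensor"
  where "tclass k V W l = tensor_rel k V W `` {l}"

definition pure ::
    "('k,'l) ring_scheme \<Rightarrow> ('k,'a,'m) module_scheme \<Rightarrow> ('k,'b,'n) module_scheme
      \<Rightarrow> 'a \<Rightarrow> 'b \<Rightarrow> ('a, 'b) tensor"
  where "pure k V W v w = tclass k V W [(v, w)]"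

definition trep :: "('a, 'b) tensor \<Rightarrow> ('a \<times> 'b) list"
  where "trep t = (SOME l. l \<in> t)"

text \<open>
  The multiplication is only meaningful if \<open>V\<close> and \<open>W\<close> are algebras; for bare modules it is junk
  and is never used.
\<close>

definition tensor ::
    "('k,'l) ring_scheme \<Rightarrow> ('k,'a,'m) module_scheme \<Rightarrow> ('k,'b,'n) module_scheme
      \<Rightarrow> ('k, ('a, 'b) tensor) module"
  where "tensor k V W =
   \<lparr>carrier = lists (carrier V \<times> carrier W) // tensor_rel k V W,
    mult = (\<lambda>s t. tclass k V W
      [(v \<otimes>\<^bsub>V\<^esub> v', w \<otimes>\<^bsub>W\<^esub> w'). (v, w) \<leftarrow> trep s, (v', w') \<leftarrow> trep t]),
    one = pure k V W \<one>\<^bsub>V\<^esub> \<one>\<^bsub>W\<^esub>,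
    zero = tclass k V W [],
    add = (\<lambda>s t. tclass k V W (trep s @ trep t)),
    smult = (\<lambda>c t. tclass k V W [(c \<odot>\<^bsub>V\<^esub> v, w). (v, w) \<leftarrow> trep t])\<rparr>"

text \<open>
  The linear map \<open>V \<otimes> W \<rightarrow> Z\<close> induced by a bilinear map \<open>f : V \<times> W \<rightarrow> Z\<close>.
  Only the additive structure of \<open>Z\<close> enters, so \<open>Z\<close> may also be the field \<open>k\<close> itself.
\<close>

definition tsum :: "('c,'o) ring_scheme \<Rightarrow> ('a \<Rightarrow> 'b \<Rightarrow> 'c) \<Rightarrow> ('a \<times> 'b) list \<Rightarrow> 'c"
  where "tsum Z f l = foldr (\<lambda>(v, w) z. f v w \<oplus>\<^bsub>Z\<^esub> z) l \<zero>\<^bsub>Z\<^esub>"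

definition tlift ::
    "('k,'l) ring_scheme \<Rightarrow> ('k,'a,'m) module_scheme \<Rightarrow> ('k,'b,'n) module_scheme
      \<Rightarrow> ('c,'o) ring_scheme \<Rightarrow> ('a \<Rightarrow> 'b \<Rightarrow> 'c) \<Rightarrow> ('a, 'b) tensor \<Rightarrow> 'c"
  where "tlift k V W Z f = (\<lambda>t\<in>carrier (tensor k V W). tsum Z f (trep t))"

subsection \<open>The universal property\<close>

lemma tensor_rel_lists:
  assumes "module k V" "module k W" "(l, l') \<in> tensor_rel k V W"
  shows "l \<in> lists (carrier V \<times> carrier W) \<and> l' \<in> lists (carrier V \<times> carrier W)"
proof -
  interpret V: module k V by fact
  interpret W: module k W by fact
  from assms(3) show ?thesis by induction auto
qed

lemma tensor_rel_equiv:
  assumes "module k V" "module k W"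
  shows "equiv (lists (carrier V \<times> carrier W)) (tensor_rel k V W)"
proof (rule equivI)
  show "tensor_rel k V W \<subseteq> lists (carrier V \<times> carrier W) \<times> lists (carrier V \<times> carrier W)"
    using tensor_rel_lists[OF assms] by fast
  show "refl_on (lists (carrier V \<times> carrier W)) (tensor_rel k V W)"
    by (rule refl_onI) (rule tensor_rel.refl)
  show "sym (tensor_rel k V W)" by (rule symI) (rule tensor_rel.sym)
  show "trans (tensor_rel k V W)" by (rule transI) (rule tensor_rel.trans)
qed

lemma tclass_eqI: "(l, l') \<in> tensor_rel k V W \<Longrightarrow> tclass k V W l = tclass k V W l'"
  by (auto simp: tclass_def intro: tensor_rel.trans tensor_rel.sym)

lemma tclass_in_carrier:
  "l \<in> lists (carrier V \<times> carrier W) \<Longrightarrow> tclass k V W l \<in> carrier (tensor k V W)"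
  by (auto simp: tensor_def tclass_def quotient_def)

lemma trep_tclass:
  assumes "l \<in> lists (carrier V \<times> carrier W)"
  shows "(l, trep (tclass k V W l)) \<in> tensor_rel k V W"
proof -
  have "l \<in> tclass k V W l" using assms by (simp add: tclass_def tensor_rel.refl)
  then have "trep (tclass k V W l) \<in> tclass k V W l" unfolding trep_def by (rule someI)
  then show ?thesis by (simp add: tclass_def)
qed

lemma tensor_cases:
  assumes "t \<in> carrier (tensor k V W)"
  obtains l where "l \<in> lists (carrier V \<times> carrier W)" "t = tclass k V W l"
  using assms by (auto simp: tensor_def tclass_def quotient_def)

lemma add_tclass:
  assumes "l \<in> lists (carrier V \<times> carrier W)" "m \<in> lists (carrier V \<times> carrier W)"
    "module k V" "module k W"
  shows "tclass k V W l \<oplus>\<^bsub>tensor k V W\<^esub> tclass k V W m = tclass k V W (l @ m)"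
proof -
  let ?l = "trep (tclass k V W l)" and ?m = "trep (tclass k V W m)"
  let ?L = "lists (carrier V \<times> carrier W)"
  have l: "(l, ?l) \<in> tensor_rel k V W" and m: "(m, ?m) \<in> tensor_rel k V W"
    using assms by (auto intro: trep_tclass)
  have L: "?l \<in> ?L" "?m \<in> ?L"
    using tensor_rel_lists[OF assms(3,4)] l m by blast+
  have "(l @ m, ?l @ m) \<in> tensor_rel k V W" using l assms(2) by (rule tensor_rel.app)
  moreover have "(?l @ m, m @ ?l) \<in> tensor_rel k V W" using L(1) assms(2) by (rule tensor_rel.comm)
  moreover have "(m @ ?l, ?m @ ?l) \<in> tensor_rel k V W" using m L(1) by (rule tensor_rel.app)
  moreover have "(?m @ ?l, ?l @ ?m) \<in> tensor_rel k V W" using L(2,1) by (rule tensor_rel.comm)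
  ultimately have "(l @ m, ?l @ ?m) \<in> tensor_rel k V W" by (blast intro: tensor_rel.trans)
  then show ?thesis by (simp add: tensor_def tclass_eqI[symmetric])
qed

lemma tensor_rel_scale:
  assumes "module k V" "module k W" "c \<in> carrier k" "(l, l') \<in> tensor_rel k V W"
  shows "([(c \<odot>\<^bsub>V\<^esub> v, w). (v, w) \<leftarrow> l], [(c \<odot>\<^bsub>V\<^esub> v, w). (v, w) \<leftarrow> l']) \<in> tensor_rel k V W"
proof -
  interpret V: module k V by fact
  interpret W: module k W by fact
  have L: "map (\<lambda>(v, w). (c \<odot>\<^bsub>V\<^esub> v, w)) m \<in> lists (carrier V \<times> carrier W)"
    if "m \<in> lists (carrier V \<times> carrier W)" for m
    using that assms(3) by (induction m) (auto simp: case_prod_beta)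
  from assms(4) show ?thesis
  proof induction
    case (scalar d v w)
    have "([(d \<odot>\<^bsub>V\<^esub> (c \<odot>\<^bsub>V\<^esub> v), w)], [(c \<odot>\<^bsub>V\<^esub> v, d \<odot>\<^bsub>W\<^esub> w)]) \<in> tensor_rel k V W"
      using scalar assms(3) by (intro tensor_rel.scalar) auto
    moreover have "c \<odot>\<^bsub>V\<^esub> (d \<odot>\<^bsub>V\<^esub> v) = d \<odot>\<^bsub>V\<^esub> (c \<odot>\<^bsub>V\<^esub> v)"
      using scalar assms(3) by (metis V.R.m_comm V.smult_assoc1)
    ultimately show ?case by simp
  next
    case (zero w) then show ?case using assms(3) V.smult_r_null by (auto intro: tensor_rel.zero)
  next
    case (add_left v v' w) then show ?case
      using assms(3) by (auto simp: V.smult_r_distr intro: tensor_rel.add_left)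
  next
    case (trans l l' l'') then show ?case by (blast intro: tensor_rel.trans)
  qed (use assms(3) L in \<open>auto intro: tensor_rel.intros\<close>)
qed

lemma smult_tclass:
  assumes "l \<in> lists (carrier V \<times> carrier W)" "c \<in> carrier k" "module k V" "module k W"
  shows "c \<odot>\<^bsub>tensor k V W\<^esub> tclass k V W l = tclass k V W [(c \<odot>\<^bsub>V\<^esub> v, w). (v, w) \<leftarrow> l]"
  using tensor_rel_scale[OF assms(3,4,2) trep_tclass[OF assms(1)]]
  by (simp add: tensor_def tclass_eqI[symmetric])

lemma tsum_Cons: "tsum Z f ((v, w) # l) = f v w \<oplus>\<^bsub>Z\<^esub> tsum Z f l"
  by (simp add: tsum_def)

lemma tsum_closed:
  assumes "module k Z" "bilinear_map k V W Z f" "l \<in> lists (carrier V \<times> carrier W)"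
  shows "tsum Z f l \<in> carrier Z"
proof -
  interpret Z: module k Z by fact
  from assms(3) show ?thesis
    using assms(2) by induction (auto simp: tsum_def bilinear_map_def linear_map_def Pi_def)
qed

lemma tsum_append:
  assumes "module k Z" "bilinear_map k V W Z f"
    "l \<in> lists (carrier V \<times> carrier W)" "m \<in> lists (carrier V \<times> carrier W)"
  shows "tsum Z f (l @ m) = tsum Z f l \<oplus>\<^bsub>Z\<^esub> tsum Z f m"
proof -
  interpret Z: module k Z by fact
  note closed = tsum_closed[OF assms(1,2)]
  from assms(3) show ?thesis
  proof induction
    case Nil then show ?case using closed[OF assms(4)] by (simp add: tsum_def)
  next
    case (Cons p l)
    obtain v w where p: "p = (v, w)" by (cases p)
    have "f v w \<in> carrier Z"
      using assms(2) Cons(1) p by (auto simp: bilinear_map_def linear_map_def Pi_def)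
    then show ?case
      using Cons closed[OF Cons(2)] closed[OF assms(4)] p by (simp add: tsum_Cons Z.M.a_assoc)
  qed
qed

lemma tsum_rel:
  assumes "module k V" "module k W" "module k Z" "bilinear_map k V W Z f"
    "(l, l') \<in> tensor_rel k V W"
  shows "tsum Z f l = tsum Z f l'"
proof -
  interpret V: module k V by fact
  interpret W: module k W by fact
  interpret Z: module k Z by fact
  have cl: "\<And>v w. v \<in> carrier V \<Longrightarrow> w \<in> carrier W \<Longrightarrow> f v w \<in> carrier Z"
    and al: "\<And>v v' w. v \<in> carrier V \<Longrightarrow> v' \<in> carrier V \<Longrightarrow> w \<in> carrier W \<Longrightarrow>
      f (v \<oplus>\<^bsub>V\<^esub> v') w = f v w \<oplus>\<^bsub>Z\<^esub> f v' w"
    and ar: "\<And>v w w'. v \<in> carrier V \<Longrightarrow> w \<in> carrier W \<Longrightarrow> w' \<in> carrier W \<Longrightarrow>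
      f v (w \<oplus>\<^bsub>W\<^esub> w') = f v w \<oplus>\<^bsub>Z\<^esub> f v w'"
    and sl: "\<And>c v w. c \<in> carrier k \<Longrightarrow> v \<in> carrier V \<Longrightarrow> w \<in> carrier W \<Longrightarrow>
      f (c \<odot>\<^bsub>V\<^esub> v) w = c \<odot>\<^bsub>Z\<^esub> f v w"
    and sr: "\<And>c v w. c \<in> carrier k \<Longrightarrow> v \<in> carrier V \<Longrightarrow> w \<in> carrier W \<Longrightarrow>
      f v (c \<odot>\<^bsub>W\<^esub> w) = c \<odot>\<^bsub>Z\<^esub> f v w"
    using assms(4) by (auto simp: bilinear_map_def linear_map_def Pi_def)
  note closed = tsum_closed[OF assms(3,4)] and append = tsum_append[OF assms(3,4)]
  from assms(5) show ?thesis
  proof induction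
    case (app l l' m)
    have "l \<in> lists (carrier V \<times> carrier W)" "l' \<in> lists (carrier V \<times> carrier W)"
      using tensor_rel_lists[OF assms(1,2) app(1)] by auto
    then show ?case using app by (simp only: append)
  next
    case (comm l m)
    then show ?case using closed by (simp only: append Z.M.a_comm)
  next
    case (zero w)
    have "f \<zero>\<^bsub>V\<^esub> w = \<zero>\<^bsub>Z\<^esub>"
      using al[of "\<zero>\<^bsub>V\<^esub>" "\<zero>\<^bsub>V\<^esub>" w] cl[of "\<zero>\<^bsub>V\<^esub>" w] zero
      by (metis V.M.l_zero V.M.zero_closed Z.M.add.r_cancel_one)
    then show ?case by (simp add: tsum_def)
  next
    case (add_left v v' w) then show ?case
      by (simp add: tsum_def al cl Z.M.a_assoc)
  next
    case (add_right v w w') then show ?case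
      by (simp add: tsum_def ar cl Z.M.a_assoc)
  next
    case (scalar c v w) then show ?case
      by (simp add: tsum_def sl sr)
  qed auto
qed

lemma tlift_tclass:
  assumes "module k V" "module k W" "module k Z" "bilinear_map k V W Z f"
    "l \<in> lists (carrier V \<times> carrier W)"
  shows "tlift k V W Z f (tclass k V W l) = tsum Z f l"
  using tsum_rel[OF assms(1-4) trep_tclass[OF assms(5)]] tclass_in_carrier[OF assms(5), of k]
  by (simp add: tlift_def)

theorem tlift_pure:
  assumes "module k V" "module k W" "module k Z" "bilinear_map k V W Z f"
    "v \<in> carrier V" "w \<in> carrier W"
  shows "tlift k V W Z f (pure k V W v w) = f v w"
proof -
  interpret Z: module k Z by fact
  have "f v w \<in> carrier Z"
    using assms(4-6) by (auto simp: bilinear_map_def linear_map_def Pi_def)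
  then show ?thesis
    using assms by (simp add: pure_def tlift_tclass tsum_def)
qed

theorem tlift_linear:
  assumes "module k V" "module k W" "module k Z" "bilinear_map k V W Z f"
  shows "linear_map k (tensor k V W) Z (tlift k V W Z f)"
  unfolding linear_map_def
proof (intro conjI ballI)
  interpret V: module k V by fact
  interpret Z: module k Z by fact
  note closed = tsum_closed[OF assms(3,4)]
  show "tlift k V W Z f \<in> carrier (tensor k V W) \<rightarrow> carrier Z"
  proof
    fix t assume "t \<in> carrier (tensor k V W)"
    then obtain l where l: "l \<in> lists (carrier V \<times> carrier W)" "t = tclass k V W l"
      by (rule tensor_cases)
    then show "tlift k V W Z f t \<in> carrier Z"
      using closed[OF l(1)] assms by (simp only: tlift_tclass)
  qed
  show "tlift k V W Z f (s \<oplus>\<^bsub>tensor k V W\<^esub> t) = tlift k V W Z f s \<oplus>\<^bsub>Z\<^esub> tlift k V W Z f t"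
    if s: "s \<in> carrier (tensor k V W)" and t: "t \<in> carrier (tensor k V W)" for s t
  proof -
    obtain l where l: "l \<in> lists (carrier V \<times> carrier W)" "s = tclass k V W l"
      using s by (rule tensor_cases)
    obtain m where m: "m \<in> lists (carrier V \<times> carrier W)" "t = tclass k V W m"
      using t by (rule tensor_cases)
    have "l @ m \<in> lists (carrier V \<times> carrier W)" using l m by simp
    then show ?thesis
      using l m assms by (simp only: add_tclass tlift_tclass tsum_append)
  qed
  show "tlift k V W Z f (c \<odot>\<^bsub>tensor k V W\<^esub> t) = c \<odot>\<^bsub>Z\<^esub> tlift k V W Z f t"
    if c: "c \<in> carrier k" and t: "t \<in> carrier (tensor k V W)" for c t
  proof -
    obtain l where l: "l \<in> lists (carrier V \<times> carrier W)" "t = tclass k V W l"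
      using t by (rule tensor_cases)
    let ?m = "\<lambda>l. [(c \<odot>\<^bsub>V\<^esub> v, w). (v, w) \<leftarrow> l]"
    have "?m l \<in> lists (carrier V \<times> carrier W) \<and> tsum Z f (?m l) = c \<odot>\<^bsub>Z\<^esub> tsum Z f l"
      using l(1)
    proof induction
      case Nil then show ?case using c by (simp add: tsum_def Z.smult_r_null)
    next
      case (Cons p l)
      obtain v w where p: "p = (v, w)" by (cases p)
      with Cons have "v \<in> carrier V" "w \<in> carrier W" by auto
      then have "f v w \<in> carrier Z" "f (c \<odot>\<^bsub>V\<^esub> v) w = c \<odot>\<^bsub>Z\<^esub> f v w"
        using assms(4) c by (auto simp: bilinear_map_def linear_map_def Pi_def)
      then show ?case
        using Cons c p \<open>v \<in> carrier V\<close> \<open>w \<in> carrier W\<close> closed[OF Cons(2)]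
        by (simp add: tsum_Cons Z.smult_r_distr)
    qed
    then show ?thesis
      using l c assms by (simp add: smult_tclass tlift_tclass)
  qed
qed

theorem tlift_unique:
  assumes "module k V" "module k W" "module k Z" "bilinear_map k V W Z f"
    "linear_map k (tensor k V W) Z g"
    "\<And>v w. v \<in> carrier V \<Longrightarrow> w \<in> carrier W \<Longrightarrow> g (pure k V W v w) = f v w"
    "t \<in> carrier (tensor k V W)"
  shows "g t = tlift k V W Z f t"
proof -
  interpret V: module k V by fact
  interpret Z: module k Z by fact
  have add: "g (tclass k V W (l @ m)) = g (tclass k V W l) \<oplus>\<^bsub>Z\<^esub> g (tclass k V W m)"
    and cl: "g (tclass k V W l) \<in> carrier Z"
    if "l \<in> lists (carrier V \<times> carrier W)" "m \<in> lists (carrier V \<times> carrier W)" for l m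
    using assms(5) tclass_in_carrier[OF that(1), of k] tclass_in_carrier[OF that(2), of k]
      add_tclass[OF that assms(1,2), symmetric]
    by (simp_all only: linear_map_def) blast+
  obtain l where l: "l \<in> lists (carrier V \<times> carrier W)" "t = tclass k V W l"
    using assms(7) by (rule tensor_cases)
  from l(1) have "g (tclass k V W l) = tsum Z f l"
  proof induction
    case Nil
    have "g (tclass k V W []) = g (tclass k V W []) \<oplus>\<^bsub>Z\<^esub> g (tclass k V W [])"
      using add[of "[]" "[]"] by simp
    then have "g (tclass k V W []) = \<zero>\<^bsub>Z\<^esub>"
      using cl[of "[]" "[]"] by (metis Z.M.add.r_cancel_one lists.Nil)
    then show ?case by (simp add: tsum_def)
  next
    case (Cons p l)
    obtain v w where p: "p = (v, w)" by (cases p)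
    then show ?case
      using Cons add[of "[p]" l] assms(6)[of v w] by (simp add: tsum_Cons pure_def)
  qed
  then show ?thesis using l assms(1-4) by (simp add: tlift_tclass)
qed

subsection \<open>Maps between tensor products\<close>

definition tmap ::
    "('k,'l) ring_scheme \<Rightarrow> ('k,'a,'m) module_scheme \<Rightarrow> ('k,'b,'n) module_scheme
      \<Rightarrow> ('k,'c,'o) module_scheme \<Rightarrow> ('k,'d,'p) module_scheme
      \<Rightarrow> ('a \<Rightarrow> 'c) \<Rightarrow> ('b \<Rightarrow> 'd) \<Rightarrow> ('a, 'b) tensor \<Rightarrow> ('c, 'd) tensor"
  where "tmap k V W V' W' f g =
    tlift k V W (tensor k V' W') (\<lambda>v w. pure k V' W' (f v) (g w))"

definition tflip ::
    "('k,'l) ring_scheme \<Rightarrow> ('k,'a,'m) module_scheme \<Rightarrow> ('k,'b,'n) module_scheme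
      \<Rightarrow> ('a, 'b) tensor \<Rightarrow> ('b, 'a) tensor"
  where "tflip k V W = tlift k V W (tensor k W V) (\<lambda>v w. pure k W V w v)"

text \<open>The associativity isomorphism \<open>(A \<otimes> B) \<otimes> C \<rightarrow> A \<otimes> (B \<otimes> C)\<close> and its inverse.\<close>

definition tassoc ::
    "('k,'l) ring_scheme \<Rightarrow> ('k,'a,'m) module_scheme \<Rightarrow> ('k,'b,'n) module_scheme
      \<Rightarrow> ('k,'c,'o) module_scheme \<Rightarrow> (('a, 'b) tensor, 'c) tensor \<Rightarrow> ('a, ('b, 'c) tensor) tensor"
  where "tassoc k A B C =
    tlift k (tensor k A B) C (tensor k A (tensor k B C))
      (\<lambda>t c. tlift k A B (tensor k A (tensor k B C))
        (\<lambda>a b. pure k A (tensor k B C) a (pure k B C b c)) t)"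

definition tunassoc ::
    "('k,'l) ring_scheme \<Rightarrow> ('k,'a,'m) module_scheme \<Rightarrow> ('k,'b,'n) module_scheme
      \<Rightarrow> ('k,'c,'o) module_scheme \<Rightarrow> ('a, ('b, 'c) tensor) tensor \<Rightarrow> (('a, 'b) tensor, 'c) tensor"
  where "tunassoc k A B C =
    tlift k A (tensor k B C) (tensor k (tensor k A B) C)
      (\<lambda>a t. tlift k B C (tensor k (tensor k A B) C)
        (\<lambda>b c. pure k (tensor k A B) C (pure k A B a b) c) t)"


section \<open>Hopf algebras\<close>

record ('k, 'h) bialg = "('k, 'h) module" +
  comult :: "'h \<Rightarrow> ('h, 'h) tensor"
  counit :: "'h \<Rightarrow> 'k"

definition mk_bialg ::
    "('k,'h,'m) module_scheme \<Rightarrow> ('h \<Rightarrow> ('h, 'h) tensor) \<Rightarrow> ('h \<Rightarrow> 'k) \<Rightarrow> ('k, 'h) bialg"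
  where "mk_bialg A \<Delta> \<epsilon> =
   \<lparr>carrier = carrier A, mult = mult A, one = one A, zero = zero A, add = add A, smult = smult A,
    comult = \<Delta>, counit = \<epsilon>\<rparr>"

definition bialgebra :: "('k,'l) ring_scheme \<Rightarrow> ('k,'h,'m) bialg_scheme \<Rightarrow> bool"
  where "bialgebra k H \<longleftrightarrow> k_algebra k H \<and>
    comult H \<in> alg_hom k H (tensor k H H) \<and>
    counit H \<in> ring_hom H k \<and> linear_form k H (counit H) \<and>
    (\<forall>h\<in>carrier H.
      tassoc k H H H (tmap k H H (tensor k H H) H (comult H) (\<lambda>y. y) (comult H h)) =
        tmap k H H H (tensor k H H) (\<lambda>y. y) (comult H) (comult H h) \<and>
      tlift k H H H (\<lambda>a b. counit H a \<odot>\<^bsub>H\<^esub> b) (comult H h) = h \<and>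
      tlift k H H H (\<lambda>a b. counit H b \<odot>\<^bsub>H\<^esub> a) (comult H h) = h)"

definition hopf_algebra :: "('k,'l) ring_scheme \<Rightarrow> ('k,'h,'m) bialg_scheme \<Rightarrow> ('h \<Rightarrow> 'h) \<Rightarrow> bool"
  where "hopf_algebra k H S \<longleftrightarrow> bialgebra k H \<and>
    linear_map k H H S \<and> bij_betw S (carrier H) (carrier H) \<and>
    (\<forall>h\<in>carrier H.
      tlift k H H H (\<lambda>a b. S a \<otimes>\<^bsub>H\<^esub> b) (comult H h) = counit H h \<odot>\<^bsub>H\<^esub> \<one>\<^bsub>H\<^esub> \<and>
      tlift k H H H (\<lambda>a b. a \<otimes>\<^bsub>H\<^esub> S b) (comult H h) = counit H h \<odot>\<^bsub>H\<^esub> \<one>\<^bsub>H\<^esub>)"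

definition co_opposite :: "('k,'l) ring_scheme \<Rightarrow> ('k,'h,'m) bialg_scheme \<Rightarrow> ('k, 'h) bialg"
  where "co_opposite k H = mk_bialg H (\<lambda>h. tflip k H H (comult H h)) (counit H)"

subsection \<open>The dual Hopf algebra\<close>

text \<open>
  The elements of the dual are the linear forms, made extensional so that they are equal as soon
  as they agree on the carrier.  The pairing \<open>\<^bold>p(h, \<theta>)\<close> is \<open>\<theta> h\<close>.
\<close>

definition dual_algebra ::
    "('k,'l) ring_scheme \<Rightarrow> ('k,'h,'m) bialg_scheme \<Rightarrow> ('k, 'h \<Rightarrow> 'k) module"
  where "dual_algebra k K =
   \<lparr>carrier = {\<theta> \<in> carrier K \<rightarrow>\<^sub>E carrier k. linear_form k K \<theta>},
    mult = (\<lambda>\<theta> \<theta>'. \<lambda>x\<in>carrier K. tlift k K K k (\<lambda>a b. \<theta> a \<otimes>\<^bsub>k\<^esub> \<theta>' b) (comult K x)),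
    one = (\<lambda>x\<in>carrier K. counit K x),
    zero = (\<lambda>x\<in>carrier K. \<zero>\<^bsub>k\<^esub>),
    add = (\<lambda>\<theta> \<theta>'. \<lambda>x\<in>carrier K. \<theta> x \<oplus>\<^bsub>k\<^esub> \<theta>' x),
    smult = (\<lambda>c \<theta>. \<lambda>x\<in>carrier K. c \<otimes>\<^bsub>k\<^esub> \<theta> x)\<rparr>"

text \<open>For finite-dimensional \<open>K\<close>, the coproduct of \<open>\<theta>\<close> is determined by
  \<open>\<^bold>p(x y, \<theta>) = \<^bold>p(x, \<theta>\<^sub>(\<^sub>1\<^sub>)) \<^bold>p(y, \<theta>\<^sub>(\<^sub>2\<^sub>))\<close>.\<close>

definition dual_comult ::
    "('k,'l) ring_scheme \<Rightarrow> ('k,'h,'m) bialg_scheme \<Rightarrow> ('h \<Rightarrow> 'k) \<Rightarrow> ('h \<Rightarrow> 'k, 'h \<Rightarrow> 'k) tensor"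
  where "dual_comult k K \<theta> =
    (THE t. t \<in> carrier (tensor k (dual_algebra k K) (dual_algebra k K)) \<and>
      (\<forall>x\<in>carrier K. \<forall>y\<in>carrier K.
        tlift k (dual_algebra k K) (dual_algebra k K) k (\<lambda>\<phi> \<psi>. \<phi> x \<otimes>\<^bsub>k\<^esub> \<psi> y) t
          = \<theta> (x \<otimes>\<^bsub>K\<^esub> y)))"

definition dual :: "('k,'l) ring_scheme \<Rightarrow> ('k,'h,'m) bialg_scheme \<Rightarrow> ('k, 'h \<Rightarrow> 'k) bialg"
  where "dual k K = mk_bialg (dual_algebra k K) (dual_comult k K) (\<lambda>\<theta>. \<theta> \<one>\<^bsub>K\<^esub>)"

definition dual_bases ::
    "('k,'l) ring_scheme \<Rightarrow> ('k,'h,'m) bialg_scheme \<Rightarrow> nat \<Rightarrow> (nat \<Rightarrow> 'h) \<Rightarrow> (nat \<Rightarrow> 'h \<Rightarrow> 'k) \<Rightarrow> bool"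
  where "dual_bases k H n h \<theta> \<longleftrightarrow> basis k H n h \<and>
    (\<forall>i<n. \<theta> i \<in> carrier (dual k H)) \<and>
    (\<forall>i<n. \<forall>j<n. \<theta> i (h j) = (if i = j then \<one>\<^bsub>k\<^esub> else \<zero>\<^bsub>k\<^esub>))"

text \<open>The element \<open>U = \<Sum>\<^sub>i h\<^sub>i \<otimes> \<theta>\<^sub>i\<close> does not depend on the dual bases.\<close>

definition canonical_U ::
    "('k,'l) ring_scheme \<Rightarrow> ('k,'h,'m) bialg_scheme \<Rightarrow> ('h, 'h \<Rightarrow> 'k) tensor"
  where "canonical_U k H =
    (THE u. \<exists>n h \<theta>. dual_bases k H n h \<theta> \<and>
      u = (\<Oplus>\<^bsub>tensor k H (dual k H)\<^esub>i\<in>{..<n}. pure k H (dual k H) (h i) (\<theta> i)))"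

subsection \<open>The Hopf algebra \<open>T\<^sub>M(H)\<close> and Majid's form \<open>D\<^sub>M(H)\<close> of the Drinfeld double\<close>

text \<open>
  The antipodes of \<open>T\<^sub>M(H)\<close> and \<open>D\<^sub>M(H)\<close> (and of the dual) are not recorded: an antipode is unique,
  and comodule and module algebras do not involve it.
\<close>

definition T_comult ::
    "('k,'l) ring_scheme \<Rightarrow> ('k,'h,'m) bialg_scheme \<Rightarrow> ('h, 'h \<Rightarrow> 'k) tensor
      \<Rightarrow> (('h, 'h \<Rightarrow> 'k) tensor, ('h, 'h \<Rightarrow> 'k) tensor) tensor"
  where "T_comult k H t =
   (let H' = dual k H; HH' = tensor k H H'; H'H = tensor k H' H; HH = tensor k H H;
        H'H' = tensor k H' H';
        \<comment> \<open>\<open>H \<otimes> H' \<rightarrow> (H \<otimes> H) \<otimes> (H' \<otimes> H') = H \<otimes> ((H \<otimes> H') \<otimes> H')\<close>\<close>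
        t1 = tmap k H H' HH H'H' (comult (co_opposite k H)) (comult H') t;
        t2 = tassoc k H H H'H' t1;
        t3 = tmap k H (tensor k H H'H') H (tensor k HH' H') (\<lambda>y. y) (tunassoc k H H' H') t2;
        \<comment> \<open>\<open>H \<otimes> ((H \<otimes> H') \<otimes> H') \<rightarrow> H \<otimes> ((H' \<otimes> H) \<otimes> H') = (H \<otimes> H') \<otimes> (H \<otimes> H')\<close>\<close>
        W = inv\<^bsub>HH'\<^esub> canonical_U k H;
        t4 = tmap k H (tensor k HH' H') H (tensor k H'H H') (\<lambda>y. y)
              (tmap k HH' H' H'H H' (\<lambda>z. tflip k H H' (Ad HH' W z)) (\<lambda>y. y)) t3;
        t5 = tmap k H (tensor k H'H H') H (tensor k H' HH') (\<lambda>y. y) (tassoc k H' H H') t4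
    in tunassoc k H H' HH' t5)"

definition T_M ::
    "('k,'l) ring_scheme \<Rightarrow> ('k,'h,'m) bialg_scheme \<Rightarrow> ('k, ('h, 'h \<Rightarrow> 'k) tensor) bialg"
  where "T_M k H = mk_bialg (tensor k H (dual k H)) (T_comult k H)
    (tlift k H (dual k H) k (\<lambda>g \<theta>. counit H g \<otimes>\<^bsub>k\<^esub> counit (dual k H) \<theta>))"

text \<open>
  The pairing \<open>(\<omega> \<bowtie> h, g \<otimes> \<theta>) \<mapsto> \<^bold>p(g, \<omega>) \<^bold>p(h, \<theta>)\<close>, as the map from \<open>H' \<otimes> H\<close> to the linear
  forms on \<open>T\<^sub>M(H)\<close>, where \<open>H'\<close> is the dual of \<open>H\<close>.  Along it, the Hopf algebra structure of the
  dual of \<open>T\<^sub>M(H)\<close> is transported to \<open>H' \<otimes> H\<close>.  (The passage to the opposite algebra does not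
  change the vector space \<open>H'\<close>.)
\<close>

definition D_pairing ::
    "('k,'l) ring_scheme \<Rightarrow> ('k,'h,'m) bialg_scheme \<Rightarrow> ('h \<Rightarrow> 'k, 'h) tensor
      \<Rightarrow> ('h, 'h \<Rightarrow> 'k) tensor \<Rightarrow> 'k"
  where "D_pairing k H d = (\<lambda>t\<in>carrier (T_M k H).
    tlift k (dual k H) H k (\<lambda>\<omega> h. tlift k H (dual k H) k (\<lambda>g \<theta>. \<omega> g \<otimes>\<^bsub>k\<^esub> \<theta> h) t) d)"

definition D_M ::
    "('k,'l) ring_scheme \<Rightarrow> ('k,'h,'m) bialg_scheme \<Rightarrow> ('k, ('h \<Rightarrow> 'k, 'h) tensor) bialg"
  where "D_M k H =
   (let E = tensor k (dual k H) H; T' = dual k (T_M k H);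
        \<Phi> = D_pairing k H; \<Psi> = the_inv_into (carrier E) \<Phi>
    in \<lparr>carrier = carrier E,
        mult = (\<lambda>d d'. \<Psi> (\<Phi> d \<otimes>\<^bsub>T'\<^esub> \<Phi> d')), one = \<Psi> \<one>\<^bsub>T'\<^esub>,
        zero = zero E, add = add E, smult = smult E,
        comult = (\<lambda>d. tmap k T' T' E E \<Psi> \<Psi> (comult T' (\<Phi> d))),
        counit = (\<lambda>d. counit T' (\<Phi> d))\<rparr>)"


section \<open>Coactions, actions, Yetter-Drinfeld conditions\<close>

text \<open>
  Coactions, actions and morphisms are taken to be extensional, so that each of them is a single
  HOL function.
\<close>

definition left_coaction ::
    "('k,'l) ring_scheme \<Rightarrow> ('k,'h,'m) bialg_scheme \<Rightarrow> ('k,'x,'n) module_scheme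
      \<Rightarrow> ('x \<Rightarrow> ('h, 'x) tensor) \<Rightarrow> bool"
  where "left_coaction k K X \<alpha> \<longleftrightarrow>
    \<alpha> \<in> extensional (carrier X) \<and> \<alpha> \<in> alg_hom k X (tensor k K X) \<and>
    (\<forall>x\<in>carrier X.
      tassoc k K K X (tmap k K X (tensor k K K) X (comult K) (\<lambda>y. y) (\<alpha> x)) =
        tmap k K X K (tensor k K X) (\<lambda>y. y) \<alpha> (\<alpha> x) \<and>
      tlift k K X X (\<lambda>h y. counit K h \<odot>\<^bsub>X\<^esub> y) (\<alpha> x) = x)"

definition right_coaction ::
    "('k,'l) ring_scheme \<Rightarrow> ('k,'h,'m) bialg_scheme \<Rightarrow> ('k,'x,'n) module_scheme
      \<Rightarrow> ('x \<Rightarrow> ('x, 'h) tensor) \<Rightarrow> bool"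
  where "right_coaction k K X \<gamma> \<longleftrightarrow>
    \<gamma> \<in> extensional (carrier X) \<and> \<gamma> \<in> alg_hom k X (tensor k X K) \<and>
    (\<forall>x\<in>carrier X.
      tassoc k X K K (tmap k X K (tensor k X K) K \<gamma> (\<lambda>y. y) (\<gamma> x)) =
        tmap k X K X (tensor k K K) (\<lambda>y. y) (comult K) (\<gamma> x) \<and>
      tlift k X K X (\<lambda>y h. counit K h \<odot>\<^bsub>X\<^esub> y) (\<gamma> x) = x)"

definition left_action ::
    "('k,'l) ring_scheme \<Rightarrow> ('k,'h,'m) bialg_scheme \<Rightarrow> ('k,'x,'n) module_scheme
      \<Rightarrow> ('h \<Rightarrow> 'x \<Rightarrow> 'x) \<Rightarrow> bool"
  where "left_action k K X act \<longleftrightarrow>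
    act \<in> carrier K \<rightarrow>\<^sub>E (carrier X \<rightarrow>\<^sub>E carrier X) \<and> bilinear_map k K X X act \<and>
    (\<forall>h\<in>carrier K. \<forall>h'\<in>carrier K. \<forall>x\<in>carrier X. act (h \<otimes>\<^bsub>K\<^esub> h') x = act h (act h' x)) \<and>
    (\<forall>x\<in>carrier X. act \<one>\<^bsub>K\<^esub> x = x) \<and>
    (\<forall>h\<in>carrier K. \<forall>x\<in>carrier X. \<forall>y\<in>carrier X.
      act h (x \<otimes>\<^bsub>X\<^esub> y) = tlift k K K X (\<lambda>a b. act a x \<otimes>\<^bsub>X\<^esub> act b y) (comult K h)) \<and>
    (\<forall>h\<in>carrier K. act h \<one>\<^bsub>X\<^esub> = counit K h \<odot>\<^bsub>X\<^esub> \<one>\<^bsub>X\<^esub>)"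

text \<open>\<open>(\<alpha> \<otimes> id) \<beta> = Ad(U\<^sub>1\<^sub>3) (id \<otimes> \<beta>) \<alpha>\<close>, as maps from \<open>X\<close> to \<open>H \<otimes> (X \<otimes> H')\<close>, where \<open>H'\<close> is the
  dual of \<open>H\<close>.\<close>

definition yd_lr_condition ::
    "('k,'l) ring_scheme \<Rightarrow> ('k,'h,'m) bialg_scheme \<Rightarrow> ('k,'x,'n) module_scheme
      \<Rightarrow> ('x \<Rightarrow> ('h, 'x) tensor) \<Rightarrow> ('x \<Rightarrow> ('x, 'h \<Rightarrow> 'k) tensor) \<Rightarrow> bool"
  where "yd_lr_condition k H X \<alpha> \<beta> \<longleftrightarrow>
   (let H' = dual k H; XH' = tensor k X H'; HXH' = tensor k H XH';
        U13 = tlift k H H' HXH' (\<lambda>h \<theta>. pure k H XH' h (pure k X H' \<one>\<^bsub>X\<^esub> \<theta>)) (canonical_U k H)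
    in \<forall>x\<in>carrier X.
        tassoc k H X H' (tmap k X H' (tensor k H X) H' \<alpha> (\<lambda>y. y) (\<beta> x)) =
        Ad HXH' U13 (tmap k H X H XH' (\<lambda>y. y) \<beta> (\<alpha> x)))"

definition yd_condition ::
    "('k,'l) ring_scheme \<Rightarrow> ('k,'h,'m) bialg_scheme \<Rightarrow> ('k,'x,'n) module_scheme
      \<Rightarrow> ('h \<Rightarrow> 'x \<Rightarrow> 'x) \<Rightarrow> ('x \<Rightarrow> ('h, 'x) tensor) \<Rightarrow> bool"
  where "yd_condition k H X act \<alpha> \<longleftrightarrow>
    (\<forall>h\<in>carrier H. \<forall>x\<in>carrier X.
      tlift k H H (tensor k H X)
        (\<lambda>a b. tmap k H X H X (\<lambda>z. a \<otimes>\<^bsub>H\<^esub> z) (act b) (\<alpha> x)) (comult H h) =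
      tlift k H H (tensor k H X)
        (\<lambda>a b. tmap k H X H X (\<lambda>z. z \<otimes>\<^bsub>H\<^esub> b) (\<lambda>y. y) (\<alpha> (act a x))) (comult H h))"

definition left_colinear ::
    "('k,'l) ring_scheme \<Rightarrow> ('k,'h,'m) bialg_scheme \<Rightarrow> ('k,'x) module \<Rightarrow> ('k,'x) module
      \<Rightarrow> ('x \<Rightarrow> ('h, 'x) tensor) \<Rightarrow> ('x \<Rightarrow> ('h, 'x) tensor) \<Rightarrow> ('x \<Rightarrow> 'x) \<Rightarrow> bool"
  where "left_colinear k K X Y \<alpha> \<alpha>' f \<longleftrightarrow>
    (\<forall>x\<in>carrier X. \<alpha>' (f x) = tmap k K X K Y (\<lambda>y. y) f (\<alpha> x))"

definition right_colinear ::
    "('k,'l) ring_scheme \<Rightarrow> ('k,'h,'m) bialg_scheme \<Rightarrow> ('k,'x) module \<Rightarrow> ('k,'x) module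
      \<Rightarrow> ('x \<Rightarrow> ('x, 'h) tensor) \<Rightarrow> ('x \<Rightarrow> ('x, 'h) tensor) \<Rightarrow> ('x \<Rightarrow> 'x) \<Rightarrow> bool"
  where "right_colinear k K X Y \<gamma> \<gamma>' f \<longleftrightarrow>
    (\<forall>x\<in>carrier X. \<gamma>' (f x) = tmap k X K Y K f (\<lambda>y. y) (\<gamma> x))"

definition equivariant ::
    "('k,'h,'m) bialg_scheme \<Rightarrow> ('k,'x) module
      \<Rightarrow> ('h \<Rightarrow> 'x \<Rightarrow> 'x) \<Rightarrow> ('h \<Rightarrow> 'x \<Rightarrow> 'x) \<Rightarrow> ('x \<Rightarrow> 'x) \<Rightarrow> bool"
  where "equivariant K X act act' f \<longleftrightarrow>
    (\<forall>h\<in>carrier K. \<forall>x\<in>carrier X. f (act h x) = act' h (f x))"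


section \<open>Categories and functors\<close>

record ('o, 'm) cat =
  Obj :: "'o set"
  Hom :: "'o \<Rightarrow> 'o \<Rightarrow> 'm set"
  Idt :: "'o \<Rightarrow> 'm"
  Cmp :: "'o \<Rightarrow> 'o \<Rightarrow> 'o \<Rightarrow> 'm \<Rightarrow> 'm \<Rightarrow> 'm"

text \<open>\<open>Cmp C X Y Z g f\<close> is the composite of \<open>f : X \<rightarrow> Y\<close> and \<open>g : Y \<rightarrow> Z\<close>.\<close>

definition category :: "('o, 'm) cat \<Rightarrow> bool"
  where "category C \<longleftrightarrow>
    (\<forall>X\<in>Obj C. Idt C X \<in> Hom C X X) \<and>
    (\<forall>X\<in>Obj C. \<forall>Y\<in>Obj C. \<forall>Z\<in>Obj C. \<forall>f\<in>Hom C X Y. \<forall>g\<in>Hom C Y Z.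
      Cmp C X Y Z g f \<in> Hom C X Z) \<and>
    (\<forall>X\<in>Obj C. \<forall>Y\<in>Obj C. \<forall>f\<in>Hom C X Y.
      Cmp C X X Y f (Idt C X) = f \<and> Cmp C X Y Y (Idt C Y) f = f) \<and>
    (\<forall>W\<in>Obj C. \<forall>X\<in>Obj C. \<forall>Y\<in>Obj C. \<forall>Z\<in>Obj C.
      \<forall>f\<in>Hom C W X. \<forall>g\<in>Hom C X Y. \<forall>h\<in>Hom C Y Z.
      Cmp C W X Z (Cmp C X Y Z h g) f = Cmp C W Y Z h (Cmp C W X Y g f))"

record ('o, 'm, 'p, 'n) func =
  fob :: "'o \<Rightarrow> 'p"
  fmor :: "'o \<Rightarrow> 'o \<Rightarrow> 'm \<Rightarrow> 'n"

definition is_functor :: "('o, 'm) cat \<Rightarrow> ('p, 'n) cat \<Rightarrow> ('o, 'm, 'p, 'n) func \<Rightarrow> bool"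
  where "is_functor C D F \<longleftrightarrow>
    (\<forall>X\<in>Obj C. fob F X \<in> Obj D) \<and>
    (\<forall>X\<in>Obj C. \<forall>Y\<in>Obj C. \<forall>f\<in>Hom C X Y. fmor F X Y f \<in> Hom D (fob F X) (fob F Y)) \<and>
    (\<forall>X\<in>Obj C. fmor F X X (Idt C X) = Idt D (fob F X)) \<and>
    (\<forall>X\<in>Obj C. \<forall>Y\<in>Obj C. \<forall>Z\<in>Obj C. \<forall>f\<in>Hom C X Y. \<forall>g\<in>Hom C Y Z.
      fmor F X Z (Cmp C X Y Z g f) =
        Cmp D (fob F X) (fob F Y) (fob F Z) (fmor F Y Z g) (fmor F X Y f))"

definition id_func :: "('o, 'm, 'o, 'm) func"
  where "id_func = \<lparr>fob = (\<lambda>X. X), fmor = (\<lambda>X Y f. f)\<rparr>"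

definition comp_func ::
    "('p, 'n, 'q, 'r) func \<Rightarrow> ('o, 'm, 'p, 'n) func \<Rightarrow> ('o, 'm, 'q, 'r) func"
  where "comp_func G F =
   \<lparr>fob = (\<lambda>X. fob G (fob F X)),
    fmor = (\<lambda>X Y f. fmor G (fob F X) (fob F Y) (fmor F X Y f))\<rparr>"

definition func_eq_on ::
    "('o, 'm) cat \<Rightarrow> ('o, 'm, 'p, 'n) func \<Rightarrow> ('o, 'm, 'p, 'n) func \<Rightarrow> bool"
  where "func_eq_on C F G \<longleftrightarrow>
    (\<forall>X\<in>Obj C. fob F X = fob G X) \<and>
    (\<forall>X\<in>Obj C. \<forall>Y\<in>Obj C. \<forall>f\<in>Hom C X Y. fmor F X Y f = fmor G X Y f)"

definition is_iso :: "('o, 'm) cat \<Rightarrow> 'o \<Rightarrow> 'o \<Rightarrow> 'm \<Rightarrow> bool"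
  where "is_iso C X Y f \<longleftrightarrow> f \<in> Hom C X Y \<and>
    (\<exists>g\<in>Hom C Y X. Cmp C X Y X g f = Idt C X \<and> Cmp C Y X Y f g = Idt C Y)"

definition natural_iso ::
    "('o, 'm) cat \<Rightarrow> ('p, 'n) cat \<Rightarrow> ('o, 'm, 'p, 'n) func \<Rightarrow> ('o, 'm, 'p, 'n) func
      \<Rightarrow> ('o \<Rightarrow> 'n) \<Rightarrow> bool"
  where "natural_iso C D F G \<eta> \<longleftrightarrow>
    (\<forall>X\<in>Obj C. is_iso D (fob F X) (fob G X) (\<eta> X)) \<and>
    (\<forall>X\<in>Obj C. \<forall>Y\<in>Obj C. \<forall>f\<in>Hom C X Y.
      Cmp D (fob F X) (fob G X) (fob G Y) (fmor G X Y f) (\<eta> X) =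
      Cmp D (fob F X) (fob F Y) (fob G Y) (\<eta> Y) (fmor F X Y f))"

definition equivalence_of_categories ::
    "('o, 'm) cat \<Rightarrow> ('p, 'n) cat \<Rightarrow> ('o, 'm, 'p, 'n) func \<Rightarrow> bool"
  where "equivalence_of_categories C D F \<longleftrightarrow>
    category C \<and> category D \<and> is_functor C D F \<and>
    (\<exists>G \<eta> \<epsilon>. is_functor D C G \<and>
      natural_iso C C id_func (comp_func G F) \<eta> \<and>
      natural_iso D D (comp_func F G) id_func \<epsilon>)"


section \<open>The four categories\<close>

text \<open>
  Here \<open>'x\<close> plays the role of a universe: the algebras that underlie the objects are those whose
  carrier is a subset of \<open>'x\<close>.
\<close>

type_synonym ('k, 'h, 'x) yd_lr_obj =
  "('k, 'x) module \<times> ('x \<Rightarrow> ('h, 'x) tensor) \<times> ('x \<Rightarrow> ('x, 'h \<Rightarrow> 'k) tensor)"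
type_synonym ('k, 'h, 'x) yd_obj =
  "('k, 'x) module \<times> ('h \<Rightarrow> 'x \<Rightarrow> 'x) \<times> ('x \<Rightarrow> ('h, 'x) tensor)"
type_synonym ('k, 'h, 'x) comod_obj = "('k, 'x) module \<times> ('x \<Rightarrow> ('x, 'h) tensor)"
type_synonym ('k, 'h, 'x) mod_obj = "('k, 'x) module \<times> ('h \<Rightarrow> 'x \<Rightarrow> 'x)"

definition alg_cat ::
    "('k,'l) ring_scheme \<Rightarrow> (('k,'x) module \<times> 's) set
      \<Rightarrow> (('k,'x) module \<times> 's \<Rightarrow> ('k,'x) module \<times> 's \<Rightarrow> ('x \<Rightarrow> 'x) \<Rightarrow> bool)
      \<Rightarrow> (('k,'x) module \<times> 's, 'x \<Rightarrow> 'x) cat"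
  where "alg_cat k Ob P =
   \<lparr>Obj = Ob,
    Hom = (\<lambda>X Y. {f \<in> alg_hom k (fst X) (fst Y). f \<in> extensional (carrier (fst X)) \<and> P X Y f}),
    Idt = (\<lambda>X. \<lambda>x\<in>carrier (fst X). x),
    Cmp = (\<lambda>X Y Z g f. compose (carrier (fst X)) g f)\<rparr>"

definition YD_lr ::
    "'x itself \<Rightarrow> ('k,'l) ring_scheme \<Rightarrow> ('k,'h,'m) bialg_scheme
      \<Rightarrow> (('k, 'h, 'x) yd_lr_obj, 'x \<Rightarrow> 'x) cat"
  where "YD_lr _ k H = alg_cat k
    {(X, \<alpha>, \<beta>). k_algebra k X \<and> left_coaction k H X \<alpha> \<and> right_coaction k (dual k H) X \<beta> \<and>
      yd_lr_condition k H X \<alpha> \<beta>}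
    (\<lambda>(X, \<alpha>, \<beta>) (X', \<alpha>', \<beta>') f.
      left_colinear k H X X' \<alpha> \<alpha>' f \<and> right_colinear k (dual k H) X X' \<beta> \<beta>' f)"

definition YD ::
    "'x itself \<Rightarrow> ('k,'l) ring_scheme \<Rightarrow> ('k,'h,'m) bialg_scheme
      \<Rightarrow> (('k, 'h, 'x) yd_obj, 'x \<Rightarrow> 'x) cat"
  where "YD _ k H = alg_cat k
    {(X, act, \<alpha>). k_algebra k X \<and> left_action k H X act \<and> left_coaction k H X \<alpha> \<and>
      yd_condition k H X act \<alpha>}
    (\<lambda>(X, act, \<alpha>) (X', act', \<alpha>') f. equivariant H X act act' f \<and> left_colinear k H X X' \<alpha> \<alpha>' f)"

definition ComodAlg ::
    "'x itself \<Rightarrow> ('k,'l) ring_scheme \<Rightarrow> ('k,'h,'m) bialg_scheme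
      \<Rightarrow> (('k, 'h, 'x) comod_obj, 'x \<Rightarrow> 'x) cat"
  where "ComodAlg _ k K = alg_cat k
    {(X, \<gamma>). k_algebra k X \<and> right_coaction k K X \<gamma>}
    (\<lambda>(X, \<gamma>) (X', \<gamma>') f. right_colinear k K X X' \<gamma> \<gamma>' f)"

definition ModAlg ::
    "'x itself \<Rightarrow> ('k,'l) ring_scheme \<Rightarrow> ('k,'h,'m) bialg_scheme
      \<Rightarrow> (('k, 'h, 'x) mod_obj, 'x \<Rightarrow> 'x) cat"
  where "ModAlg _ k K = alg_cat k
    {(X, act). k_algebra k X \<and> left_action k K X act}
    (\<lambda>(X, act) (X', act') f. equivariant K X act act' f)"


section \<open>The four functors\<close>

definition identical_on_morphisms :: "('o \<Rightarrow> 'p) \<Rightarrow> ('o, 'm, 'p, 'm) func"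
  where "identical_on_morphisms F = \<lparr>fob = F, fmor = (\<lambda>X Y f. f)\<rparr>"

text \<open>\<open>\<omega> \<rhd>\<^sub>\<gamma> x = (id \<otimes> \<omega>)(\<gamma>(x))\<close> for \<open>\<omega>\<close> in the dual of \<open>K\<close>\<close>

definition induced_action ::
    "('k,'l) ring_scheme \<Rightarrow> ('k,'h,'m) bialg_scheme \<Rightarrow> ('k,'x,'n) module_scheme
      \<Rightarrow> ('x \<Rightarrow> ('x, 'h) tensor) \<Rightarrow> ('h \<Rightarrow> 'k) \<Rightarrow> 'x \<Rightarrow> 'x"
  where "induced_action k K X \<gamma> \<omega> x = tlift k X K X (\<lambda>y t. \<omega> t \<odot>\<^bsub>X\<^esub> y) (\<gamma> x)"

definition YD_lr_to_ComodAlg ::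
    "('k,'l) ring_scheme \<Rightarrow> ('k,'h,'m) bialg_scheme
      \<Rightarrow> (('k, 'h, 'x) yd_lr_obj, 'x \<Rightarrow> 'x, ('k, ('h, 'h \<Rightarrow> 'k) tensor, 'x) comod_obj, 'x \<Rightarrow> 'x) func"
  where "YD_lr_to_ComodAlg k H = identical_on_morphisms (\<lambda>(X, \<alpha>, \<beta>).
    (X, \<lambda>x\<in>carrier X. tassoc k X H (dual k H)
      (tmap k X (dual k H) (tensor k X H) (dual k H) (\<lambda>y. tflip k H X (\<alpha> y)) (\<lambda>\<theta>. \<theta>) (\<beta> x))))"

definition ComodAlg_to_ModAlg ::
    "('k,'l) ring_scheme \<Rightarrow> ('k,'h,'m) bialg_scheme
      \<Rightarrow> (('k, ('h, 'h \<Rightarrow> 'k) tensor, 'x) comod_obj, 'x \<Rightarrow> 'x,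
          ('k, ('h \<Rightarrow> 'k, 'h) tensor, 'x) mod_obj, 'x \<Rightarrow> 'x) func"
  where "ComodAlg_to_ModAlg k H = identical_on_morphisms (\<lambda>(X, \<gamma>).
    (X, \<lambda>d\<in>carrier (D_M k H). \<lambda>x\<in>carrier X. induced_action k (T_M k H) X \<gamma> (D_pairing k H d) x))"

text \<open>\<open>h \<rhd>\<^sub>\<beta> x = (id \<otimes> \<^bold>p(h, \<cdot>))(\<beta>(x))\<close>\<close>

definition YD_lr_to_YD ::
    "('k,'l) ring_scheme \<Rightarrow> ('k,'h,'m) bialg_scheme
      \<Rightarrow> (('k, 'h, 'x) yd_lr_obj, 'x \<Rightarrow> 'x, ('k, 'h, 'x) yd_obj, 'x \<Rightarrow> 'x) func"
  where "YD_lr_to_YD k H = identical_on_morphisms (\<lambda>(X, \<alpha>, \<beta>).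
    (X, \<lambda>h\<in>carrier H. \<lambda>x\<in>carrier X. tlift k X (dual k H) X (\<lambda>y \<theta>. \<theta> h \<odot>\<^bsub>X\<^esub> y) (\<beta> x), \<alpha>))"

text \<open>\<open>(\<omega> \<bowtie> h) \<cdot> x = (\<^bold>p(\<cdot>, \<omega>) \<otimes> id)(\<alpha>(h \<rhd> x))\<close>, extended linearly in \<open>\<omega> \<bowtie> h\<close>\<close>

definition YD_to_ModAlg ::
    "('k,'l) ring_scheme \<Rightarrow> ('k,'h,'m) bialg_scheme
      \<Rightarrow> (('k, 'h, 'x) yd_obj, 'x \<Rightarrow> 'x, ('k, ('h \<Rightarrow> 'k, 'h) tensor, 'x) mod_obj, 'x \<Rightarrow> 'x) func"
  where "YD_to_ModAlg k H = identical_on_morphisms (\<lambda>(X, act, \<alpha>).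
    (X, \<lambda>d\<in>carrier (D_M k H). \<lambda>x\<in>carrier X.
      tlift k (dual k H) H X
        (\<lambda>\<omega> h. tlift k H X X (\<lambda>g y. \<omega> g \<odot>\<^bsub>X\<^esub> y) (\<alpha> (act h x))) d))"

end

theory Submission
  imports Defs
begin

text \<open>
  The square consists of equivalences because the objects of all four categories are encodings of
  the same operators on \<open>X\<close>.  A map into a tensor product with a finite-dimensional
  space is the same as a family of maps indexed by the dual space: its slices.  Slicing a left
  coaction \<open>\<alpha>\<close> of \<open>H\<close>, a right coaction \<open>\<beta>\<close> of the dual \<open>H'\<close> and a right coaction \<open>\<gamma>\<close> of
  \<open>T\<^sub>M(H)\<close> gives the operators
  \<open>a\<^sub>\<omega> = (\<omega> \<otimes> id) \<alpha>\<close>, \<open>b\<^sub>h = (id \<otimes> h) \<beta>\<close> and \<open>c\<^sub>\<omega>\<^sub>,\<^sub>h = (id \<otimes> \<omega> \<otimes> h) \<gamma>\<close>.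
  Slices separate the elements of a tensor product, so every axiom about the coactions becomes an
  identity between operators.

  \<^item> Coactions of an algebra \<open>K\<close> correspond bijectively to actions of its dual.  This is proved for any
    perfect pairing of \<open>K\<close> with some \<open>L\<close> under which products and coproducts are adjoint
    (locale \<open>bialgebra_pairing\<close>), and used twice: for \<open>H\<close> and \<open>H'\<close>, and for \<open>D\<^sub>M(H)\<close> and \<open>T\<^sub>M(H)\<close>.
    It gives the functors \<open>YD_lr \<rightarrow> YD\<close> and \<open>ComodAlg \<rightarrow> ModAlg\<close>.
  \<^item> Both Yetter-Drinfeld conditions say
    \<open>b\<^sub>h\<^sub>(\<^sub>2\<^sub>) a(\<omega>(h\<^sub>(\<^sub>1\<^sub>) _)) = a(\<omega>(_ h\<^sub>(\<^sub>2\<^sub>))) b\<^sub>h\<^sub>(\<^sub>1\<^sub>)\<close>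
    (\<open>yd_condition_iff\<close>, \<open>yd_lr_condition_iff\<close>): for the left-right version write \<open>Ad(U\<^sub>1\<^sub>3)\<close> as
    multiplication by \<open>U\<^sub>1\<^sub>3\<close> on either side and use that slicing \<open>U\<close> at \<open>h\<close> returns \<open>h\<close>.  By the antipode
    axioms the condition is equivalent to a commutation rule
    \<open>b\<^sub>h a\<^sub>\<omega> = a(\<omega>(S(h\<^sub>(\<^sub>1\<^sub>)) _ h\<^sub>(\<^sub>3\<^sub>))) b\<^sub>h\<^sub>(\<^sub>2\<^sub>)\<close> (\<open>yd_op_iff\<close>).
  \<^item> The same rule governs the product of \<open>D\<^sub>M(H)\<close>, which is
    \<open>(\<omega> \<bowtie> h)(\<omega>' \<bowtie> h') = \<omega>'(S(h\<^sub>(\<^sub>1\<^sub>)) _ h\<^sub>(\<^sub>3\<^sub>)) \<omega> \<bowtie> h\<^sub>(\<^sub>2\<^sub>) h'\<close> (\<open>D_mult_pure\<close>): the conjugation by \<open>U\<close> in the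
    coproduct of \<open>T\<^sub>M(H)\<close> dualizes to it.  Since \<open>\<gamma> = (\<Sigma>\<alpha> \<otimes> id)\<beta>\<close> means \<open>c\<^sub>\<omega>\<^sub>,\<^sub>h = a\<^sub>\<omega> b\<^sub>h\<close>, it is a
    coaction exactly when the commutation rule holds, and \<open>a\<close> and \<open>b\<close> are recovered from \<open>c\<close> by inserting
    the units (\<open>gamma_coaction\<close>, \<open>gamma_inj\<close>, \<open>gamma_surj\<close>).

  Thus three of the functors are bijective on objects and keep the sets of morphisms; the fourth
  inherits this from the commutativity of the square.  Such a functor is an isomorphism of
  categories (\<open>alg_cat_equivalence\<close>).
\<close>

section \<open>Linear maps and tensor products of modules\<close>

lemma linear_mapI:
  assumes "\<And>x. x \<in> carrier V \<Longrightarrow> f x \<in> carrier W"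
    "\<And>x y. x \<in> carrier V \<Longrightarrow> y \<in> carrier V \<Longrightarrow> f (x \<oplus>\<^bsub>V\<^esub> y) = f x \<oplus>\<^bsub>W\<^esub> f y"
    "\<And>c x. c \<in> carrier k \<Longrightarrow> x \<in> carrier V \<Longrightarrow> f (c \<odot>\<^bsub>V\<^esub> x) = c \<odot>\<^bsub>W\<^esub> f x"
  shows "linear_map k V W f"
  using assms by (auto simp: linear_map_def)

lemma linear_map_closed: "linear_map k V W f \<Longrightarrow> x \<in> carrier V \<Longrightarrow> f x \<in> carrier W"
  and linear_map_add: "linear_map k V W f \<Longrightarrow> x \<in> carrier V \<Longrightarrow> y \<in> carrier V \<Longrightarrow>
    f (x \<oplus>\<^bsub>V\<^esub> y) = f x \<oplus>\<^bsub>W\<^esub> f y"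
  and linear_map_smult: "linear_map k V W f \<Longrightarrow> c \<in> carrier k \<Longrightarrow> x \<in> carrier V \<Longrightarrow>
    f (c \<odot>\<^bsub>V\<^esub> x) = c \<odot>\<^bsub>W\<^esub> f x"
  by (auto simp: linear_map_def)

lemma linear_map_zero:
  assumes "module k V" "module k W" "linear_map k V W f"
  shows "f \<zero>\<^bsub>V\<^esub> = \<zero>\<^bsub>W\<^esub>"
proof -
  interpret V: module k V by fact
  interpret W: module k W by fact
  have "f (\<zero>\<^bsub>V\<^esub> \<oplus>\<^bsub>V\<^esub> \<zero>\<^bsub>V\<^esub>) = f \<zero>\<^bsub>V\<^esub> \<oplus>\<^bsub>W\<^esub> f \<zero>\<^bsub>V\<^esub>"
    using assms(3) by (simp add: linear_map_add del: V.M.r_zero V.M.l_zero)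
  then show ?thesis
    using linear_map_closed[OF assms(3), of "\<zero>\<^bsub>V\<^esub>"] by (metis V.M.l_zero V.M.zero_closed W.M.add.r_cancel_one)
qed

lemma bilinear_mapI:
  assumes "\<And>v. v \<in> carrier V \<Longrightarrow> linear_map k W Z (f v)"
    "\<And>w. w \<in> carrier W \<Longrightarrow> linear_map k V Z (\<lambda>v. f v w)"
  shows "bilinear_map k V W Z f"
  using assms by (auto simp: bilinear_map_def)

lemma bilinear_map_left: "bilinear_map k V W Z f \<Longrightarrow> w \<in> carrier W \<Longrightarrow> linear_map k V Z (\<lambda>v. f v w)"
  and bilinear_map_right: "bilinear_map k V W Z f \<Longrightarrow> v \<in> carrier V \<Longrightarrow> linear_map k W Z (f v)"
  and bilinear_map_closed: "bilinear_map k V W Z f \<Longrightarrow> v \<in> carrier V \<Longrightarrow> w \<in> carrier W \<Longrightarrow> f v w \<in> carrier Z"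
  by (auto simp: bilinear_map_def linear_map_def)

lemma lin_comp:
  "linear_map k V W f \<Longrightarrow> linear_map k U V g \<Longrightarrow> linear_map k U W (\<lambda>x. f (g x))"
  by (rule linear_mapI) (simp_all add: linear_map_closed linear_map_add linear_map_smult)

lemma lin_id: "linear_map k V V (\<lambda>x. x)"
  by (auto simp: linear_map_def)

lemma linear_map_cong:
  assumes "module k V"
  shows "(\<And>x. x \<in> carrier V \<Longrightarrow> f x = g x) \<Longrightarrow> linear_map k V W f \<longleftrightarrow> linear_map k V W g"
proof -
  interpret V: module k V by fact
  show "(\<And>x. x \<in> carrier V \<Longrightarrow> f x = g x) \<Longrightarrow> linear_map k V W f \<longleftrightarrow> linear_map k V W g"
    by (auto simp: linear_map_def Pi_def)
qed

lemma tensor_zero: "\<zero>\<^bsub>tensor k V W\<^esub> = tclass k V W []"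
  by (simp add: tensor_def)

lemma pure_closed: "v \<in> carrier V \<Longrightarrow> w \<in> carrier W \<Longrightarrow> pure k V W v w \<in> carrier (tensor k V W)"
  by (simp add: pure_def tclass_in_carrier)

lemma tclass_Cons:
  assumes "module k V" "module k W" "v \<in> carrier V" "w \<in> carrier W" "l \<in> lists (carrier V \<times> carrier W)"
  shows "tclass k V W ((v, w) # l) = pure k V W v w \<oplus>\<^bsub>tensor k V W\<^esub> tclass k V W l"
  using add_tclass[of "[(v,w)]" V W l k] assms by (simp add: pure_def)

text \<open>
  A scalar acts on a formal sum by acting on all left factors.  So negation is the action of \<open>-1\<close>,
  and all module axioms are identities between lists, to be checked entry by entry.
\<close>

lemma module_tensor:
  assumes V: "module k V" and W: "module k W"
  shows "module k (tensor k V W)"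
proof -
  interpret V: module k V by fact
  interpret W: module k W by fact
  let ?T = "tensor k V W" and ?L = "lists (carrier V \<times> carrier W)"
  note in_lists_conv_set [simp del]
  note add = add_tclass[OF _ _ V W] and sm = smult_tclass[OF _ _ V W]
  have closed: "s \<oplus>\<^bsub>?T\<^esub> t \<in> carrier ?T" if st: "s \<in> carrier ?T" "t \<in> carrier ?T" for s t
  proof -
    obtain l where l: "l \<in> ?L" "s = tclass k V W l" using st(1) by (rule tensor_cases)
    obtain m where m: "m \<in> ?L" "t = tclass k V W m" using st(2) by (rule tensor_cases)
    show ?thesis unfolding l(2) m(2) add[OF l(1) m(1)]
      using l(1) m(1) by (intro tclass_in_carrier) simp
  qed
  have assoc: "s \<oplus>\<^bsub>?T\<^esub> t \<oplus>\<^bsub>?T\<^esub> u = s \<oplus>\<^bsub>?T\<^esub> (t \<oplus>\<^bsub>?T\<^esub> u)"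
    if "s \<in> carrier ?T" "t \<in> carrier ?T" "u \<in> carrier ?T" for s t u
    using that by - (elim tensor_cases, simp add: add)
  have comm: "s \<oplus>\<^bsub>?T\<^esub> t = t \<oplus>\<^bsub>?T\<^esub> s" if "s \<in> carrier ?T" "t \<in> carrier ?T" for s t
    using that by - (elim tensor_cases, simp add: add tclass_eqI tensor_rel.comm)
  have zero: "\<zero>\<^bsub>?T\<^esub> \<oplus>\<^bsub>?T\<^esub> t = t" if "t \<in> carrier ?T" for t
    using that by - (elim tensor_cases, simp add: add tensor_zero)
  have zcl: "\<zero>\<^bsub>?T\<^esub> \<in> carrier ?T" by (simp add: tensor_zero tclass_in_carrier)
  have L: "map (\<lambda>(v, w). (c \<odot>\<^bsub>V\<^esub> v, w)) l \<in> ?L" if "l \<in> ?L" "c \<in> carrier k" for c l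
    using that by (induction l) auto
  have scl: "c \<odot>\<^bsub>?T\<^esub> t \<in> carrier ?T" if "c \<in> carrier k" "t \<in> carrier ?T" for c t
    using that L by - (elim tensor_cases, simp add: sm tclass_in_carrier)
  have sr: "c \<odot>\<^bsub>?T\<^esub> (s \<oplus>\<^bsub>?T\<^esub> t) = c \<odot>\<^bsub>?T\<^esub> s \<oplus>\<^bsub>?T\<^esub> c \<odot>\<^bsub>?T\<^esub> t"
    if "c \<in> carrier k" "s \<in> carrier ?T" "t \<in> carrier ?T" for c s t
    using that L by - (elim tensor_cases, simp add: add sm)
  have z0: "pure k V W \<zero>\<^bsub>V\<^esub> w = \<zero>\<^bsub>?T\<^esub>" if "w \<in> carrier W" for w
    using that by (simp add: pure_def tensor_zero tclass_eqI tensor_rel.zero)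
  have pa: "pure k V W (v \<oplus>\<^bsub>V\<^esub> v') w = pure k V W v w \<oplus>\<^bsub>?T\<^esub> pure k V W v' w"
    if "v \<in> carrier V" "v' \<in> carrier V" "w \<in> carrier W" for v v' w
    using tclass_eqI[OF tensor_rel.add_left[OF that]] that by (simp add: pure_def add)
  have sl: "(c \<oplus>\<^bsub>k\<^esub> d) \<odot>\<^bsub>?T\<^esub> t = c \<odot>\<^bsub>?T\<^esub> t \<oplus>\<^bsub>?T\<^esub> d \<odot>\<^bsub>?T\<^esub> t"
    if c: "c \<in> carrier k" "d \<in> carrier k" and t: "t \<in> carrier ?T" for c d t
  proof -
    obtain l where l: "l \<in> ?L" "t = tclass k V W l" using t by (rule tensor_cases)
    from l(1) show ?thesis unfolding l(2)
    proof (induction l)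
      case Nil then show ?case using c by (simp add: sm add)
    next
      case (Cons p l)
      obtain v w where p: "p = (v, w)" "v \<in> carrier V" "w \<in> carrier W" using Cons(1) by (cases p) auto
      let ?A = "pure k V W (c \<odot>\<^bsub>V\<^esub> v) w" and ?B = "pure k V W (d \<odot>\<^bsub>V\<^esub> v) w"
      let ?C = "c \<odot>\<^bsub>?T\<^esub> tclass k V W l" and ?D = "d \<odot>\<^bsub>?T\<^esub> tclass k V W l"
      have eq: "e \<odot>\<^bsub>?T\<^esub> tclass k V W (p # l) = pure k V W (e \<odot>\<^bsub>V\<^esub> v) w \<oplus>\<^bsub>?T\<^esub> e \<odot>\<^bsub>?T\<^esub> tclass k V W l"
        if "e \<in> carrier k" for e
      proof -
        have "p # l \<in> ?L" using Cons(1,2) by simp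
        then show ?thesis unfolding sm[OF \<open>p # l \<in> ?L\<close> that] sm[OF Cons(2) that]
          using that p L[OF Cons(2) that] by (simp add: tclass_Cons[OF V W])
      qed
      have cl: "?A \<in> carrier ?T" "?B \<in> carrier ?T" "?C \<in> carrier ?T" "?D \<in> carrier ?T"
        using c p Cons(2) by (auto intro!: pure_closed scl tclass_in_carrier)
      have "(?A \<oplus>\<^bsub>?T\<^esub> ?B) \<oplus>\<^bsub>?T\<^esub> (?C \<oplus>\<^bsub>?T\<^esub> ?D) = (?A \<oplus>\<^bsub>?T\<^esub> ?C) \<oplus>\<^bsub>?T\<^esub> (?B \<oplus>\<^bsub>?T\<^esub> ?D)"
      proof -
        have "?A \<oplus>\<^bsub>?T\<^esub> ?B \<oplus>\<^bsub>?T\<^esub> (?C \<oplus>\<^bsub>?T\<^esub> ?D) = ?A \<oplus>\<^bsub>?T\<^esub> ((?B \<oplus>\<^bsub>?T\<^esub> ?C) \<oplus>\<^bsub>?T\<^esub> ?D)"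
          using cl closed by (simp add: assoc)
        also have "?B \<oplus>\<^bsub>?T\<^esub> ?C = ?C \<oplus>\<^bsub>?T\<^esub> ?B" using cl by (simp add: comm)
        finally show ?thesis using cl closed by (simp add: assoc)
      qed
      then show ?case
        using Cons(3) c p unfolding eq[OF c(1)] eq[OF c(2)] eq[OF V.R.add.m_closed[OF c]]
        by (simp add: V.smult_l_distr pa)
    qed
  qed
  have z: "\<zero>\<^bsub>k\<^esub> \<odot>\<^bsub>?T\<^esub> t = \<zero>\<^bsub>?T\<^esub>" if t: "t \<in> carrier ?T" for t
  proof -
    obtain l where l: "l \<in> ?L" "t = tclass k V W l" using t by (rule tensor_cases)
    from l(1) show ?thesis unfolding l(2)
    proof (induction l)
      case Nil then show ?case by (simp add: sm tensor_zero)
    next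
      case (Cons p l)
      then obtain v w where p: "p = (v, w)" "v \<in> carrier V" "w \<in> carrier W" by (cases p) auto
      have pl: "p # l \<in> ?L" using Cons(1,2) by simp
      then show ?case
        using Cons(3) p Cons(2) L[of l "\<zero>\<^bsub>k\<^esub>"] unfolding sm[OF pl V.R.zero_closed] sm[OF Cons(2) V.R.zero_closed]
        by (simp add: tclass_Cons[OF V W] z0 zero zcl)
    qed
  qed
  have one: "\<one>\<^bsub>k\<^esub> \<odot>\<^bsub>?T\<^esub> t = t" if t: "t \<in> carrier ?T" for t
  proof -
    obtain l where l: "l \<in> ?L" "t = tclass k V W l" using t by (rule tensor_cases)
    have "map (\<lambda>(v, w). (\<one>\<^bsub>k\<^esub> \<odot>\<^bsub>V\<^esub> v, w)) l = l" using l(1) by (induction l) auto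
    then show ?thesis using l by (simp add: sm)
  qed
  have assoc1: "(c \<otimes>\<^bsub>k\<^esub> d) \<odot>\<^bsub>?T\<^esub> t = c \<odot>\<^bsub>?T\<^esub> (d \<odot>\<^bsub>?T\<^esub> t)"
    if c: "c \<in> carrier k" "d \<in> carrier k" and t: "t \<in> carrier ?T" for c d t
  proof -
    obtain l where l: "l \<in> ?L" "t = tclass k V W l" using t by (rule tensor_cases)
    have *: "map (\<lambda>(v, w). ((c \<otimes>\<^bsub>k\<^esub> d) \<odot>\<^bsub>V\<^esub> v, w)) l = map (\<lambda>(v, w). (c \<odot>\<^bsub>V\<^esub> v, w)) (map (\<lambda>(v, w). (d \<odot>\<^bsub>V\<^esub> v, w)) l)"
      using l(1) c by (induction l) (auto simp: V.smult_assoc1)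
    show ?thesis
      unfolding l(2) sm[OF l(1) V.R.m_closed[OF c]] sm[OF l(1) c(2)] sm[OF L[OF l(1) c(2)] c(1)] * ..
  qed
  have inv: "\<exists>u\<in>carrier ?T. u \<oplus>\<^bsub>?T\<^esub> t = \<zero>\<^bsub>?T\<^esub>" if t: "t \<in> carrier ?T" for t
  proof
    show "(\<ominus>\<^bsub>k\<^esub> \<one>\<^bsub>k\<^esub>) \<odot>\<^bsub>?T\<^esub> t \<in> carrier ?T" using t by (simp add: scl)
    show "(\<ominus>\<^bsub>k\<^esub> \<one>\<^bsub>k\<^esub>) \<odot>\<^bsub>?T\<^esub> t \<oplus>\<^bsub>?T\<^esub> t = \<zero>\<^bsub>?T\<^esub>"
      using sl[of "\<ominus>\<^bsub>k\<^esub> \<one>\<^bsub>k\<^esub>" "\<one>\<^bsub>k\<^esub>" t] t by (simp add: one z V.R.l_neg)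
  qed
  show ?thesis
    by (intro moduleI abelian_groupI V.R.is_cring)
      (simp_all add: closed assoc zcl zero scl sr one assoc1 sl inv, simp add: comm)
qed

lemma tensor_induct [consumes 3, case_names zero add]:
  assumes V: "module k V" and W: "module k W" and t: "t \<in> carrier (tensor k V W)"
  assumes 0: "P \<zero>\<^bsub>tensor k V W\<^esub>"
    and add: "\<And>v w t. v \<in> carrier V \<Longrightarrow> w \<in> carrier W \<Longrightarrow> t \<in> carrier (tensor k V W) \<Longrightarrow> P t \<Longrightarrow>
      P (pure k V W v w \<oplus>\<^bsub>tensor k V W\<^esub> t)"
  shows "P t"
proof -
  obtain l where l: "l \<in> lists (carrier V \<times> carrier W)" "t = tclass k V W l" using t by (rule tensor_cases)
  from l(1) show ?thesis unfolding l(2)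
  proof (induction l)
    case Nil then show ?case using 0 by (simp add: tensor_zero)
  next
    case (Cons p l)
    then obtain v w where p: "p = (v, w)" "v \<in> carrier V" "w \<in> carrier W" by (cases p) auto
    then show ?case using Cons(2,3) by (auto simp: tclass_Cons[OF V W] intro!: add tclass_in_carrier)
  qed
qed

text \<open>
  Two linear maps that agree on pure tensors are equal.  Nearly every identity below is proved by
  this principle, once for each leg of the tensor product.
\<close>

lemma tensor_ext:
  assumes V: "module k V" and W: "module k W" and Z: "module k Z"
    and f: "linear_map k (tensor k V W) Z f" and g: "linear_map k (tensor k V W) Z g"
    and eq: "\<And>v w. v \<in> carrier V \<Longrightarrow> w \<in> carrier W \<Longrightarrow> f (pure k V W v w) = g (pure k V W v w)"
    and t: "t \<in> carrier (tensor k V W)"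
  shows "f t = g t"
  using V W t
proof (induction rule: tensor_induct)
  case zero
  show ?case using linear_map_zero[OF module_tensor[OF V W] Z] f g by metis
next
  case (add v w t)
  then show ?case using eq f g by (simp add: linear_map_add pure_closed)
qed

section \<open>The ground ring as a module\<close>

text \<open>
  Linear forms become linear maps with values in this module, so that the universal property and
  the linearity rules serve for forms too.
\<close>

definition kmod :: "('k, 'l) ring_scheme \<Rightarrow> ('k, 'k) module"
  where "kmod k = \<lparr>carrier = carrier k, mult = mult k, one = one k, zero = zero k, add = add k, smult = mult k\<rparr>"

lemma kmod_simps [simp]: "carrier (kmod k) = carrier k" "mult (kmod k) = mult k" "one (kmod k) = one k"
  "zero (kmod k) = zero k" "add (kmod k) = add k" "smult (kmod k) = mult k"
  by (simp_all add: kmod_def)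

lemma module_kmod: "cring k \<Longrightarrow> module k (kmod k)"
proof -
  assume "cring k"
  then interpret cring k .
  show ?thesis
    by (intro moduleI abelian_groupI is_cring)
      (auto simp: a_ac m_assoc l_distr r_distr intro: l_neg)
qed

lemma tlift_kmod: "tlift k V W k f = tlift k V W (kmod k) f"
proof -
  have "tsum k f l = tsum (kmod k) f l" for l by (simp add: tsum_def)
  then show ?thesis by (auto simp: tlift_def)
qed

lemma linear_form_iff: "linear_form k V f \<longleftrightarrow> linear_map k V (kmod k) f"
  by (simp add: linear_form_def linear_map_def)

lemma module_cring: "module k V \<Longrightarrow> cring k"
  by (simp add: module_def)

section \<open>Multilinear expressions\<close>

text \<open>
  The following rules reduce the linearity of a nested expression in one of its variables to the
  linearity of the subexpression in which the variable occurs.  Their conclusions are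
  higher-order patterns that are told apart by the outermost operation, so that the simplifier can
  decide the multilinearity of all expressions that occur.
\<close>

lemma lin_pure_left:
  assumes "module k V" "module k W" "linear_map k U V f" "w \<in> carrier W"
  shows "linear_map k U (tensor k V W) (\<lambda>x. pure k V W (f x) w)"
proof (rule linear_mapI)
  interpret V: module k V by fact
  fix x assume x: "x \<in> carrier U"
  then show "pure k V W (f x) w \<in> carrier (tensor k V W)"
    using assms by (auto intro!: pure_closed linear_map_closed[OF assms(3)])
  { fix y assume y: "y \<in> carrier U"
    have fxy: "f x \<in> carrier V" "f y \<in> carrier V" using x y assms(3) by (auto simp: linear_map_closed)
    show "pure k V W (f (x \<oplus>\<^bsub>U\<^esub> y)) w = pure k V W (f x) w \<oplus>\<^bsub>tensor k V W\<^esub> pure k V W (f y) w"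
      using tclass_eqI[OF tensor_rel.add_left[OF fxy assms(4), where k=k]] fxy x y assms
      by (simp add: pure_def add_tclass linear_map_add) }
  { fix c assume c: "c \<in> carrier k"
    have fx: "f x \<in> carrier V" using x assms(3) by (auto simp: linear_map_closed)
    show "pure k V W (f (c \<odot>\<^bsub>U\<^esub> x)) w = c \<odot>\<^bsub>tensor k V W\<^esub> pure k V W (f x) w"
      using fx x c assms by (simp add: pure_def smult_tclass linear_map_smult) }
qed

lemma lin_pure_right:
  assumes "module k V" "module k W" "linear_map k U W f" "v \<in> carrier V"
  shows "linear_map k U (tensor k V W) (\<lambda>x. pure k V W v (f x))"
proof (rule linear_mapI)
  interpret V: module k V by fact
  fix x assume x: "x \<in> carrier U"
  then show "pure k V W v (f x) \<in> carrier (tensor k V W)"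
    using assms by (auto intro!: pure_closed linear_map_closed[OF assms(3)])
  { fix y assume y: "y \<in> carrier U"
    have fxy: "f x \<in> carrier W" "f y \<in> carrier W" using x y assms(3) by (auto simp: linear_map_closed)
    show "pure k V W v (f (x \<oplus>\<^bsub>U\<^esub> y)) = pure k V W v (f x) \<oplus>\<^bsub>tensor k V W\<^esub> pure k V W v (f y)"
      using tclass_eqI[OF tensor_rel.add_right[OF assms(4) fxy, where k=k]] fxy x y assms
      by (simp add: pure_def add_tclass linear_map_add) }
  { fix c assume c: "c \<in> carrier k"
    have fx: "f x \<in> carrier W" using x assms(3) by (auto simp: linear_map_closed)
    show "pure k V W v (f (c \<odot>\<^bsub>U\<^esub> x)) = c \<odot>\<^bsub>tensor k V W\<^esub> pure k V W v (f x)"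
      using tclass_eqI[OF tensor_rel.scalar[OF c assms(4) fx]] fx x c assms
      by (simp add: pure_def smult_tclass linear_map_smult) }
qed

lemma lin_smult_right:
  assumes "module k V" "linear_map k U V f" "c \<in> carrier k"
  shows "linear_map k U V (\<lambda>x. c \<odot>\<^bsub>V\<^esub> f x)"
proof -
  interpret V: module k V by fact
  have *: "c \<odot>\<^bsub>V\<^esub> (d \<odot>\<^bsub>V\<^esub> x) = d \<odot>\<^bsub>V\<^esub> (c \<odot>\<^bsub>V\<^esub> x)" if "d \<in> carrier k" "x \<in> carrier V" for d x
    using that assms(3) by (metis V.R.m_comm V.smult_assoc1)
  show ?thesis
    using assms by (intro linear_mapI)
      (auto simp: linear_map_closed linear_map_add linear_map_smult V.smult_r_distr *)
qed

lemma lin_smult_left: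
  assumes "module k V" "linear_map k U (kmod k) f" "v \<in> carrier V"
  shows "linear_map k U V (\<lambda>x. f x \<odot>\<^bsub>V\<^esub> v)"
proof -
  interpret V: module k V by fact
  note [simp] = linear_map_closed[OF assms(2), simplified]
  show ?thesis
    using assms by (intro linear_mapI)
      (auto simp: linear_map_add linear_map_smult V.smult_l_distr V.smult_assoc1)
qed

lemma lin_kmult_right:
  assumes "cring k" "linear_map k U (kmod k) f" "c \<in> carrier k"
  shows "linear_map k U (kmod k) (\<lambda>x. c \<otimes>\<^bsub>k\<^esub> f x)"
  using lin_smult_right[OF module_kmod] assms by fastforce

lemma lin_kmult_left:
  assumes "cring k" "linear_map k U (kmod k) f" "c \<in> carrier k"
  shows "linear_map k U (kmod k) (\<lambda>x. f x \<otimes>\<^bsub>k\<^esub> c)"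
  using lin_smult_left[OF module_kmod] assms by fastforce

lemma k_algebraD: 
  assumes "k_algebra k A"
  shows k_algebra_module: "module k A" and k_algebra_ring: "ring A"
    and k_algebra_smult_left: "\<And>c x y. c \<in> carrier k \<Longrightarrow> x \<in> carrier A \<Longrightarrow> y \<in> carrier A \<Longrightarrow>
      (c \<odot>\<^bsub>A\<^esub> x) \<otimes>\<^bsub>A\<^esub> y = c \<odot>\<^bsub>A\<^esub> (x \<otimes>\<^bsub>A\<^esub> y)"
    and k_algebra_smult_right: "\<And>c x y. c \<in> carrier k \<Longrightarrow> x \<in> carrier A \<Longrightarrow> y \<in> carrier A \<Longrightarrow>
      x \<otimes>\<^bsub>A\<^esub> (c \<odot>\<^bsub>A\<^esub> y) = c \<odot>\<^bsub>A\<^esub> (x \<otimes>\<^bsub>A\<^esub> y)"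
  using assms by (auto simp: k_algebra_def)

lemma lin_mult_left:
  assumes "k_algebra k A" "linear_map k U A f" "a \<in> carrier A"
  shows "linear_map k U A (\<lambda>x. f x \<otimes>\<^bsub>A\<^esub> a)"
proof -
  interpret A: ring A using assms(1) by (rule k_algebra_ring)
  show ?thesis
    using assms by (intro linear_mapI)
      (auto simp: linear_map_closed linear_map_add linear_map_smult A.l_distr k_algebra_smult_left)
qed

lemma lin_mult_right:
  assumes "k_algebra k A" "linear_map k U A f" "a \<in> carrier A"
  shows "linear_map k U A (\<lambda>x. a \<otimes>\<^bsub>A\<^esub> f x)"
proof -
  interpret A: ring A using assms(1) by (rule k_algebra_ring)
  show ?thesis
    using assms by (intro linear_mapI)
      (auto simp: linear_map_closed linear_map_add linear_map_smult A.r_distr k_algebra_smult_right)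
qed

lemma tlift_cong:
  assumes "module k V" "module k W"
    "\<And>v w. v \<in> carrier V \<Longrightarrow> w \<in> carrier W \<Longrightarrow> f v w = g v w"
  shows "tlift k V W Z f t = tlift k V W Z g t"
proof (cases "t \<in> carrier (tensor k V W)")
  case True
  then obtain l where l: "l \<in> lists (carrier V \<times> carrier W)" "t = tclass k V W l" by (rule tensor_cases)
  have "trep t \<in> lists (carrier V \<times> carrier W)"
    using tensor_rel_lists[OF assms(1,2) trep_tclass[OF l(1), where k=k]] l(2) by simp
  then have "tsum Z f (trep t) = tsum Z g (trep t)"
    by induction (auto simp: tsum_def assms(3))
  then show ?thesis using True by (simp add: tlift_def)
qed (simp add: tlift_def)

lemma tlift_closed:
  assumes "module k V" "module k W" "module k Z" "bilinear_map k V W Z f" "t \<in> carrier (tensor k V W)"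
  shows "tlift k V W Z f t \<in> carrier Z"
  using tlift_linear[OF assms(1-4)] assms(5) by (rule linear_map_closed)

lemma lin_tlift_arg:
  assumes "module k V" "module k W" "module k Z" "bilinear_map k V W Z f" "linear_map k U (tensor k V W) g"
  shows "linear_map k U Z (\<lambda>x. tlift k V W Z f (g x))"
  using tlift_linear[OF assms(1-4)] assms(5) by (rule lin_comp)

lemma lin_add:
  assumes "module k V" "linear_map k U V f" "linear_map k U V g"
  shows "linear_map k U V (\<lambda>x. f x \<oplus>\<^bsub>V\<^esub> g x)"
proof -
  interpret V: module k V by fact
  have "linear_map k U V f" "linear_map k U V g" by fact+
  then show ?thesis
    by (intro linear_mapI)
      (auto simp: linear_map_closed linear_map_add linear_map_smult V.smult_r_distr V.M.a_ac)
qed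

lemma lin_zero:
  assumes "module k V"
  shows "linear_map k U V (\<lambda>x. \<zero>\<^bsub>V\<^esub>)"
proof -
  interpret V: module k V by fact
  show ?thesis by (intro linear_mapI) auto
qed

text \<open>
  Here the variable occurs in the bilinear map and not in the tensor.  By induction on the tensor,
  the value is a finite sum of values of the bilinear map, each of which is linear in it.
\<close>

lemma lin_tlift_param:
  assumes V: "module k V" and W: "module k W" and Z: "module k Z"
    and F: "\<And>x. x \<in> carrier U \<Longrightarrow> bilinear_map k V W Z (F x)"
    and lin: "\<And>v w. v \<in> carrier V \<Longrightarrow> w \<in> carrier W \<Longrightarrow> linear_map k U Z (\<lambda>x. F x v w)"
    and U: "module k U" and t: "t \<in> carrier (tensor k V W)"
  shows "linear_map k U Z (\<lambda>x. tlift k V W Z (F x) t)"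
  using V W t
proof (induction rule: tensor_induct)
  case zero
  have "tlift k V W Z (F x) \<zero>\<^bsub>tensor k V W\<^esub> = \<zero>\<^bsub>Z\<^esub>" if "x \<in> carrier U" for x
    using linear_map_zero[OF module_tensor[OF V W] Z tlift_linear[OF V W Z F[OF that]]] .
  then show ?case by (subst linear_map_cong[OF U, where g = "\<lambda>x. \<zero>\<^bsub>Z\<^esub>"]) (auto intro: lin_zero[OF Z])
next
  case (add v w t)
  have "tlift k V W Z (F x) (pure k V W v w \<oplus>\<^bsub>tensor k V W\<^esub> t) = F x v w \<oplus>\<^bsub>Z\<^esub> tlift k V W Z (F x) t"
    if "x \<in> carrier U" for x
    using linear_map_add[OF tlift_linear[OF V W Z F[OF that]] pure_closed[OF add(1,2)] add(3)]
    by (simp add: tlift_pure[OF V W Z F[OF that] add(1,2)])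
  moreover have "linear_map k U Z (\<lambda>x. F x v w \<oplus>\<^bsub>Z\<^esub> tlift k V W Z (F x) t)"
    using add lin by (intro lin_add[OF Z]) auto
  ultimately show ?case
    by (subst linear_map_cong[OF U, where g = "\<lambda>x. F x v w \<oplus>\<^bsub>Z\<^esub> tlift k V W Z (F x) t"]) auto
qed

text \<open>
  If the linear map is itself a lifted bilinear map, this exchanges two summations.
\<close>

lemma linear_tlift:
  assumes "module k V" "module k W" "module k Z" "module k Z'" "linear_map k Z Z' L"
    "bilinear_map k V W Z F" "t \<in> carrier (tensor k V W)"
  shows "L (tlift k V W Z F t) = tlift k V W Z' (\<lambda>v w. L (F v w)) t"
proof -
  have b: "bilinear_map k V W Z' (\<lambda>v w. L (F v w))"
    using assms(5,6) by (auto simp: bilinear_map_def intro: lin_comp)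
  show ?thesis
    by (rule tensor_ext[OF assms(1,2,4) _ _ _ assms(7)])
      (use assms b in \<open>auto simp: tlift_pure intro!: lin_comp[OF assms(5)] tlift_linear\<close>)
qed

section \<open>Tensor products of algebras\<close>

lemma tsum_map:
  assumes "module k V" "module k W" "l \<in> lists L"
    "\<And>v w. (v, w) \<in> L \<Longrightarrow> f v w \<in> carrier V \<and> g v w \<in> carrier W"
  shows "map (\<lambda>(v, w). (f v w, g v w)) l \<in> lists (carrier V \<times> carrier W) \<and>
    tclass k V W (map (\<lambda>(v, w). (f v w, g v w)) l) = tsum (tensor k V W) (\<lambda>v w. pure k V W (f v w) (g v w)) l"
  using assms(3)
proof induction
  case Nil then show ?case by (simp add: tsum_def tensor_zero)
next
  case (Cons p l)
  obtain v w where p: "p = (v, w)" by (cases p)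
  then show ?case using Cons assms(4)[of v w] by (simp add: tsum_Cons tclass_Cons[OF assms(1,2)])
qed

lemma trep_lists:
  assumes "module k V" "module k W" "t \<in> carrier (tensor k V W)"
  shows "trep t \<in> lists (carrier V \<times> carrier W)"
proof -
  obtain l where l: "l \<in> lists (carrier V \<times> carrier W)" "t = tclass k V W l" using assms(3) by (rule tensor_cases)
  show ?thesis
    using tensor_rel_lists[OF assms(1,2) trep_tclass[OF l(1), where k=k]] l(2) by simp
qed

text \<open>
  The product is defined by the lists that represent the factors.  It is the bilinear extension of
  the product of pure tensors, whence it does not depend on the representatives.
\<close>

lemma tensor_mult:
  assumes V: "k_algebra k V" and W: "k_algebra k W"
    and s: "s \<in> carrier (tensor k V W)" and t: "t \<in> carrier (tensor k V W)"
  shows "s \<otimes>\<^bsub>tensor k V W\<^esub> t = tlift k V W (tensor k V W)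
    (\<lambda>v w. tlift k V W (tensor k V W) (\<lambda>v' w'. pure k V W (v \<otimes>\<^bsub>V\<^esub> v') (w \<otimes>\<^bsub>W\<^esub> w')) t) s"
proof -
  interpret V: ring V using V by (rule k_algebra_ring)
  interpret W: ring W using W by (rule k_algebra_ring)
  note mods = k_algebra_module[OF V] k_algebra_module[OF W]
  let ?T = "tensor k V W" and ?L = "carrier V \<times> carrier W"
  let ?f = "\<lambda>v w l. map (\<lambda>(v', w'). (v \<otimes>\<^bsub>V\<^esub> v', w \<otimes>\<^bsub>W\<^esub> w')) l"
  let ?g = "\<lambda>v w. tsum ?T (\<lambda>v' w'. pure k V W (v \<otimes>\<^bsub>V\<^esub> v') (w \<otimes>\<^bsub>W\<^esub> w')) (trep t)"
  note ts = trep_lists[OF mods s] trep_lists[OF mods t]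
  have *: "concat (map (\<lambda>(v, w). ?f v w (trep t)) l) \<in> lists ?L \<and>
    tclass k V W (concat (map (\<lambda>(v, w). ?f v w (trep t)) l)) = tsum ?T ?g l" if "l \<in> lists ?L" for l
    using that
  proof induction
    case Nil then show ?case by (simp add: tsum_def tensor_zero)
  next
    case (Cons p l)
    obtain v w where p: "p = (v, w)" "v \<in> carrier V" "w \<in> carrier W" using Cons(1) by (cases p) auto
    have c: "?f v w (trep t) \<in> lists ?L \<and> tclass k V W (?f v w (trep t)) = ?g v w"
      using p by (intro tsum_map[OF mods ts(2)]) auto
    then show ?case using Cons(3) add_tclass[OF _ _ mods, of "?f v w (trep t)", symmetric]
      by (simp add: p tsum_Cons)
  qed
  have "s \<otimes>\<^bsub>?T\<^esub> t = tclass k V W (concat (map (\<lambda>(v, w). ?f v w (trep t)) (trep s)))"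
    by (simp add: tensor_def)
  then show ?thesis using * ts s t by (simp add: tlift_def)
qed

lemmas lin_basic = lin_id lin_pure_left lin_pure_right lin_smult_right lin_smult_left lin_kmult_right lin_kmult_left
  lin_mult_left lin_mult_right lin_tlift_arg lin_tlift_param bilinear_mapI
lemmas lin = lin_basic k_algebra_module

lemma tensor_mult_pure:
  assumes V: "k_algebra k V" and W: "k_algebra k W"
    and "v \<in> carrier V" "w \<in> carrier W" "v' \<in> carrier V" "w' \<in> carrier W"
  shows "pure k V W v w \<otimes>\<^bsub>tensor k V W\<^esub> pure k V W v' w' = pure k V W (v \<otimes>\<^bsub>V\<^esub> v') (w \<otimes>\<^bsub>W\<^esub> w')"
proof -
  interpret V: ring V using V by (rule k_algebra_ring)
  interpret W: ring W using W by (rule k_algebra_ring)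
  note mods = k_algebra_module[OF V] k_algebra_module[OF W]
  show ?thesis
    using assms mods
    by (simp add: tensor_mult pure_closed tlift_pure lin module_tensor)
qed

lemma tensor_mult_linear:
  assumes V: "k_algebra k V" and W: "k_algebra k W"
    and t: "t \<in> carrier (tensor k V W)"
  shows "linear_map k (tensor k V W) (tensor k V W) (\<lambda>s. s \<otimes>\<^bsub>tensor k V W\<^esub> t)" (is ?A)
    and "linear_map k (tensor k V W) (tensor k V W) (\<lambda>s. t \<otimes>\<^bsub>tensor k V W\<^esub> s)" (is ?B)
proof -
  interpret V: ring V using V by (rule k_algebra_ring)
  interpret W: ring W using W by (rule k_algebra_ring)
  note mods = k_algebra_module[OF V] k_algebra_module[OF W]
  note mT = module_tensor[OF mods]
  show ?A using assms mods
    by (subst linear_map_cong[OF mT tensor_mult[OF V W]])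
      (simp_all add: lin pure_closed mT)
  show ?B using assms mods
    by (subst linear_map_cong[OF mT tensor_mult[OF V W]])
      (simp_all add: lin pure_closed mT)
qed

lemma k_algebra_tensor:
  assumes V: "k_algebra k V" and W: "k_algebra k W"
  shows "k_algebra k (tensor k V W)"
proof -
  interpret V: ring V using V by (rule k_algebra_ring)
  interpret W: ring W using W by (rule k_algebra_ring)
  note mods = k_algebra_module[OF V] k_algebra_module[OF W]
  let ?T = "tensor k V W"
  note mT = module_tensor[OF mods]
  interpret T: module k ?T by (rule mT)
  note ml = tensor_mult_linear[OF V W]
  note mp = tensor_mult_pure[OF V W]
  have cl: "s \<otimes>\<^bsub>?T\<^esub> t \<in> carrier ?T" if "s \<in> carrier ?T" "t \<in> carrier ?T" for s t
    using linear_map_closed[OF ml(1)] that by blast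
  have one: "\<one>\<^bsub>?T\<^esub> = pure k V W \<one>\<^bsub>V\<^esub> \<one>\<^bsub>W\<^esub>" by (simp add: tensor_def)
  have onecl: "\<one>\<^bsub>?T\<^esub> \<in> carrier ?T" unfolding one by (intro pure_closed) auto
  have assoc: "s \<otimes>\<^bsub>?T\<^esub> t \<otimes>\<^bsub>?T\<^esub> u = s \<otimes>\<^bsub>?T\<^esub> (t \<otimes>\<^bsub>?T\<^esub> u)"
    if s: "s \<in> carrier ?T" and t: "t \<in> carrier ?T" and u: "u \<in> carrier ?T" for s t u
  proof -
    have 1: "s \<otimes>\<^bsub>?T\<^esub> t \<otimes>\<^bsub>?T\<^esub> u = s \<otimes>\<^bsub>?T\<^esub> (t \<otimes>\<^bsub>?T\<^esub> u)" 
      if s: "s = pure k V W a b" "a \<in> carrier V" "b \<in> carrier W" and t: "t = pure k V W a' b'" "a' \<in> carrier V" "b' \<in> carrier W" 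
      and u: "u \<in> carrier ?T" for s t u a b a' b'
    proof (rule tensor_ext[OF mods mT _ _ _ u])
      show "linear_map k ?T ?T (\<lambda>u. s \<otimes>\<^bsub>?T\<^esub> t \<otimes>\<^bsub>?T\<^esub> u)"
        using s t cl by (intro ml) (simp add: pure_closed)
      show "linear_map k ?T ?T (\<lambda>u. s \<otimes>\<^bsub>?T\<^esub> (t \<otimes>\<^bsub>?T\<^esub> u))"
        using s t by (intro lin_comp[OF ml(2)] ml) (simp_all add: pure_closed)
    qed (use s t in \<open>simp add: mp V.m_assoc W.m_assoc\<close>)
    have 2: "s \<otimes>\<^bsub>?T\<^esub> t \<otimes>\<^bsub>?T\<^esub> u = s \<otimes>\<^bsub>?T\<^esub> (t \<otimes>\<^bsub>?T\<^esub> u)" 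
      if s: "s = pure k V W a b" "a \<in> carrier V" "b \<in> carrier W" and t: "t \<in> carrier ?T"
      and u: "u \<in> carrier ?T" for s t u a b
    proof (rule tensor_ext[OF mods mT _ _ _ t])
      show "linear_map k ?T ?T (\<lambda>t. s \<otimes>\<^bsub>?T\<^esub> t \<otimes>\<^bsub>?T\<^esub> u)"
        using s u by (intro lin_comp[OF ml(1)] ml) (simp_all add: pure_closed)
      show "linear_map k ?T ?T (\<lambda>t. s \<otimes>\<^bsub>?T\<^esub> (t \<otimes>\<^bsub>?T\<^esub> u))"
        using s u by (intro lin_comp[OF ml(2)] ml) (simp_all add: pure_closed)
    qed (use s u in \<open>simp add: 1[OF HOL.refl _ _ HOL.refl]\<close>)
    show ?thesis
    proof (rule tensor_ext[OF mods mT _ _ _ s])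
      show "linear_map k ?T ?T (\<lambda>s. s \<otimes>\<^bsub>?T\<^esub> t \<otimes>\<^bsub>?T\<^esub> u)"
        using t u by (intro lin_comp[OF ml(1)] ml)
      show "linear_map k ?T ?T (\<lambda>s. s \<otimes>\<^bsub>?T\<^esub> (t \<otimes>\<^bsub>?T\<^esub> u))"
        using t u cl by (intro ml) 
    qed (use t u in \<open>simp add: 2[OF HOL.refl]\<close>)
  qed
  have l1: "\<one>\<^bsub>?T\<^esub> \<otimes>\<^bsub>?T\<^esub> t = t" if t: "t \<in> carrier ?T" for t
    by (rule tensor_ext[OF mods mT ml(2)[OF onecl] lin_id _ t]) (auto simp: one mp)
  have r1: "t \<otimes>\<^bsub>?T\<^esub> \<one>\<^bsub>?T\<^esub> = t" if t: "t \<in> carrier ?T" for t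
    by (rule tensor_ext[OF mods mT ml(1)[OF onecl] lin_id _ t]) (auto simp: one mp)
  have "ring ?T"
    using linear_map_add[OF ml(1)] linear_map_add[OF ml(2)]
    by (intro ringI monoidI T.abelian_group_axioms) (simp_all add: cl onecl assoc l1 r1)
  then show ?thesis
    using linear_map_smult[OF ml(1)] linear_map_smult[OF ml(2)] mT by (simp add: k_algebra_def)
qed

section \<open>Maps between tensor products\<close>

lemma tensor_one: "\<one>\<^bsub>tensor k V W\<^esub> = pure k V W \<one>\<^bsub>V\<^esub> \<one>\<^bsub>W\<^esub>"
  by (simp add: tensor_def)

lemmas lin2 = lin pure_closed module_tensor bilinear_map_closed linear_map_closed k_algebra_tensor tlift_closed

lemma tmap_pure:
  assumes "module k V" "module k W" "module k V'" "module k W'" "linear_map k V V' f" "linear_map k W W' g"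
    "v \<in> carrier V" "w \<in> carrier W"
  shows "tmap k V W V' W' f g (pure k V W v w) = pure k V' W' (f v) (g w)"
  using assms by (simp add: tmap_def tlift_pure lin2)

lemma tmap_linear:
  assumes "module k V" "module k W" "module k V'" "module k W'" "linear_map k V V' f" "linear_map k W W' g"
  shows "linear_map k (tensor k V W) (tensor k V' W') (tmap k V W V' W' f g)"
  using assms by (simp add: tmap_def lin2 tlift_linear)

lemma lin_tmap:
  assumes "module k V" "module k W" "module k V'" "module k W'" "linear_map k V V' f" "linear_map k W W' g"
    "linear_map k U (tensor k V W) h"
  shows "linear_map k U (tensor k V' W') (\<lambda>x. tmap k V W V' W' f g (h x))"
  using tmap_linear[OF assms(1-6)] assms(7) by (rule lin_comp)

lemma tflip_pure:
  assumes "module k V" "module k W" "v \<in> carrier V" "w \<in> carrier W"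
  shows "tflip k V W (pure k V W v w) = pure k W V w v"
  using assms by (simp add: tflip_def tlift_pure lin2)

lemma tflip_linear:
  assumes "module k V" "module k W"
  shows "linear_map k (tensor k V W) (tensor k W V) (tflip k V W)"
  using assms by (simp add: tflip_def lin2 tlift_linear)

lemma lin_tflip:
  assumes "module k V" "module k W" "linear_map k U (tensor k V W) h"
  shows "linear_map k U (tensor k W V) (\<lambda>x. tflip k V W (h x))"
  using tflip_linear[OF assms(1,2)] assms(3) by (rule lin_comp)

lemma tassoc_pure:
  assumes "module k A" "module k B" "module k C" "a \<in> carrier A" "b \<in> carrier B" "c \<in> carrier C"
  shows "tassoc k A B C (pure k (tensor k A B) C (pure k A B a b) c) = pure k A (tensor k B C) a (pure k B C b c)"
  using assms by (simp add: tassoc_def tlift_pure lin2)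

lemma tassoc_linear:
  assumes "module k A" "module k B" "module k C"
  shows "linear_map k (tensor k (tensor k A B) C) (tensor k A (tensor k B C)) (tassoc k A B C)"
  using assms by (simp add: tassoc_def lin2 tlift_linear)

lemma lin_tassoc:
  assumes "module k A" "module k B" "module k C" "linear_map k U (tensor k (tensor k A B) C) h"
  shows "linear_map k U (tensor k A (tensor k B C)) (\<lambda>x. tassoc k A B C (h x))"
  using tassoc_linear[OF assms(1-3)] assms(4) by (rule lin_comp)

lemma tunassoc_pure:
  assumes "module k A" "module k B" "module k C" "a \<in> carrier A" "b \<in> carrier B" "c \<in> carrier C"
  shows "tunassoc k A B C (pure k A (tensor k B C) a (pure k B C b c)) = pure k (tensor k A B) C (pure k A B a b) c"
  using assms by (simp add: tunassoc_def tlift_pure lin2)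

lemma tunassoc_linear:
  assumes "module k A" "module k B" "module k C"
  shows "linear_map k (tensor k A (tensor k B C)) (tensor k (tensor k A B) C) (tunassoc k A B C)"
  using assms by (simp add: tunassoc_def lin2 tlift_linear)

lemma lin_tunassoc:
  assumes "module k A" "module k B" "module k C" "linear_map k U (tensor k A (tensor k B C)) h"
  shows "linear_map k U (tensor k (tensor k A B) C) (\<lambda>x. tunassoc k A B C (h x))"
  using tunassoc_linear[OF assms(1-3)] assms(4) by (rule lin_comp)

lemma lin_app: "linear_map k V W (\<lambda>x. f x) \<Longrightarrow> linear_map k V W f"
  by simp

lemmas lin3 = lin2 lin_tmap lin_tflip lin_tassoc lin_tunassoc tmap_linear tflip_linear tassoc_linear tunassoc_linear
  tlift_linear

lemma tensor_ext_right:
  assumes "module k A" "module k B" "module k C" "module k Z"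
    "linear_map k (tensor k A (tensor k B C)) Z f" "linear_map k (tensor k A (tensor k B C)) Z g"
    "\<And>a b c. a \<in> carrier A \<Longrightarrow> b \<in> carrier B \<Longrightarrow> c \<in> carrier C \<Longrightarrow>
      f (pure k A (tensor k B C) a (pure k B C b c)) = g (pure k A (tensor k B C) a (pure k B C b c))"
    "t \<in> carrier (tensor k A (tensor k B C))"
  shows "f t = g t"
proof (rule tensor_ext[OF assms(1) module_tensor[OF assms(2,3)] assms(4-6) _ assms(8)])
  fix a s assume a: "a \<in> carrier A" and s: "s \<in> carrier (tensor k B C)"
  show "f (pure k A (tensor k B C) a s) = g (pure k A (tensor k B C) a s)"
    by (rule tensor_ext[OF assms(2-4) lin_comp[OF assms(5)] lin_comp[OF assms(6)] _ s])
      (use assms a in \<open>simp_all add: lin3\<close>)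
qed

section \<open>Algebra homomorphisms\<close>

lemma alg_homI:
  assumes "linear_map k A B f" "f \<one>\<^bsub>A\<^esub> = \<one>\<^bsub>B\<^esub>"
    "\<And>x y. x \<in> carrier A \<Longrightarrow> y \<in> carrier A \<Longrightarrow> f (x \<otimes>\<^bsub>A\<^esub> y) = f x \<otimes>\<^bsub>B\<^esub> f y"
  shows "f \<in> alg_hom k A B"
  using assms by (auto simp: alg_hom_def ring_hom_def linear_map_def)

lemma alg_homD:
  assumes "f \<in> alg_hom k A B"
  shows alg_hom_linear: "linear_map k A B f" and alg_hom_one: "f \<one>\<^bsub>A\<^esub> = \<one>\<^bsub>B\<^esub>"
    and alg_hom_mult: "\<And>x y. x \<in> carrier A \<Longrightarrow> y \<in> carrier A \<Longrightarrow> f (x \<otimes>\<^bsub>A\<^esub> y) = f x \<otimes>\<^bsub>B\<^esub> f y"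
  using assms by (auto simp: alg_hom_def ring_hom_def)

lemma alg_hom_id: "(\<lambda>x. x) \<in> alg_hom k A A"
  by (auto intro!: alg_homI lin_id)

lemma alg_hom_comp: "f \<in> alg_hom k B C \<Longrightarrow> g \<in> alg_hom k A B \<Longrightarrow> (\<lambda>x. f (g x)) \<in> alg_hom k A C"
  by (rule alg_homI)
    (auto intro: lin_comp alg_hom_linear simp: alg_hom_one alg_hom_mult linear_map_closed[OF alg_hom_linear])

lemma alg_hom_tensorI:
  assumes V: "k_algebra k V" and W: "k_algebra k W" and B: "k_algebra k B"
    and f: "linear_map k (tensor k V W) B f" and one: "f (pure k V W \<one>\<^bsub>V\<^esub> \<one>\<^bsub>W\<^esub>) = \<one>\<^bsub>B\<^esub>"
    and mult: "\<And>v w v' w'. v \<in> carrier V \<Longrightarrow> w \<in> carrier W \<Longrightarrow> v' \<in> carrier V \<Longrightarrow> w' \<in> carrier W \<Longrightarrow>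
      f (pure k V W (v \<otimes>\<^bsub>V\<^esub> v') (w \<otimes>\<^bsub>W\<^esub> w')) = f (pure k V W v w) \<otimes>\<^bsub>B\<^esub> f (pure k V W v' w')"
  shows "f \<in> alg_hom k (tensor k V W) B"
proof (rule alg_homI[OF f])
  let ?T = "tensor k V W"
  note mods = k_algebra_module[OF V] k_algebra_module[OF W]
  note mB = k_algebra_module[OF B] and mT = module_tensor[OF mods] and T = k_algebra_tensor[OF V W]
  show "f \<one>\<^bsub>?T\<^esub> = \<one>\<^bsub>B\<^esub>" using one by (simp add: tensor_one)
  fix x y assume x: "x \<in> carrier ?T" and y: "y \<in> carrier ?T"
  note fcl = linear_map_closed[OF f]
  show "f (x \<otimes>\<^bsub>?T\<^esub> y) = f x \<otimes>\<^bsub>B\<^esub> f y"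
  proof (rule tensor_ext[OF mods mB _ _ _ x])
    fix v w assume vw: "v \<in> carrier V" "w \<in> carrier W"
    show "f (pure k V W v w \<otimes>\<^bsub>?T\<^esub> y) = f (pure k V W v w) \<otimes>\<^bsub>B\<^esub> f y"
      by (rule tensor_ext[OF mods mB _ _ _ y])
        (use vw V W B mods mT T f in \<open>simp_all add: tensor_mult_pure mult fcl lin3 lin_comp[OF f]\<close>)
  qed (use y V W B mods mT T f in \<open>simp_all add: fcl lin3 lin_comp[OF f]\<close>)
qed

lemma tmap_alg_hom:
  assumes "k_algebra k V" "k_algebra k W" "k_algebra k V'" "k_algebra k W'"
    "f \<in> alg_hom k V V'" "g \<in> alg_hom k W W'"
  shows "tmap k V W V' W' f g \<in> alg_hom k (tensor k V W) (tensor k V' W')"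
proof -
  interpret V: ring V using assms by (simp add: k_algebra_ring)
  interpret W: ring W using assms by (simp add: k_algebra_ring)
  note f = alg_hom_linear[OF assms(5)] and g = alg_hom_linear[OF assms(6)]
  show ?thesis
    by (rule alg_hom_tensorI)
      (use assms f g in \<open>simp_all add: lin3 tmap_pure tensor_mult_pure alg_hom_one alg_hom_mult
        linear_map_closed[OF f] linear_map_closed[OF g] tensor_one\<close>)
qed

lemma tflip_alg_hom:
  assumes "k_algebra k V" "k_algebra k W"
  shows "tflip k V W \<in> alg_hom k (tensor k V W) (tensor k W V)"
proof -
  interpret V: ring V using assms by (simp add: k_algebra_ring)
  interpret W: ring W using assms by (simp add: k_algebra_ring)
  show ?thesis
    by (rule alg_hom_tensorI)
      (use assms in \<open>simp_all add: lin3 tflip_pure tensor_mult_pure tensor_one\<close>)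
qed

text \<open>
  Both sides of multiplicativity are linear in either argument, so that it can be tested on pure
  tensors of all three legs.
\<close>

lemma alg_hom_tensor_leftI:
  assumes A: "k_algebra k A" and B: "k_algebra k B" and C: "k_algebra k C" and Z: "k_algebra k Z"
    and f: "linear_map k (tensor k (tensor k A B) C) Z f"
    and one: "f (pure k (tensor k A B) C (pure k A B \<one>\<^bsub>A\<^esub> \<one>\<^bsub>B\<^esub>) \<one>\<^bsub>C\<^esub>) = \<one>\<^bsub>Z\<^esub>"
    and mult: "\<And>a b c a' b' c'. a \<in> carrier A \<Longrightarrow> b \<in> carrier B \<Longrightarrow> c \<in> carrier C \<Longrightarrow>
      a' \<in> carrier A \<Longrightarrow> b' \<in> carrier B \<Longrightarrow> c' \<in> carrier C \<Longrightarrow>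
      f (pure k (tensor k A B) C (pure k A B (a \<otimes>\<^bsub>A\<^esub> a') (b \<otimes>\<^bsub>B\<^esub> b')) (c \<otimes>\<^bsub>C\<^esub> c')) =
      f (pure k (tensor k A B) C (pure k A B a b) c) \<otimes>\<^bsub>Z\<^esub> f (pure k (tensor k A B) C (pure k A B a' b') c')"
  shows "f \<in> alg_hom k (tensor k (tensor k A B) C) Z"
proof (rule alg_hom_tensorI[OF k_algebra_tensor[OF A B] C Z f])
  let ?T = "tensor k A B"
  interpret C: ring C using C by (simp add: k_algebra_ring)
  note mods = k_algebra_module[OF A] k_algebra_module[OF B] and mC = k_algebra_module[OF C]
  note mZ = k_algebra_module[OF Z] and mT = module_tensor[OF mods] and T = k_algebra_tensor[OF A B]
  note fcl = linear_map_closed[OF f]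
  show "f (pure k ?T C \<one>\<^bsub>?T\<^esub> \<one>\<^bsub>C\<^esub>) = \<one>\<^bsub>Z\<^esub>" using one by (simp add: tensor_one)
  fix x c y c' assume x: "x \<in> carrier ?T" and y: "y \<in> carrier ?T" and c: "c \<in> carrier C" "c' \<in> carrier C"
  show "f (pure k ?T C (x \<otimes>\<^bsub>?T\<^esub> y) (c \<otimes>\<^bsub>C\<^esub> c')) = f (pure k ?T C x c) \<otimes>\<^bsub>Z\<^esub> f (pure k ?T C y c')"
  proof (rule tensor_ext[OF mods mZ _ _ _ x])
    fix a b assume ab: "a \<in> carrier A" "b \<in> carrier B"
    show "f (pure k ?T C (pure k A B a b \<otimes>\<^bsub>?T\<^esub> y) (c \<otimes>\<^bsub>C\<^esub> c')) = f (pure k ?T C (pure k A B a b) c) \<otimes>\<^bsub>Z\<^esub> f (pure k ?T C y c')"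
      by (rule tensor_ext[OF mods mZ _ _ _ y])
        (use ab c A B C Z mods mC mZ mT T f in \<open>simp_all add: tensor_mult_pure mult fcl lin3 lin_comp[OF f]\<close>)
  qed (use y c A B C Z mods mC mZ mT T f in \<open>simp_all add: fcl lin3 lin_comp[OF f]\<close>)
qed

lemma tassoc_alg_hom:
  assumes "k_algebra k A" "k_algebra k B" "k_algebra k C"
  shows "tassoc k A B C \<in> alg_hom k (tensor k (tensor k A B) C) (tensor k A (tensor k B C))"
proof -
  interpret A: ring A using assms by (simp add: k_algebra_ring)
  interpret B: ring B using assms by (simp add: k_algebra_ring)
  interpret C: ring C using assms by (simp add: k_algebra_ring)
  show ?thesis
    by (rule alg_hom_tensor_leftI)
      (use assms in \<open>simp_all add: lin3 tassoc_pure tensor_mult_pure tensor_one\<close>)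
qed

section \<open>Dependence on the module structure only\<close>

text \<open>
  \<open>T\<^sub>M(H)\<close> and \<open>D\<^sub>M(H)\<close> are built on the modules \<open>H \<otimes> H'\<close> and \<open>H' \<otimes> H\<close>, with other coproducts or
  products.  Tensor constructions depend on the module structure only, which lets statements
  pass between these records.
\<close>

definition same_module :: "('k, 'a, 'm) module_scheme \<Rightarrow> ('k, 'a, 'n) module_scheme \<Rightarrow> bool"
  where "same_module V V' \<longleftrightarrow> carrier V = carrier V' \<and> add V = add V' \<and> zero V = zero V' \<and> smult V = smult V'"

lemma same_module_sym: "same_module V V' \<Longrightarrow> same_module V' V"
  by (simp add: same_module_def)

lemma tensor_rel_same_aux:
  assumes "same_module V V'" "same_module W W'" "(l, m) \<in> tensor_rel k V W"
  shows "(l, m) \<in> tensor_rel k V' W'"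
  using assms(3)
proof induction
  case (zero w)
  then show ?case using tensor_rel.zero[of w W' V' k] assms by (simp add: same_module_def)
next
  case (add_left v v' w)
  then show ?case using tensor_rel.add_left[of v V' v' w W' k] assms by (simp add: same_module_def)
next
  case (add_right v w w')
  then show ?case using tensor_rel.add_right[of v V' w W' w' k] assms by (simp add: same_module_def)
next
  case (scalar c v w)
  then show ?case using tensor_rel.scalar[of c k v V' w W'] assms by (simp add: same_module_def)
next
  case (refl l)
  then show ?case using tensor_rel.refl[of l V' W' k] assms by (simp add: same_module_def)
next
  case (comm l m)
  then show ?case using tensor_rel.comm[of l V' W' m k] assms by (simp add: same_module_def)
next
  case (app l l' m)
  then show ?case using tensor_rel.app[of l l' k V' W' m] assms by (simp add: same_module_def)
qed (blast intro: tensor_rel.sym tensor_rel.trans)+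

lemma tensor_rel_same:
  assumes "same_module V V'" "same_module W W'"
  shows "tensor_rel k V W = tensor_rel k V' W'"
  using tensor_rel_same_aux[OF assms] tensor_rel_same_aux[OF assms[THEN same_module_sym]] by auto

lemma pure_same:
  assumes "same_module V V'" "same_module W W'"
  shows "pure k V W = pure k V' W'"
  using tensor_rel_same[OF assms, of k] by (intro ext) (simp add: pure_def tclass_def)

lemma same_module_tensor:
  assumes "same_module V V'" "same_module W W'"
  shows "same_module (tensor k V W) (tensor k V' W')"
  using tensor_rel_same[OF assms, of k] assms by (simp add: same_module_def tensor_def tclass_def)

lemma tlift_same:
  assumes "same_module V V'" "same_module W W'"
  shows "tlift k V W Z f = tlift k V' W' Z f"
  using same_module_tensor[OF assms, of k] by (simp add: tlift_def same_module_def)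

lemma same_module_linear_map:
  assumes "same_module V V'" "same_module W W'"
  shows "linear_map k V W f \<longleftrightarrow> linear_map k V' W' f"
  using assms by (simp add: linear_map_def same_module_def)

lemma tlift_same_range:
  assumes "same_module Z Z'"
  shows "tlift k V W Z f = tlift k V W Z' f"
proof -
  have "tsum Z f l = tsum Z' f l" for l using assms by (simp add: tsum_def same_module_def)
  then show ?thesis by (simp add: tlift_def)
qed

lemma same_module_module:
  assumes "same_module V V'" "module k V"
  shows "module k V'"
proof -
  interpret V: module k V by fact
  note [simp] = assms(1)[unfolded same_module_def, THEN conjunct1, symmetric]
    assms(1)[unfolded same_module_def, THEN conjunct2, THEN conjunct1, symmetric]
    assms(1)[unfolded same_module_def, THEN conjunct2, THEN conjunct2, THEN conjunct1, symmetric]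
    assms(1)[unfolded same_module_def, THEN conjunct2, THEN conjunct2, THEN conjunct2, symmetric]
  show ?thesis
    by (intro moduleI abelian_groupI V.R.is_cring)
      (auto simp: V.M.a_ac V.smult_l_distr V.smult_r_distr V.smult_assoc1 intro: V.M.l_neg)
qed

section \<open>Slices\<close>

text \<open>
  The slice maps \<open>id \<otimes> \<phi>\<close> and \<open>\<phi> \<otimes> id\<close> of a linear form \<open>\<phi>\<close>.
\<close>

definition rs :: "('k,'l) ring_scheme \<Rightarrow> ('k,'x,'n) module_scheme \<Rightarrow> ('k,'a,'m) module_scheme \<Rightarrow> ('a \<Rightarrow> 'k) \<Rightarrow> ('x, 'a) tensor \<Rightarrow> 'x"
  where "rs k X K \<phi> z = tlift k X K X (\<lambda>y t. \<phi> t \<odot>\<^bsub>X\<^esub> y) z"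

definition ls :: "('k,'l) ring_scheme \<Rightarrow> ('k,'a,'m) module_scheme \<Rightarrow> ('k,'x,'n) module_scheme \<Rightarrow> ('a \<Rightarrow> 'k) \<Rightarrow> ('a, 'x) tensor \<Rightarrow> 'x"
  where "ls k K X \<phi> z = tlift k K X X (\<lambda>t y. \<phi> t \<odot>\<^bsub>X\<^esub> y) z"

lemma rs_pure:
  assumes "module k X" "module k K" "linear_map k K (kmod k) \<phi>" "x \<in> carrier X" "t \<in> carrier K"
  shows "rs k X K \<phi> (pure k X K x t) = \<phi> t \<odot>\<^bsub>X\<^esub> x"
  using assms linear_map_closed[OF assms(3)] by (simp add: rs_def tlift_pure lin3)

lemma ls_pure:
  assumes "module k X" "module k K" "linear_map k K (kmod k) \<phi>" "x \<in> carrier X" "t \<in> carrier K"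
  shows "ls k K X \<phi> (pure k K X t x) = \<phi> t \<odot>\<^bsub>X\<^esub> x"
  using assms linear_map_closed[OF assms(3)] by (simp add: ls_def tlift_pure lin3)

lemma lin_rs:
  assumes "module k X" "module k K" "linear_map k K (kmod k) \<phi>" "linear_map k U (tensor k X K) h"
  shows "linear_map k U X (\<lambda>u. rs k X K \<phi> (h u))"
  using assms linear_map_closed[OF assms(3)] by (simp add: rs_def lin3)

lemma lin_ls:
  assumes "module k X" "module k K" "linear_map k K (kmod k) \<phi>" "linear_map k U (tensor k K X) h"
  shows "linear_map k U X (\<lambda>u. ls k K X \<phi> (h u))"
  using assms linear_map_closed[OF assms(3)] by (simp add: ls_def lin3)

lemma lin_rs_param:
  assumes "module k X" "module k K" "module k U" "\<And>u. u \<in> carrier U \<Longrightarrow> linear_map k K (kmod k) (\<phi> u)"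
    "\<And>t. t \<in> carrier K \<Longrightarrow> linear_map k U (kmod k) (\<lambda>u. \<phi> u t)" "z \<in> carrier (tensor k X K)"
  shows "linear_map k U X (\<lambda>u. rs k X K (\<phi> u) z)"
  using assms linear_map_closed[OF assms(4)] by (simp add: rs_def lin3)

lemma lin_ls_param:
  assumes "module k X" "module k K" "module k U" "\<And>u. u \<in> carrier U \<Longrightarrow> linear_map k K (kmod k) (\<phi> u)"
    "\<And>t. t \<in> carrier K \<Longrightarrow> linear_map k U (kmod k) (\<lambda>u. \<phi> u t)" "z \<in> carrier (tensor k K X)"
  shows "linear_map k U X (\<lambda>u. ls k K X (\<phi> u) z)"
  using assms linear_map_closed[OF assms(4)] by (simp add: ls_def lin3)

lemma rs_linear:
  "module k X \<Longrightarrow> module k K \<Longrightarrow> linear_map k K (kmod k) \<phi> \<Longrightarrow> linear_map k (tensor k X K) X (rs k X K \<phi>)"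
  using lin_rs[OF _ _ _ lin_id] .

lemma ls_linear:
  "module k X \<Longrightarrow> module k K \<Longrightarrow> linear_map k K (kmod k) \<phi> \<Longrightarrow> linear_map k (tensor k K X) X (ls k K X \<phi>)"
  using lin_ls[OF _ _ _ lin_id] .

lemma rs_closed:
  "module k X \<Longrightarrow> module k K \<Longrightarrow> linear_map k K (kmod k) \<phi> \<Longrightarrow> z \<in> carrier (tensor k X K) \<Longrightarrow> rs k X K \<phi> z \<in> carrier X"
  using linear_map_closed[OF rs_linear] .

lemma ls_closed:
  "module k X \<Longrightarrow> module k K \<Longrightarrow> linear_map k K (kmod k) \<phi> \<Longrightarrow> z \<in> carrier (tensor k K X) \<Longrightarrow> ls k K X \<phi> z \<in> carrier X"
  using linear_map_closed[OF ls_linear] .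

lemmas lin4 = lin3 lin_rs lin_ls lin_rs_param lin_ls_param rs_closed ls_closed

lemma smult_closed: "module k V \<Longrightarrow> c \<in> carrier k \<Longrightarrow> v \<in> carrier V \<Longrightarrow> c \<odot>\<^bsub>V\<^esub> v \<in> carrier V"
  using module.smult_closed .

lemma mult_closed: "k_algebra k A \<Longrightarrow> x \<in> carrier A \<Longrightarrow> y \<in> carrier A \<Longrightarrow> x \<otimes>\<^bsub>A\<^esub> y \<in> carrier A"
  by (simp add: k_algebra_def ring_def monoid.m_closed)

lemma one_closed: "k_algebra k A \<Longrightarrow> \<one>\<^bsub>A\<^esub> \<in> carrier A"
  by (simp add: k_algebra_def ring_def monoid.one_closed)

lemma kmult_closed: "cring k \<Longrightarrow> x \<in> carrier k \<Longrightarrow> y \<in> carrier k \<Longrightarrow> x \<otimes>\<^bsub>k\<^esub> y \<in> carrier k"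
  by (simp add: cring_def ring_def monoid.m_closed)

lemmas clos = smult_closed mult_closed one_closed kmult_closed module_kmod

lemma pure_smult_left:
  assumes "module k V" "module k W" "c \<in> carrier k" "v \<in> carrier V" "w \<in> carrier W"
  shows "pure k V W (c \<odot>\<^bsub>V\<^esub> v) w = c \<odot>\<^bsub>tensor k V W\<^esub> pure k V W v w"
  by (rule linear_map_smult[of k V _ "\<lambda>v. pure k V W v w"]) (use assms in \<open>simp_all add: lin3\<close>)

lemma pure_smult_right:
  assumes "module k V" "module k W" "c \<in> carrier k" "v \<in> carrier V" "w \<in> carrier W"
  shows "pure k V W v (c \<odot>\<^bsub>W\<^esub> w) = c \<odot>\<^bsub>tensor k V W\<^esub> pure k V W v w"
  by (rule linear_map_smult[of k W _ "\<lambda>w. pure k V W v w"]) (use assms in \<open>simp_all add: lin3\<close>)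

lemma smult_smult: "module k V \<Longrightarrow> c \<in> carrier k \<Longrightarrow> d \<in> carrier k \<Longrightarrow> v \<in> carrier V \<Longrightarrow>
  c \<odot>\<^bsub>V\<^esub> (d \<odot>\<^bsub>V\<^esub> v) = (c \<otimes>\<^bsub>k\<^esub> d) \<odot>\<^bsub>V\<^esub> v"
  by (simp add: module.smult_assoc1)

lemma kmult_comm: "cring k \<Longrightarrow> x \<in> carrier k \<Longrightarrow> y \<in> carrier k \<Longrightarrow> x \<otimes>\<^bsub>k\<^esub> y = y \<otimes>\<^bsub>k\<^esub> x"
  by (simp add: cring.cring_simprules)

section \<open>Perfect pairings\<close>

text \<open>
  The pairing \<open>p\<close> identifies \<open>L\<close> with the dual of \<open>K\<close>.  The copairing \<open>C\<close> is the canonical element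
  \<open>\<Sum>\<^sub>i e\<^sub>i \<otimes> f\<^sub>i\<close> of dual bases \<open>e\<^sub>i\<close> of \<open>K\<close> and \<open>f\<^sub>i\<close> of \<open>L\<close>, and the last two assumptions are the
  expansions of elements of \<open>K\<close> and of \<open>L\<close> in these bases.  Stated with \<open>C\<close>, they are sums over a
  tensor and can be handled by the linearity rules, without indices.
\<close>

locale perfect_pairing =
  fixes k :: "('k,'z) ring_scheme" and L :: "('k,'l,'m) module_scheme" and K :: "('k,'a,'n) module_scheme"
    and p :: "'l \<Rightarrow> 'a \<Rightarrow> 'k" and C :: "('a, 'l) tensor"
  assumes L: "module k L" and K: "module k K" and p: "bilinear_map k L K (kmod k) p"
    and C: "C \<in> carrier (tensor k K L)"
    and expand_K: "\<And>t. t \<in> carrier K \<Longrightarrow> tlift k K L K (\<lambda>e f. p f t \<odot>\<^bsub>K\<^esub> e) C = t"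
    and expand_L: "\<And>l. l \<in> carrier L \<Longrightarrow> tlift k K L L (\<lambda>e f. p l e \<odot>\<^bsub>L\<^esub> f) C = l"
begin

lemma cring: "cring k"
  using L by (simp add: module_def)

lemma p_closed: "l \<in> carrier L \<Longrightarrow> t \<in> carrier K \<Longrightarrow> p l t \<in> carrier k"
  using bilinear_map_closed[OF p] by simp

lemma lin_p_left: "linear_map k U L f \<Longrightarrow> t \<in> carrier K \<Longrightarrow> linear_map k U (kmod k) (\<lambda>u. p (f u) t)"
  using lin_comp[OF bilinear_map_left[OF p]] .

lemma lin_p_right: "linear_map k U K f \<Longrightarrow> l \<in> carrier L \<Longrightarrow> linear_map k U (kmod k) (\<lambda>u. p l (f u))"
  using lin_comp[OF bilinear_map_right[OF p]] .

lemma p_linear: "l \<in> carrier L \<Longrightarrow> linear_map k K (kmod k) (p l)"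
  using bilinear_map_right[OF p] .

lemmas rules = lin4 clos cring K L C p_closed lin_p_left lin_p_right p_linear

text \<open>
  Expanding the second leg in the dual bases writes a tensor as \<open>\<Sum>\<^sub>i (id \<otimes> f\<^sub>i)(z) \<otimes> e\<^sub>i\<close>.  Hence the
  slices determine it.
\<close>

lemma rs_expand:
  assumes X: "module k X" and z: "z \<in> carrier (tensor k X K)"
  shows "tlift k K L (tensor k X K) (\<lambda>e f. pure k X K (rs k X K (p f) z) e) C = z"
proof (rule tensor_ext[OF X K module_tensor[OF X K] _ lin_id _ z])
  show "linear_map k (tensor k X K) (tensor k X K)
      (\<lambda>z. tlift k K L (tensor k X K) (\<lambda>e f. pure k X K (rs k X K (p f) z) e) C)"
    by (simp add: rules X)
  fix x t assume x: "x \<in> carrier X" and t: "t \<in> carrier K"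
  have "tlift k K L (tensor k X K) (\<lambda>e f. pure k X K (rs k X K (p f) (pure k X K x t)) e) C
    = tlift k K L (tensor k X K) (\<lambda>e f. pure k X K x (p f t \<odot>\<^bsub>K\<^esub> e)) C"
    by (rule tlift_cong) (simp_all add: rules X x t rs_pure pure_smult_left pure_smult_right)
  also have "\<dots> = pure k X K x (tlift k K L K (\<lambda>e f. p f t \<odot>\<^bsub>K\<^esub> e) C)"
    by (rule linear_tlift[symmetric]) (simp_all add: rules X x t)
  finally show "tlift k K L (tensor k X K) (\<lambda>e f. pure k X K (rs k X K (p f) (pure k X K x t)) e) C = pure k X K x t"
    by (simp add: expand_K t)
qed

lemma ls_expand:
  assumes X: "module k X" and z: "z \<in> carrier (tensor k K X)"
  shows "tlift k K L (tensor k K X) (\<lambda>e f. pure k K X e (ls k K X (p f) z)) C = z"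
proof (rule tensor_ext[OF K X module_tensor[OF K X] _ lin_id _ z])
  show "linear_map k (tensor k K X) (tensor k K X)
      (\<lambda>z. tlift k K L (tensor k K X) (\<lambda>e f. pure k K X e (ls k K X (p f) z)) C)"
    by (simp add: rules X)
  fix t x assume x: "x \<in> carrier X" and t: "t \<in> carrier K"
  have "tlift k K L (tensor k K X) (\<lambda>e f. pure k K X e (ls k K X (p f) (pure k K X t x))) C
    = tlift k K L (tensor k K X) (\<lambda>e f. pure k K X (p f t \<odot>\<^bsub>K\<^esub> e) x) C"
    by (rule tlift_cong) (simp_all add: rules X x t ls_pure pure_smult_left pure_smult_right)
  also have "\<dots> = pure k K X (tlift k K L K (\<lambda>e f. p f t \<odot>\<^bsub>K\<^esub> e) C) x"
    by (rule linear_tlift[symmetric, where L = "\<lambda>u. pure k K X u x"]) (simp_all add: rules X x t)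
  finally show "tlift k K L (tensor k K X) (\<lambda>e f. pure k K X e (ls k K X (p f) (pure k K X t x))) C = pure k K X t x"
    by (simp add: expand_K t)
qed

lemma rs_eqI:
  assumes "module k X" "z \<in> carrier (tensor k X K)" "z' \<in> carrier (tensor k X K)"
    "\<And>l. l \<in> carrier L \<Longrightarrow> rs k X K (p l) z = rs k X K (p l) z'"
  shows "z = z'"
proof -
  have "tlift k K L (tensor k X K) (\<lambda>e f. pure k X K (rs k X K (p f) z) e) C =
    tlift k K L (tensor k X K) (\<lambda>e f. pure k X K (rs k X K (p f) z') e) C"
    by (rule tlift_cong[OF K L]) (simp add: assms(4))
  then show ?thesis by (simp add: rs_expand assms)
qed

lemma ls_eqI:
  assumes "module k X" "z \<in> carrier (tensor k K X)" "z' \<in> carrier (tensor k K X)"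
    "\<And>l. l \<in> carrier L \<Longrightarrow> ls k K X (p l) z = ls k K X (p l) z'"
  shows "z = z'"
proof -
  have "tlift k K L (tensor k K X) (\<lambda>e f. pure k K X e (ls k K X (p f) z)) C =
    tlift k K L (tensor k K X) (\<lambda>e f. pure k K X e (ls k K X (p f) z')) C"
    by (rule tlift_cong[OF K L]) (simp add: assms(4))
  then show ?thesis by (simp add: ls_expand assms)
qed

lemma L_eqI:
  assumes "l \<in> carrier L" "l' \<in> carrier L" "\<And>t. t \<in> carrier K \<Longrightarrow> p l t = p l' t"
  shows "l = l'"
proof -
  have "tlift k K L L (\<lambda>e f. p l e \<odot>\<^bsub>L\<^esub> f) C = tlift k K L L (\<lambda>e f. p l' e \<odot>\<^bsub>L\<^esub> f) C"
    by (rule tlift_cong[OF K L]) (simp add: assms(3))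
  then show ?thesis by (simp add: expand_L assms)
qed

text \<open>
  The element is \<open>\<Sum>\<^sub>i \<phi>(e\<^sub>i) f\<^sub>i\<close>.
\<close>

lemma represent:
  assumes "linear_map k K (kmod k) \<phi>"
  shows "\<exists>l\<in>carrier L. \<forall>t\<in>carrier K. p l t = \<phi> t"
proof (intro bexI ballI)
  note [simp] = linear_map_closed[OF assms, simplified]
  let ?l = "tlift k K L L (\<lambda>e f. \<phi> e \<odot>\<^bsub>L\<^esub> f) C"
  show "?l \<in> carrier L" by (simp add: rules assms)
  fix t assume t: "t \<in> carrier K"
  have "p ?l t = tlift k K L (kmod k) (\<lambda>e f. p (\<phi> e \<odot>\<^bsub>L\<^esub> f) t) C"
    by (rule linear_tlift[where L = "\<lambda>u. p u t"]) (simp_all add: rules t assms)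
  also have "\<dots> = tlift k K L (kmod k) (\<lambda>e f. \<phi> (p f t \<odot>\<^bsub>K\<^esub> e)) C"
    by (rule tlift_cong[OF K L])
      (simp add: linear_map_smult[OF assms] linear_map_smult[OF bilinear_map_left[OF p]] rules t kmult_comm)
  also have "\<dots> = \<phi> (tlift k K L K (\<lambda>e f. p f t \<odot>\<^bsub>K\<^esub> e) C)"
    by (rule linear_tlift[symmetric]) (simp_all add: rules t assms)
  finally show "p ?l t = \<phi> t" by (simp add: expand_K t)
qed

lemma tlift_flip:
  assumes "module k Z" "bilinear_map k L K Z f"
  shows "tlift k L K Z f (tflip k K L C) = tlift k K L Z (\<lambda>e g. f g e) C"
proof -
  have "tlift k L K Z f (tflip k K L C) = tlift k K L Z (\<lambda>e g. tlift k L K Z f (pure k L K g e)) C"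
    unfolding tflip_def by (rule linear_tlift) (simp_all add: rules assms)
  also have "\<dots> = tlift k K L Z (\<lambda>e g. f g e) C"
    by (rule tlift_cong[OF K L]) (simp add: tlift_pure K L assms)
  finally show ?thesis .
qed

lemma flip: "perfect_pairing k K L (\<lambda>t l. p l t) (tflip k K L C)"
proof (rule perfect_pairing.intro)
  show "module k K" by (fact K)
  show "module k L" by (fact L)
  show "bilinear_map k K L (kmod k) (\<lambda>t l. p l t)" by (simp add: rules)
  show "tflip k K L C \<in> carrier (tensor k L K)"
    using linear_map_closed[OF tflip_linear[OF K L] C] .
  show "tlift k L K L (\<lambda>e f. p l f \<odot>\<^bsub>L\<^esub> e) (tflip k K L C) = l" if "l \<in> carrier L" for l
    using that by (simp add: tlift_flip rules expand_L)
  show "tlift k L K K (\<lambda>e f. p e t \<odot>\<^bsub>K\<^esub> f) (tflip k K L C) = t" if "t \<in> carrier K" for t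
    using that by (simp add: tlift_flip rules expand_K)
qed

end

section \<open>Coactions and actions under a perfect pairing\<close>

context perfect_pairing
begin

text \<open>
  After moving the brackets to the left, the two legs in \<open>K\<close> can be sliced one after the other.
\<close>

lemma rs2_eqI:
  assumes X: "module k X" and z: "z \<in> carrier (tensor k X (tensor k K K))"
    and z': "z' \<in> carrier (tensor k X (tensor k K K))"
    and eq: "\<And>l l'. l \<in> carrier L \<Longrightarrow> l' \<in> carrier L \<Longrightarrow>
      rs k X (tensor k K K) (tlift k K K (kmod k) (\<lambda>a b. p l a \<otimes>\<^bsub>k\<^esub> p l' b)) z =
      rs k X (tensor k K K) (tlift k K K (kmod k) (\<lambda>a b. p l a \<otimes>\<^bsub>k\<^esub> p l' b)) z'"
  shows "z = z'"
proof -
  let ?XK = "tensor k X K" and ?XKK = "tensor k X (tensor k K K)"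
  let ?u = "tunassoc k X K K"
  have [simp]: "?u y \<in> carrier (tensor k ?XK K)" if "y \<in> carrier ?XKK" for y
    using linear_map_closed[OF tunassoc_linear] that X K by blast
  have slice: "rs k X K (p l) (rs k ?XK K (p l') (?u y)) =
      rs k X (tensor k K K) (tlift k K K (kmod k) (\<lambda>a b. p l a \<otimes>\<^bsub>k\<^esub> p l' b)) y"
    if l: "l \<in> carrier L" "l' \<in> carrier L" and y: "y \<in> carrier ?XKK" for l l' y
    by (rule tensor_ext_right[OF X K K X _ _ _ y])
      (simp_all add: rules X l tunassoc_pure rs_pure tlift_pure linear_map_smult[OF rs_linear]
        smult_smult[OF X] kmult_comm)
  have "?u z = ?u z'"
    using z z' X by (intro rs_eqI[of ?XK] rs_eqI[of X]) (simp_all add: rules slice eq)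
  moreover have "tassoc k X K K (?u y) = y" if y: "y \<in> carrier ?XKK" for y
    by (rule tensor_ext_right[OF X K K _ _ lin_id _ y]) (simp_all add: rules X tunassoc_pure tassoc_pure)
  ultimately show ?thesis using z z' by metis
qed

lemma ls2_eqI:
  assumes X: "module k X" and z: "z \<in> carrier (tensor k K (tensor k K X))"
    and z': "z' \<in> carrier (tensor k K (tensor k K X))"
    and eq: "\<And>l l'. l \<in> carrier L \<Longrightarrow> l' \<in> carrier L \<Longrightarrow>
      ls k K X (p l') (ls k K (tensor k K X) (p l) z) = ls k K X (p l') (ls k K (tensor k K X) (p l) z')"
  shows "z = z'"
  using z z' X by (intro ls_eqI[of "tensor k K X"] ls_eqI[of X]) (simp_all add: rules eq)

text \<open>
  Slice both sides of coassociativity at \<open>l \<otimes> l'\<close>.  The side \<open>(\<gamma> \<otimes> id) \<gamma>\<close> gives the iterated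
  operator; the side \<open>(id \<otimes> \<Delta>) \<gamma>\<close> gives the operator of the product, which is dual to \<open>\<Delta>\<close>.
\<close>

lemma right_coassoc_iff:
  assumes X: "module k X" and \<gamma>: "linear_map k X (tensor k X K) \<gamma>"
    and \<Delta>: "linear_map k K (tensor k K K) \<Delta>"
    and m: "\<And>l l'. l \<in> carrier L \<Longrightarrow> l' \<in> carrier L \<Longrightarrow> m l l' \<in> carrier L"
    and pm: "\<And>l l' t. l \<in> carrier L \<Longrightarrow> l' \<in> carrier L \<Longrightarrow> t \<in> carrier K \<Longrightarrow>
      p (m l l') t = tlift k K K (kmod k) (\<lambda>a b. p l a \<otimes>\<^bsub>k\<^esub> p l' b) (\<Delta> t)"
    and x: "x \<in> carrier X"
  shows "tassoc k X K K (tmap k X K (tensor k X K) K \<gamma> (\<lambda>y. y) (\<gamma> x)) = tmap k X K X (tensor k K K) (\<lambda>y. y) \<Delta> (\<gamma> x)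
    \<longleftrightarrow> (\<forall>l\<in>carrier L. \<forall>l'\<in>carrier L. rs k X K (p l) (\<gamma> (rs k X K (p l') (\<gamma> x))) = rs k X K (p (m l l')) (\<gamma> x))"
    (is "?A = ?B \<longleftrightarrow> _")
proof -
  let ?XK = "tensor k X K"
  let ?R = "\<lambda>l l'. rs k X (tensor k K K) (tlift k K K (kmod k) (\<lambda>a b. p l a \<otimes>\<^bsub>k\<^esub> p l' b))"
  note r = rules X \<gamma> \<Delta> lin_comp[OF \<gamma>] lin_comp[OF \<Delta>] linear_map_closed[OF \<gamma>] linear_map_closed[OF \<Delta>]
  have gx: "\<gamma> x \<in> carrier ?XK" using x by (simp add: r)
  have 1: "?R l l' ?A = rs k X K (p l) (\<gamma> (rs k X K (p l') (\<gamma> x)))"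
    if l: "l \<in> carrier L" "l' \<in> carrier L" for l l'
  proof (rule tensor_ext[OF X K X _ _ _ gx])
    fix y t assume y: "y \<in> carrier X" and t: "t \<in> carrier K"
    have "?R l l' (tassoc k X K K (pure k ?XK K z t)) = p l' t \<odot>\<^bsub>X\<^esub> rs k X K (p l) z"
      if z: "z \<in> carrier ?XK" for z
      by (rule tensor_ext[OF X K X _ _ _ z])
        (simp_all add: r l t tassoc_pure rs_pure tlift_pure smult_smult[OF X] kmult_comm)
    then show "?R l l' (tassoc k X K K (tmap k X K ?XK K \<gamma> (\<lambda>y. y) (pure k X K y t))) =
       rs k X K (p l) (\<gamma> (rs k X K (p l') (pure k X K y t)))"
      by (simp add: r l y t tmap_pure rs_pure linear_map_smult[OF \<gamma>] linear_map_smult[OF rs_linear])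
  qed (simp_all add: r l)
  have 2: "?R l l' ?B = rs k X K (p (m l l')) (\<gamma> x)"
    if l: "l \<in> carrier L" "l' \<in> carrier L" for l l'
    by (rule tensor_ext[OF X K X _ _ _ gx]) (simp_all add: r l m pm tmap_pure rs_pure)
  show ?thesis
  proof
    assume "?A = ?B"
    then show "\<forall>l\<in>carrier L. \<forall>l'\<in>carrier L. rs k X K (p l) (\<gamma> (rs k X K (p l') (\<gamma> x))) = rs k X K (p (m l l')) (\<gamma> x)"
      using 1 2 by simp
  next
    assume *: "\<forall>l\<in>carrier L. \<forall>l'\<in>carrier L. rs k X K (p l) (\<gamma> (rs k X K (p l') (\<gamma> x))) = rs k X K (p (m l l')) (\<gamma> x)"
    show "?A = ?B"
    proof (rule rs2_eqI[OF X])
      show "?A \<in> carrier (tensor k X (tensor k K K))" "?B \<in> carrier (tensor k X (tensor k K K))"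
        using gx X K \<gamma> \<Delta>
        by (auto intro!: linear_map_closed[OF tassoc_linear] linear_map_closed[OF tmap_linear] module_tensor lin_id)
    qed (simp only: 1 2 *)
  qed
qed

text \<open>
  The mirror image of the previous lemma.  The order of composition is reversed: a left coaction of
  \<open>K\<close> is a right action of its dual.
\<close>

lemma left_coassoc_iff:
  assumes X: "module k X" and \<alpha>: "linear_map k X (tensor k K X) \<alpha>"
    and \<Delta>: "linear_map k K (tensor k K K) \<Delta>"
    and m: "\<And>l l'. l \<in> carrier L \<Longrightarrow> l' \<in> carrier L \<Longrightarrow> m l l' \<in> carrier L"
    and pm: "\<And>l l' t. l \<in> carrier L \<Longrightarrow> l' \<in> carrier L \<Longrightarrow> t \<in> carrier K \<Longrightarrow>
      p (m l l') t = tlift k K K (kmod k) (\<lambda>a b. p l a \<otimes>\<^bsub>k\<^esub> p l' b) (\<Delta> t)"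
    and x: "x \<in> carrier X"
  shows "tassoc k K K X (tmap k K X (tensor k K K) X \<Delta> (\<lambda>y. y) (\<alpha> x)) = tmap k K X K (tensor k K X) (\<lambda>y. y) \<alpha> (\<alpha> x)
    \<longleftrightarrow> (\<forall>l\<in>carrier L. \<forall>l'\<in>carrier L. ls k K X (p l') (\<alpha> (ls k K X (p l) (\<alpha> x))) = ls k K X (p (m l l')) (\<alpha> x))"
    (is "?A = ?B \<longleftrightarrow> _")
proof -
  let ?KX = "tensor k K X"
  let ?R = "\<lambda>l l' z. ls k K X (p l') (ls k K ?KX (p l) z)"
  note r = rules X \<alpha> \<Delta> lin_comp[OF \<alpha>] lin_comp[OF \<Delta>] linear_map_closed[OF \<alpha>] linear_map_closed[OF \<Delta>]
  have ax: "\<alpha> x \<in> carrier ?KX" using x by (simp add: r)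
  have 1: "?R l l' ?B = ls k K X (p l') (\<alpha> (ls k K X (p l) (\<alpha> x)))"
    if l: "l \<in> carrier L" "l' \<in> carrier L" for l l'
    by (rule tensor_ext[OF K X X _ _ _ ax])
      (simp_all add: r l tmap_pure ls_pure linear_map_smult[OF \<alpha>])
  have 2: "?R l l' ?A = ls k K X (p (m l l')) (\<alpha> x)"
    if l: "l \<in> carrier L" "l' \<in> carrier L" for l l'
  proof (rule tensor_ext[OF K X X _ _ _ ax])
    fix y t assume y: "y \<in> carrier X" and t: "t \<in> carrier K"
    have "?R l l' (tassoc k K K X (pure k (tensor k K K) X z y)) =
        tlift k K K (kmod k) (\<lambda>a b. p l a \<otimes>\<^bsub>k\<^esub> p l' b) z \<odot>\<^bsub>X\<^esub> y"
      if z: "z \<in> carrier (tensor k K K)" for z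
      by (rule tensor_ext[OF K K X _ _ _ z])
        (simp_all add: r l y tassoc_pure ls_pure tlift_pure smult_smult[OF X] kmult_comm linear_map_smult[OF ls_linear])
    then show "?R l l' (tassoc k K K X (tmap k K X (tensor k K K) X \<Delta> (\<lambda>y. y) (pure k K X t y))) =
       ls k K X (p (m l l')) (pure k K X t y)"
      by (simp add: r l y t m pm tmap_pure ls_pure)
  qed (simp_all add: r l m)
  show ?thesis
  proof
    assume "?A = ?B"
    then show "\<forall>l\<in>carrier L. \<forall>l'\<in>carrier L. ls k K X (p l') (\<alpha> (ls k K X (p l) (\<alpha> x))) = ls k K X (p (m l l')) (\<alpha> x)"
      using 1 2 by simp
  next
    assume *: "\<forall>l\<in>carrier L. \<forall>l'\<in>carrier L. ls k K X (p l') (\<alpha> (ls k K X (p l) (\<alpha> x))) = ls k K X (p (m l l')) (\<alpha> x)"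
    show "?A = ?B"
    proof (rule ls2_eqI[OF X])
      show "?A \<in> carrier (tensor k K (tensor k K X))" "?B \<in> carrier (tensor k K (tensor k K X))"
        using ax X K \<alpha> \<Delta>
        by (auto intro!: linear_map_closed[OF tassoc_linear] linear_map_closed[OF tmap_linear] module_tensor lin_id)
    qed (simp only: 1 2 *)
  qed
qed

text \<open>
  The product of slices is governed by the coproduct of \<open>L\<close>, which is dual to the product of \<open>K\<close>.
\<close>

lemma rs_mult:
  assumes Ka: "k_algebra k K" and Xa: "k_algebra k X" and l: "l \<in> carrier L" and D: "D \<in> carrier (tensor k L L)"
    and pD: "\<And>t s. t \<in> carrier K \<Longrightarrow> s \<in> carrier K \<Longrightarrow>
      tlift k L L (kmod k) (\<lambda>a b. p a t \<otimes>\<^bsub>k\<^esub> p b s) D = p l (t \<otimes>\<^bsub>K\<^esub> s)"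
    and z: "z \<in> carrier (tensor k X K)" and w: "w \<in> carrier (tensor k X K)"
  shows "rs k X K (p l) (z \<otimes>\<^bsub>tensor k X K\<^esub> w) = tlift k L L X (\<lambda>a b. rs k X K (p a) z \<otimes>\<^bsub>X\<^esub> rs k X K (p b) w) D"
proof -
  let ?XK = "tensor k X K"
  note X = k_algebra_module[OF Xa]
  note r = rules X Xa Ka l D smult_closed[OF X] mult_closed[OF Xa] mult_closed[OF Ka]
  show ?thesis
  proof (rule tensor_ext[OF X K X _ _ _ z])
    fix x t assume xt: "x \<in> carrier X" "t \<in> carrier K"
    show "rs k X K (p l) (pure k X K x t \<otimes>\<^bsub>?XK\<^esub> w) =
      tlift k L L X (\<lambda>a b. rs k X K (p a) (pure k X K x t) \<otimes>\<^bsub>X\<^esub> rs k X K (p b) w) D"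
    proof (rule tensor_ext[OF X K X _ _ _ w])
      fix y s assume ys: "y \<in> carrier X" "s \<in> carrier K"
      have "tlift k L L X (\<lambda>a b. rs k X K (p a) (pure k X K x t) \<otimes>\<^bsub>X\<^esub> rs k X K (p b) (pure k X K y s)) D =
        tlift k L L X (\<lambda>a b. (p a t \<otimes>\<^bsub>k\<^esub> p b s) \<odot>\<^bsub>X\<^esub> (x \<otimes>\<^bsub>X\<^esub> y)) D"
        by (rule tlift_cong[OF L L])
          (simp add: r xt ys rs_pure k_algebra_smult_left[OF Xa] k_algebra_smult_right[OF Xa] smult_smult[OF X] kmult_comm)
      also have "\<dots> = tlift k L L (kmod k) (\<lambda>a b. p a t \<otimes>\<^bsub>k\<^esub> p b s) D \<odot>\<^bsub>X\<^esub> (x \<otimes>\<^bsub>X\<^esub> y)"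
        by (rule linear_tlift[symmetric]) (simp_all add: r xt ys)
      also have "\<dots> = rs k X K (p l) (pure k X K x t \<otimes>\<^bsub>?XK\<^esub> pure k X K y s)"
        by (simp add: pD r xt ys tensor_mult_pure rs_pure)
      finally show "rs k X K (p l) (pure k X K x t \<otimes>\<^bsub>?XK\<^esub> pure k X K y s) =
         tlift k L L X (\<lambda>a b. rs k X K (p a) (pure k X K x t) \<otimes>\<^bsub>X\<^esub> rs k X K (p b) (pure k X K y s)) D" ..
    qed (simp_all add: r xt)
  qed (simp_all add: r w)
qed

end

section \<open>Comodule algebras and module algebras\<close>

text \<open>
  A perfect pairing under which product and unit of each side are adjoint to coproduct and counit of
  the other.
\<close>

locale bialgebra_pairing = perfect_pairing k L K p C
  for k :: "('k,'z) ring_scheme" and L :: "('k,'l,'m) bialg_scheme" and K :: "('k,'a,'n) bialg_scheme"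
    and p :: "'l \<Rightarrow> 'a \<Rightarrow> 'k" and C :: "('a, 'l) tensor" +
  assumes K_alg: "k_algebra k K" and comult_K: "linear_map k K (tensor k K K) (comult K)"
    and mult_L: "\<And>l l'. l \<in> carrier L \<Longrightarrow> l' \<in> carrier L \<Longrightarrow> l \<otimes>\<^bsub>L\<^esub> l' \<in> carrier L"
    and one_L: "\<one>\<^bsub>L\<^esub> \<in> carrier L"
    and comult_L: "\<And>l. l \<in> carrier L \<Longrightarrow> comult L l \<in> carrier (tensor k L L)"
    and p_mult: "\<And>l l' t. l \<in> carrier L \<Longrightarrow> l' \<in> carrier L \<Longrightarrow> t \<in> carrier K \<Longrightarrow>
      p (l \<otimes>\<^bsub>L\<^esub> l') t = tlift k K K (kmod k) (\<lambda>a b. p l a \<otimes>\<^bsub>k\<^esub> p l' b) (comult K t)"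
    and p_one: "\<And>t. t \<in> carrier K \<Longrightarrow> p \<one>\<^bsub>L\<^esub> t = counit K t"
    and p_comult: "\<And>l t s. l \<in> carrier L \<Longrightarrow> t \<in> carrier K \<Longrightarrow> s \<in> carrier K \<Longrightarrow>
      tlift k L L (kmod k) (\<lambda>a b. p a t \<otimes>\<^bsub>k\<^esub> p b s) (comult L l) = p l (t \<otimes>\<^bsub>K\<^esub> s)"
    and p_counit: "\<And>l. l \<in> carrier L \<Longrightarrow> p l \<one>\<^bsub>K\<^esub> = counit L l"
begin

text \<open>
  The action \<open>\<rhd>\<^sub>\<gamma>\<close>, with the elements of \<open>L\<close> in the place of the forms on \<open>K\<close> that they represent.
\<close>

definition slice_action :: "('k,'x,'q) module_scheme \<Rightarrow> ('x \<Rightarrow> ('x, 'a) tensor) \<Rightarrow> 'l \<Rightarrow> 'x \<Rightarrow> 'x"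
  where "slice_action X \<gamma> = (\<lambda>l\<in>carrier L. \<lambda>x\<in>carrier X. rs k X K (p l) (\<gamma> x))"

lemma right_coactionD:
  assumes "right_coaction k K X \<gamma>"
  shows "\<gamma> \<in> alg_hom k X (tensor k X K)" "linear_map k X (tensor k X K) \<gamma>" "\<gamma> \<in> extensional (carrier X)"
    "\<And>x. x \<in> carrier X \<Longrightarrow> \<gamma> x \<in> carrier (tensor k X K)"
  using assms linear_map_closed[OF alg_hom_linear[of \<gamma> k X "tensor k X K"]] by (auto simp: right_coaction_def alg_hom_linear)

lemma rs_one: 
  assumes "module k X"
  shows "rs k X K (p \<one>\<^bsub>L\<^esub>) z = tlift k X K X (\<lambda>y h. counit K h \<odot>\<^bsub>X\<^esub> y) z"
  unfolding rs_def by (rule tlift_cong) (simp_all add: assms K p_one)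

lemma coaction_iff:
  assumes Xa: "k_algebra k X" and \<gamma>: "linear_map k X (tensor k X K) \<gamma>"
  shows "(\<forall>x\<in>carrier X.
      tassoc k X K K (tmap k X K (tensor k X K) K \<gamma> (\<lambda>y. y) (\<gamma> x)) =
        tmap k X K X (tensor k K K) (\<lambda>y. y) (comult K) (\<gamma> x) \<and>
      tlift k X K X (\<lambda>y h. counit K h \<odot>\<^bsub>X\<^esub> y) (\<gamma> x) = x) \<longleftrightarrow>
    (\<forall>x\<in>carrier X. (\<forall>l\<in>carrier L. \<forall>l'\<in>carrier L.
        rs k X K (p l) (\<gamma> (rs k X K (p l') (\<gamma> x))) = rs k X K (p (l \<otimes>\<^bsub>L\<^esub> l')) (\<gamma> x)) \<and>
      rs k X K (p \<one>\<^bsub>L\<^esub>) (\<gamma> x) = x)"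
  using right_coassoc_iff[OF k_algebra_module[OF Xa] \<gamma> comult_K mult_L p_mult]
  by (simp add: rs_one k_algebra_module[OF Xa])

lemma slice_action_left_action:
  assumes Xa: "k_algebra k X" and c: "right_coaction k K X \<gamma>"
  shows "left_action k L X (slice_action X \<gamma>)"
proof -
  note X = k_algebra_module[OF Xa]
  note g = right_coactionD[OF c]
  note ax = c[unfolded right_coaction_def, THEN conjunct2, THEN conjunct2, unfolded coaction_iff[OF Xa g(2)]]
  interpret X: ring X using Xa by (rule k_algebra_ring)
  note r = rules X Xa smult_closed[OF X] mult_closed[OF Xa] g lin_comp[OF g(2)] lin_app[OF g(2)]
  have cl: "rs k X K (p l) (\<gamma> x) \<in> carrier X" if "l \<in> carrier L" "x \<in> carrier X" for l x
    using that by (simp add: r)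
  have bil: "bilinear_map k L X X (\<lambda>l x. rs k X K (p l) (\<gamma> x))"
    by (rule bilinear_mapI) (simp_all add: r)
  have "bilinear_map k L X X (slice_action X \<gamma>)"
  proof (rule bilinear_mapI)
    show "linear_map k X X (slice_action X \<gamma> l)" if "l \<in> carrier L" for l
      using bilinear_map_right[OF bil that] that
      by (subst linear_map_cong[OF X, where g = "\<lambda>x. rs k X K (p l) (\<gamma> x)"]) (simp_all add: slice_action_def)
    show "linear_map k L X (\<lambda>l. slice_action X \<gamma> l x)" if "x \<in> carrier X" for x
      using bilinear_map_left[OF bil that] that
      by (subst linear_map_cong[OF L, where g = "\<lambda>l. rs k X K (p l) (\<gamma> x)"]) (simp_all add: slice_action_def)
  qed
  moreover have "rs k X K (p l) (\<gamma> (x \<otimes>\<^bsub>X\<^esub> y)) =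
     tlift k L L X (\<lambda>a b. slice_action X \<gamma> a x \<otimes>\<^bsub>X\<^esub> slice_action X \<gamma> b y) (comult L l)"
    if "l \<in> carrier L" "x \<in> carrier X" "y \<in> carrier X" for l x y
  proof -
    have "rs k X K (p l) (\<gamma> (x \<otimes>\<^bsub>X\<^esub> y)) =
      tlift k L L X (\<lambda>a b. rs k X K (p a) (\<gamma> x) \<otimes>\<^bsub>X\<^esub> rs k X K (p b) (\<gamma> y)) (comult L l)"
      using that by (simp add: alg_hom_mult[OF g(1)] rs_mult[OF K_alg Xa that(1) comult_L p_comult] g(4))
    also have "\<dots> = tlift k L L X (\<lambda>a b. slice_action X \<gamma> a x \<otimes>\<^bsub>X\<^esub> slice_action X \<gamma> b y) (comult L l)"
      by (rule tlift_cong[OF L L]) (simp add: slice_action_def that)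
    finally show ?thesis .
  qed
  moreover have "rs k X K (p l) (\<gamma> \<one>\<^bsub>X\<^esub>) = counit L l \<odot>\<^bsub>X\<^esub> \<one>\<^bsub>X\<^esub>" if "l \<in> carrier L" for l
    using that by (simp add: alg_hom_one[OF g(1)] tensor_one rs_pure X K p_linear one_closed[OF K_alg] p_counit)
  ultimately show ?thesis
    using ax cl unfolding left_action_def
    by (auto simp: slice_action_def mult_L one_L)
qed

lemma slice_action_inj:
  assumes X: "module k X" and c: "right_coaction k K X \<gamma>" "right_coaction k K X \<gamma>'"
    and eq: "slice_action X \<gamma> = slice_action X \<gamma>'"
  shows "\<gamma> = \<gamma>'"
proof (rule extensionalityI[OF right_coactionD(3)[OF c(1)] right_coactionD(3)[OF c(2)]])
  fix x assume x: "x \<in> carrier X"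
  show "\<gamma> x = \<gamma>' x"
  proof (rule rs_eqI[OF X])
    fix l assume l: "l \<in> carrier L"
    have "slice_action X \<gamma> l x = slice_action X \<gamma>' l x" by (simp add: eq)
    then show "rs k X K (p l) (\<gamma> x) = rs k X K (p l) (\<gamma>' x)" using l x by (simp add: slice_action_def)
  qed (use x right_coactionD(4)[OF c(1)] right_coactionD(4)[OF c(2)] in simp_all)
qed

text \<open>
  The coaction is \<open>\<gamma>(x) = \<Sum>\<^sub>i f\<^sub>i x \<otimes> e\<^sub>i\<close>.  Its slices are the given operators, and so its axioms follow
  from those of the action.
\<close>

lemma slice_action_surj:
  assumes Xa: "k_algebra k X" and a: "left_action k L X act"
  shows "\<exists>\<gamma>. right_coaction k K X \<gamma> \<and> slice_action X \<gamma> = act"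
proof -
  note X = k_algebra_module[OF Xa]
  interpret X: ring X using Xa by (rule k_algebra_ring)
  have act: "act \<in> carrier L \<rightarrow>\<^sub>E (carrier X \<rightarrow>\<^sub>E carrier X)" and bil: "bilinear_map k L X X act"
    and am: "\<And>h h' x. h \<in> carrier L \<Longrightarrow> h' \<in> carrier L \<Longrightarrow> x \<in> carrier X \<Longrightarrow> act (h \<otimes>\<^bsub>L\<^esub> h') x = act h (act h' x)"
    and a1: "\<And>x. x \<in> carrier X \<Longrightarrow> act \<one>\<^bsub>L\<^esub> x = x"
    and axy: "\<And>h x y. h \<in> carrier L \<Longrightarrow> x \<in> carrier X \<Longrightarrow> y \<in> carrier X \<Longrightarrow>
      act h (x \<otimes>\<^bsub>X\<^esub> y) = tlift k L L X (\<lambda>a b. act a x \<otimes>\<^bsub>X\<^esub> act b y) (comult L h)"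
    and au: "\<And>h. h \<in> carrier L \<Longrightarrow> act h \<one>\<^bsub>X\<^esub> = counit L h \<odot>\<^bsub>X\<^esub> \<one>\<^bsub>X\<^esub>"
    using a by (simp_all add: left_action_def)
  note acl = bilinear_map_closed[OF bil]
  note r = rules X Xa smult_closed[OF X] mult_closed[OF Xa] acl lin_comp[OF bilinear_map_left[OF bil]] lin_comp[OF bilinear_map_right[OF bil]]
    lin_app[OF bilinear_map_left[OF bil]]  lin_app[OF bilinear_map_right[OF bil]]
  let ?g = "\<lambda>x. tlift k K L (tensor k X K) (\<lambda>e f. pure k X K (act f x) e) C"
  define \<gamma> where "\<gamma> = (\<lambda>x\<in>carrier X. ?g x)"
  have lin: "linear_map k X (tensor k X K) \<gamma>"
    unfolding \<gamma>_def
    by (subst linear_map_cong[OF X, where g = ?g]) (simp_all add: r)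
  have gcl: "\<gamma> x \<in> carrier (tensor k X K)" if "x \<in> carrier X" for x
    using linear_map_closed[OF lin that] .
  have sl: "rs k X K (p l) (\<gamma> x) = act l x" if l: "l \<in> carrier L" and x: "x \<in> carrier X" for l x
  proof -
    have "rs k X K (p l) (\<gamma> x) = tlift k K L X (\<lambda>e f. rs k X K (p l) (pure k X K (act f x) e)) C"
      using x by (simp add: \<gamma>_def) (rule linear_tlift, simp_all add: r l x)
    also have "\<dots> = tlift k K L X (\<lambda>e f. act (p l e \<odot>\<^bsub>L\<^esub> f) x) C"
      by (rule tlift_cong[OF K L]) (simp add: r l x rs_pure linear_map_smult[OF bilinear_map_left[OF bil]])
    also have "\<dots> = act (tlift k K L L (\<lambda>e f. p l e \<odot>\<^bsub>L\<^esub> f) C) x"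
      by (rule linear_tlift[symmetric, where L = "\<lambda>u. act u x"]) (simp_all add: r l x)
    finally show ?thesis by (simp add: expand_L l)
  qed
  have alg: "\<gamma> \<in> alg_hom k X (tensor k X K)"
  proof (rule alg_homI[OF lin])
    have T: "k_algebra k (tensor k X K)" by (simp add: k_algebra_tensor Xa K_alg)
    show "\<gamma> \<one>\<^bsub>X\<^esub> = \<one>\<^bsub>tensor k X K\<^esub>"
      by (rule rs_eqI[OF X]) (simp_all add: gcl one_closed[OF T] sl au, simp add: tensor_one rs_pure X K p_linear one_closed[OF K_alg] p_counit)
    fix x y assume xy: "x \<in> carrier X" "y \<in> carrier X"
    show "\<gamma> (x \<otimes>\<^bsub>X\<^esub> y) = \<gamma> x \<otimes>\<^bsub>tensor k X K\<^esub> \<gamma> y"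
    proof (rule rs_eqI[OF X])
      fix l assume l: "l \<in> carrier L"
      show "rs k X K (p l) (\<gamma> (x \<otimes>\<^bsub>X\<^esub> y)) = rs k X K (p l) (\<gamma> x \<otimes>\<^bsub>tensor k X K\<^esub> \<gamma> y)"
        using l xy
        by (simp add: sl axy rs_mult[OF K_alg Xa l comult_L p_comult] gcl) (rule tlift_cong[OF L L], simp add: sl)
    qed (use xy gcl mult_closed[OF T] in auto)
  qed
  have gext: "\<gamma> \<in> extensional (carrier X)" by (simp add: \<gamma>_def)
  have "right_coaction k K X \<gamma>"
    unfolding right_coaction_def coaction_iff[OF Xa lin]
    using alg gext by (simp add: sl acl mult_L one_L am a1)
  moreover have "slice_action X \<gamma> = act"
  proof (rule ext)
    fix l show "slice_action X \<gamma> l = act l"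
    proof (cases "l \<in> carrier L")
      case True
      then have "act l \<in> carrier X \<rightarrow>\<^sub>E carrier X" using act by auto
      then show ?thesis using True by (auto simp: slice_action_def sl PiE_def intro!: extensionalityI[of _ "carrier X"])
    qed (use act in \<open>auto simp: slice_action_def PiE_def extensional_def\<close>)
  qed
  ultimately show ?thesis by blast
qed

lemma colinear_iff_equivariant:
  assumes X: "module k X" and Y: "module k Y"
    and c: "right_coaction k K X \<gamma>" "right_coaction k K Y \<gamma>'" and f: "linear_map k X Y f"
  shows "right_colinear k K X Y \<gamma> \<gamma>' f \<longleftrightarrow> equivariant L X (slice_action X \<gamma>) (slice_action Y \<gamma>') f"
proof -
  note fcl = linear_map_closed[OF f]
  note gcl = right_coactionD(4)[OF c(1)] and g'cl = right_coactionD(4)[OF c(2)]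
  have sl: "rs k Y K (p l) (tmap k X K Y K f (\<lambda>y. y) z) = f (rs k X K (p l) z)"
    if "l \<in> carrier L" "z \<in> carrier (tensor k X K)" for l z
    by (rule tensor_ext[OF X K Y _ _ _ that(2)])
      (simp_all add: rules lin_comp[OF f] lin_app[OF f] X Y that(1) tmap_pure f fcl rs_pure linear_map_smult[OF f])
  have "\<gamma>' (f x) = tmap k X K Y K f (\<lambda>y. y) (\<gamma> x) \<longleftrightarrow> (\<forall>l\<in>carrier L. f (rs k X K (p l) (\<gamma> x)) = rs k Y K (p l) (\<gamma>' (f x)))"
    if x: "x \<in> carrier X" for x
  proof -
    have "tmap k X K Y K f (\<lambda>y. y) (\<gamma> x) \<in> carrier (tensor k Y K)"
      using linear_map_closed[OF tmap_linear] X Y K f lin_id gcl[OF x] by blast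
    then have "\<gamma>' (f x) = tmap k X K Y K f (\<lambda>y. y) (\<gamma> x) \<longleftrightarrow>
      (\<forall>l\<in>carrier L. rs k Y K (p l) (\<gamma>' (f x)) = rs k Y K (p l) (tmap k X K Y K f (\<lambda>y. y) (\<gamma> x)))"
      by (metis rs_eqI[OF Y g'cl[OF fcl[OF x]]])
    then show ?thesis using sl[OF _ gcl[OF x]] by metis
  qed
  then show ?thesis
    by (simp add: right_colinear_def equivariant_def slice_action_def fcl) blast
qed

end

section \<open>The dual\<close>

text \<open>
  Evaluation is given a name of its own because terms of the form \<open>\<phi> x\<close> with a variable \<open>\<phi>\<close> are
  not patterns: linearity in the form and in the argument could not be told apart by rewriting.
\<close>

definition ev :: "'a \<Rightarrow> ('a \<Rightarrow> 'k) \<Rightarrow> 'k"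
  where "ev x \<phi> = \<phi> x"

lemma dual_simps:
  "carrier (dual k K) = {\<theta> \<in> carrier K \<rightarrow>\<^sub>E carrier k. linear_map k K (kmod k) \<theta>}"
  "\<zero>\<^bsub>dual k K\<^esub> = (\<lambda>x\<in>carrier K. \<zero>\<^bsub>k\<^esub>)"
  "\<one>\<^bsub>dual k K\<^esub> = (\<lambda>x\<in>carrier K. counit K x)"
  "\<phi> \<oplus>\<^bsub>dual k K\<^esub> \<psi> = (\<lambda>x\<in>carrier K. \<phi> x \<oplus>\<^bsub>k\<^esub> \<psi> x)"
  "c \<odot>\<^bsub>dual k K\<^esub> \<phi> = (\<lambda>x\<in>carrier K. c \<otimes>\<^bsub>k\<^esub> \<phi> x)"
  "\<phi> \<otimes>\<^bsub>dual k K\<^esub> \<psi> = (\<lambda>x\<in>carrier K. tlift k K K (kmod k) (\<lambda>a b. \<phi> a \<otimes>\<^bsub>k\<^esub> \<psi> b) (comult K x))"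
  "comult (dual k K) = dual_comult k K"
  "counit (dual k K) \<phi> = ev \<one>\<^bsub>K\<^esub> \<phi>"
  by (simp_all add: dual_def mk_bialg_def dual_algebra_def linear_form_iff tlift_kmod ev_def)

lemma dual_carrierI: "linear_map k K (kmod k) \<phi> \<Longrightarrow> \<phi> \<in> extensional (carrier K) \<Longrightarrow> \<phi> \<in> carrier (dual k K)"
  by (auto simp: dual_simps PiE_def linear_map_def)

lemma dual_carrierI': 
  assumes "module k K" "linear_map k K (kmod k) \<phi>"
  shows "(\<lambda>x\<in>carrier K. \<phi> x) \<in> carrier (dual k K)"
  by (rule dual_carrierI) (use assms(2) in \<open>simp_all add: linear_map_cong[OF assms(1), of "\<lambda>x\<in>carrier K. \<phi> x" \<phi>]\<close>)

lemma dual_eqI: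
  assumes "\<phi> \<in> carrier (dual k K)" "\<psi> \<in> carrier (dual k K)" "\<And>x. x \<in> carrier K \<Longrightarrow> ev x \<phi> = ev x \<psi>"
  shows "\<phi> = \<psi>"
  using assms by (auto simp: dual_simps PiE_def ev_def intro!: extensionalityI)

lemma dual_linear: "\<phi> \<in> carrier (dual k K) \<Longrightarrow> linear_map k K (kmod k) (\<lambda>x. ev x \<phi>)"
  by (simp add: dual_simps ev_def)

lemma module_dual:
  assumes "module k K"
  shows "module k (dual k K)"
proof -
  interpret K: module k K by fact
  note kk = module_kmod[OF K.R.is_cring]
  have cl: "ev x \<phi> \<in> carrier k" if "\<phi> \<in> carrier (dual k K)" "x \<in> carrier K" for \<phi> x
    using linear_map_closed[OF dual_linear[OF that(1)] that(2)] by simp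
  have e: "\<phi> x = ev x \<phi>" for \<phi> :: "_ \<Rightarrow> 'a" and x :: 'c by (simp add: ev_def)
  note lin = dual_linear[unfolded ev_def]
  have ac: "\<phi> \<oplus>\<^bsub>dual k K\<^esub> \<psi> \<in> carrier (dual k K)"
    if "\<phi> \<in> carrier (dual k K)" "\<psi> \<in> carrier (dual k K)" for \<phi> \<psi>
    unfolding dual_simps(4) using dual_carrierI'[OF assms lin_add[OF kk lin[OF that(1)] lin[OF that(2)]]] by simp
  have sc: "c \<odot>\<^bsub>dual k K\<^esub> \<phi> \<in> carrier (dual k K)"
    if "\<phi> \<in> carrier (dual k K)" "c \<in> carrier k" for \<phi> c
    unfolding dual_simps(5) using dual_carrierI'[OF assms lin_kmult_right[OF K.R.is_cring lin[OF that(1)] that(2)]] .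
  have z: "\<zero>\<^bsub>dual k K\<^esub> \<in> carrier (dual k K)"
    using dual_carrierI'[OF assms lin_zero[OF kk, where U = K]] by (simp add: dual_simps(2))
  have s [simp]: "ev x (\<phi> \<oplus>\<^bsub>dual k K\<^esub> \<psi>) = ev x \<phi> \<oplus>\<^bsub>k\<^esub> ev x \<psi>" "ev x (c \<odot>\<^bsub>dual k K\<^esub> \<phi>) = c \<otimes>\<^bsub>k\<^esub> ev x \<phi>"
    "ev x \<zero>\<^bsub>dual k K\<^esub> = \<zero>\<^bsub>k\<^esub>" if "x \<in> carrier K" for x \<phi> \<psi> c
    using that by (simp_all add: dual_simps(2,4,5) ev_def)
  have inv: "\<exists>\<psi>\<in>carrier (dual k K). \<psi> \<oplus>\<^bsub>dual k K\<^esub> \<phi> = \<zero>\<^bsub>dual k K\<^esub>" if \<phi>: "\<phi> \<in> carrier (dual k K)" for \<phi>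
  proof
    have m: "\<ominus>\<^bsub>k\<^esub> \<one>\<^bsub>k\<^esub> \<in> carrier k" by simp
    show m2: "(\<ominus>\<^bsub>k\<^esub> \<one>\<^bsub>k\<^esub>) \<odot>\<^bsub>dual k K\<^esub> \<phi> \<in> carrier (dual k K)" using sc[OF \<phi> m] .
    show "(\<ominus>\<^bsub>k\<^esub> \<one>\<^bsub>k\<^esub>) \<odot>\<^bsub>dual k K\<^esub> \<phi> \<oplus>\<^bsub>dual k K\<^esub> \<phi> = \<zero>\<^bsub>dual k K\<^esub>"
      by (rule dual_eqI[OF ac[OF m2 \<phi>] z]) (simp add: cl[OF \<phi>] K.R.l_minus K.R.l_neg)
  qed
  show ?thesis
    by (intro moduleI abelian_groupI K.R.is_cring; (rule dual_eqI[where k = k and K = K])?)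
      (simp_all add: ac sc z inv cl K.R.a_ac K.R.l_distr K.R.r_distr K.R.m_assoc)
qed

lemma ev_closed: "module k K \<Longrightarrow> \<phi> \<in> carrier (dual k K) \<Longrightarrow> x \<in> carrier K \<Longrightarrow> ev x \<phi> \<in> carrier k"
  using linear_map_closed[OF dual_linear] by fastforce

lemma ev_linear_left:
  assumes "module k K" "\<phi> \<in> carrier (dual k K)" "linear_map k U K f"
  shows "linear_map k U (kmod k) (\<lambda>u. ev (f u) \<phi>)"
  using lin_comp[OF dual_linear[OF assms(2)] assms(3)] .

lemma ev_linear_right:
  assumes "module k K" "x \<in> carrier K" "linear_map k U (dual k K) f"
  shows "linear_map k U (kmod k) (\<lambda>u. ev x (f u))"
proof -
  have "linear_map k (dual k K) (kmod k) (ev x)"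
    using assms(1,2) by (intro linear_mapI) (simp_all add: ev_closed, simp_all add: dual_simps ev_def)
  from lin_comp[OF this assms(3)] show ?thesis .
qed

lemma linear_finsum:
  assumes V: "module k V" and W: "module k W" and f: "linear_map k V W f" and A: "finite A"
    and g: "g \<in> A \<rightarrow> carrier V"
  shows "f (\<Oplus>\<^bsub>V\<^esub>i\<in>A. g i) = (\<Oplus>\<^bsub>W\<^esub>i\<in>A. f (g i))"
proof -
  interpret V: module k V by fact
  interpret W: module k W by fact
  from A g show ?thesis
  proof induction
    case empty then show ?case by (simp add: linear_map_zero[OF V W f])
  next
    case (insert a F)
    then have "g \<in> F \<rightarrow> carrier V" "g a \<in> carrier V" by auto
    then show ?case using insert f
      by (simp add: linear_map_add[OF f] Pi_def linear_map_closed[OF f])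
  qed
qed

text \<open>
  The two expansions are \<open>x = \<Sum>\<^sub>i \<theta>\<^sub>i(x) h\<^sub>i\<close>, by comparison of coefficients, and
  \<open>\<phi> = \<Sum>\<^sub>i \<phi>(h\<^sub>i) \<theta>\<^sub>i\<close>, by evaluation at \<open>x\<close> and the first one.
\<close>

lemma dual_bases_perfect_pairing:
  assumes K: "module k K" and d: "dual_bases k K n h \<theta>"
  shows "perfect_pairing k (dual k K) K (\<lambda>\<phi> x. ev x \<phi>) (\<Oplus>\<^bsub>tensor k K (dual k K)\<^esub>i\<in>{..<n}. pure k K (dual k K) (h i) (\<theta> i))"
proof -
  interpret K: module k K by fact
  let ?K' = "dual k K"
  note K' = module_dual[OF K]
  interpret K': module k ?K' by (rule K')
  interpret T: module k "tensor k K ?K'" by (rule module_tensor[OF K K'])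
  note kk = module_kmod[OF K.R.is_cring]
  interpret kk: module k "kmod k" by (rule kk)
  have b: "basis k K n h" and \<theta>: "\<And>i. i < n \<Longrightarrow> \<theta> i \<in> carrier ?K'"
    and \<delta>: "\<And>i j. i < n \<Longrightarrow> j < n \<Longrightarrow> ev (h j) (\<theta> i) = (if i = j then \<one>\<^bsub>k\<^esub> else \<zero>\<^bsub>k\<^esub>)"
    using d by (auto simp: dual_bases_def ev_def)
  have h: "\<And>i. i < n \<Longrightarrow> h i \<in> carrier K" using b by (auto simp: basis_def)
  note r = lin4 clos K K' K.R.is_cring kk ev_closed[OF K] ev_linear_left[OF K] ev_linear_right[OF K]
  have ex: "(\<Oplus>\<^bsub>K\<^esub>i\<in>{..<n}. ev x (\<theta> i) \<odot>\<^bsub>K\<^esub> h i) = x" if x: "x \<in> carrier K" for x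
  proof -
    obtain c where c: "c \<in> {..<n} \<rightarrow>\<^sub>E carrier k" "x = (\<Oplus>\<^bsub>K\<^esub>i\<in>{..<n}. c i \<odot>\<^bsub>K\<^esub> h i)"
      using b x by (auto simp: basis_def)
    have ccl: "c i \<in> carrier k" if "i < n" for i
      using PiE_mem[OF c(1)] that by simp
    have "ev x (\<theta> j) = c j" if j: "j < n" for j
    proof -
      have "ev x (\<theta> j) = (\<Oplus>\<^bsub>kmod k\<^esub>i\<in>{..<n}. ev (c i \<odot>\<^bsub>K\<^esub> h i) (\<theta> j))"
        unfolding c(2) by (rule linear_finsum[OF K kk dual_linear[OF \<theta>[OF j]]]) (use ccl h in auto)
      also have "\<dots> = (\<Oplus>\<^bsub>kmod k\<^esub>i\<in>{..<n}. if j = i then c i else \<zero>\<^bsub>kmod k\<^esub>)"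
      proof (rule kk.M.finsum_cong')
        show "(\<lambda>i. if j = i then c i else \<zero>\<^bsub>kmod k\<^esub>) \<in> {..<n} \<rightarrow> carrier (kmod k)" using ccl by simp
      next
        fix i assume i: "i \<in> {..<n}"
        then have "c i \<in> carrier k" using ccl by simp
        then show "ev (c i \<odot>\<^bsub>K\<^esub> h i) (\<theta> j) = (if j = i then c i else \<zero>\<^bsub>kmod k\<^esub>)"
          using i j h by (simp add: linear_map_smult[OF dual_linear[OF \<theta>[OF j]]] \<delta>)
      qed simp
      also have "\<dots> = c j"
        by (rule kk.M.finsum_singleton) (use j ccl in auto)
      finally show ?thesis .
    qed
    then have "(\<Oplus>\<^bsub>K\<^esub>i\<in>{..<n}. ev x (\<theta> i) \<odot>\<^bsub>K\<^esub> h i) = (\<Oplus>\<^bsub>K\<^esub>i\<in>{..<n}. c i \<odot>\<^bsub>K\<^esub> h i)"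
      by (intro K.M.finsum_cong') (use ccl h in auto)
    then show ?thesis by (simp only: c(2)[symmetric])
  qed
  have ex': "(\<Oplus>\<^bsub>?K'\<^esub>i\<in>{..<n}. ev (h i) \<phi> \<odot>\<^bsub>?K'\<^esub> \<theta> i) = \<phi>" if \<phi>: "\<phi> \<in> carrier ?K'" for \<phi>
  proof (rule dual_eqI)
    have c: "(\<lambda>i. ev (h i) \<phi> \<odot>\<^bsub>?K'\<^esub> \<theta> i) \<in> {..<n} \<rightarrow> carrier ?K'"
      using h \<theta> \<phi> K by (auto simp: ev_closed)
    then show "(\<Oplus>\<^bsub>?K'\<^esub>i\<in>{..<n}. ev (h i) \<phi> \<odot>\<^bsub>?K'\<^esub> \<theta> i) \<in> carrier ?K'" by (rule K'.M.finsum_closed)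
    fix x assume x: "x \<in> carrier K"
    have lx: "linear_map k ?K' (kmod k) (ev x)" using ev_linear_right[OF K x lin_id] .
    have "ev x (\<Oplus>\<^bsub>?K'\<^esub>i\<in>{..<n}. ev (h i) \<phi> \<odot>\<^bsub>?K'\<^esub> \<theta> i) = (\<Oplus>\<^bsub>kmod k\<^esub>i\<in>{..<n}. ev x (ev (h i) \<phi> \<odot>\<^bsub>?K'\<^esub> \<theta> i))"
      by (rule linear_finsum[OF K' kk lx _ c]) simp
    also have "\<dots> = (\<Oplus>\<^bsub>kmod k\<^esub>i\<in>{..<n}. ev (ev x (\<theta> i) \<odot>\<^bsub>K\<^esub> h i) \<phi>)"
      by (rule kk.M.finsum_cong') (use h \<theta> \<phi> x K in \<open>auto simp: linear_map_smult[OF lx] linear_map_smult[OF dual_linear[OF \<phi>]] ev_closed K.R.m_comm\<close>)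
    also have "\<dots> = ev (\<Oplus>\<^bsub>K\<^esub>i\<in>{..<n}. ev x (\<theta> i) \<odot>\<^bsub>K\<^esub> h i) \<phi>"
      by (rule linear_finsum[OF K kk dual_linear[OF \<phi>], symmetric]) (use h \<theta> x K in \<open>auto simp: ev_closed\<close>)
    finally show "ev x (\<Oplus>\<^bsub>?K'\<^esub>i\<in>{..<n}. ev (h i) \<phi> \<odot>\<^bsub>?K'\<^esub> \<theta> i) = ev x \<phi>" by (simp add: ex x)
  qed (rule \<phi>)
  have pc: "(\<lambda>i. pure k K ?K' (h i) (\<theta> i)) \<in> {..<n} \<rightarrow> carrier (tensor k K ?K')"
    using h \<theta> by (auto intro: pure_closed)
  show ?thesis
  proof (rule perfect_pairing.intro)
    show "module k ?K'" "module k K" by (rule K', rule K)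
    show "bilinear_map k ?K' K (kmod k) (\<lambda>\<phi> x. ev x \<phi>)" by (simp add: r)
    show "(\<Oplus>\<^bsub>tensor k K ?K'\<^esub>i\<in>{..<n}. pure k K ?K' (h i) (\<theta> i)) \<in> carrier (tensor k K ?K')"
      using pc by (rule T.M.finsum_closed)
  next
    fix t assume t: "t \<in> carrier K"
    have bl: "bilinear_map k K ?K' K (\<lambda>e f. ev t f \<odot>\<^bsub>K\<^esub> e)" by (simp add: r t)
    have "tlift k K ?K' K (\<lambda>e f. ev t f \<odot>\<^bsub>K\<^esub> e) (\<Oplus>\<^bsub>tensor k K ?K'\<^esub>i\<in>{..<n}. pure k K ?K' (h i) (\<theta> i)) =
      (\<Oplus>\<^bsub>K\<^esub>i\<in>{..<n}. tlift k K ?K' K (\<lambda>e f. ev t f \<odot>\<^bsub>K\<^esub> e) (pure k K ?K' (h i) (\<theta> i)))"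
      by (rule linear_finsum[OF T.module_axioms K tlift_linear[OF K K' K bl] _ pc]) simp
    also have "\<dots> = (\<Oplus>\<^bsub>K\<^esub>i\<in>{..<n}. ev t (\<theta> i) \<odot>\<^bsub>K\<^esub> h i)"
      by (rule K.M.finsum_cong') (use h \<theta> t K in \<open>auto simp: tlift_pure[OF K K' K bl] ev_closed\<close>)
    finally show "tlift k K ?K' K (\<lambda>e f. ev t f \<odot>\<^bsub>K\<^esub> e) (\<Oplus>\<^bsub>tensor k K ?K'\<^esub>i\<in>{..<n}. pure k K ?K' (h i) (\<theta> i)) = t"
      by (simp add: ex t)
  next
    fix l assume l: "l \<in> carrier ?K'"
    have bl: "bilinear_map k K ?K' ?K' (\<lambda>e f. ev e l \<odot>\<^bsub>?K'\<^esub> f)" by (simp add: r l)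
    have "tlift k K ?K' ?K' (\<lambda>e f. ev e l \<odot>\<^bsub>?K'\<^esub> f) (\<Oplus>\<^bsub>tensor k K ?K'\<^esub>i\<in>{..<n}. pure k K ?K' (h i) (\<theta> i)) =
      (\<Oplus>\<^bsub>?K'\<^esub>i\<in>{..<n}. tlift k K ?K' ?K' (\<lambda>e f. ev e l \<odot>\<^bsub>?K'\<^esub> f) (pure k K ?K' (h i) (\<theta> i)))"
      by (rule linear_finsum[OF T.module_axioms K' tlift_linear[OF K K' K' bl] _ pc]) simp
    also have "\<dots> = (\<Oplus>\<^bsub>?K'\<^esub>i\<in>{..<n}. ev (h i) l \<odot>\<^bsub>?K'\<^esub> \<theta> i)"
      by (rule K'.M.finsum_cong') (use h \<theta> l K in \<open>auto simp: tlift_pure[OF K K' K' bl] ev_closed\<close>)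
    finally show "tlift k K ?K' ?K' (\<lambda>e f. ev e l \<odot>\<^bsub>?K'\<^esub> f) (\<Oplus>\<^bsub>tensor k K ?K'\<^esub>i\<in>{..<n}. pure k K ?K' (h i) (\<theta> i)) = l"
      by (simp add: ex' l)
  qed
qed

text \<open>
  The dual basis consists of the coefficient functions, whose linearity comes from the uniqueness of
  coefficients.
\<close>

lemma dual_bases_exist:
  assumes K: "module k K" and b: "basis k K n h"
  shows "\<exists>\<theta>. dual_bases k K n h \<theta>"
proof -
  interpret K: module k K by fact
  define c where "c x = (THE c. c \<in> {..<n} \<rightarrow>\<^sub>E carrier k \<and> x = (\<Oplus>\<^bsub>K\<^esub>i\<in>{..<n}. c i \<odot>\<^bsub>K\<^esub> h i))" for x
  have h: "\<And>i. i < n \<Longrightarrow> h i \<in> carrier K" using b by (auto simp: basis_def)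
  have ex1: "\<exists>!c. c \<in> {..<n} \<rightarrow>\<^sub>E carrier k \<and> x = (\<Oplus>\<^bsub>K\<^esub>i\<in>{..<n}. c i \<odot>\<^bsub>K\<^esub> h i)" if "x \<in> carrier K" for x
    using b that by (auto simp: basis_def)
  have c: "c x \<in> {..<n} \<rightarrow>\<^sub>E carrier k" "(\<Oplus>\<^bsub>K\<^esub>i\<in>{..<n}. c x i \<odot>\<^bsub>K\<^esub> h i) = x" if "x \<in> carrier K" for x
    using theI'[OF ex1[OF that]] by (auto simp: c_def)
  have ccl: "c x i \<in> carrier k" if "x \<in> carrier K" "i < n" for x i using c(1)[OF that(1)] that(2) by auto
  have uniq: "c x i = d i" if "d \<in> {..<n} \<rightarrow> carrier k" "(\<Oplus>\<^bsub>K\<^esub>i\<in>{..<n}. d i \<odot>\<^bsub>K\<^esub> h i) = x" "i < n" "x \<in> carrier K" for x d i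
  proof -
    have "(\<Oplus>\<^bsub>K\<^esub>i\<in>{..<n}. restrict d {..<n} i \<odot>\<^bsub>K\<^esub> h i) = (\<Oplus>\<^bsub>K\<^esub>i\<in>{..<n}. d i \<odot>\<^bsub>K\<^esub> h i)"
      by (rule K.M.finsum_cong') (use that h in auto)
    then have "c x = restrict d {..<n}"
      unfolding c_def by (intro the1_equality[OF ex1]) (use that in auto)
    then show ?thesis using that by simp
  qed
  define \<theta> where "\<theta> i = (\<lambda>x\<in>carrier K. c x i)" for i
  have "\<theta> i \<in> carrier (dual k K)" if i: "i < n" for i
    unfolding \<theta>_def
  proof (rule dual_carrierI'[OF K], rule linear_mapI)
    fix x assume x: "x \<in> carrier K"
    show "c x i \<in> carrier (kmod k)" using x i ccl by simp
    { fix y assume y: "y \<in> carrier K"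
      have "(\<Oplus>\<^bsub>K\<^esub>i\<in>{..<n}. (c x i \<oplus>\<^bsub>k\<^esub> c y i) \<odot>\<^bsub>K\<^esub> h i) = (\<Oplus>\<^bsub>K\<^esub>i\<in>{..<n}. c x i \<odot>\<^bsub>K\<^esub> h i \<oplus>\<^bsub>K\<^esub> c y i \<odot>\<^bsub>K\<^esub> h i)"
        by (rule K.M.finsum_cong') (use x y h ccl in \<open>auto simp: K.smult_l_distr\<close>)
      also have "\<dots> = x \<oplus>\<^bsub>K\<^esub> y"
        using x y h ccl by (subst K.M.finsum_addf) (auto simp: c(2))
      finally show "c (x \<oplus>\<^bsub>K\<^esub> y) i = c x i \<oplus>\<^bsub>kmod k\<^esub> c y i"
        using x y i ccl by (intro HOL.trans[OF uniq[of "\<lambda>i. c x i \<oplus>\<^bsub>k\<^esub> c y i"]]) auto }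
    { fix a assume a: "a \<in> carrier k"
      have "(\<Oplus>\<^bsub>K\<^esub>i\<in>{..<n}. (a \<otimes>\<^bsub>k\<^esub> c x i) \<odot>\<^bsub>K\<^esub> h i) = (\<Oplus>\<^bsub>K\<^esub>i\<in>{..<n}. a \<odot>\<^bsub>K\<^esub> (c x i \<odot>\<^bsub>K\<^esub> h i))"
        by (rule K.M.finsum_cong') (use x a h ccl in \<open>auto simp: K.smult_assoc1\<close>)
      also have "\<dots> = a \<odot>\<^bsub>K\<^esub> (\<Oplus>\<^bsub>K\<^esub>i\<in>{..<n}. c x i \<odot>\<^bsub>K\<^esub> h i)"
        by (rule linear_finsum[OF K K lin_smult_right[OF K lin_id a], symmetric]) (use x h ccl in auto)
      finally have *: "(\<Oplus>\<^bsub>K\<^esub>i\<in>{..<n}. (a \<otimes>\<^bsub>k\<^esub> c x i) \<odot>\<^bsub>K\<^esub> h i) = a \<odot>\<^bsub>K\<^esub> x" by (simp add: c(2) x)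
      show "c (a \<odot>\<^bsub>K\<^esub> x) i = a \<odot>\<^bsub>kmod k\<^esub> c x i"
        using x a i ccl * by (intro HOL.trans[OF uniq[of "\<lambda>i. a \<otimes>\<^bsub>k\<^esub> c x i"]]) auto }
  qed
  moreover have "\<theta> i (h j) = (if i = j then \<one>\<^bsub>k\<^esub> else \<zero>\<^bsub>k\<^esub>)" if "i < n" "j < n" for i j
  proof -
    have "(\<Oplus>\<^bsub>K\<^esub>i\<in>{..<n}. (if j = i then \<one>\<^bsub>k\<^esub> else \<zero>\<^bsub>k\<^esub>) \<odot>\<^bsub>K\<^esub> h i) = (\<Oplus>\<^bsub>K\<^esub>i\<in>{..<n}. if j = i then h i else \<zero>\<^bsub>K\<^esub>)"
      by (rule K.M.finsum_cong') (use h in auto)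
    also have "\<dots> = h j" by (rule K.M.finsum_singleton) (use that h in auto)
    finally have "c (h j) i = (if j = i then \<one>\<^bsub>k\<^esub> else \<zero>\<^bsub>k\<^esub>)"
      using that h by (intro uniq) auto
    then show ?thesis using that h by (simp add: \<theta>_def)
  qed
  ultimately show ?thesis using b unfolding dual_bases_def by blast
qed

text \<open>
  The slices of a copairing are prescribed by the expansion of \<open>L\<close>.
\<close>

lemma perfect_pairing_unique:
  assumes "perfect_pairing k L K p C" "perfect_pairing k L K p C'"
  shows "C = C'"
proof -
  interpret C: perfect_pairing k L K p C by fact
  interpret C': perfect_pairing k L K p C' by fact
  show ?thesis
  proof (rule C.ls_eqI[OF C.L C.C C'.C])
    fix l assume l: "l \<in> carrier L"
    show "ls k K L (p l) C = ls k K L (p l) C'"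
      using C.expand_L[OF l] C'.expand_L[OF l] by (simp add: ls_def)
  qed
qed

lemma canonical_U_eq:
  assumes K: "module k K" and d: "dual_bases k K n h \<theta>"
  shows "canonical_U k K = (\<Oplus>\<^bsub>tensor k K (dual k K)\<^esub>i\<in>{..<n}. pure k K (dual k K) (h i) (\<theta> i))"
  unfolding canonical_U_def
proof (rule the_equality)
  show "\<exists>n' h' \<theta>'. dual_bases k K n' h' \<theta>' \<and>
     (\<Oplus>\<^bsub>tensor k K (dual k K)\<^esub>i\<in>{..<n}. pure k K (dual k K) (h i) (\<theta> i)) =
     (\<Oplus>\<^bsub>tensor k K (dual k K)\<^esub>i\<in>{..<n'}. pure k K (dual k K) (h' i) (\<theta>' i))"
    using d by blast
next
  fix u assume "\<exists>n h \<theta>. dual_bases k K n h \<theta> \<and>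
    u = (\<Oplus>\<^bsub>tensor k K (dual k K)\<^esub>i\<in>{..<n}. pure k K (dual k K) (h i) (\<theta> i))"
  then obtain n' h' \<theta>' where "dual_bases k K n' h' \<theta>'"
    "u = (\<Oplus>\<^bsub>tensor k K (dual k K)\<^esub>i\<in>{..<n'}. pure k K (dual k K) (h' i) (\<theta>' i))" by blast
  then show "u = (\<Oplus>\<^bsub>tensor k K (dual k K)\<^esub>i\<in>{..<n}. pure k K (dual k K) (h i) (\<theta> i))"
    using perfect_pairing_unique[OF dual_bases_perfect_pairing[OF K] dual_bases_perfect_pairing[OF K d]] by simp
qed

lemma canonical_pairing:
  assumes "module k K" "finite_dimensional k K"
  shows "perfect_pairing k (dual k K) K (\<lambda>\<phi> x. ev x \<phi>) (canonical_U k K)"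
proof -
  obtain n h \<theta> where d: "dual_bases k K n h \<theta>"
    using assms dual_bases_exist by (force simp: finite_dimensional_def)
  show ?thesis
    unfolding canonical_U_eq[OF assms(1) d] by (rule dual_bases_perfect_pairing[OF assms(1) d])
qed

section \<open>The coproduct of the dual\<close>

text \<open>
  The algebras for which the coproduct of the dual is defined.  This will be used both for \<open>H\<close> and
  for \<open>T\<^sub>M(H)\<close>.
\<close>

locale dualizable =
  fixes k :: "('k,'z) ring_scheme" and K :: "('k,'a,'n) bialg_scheme" and C :: "('a, 'a \<Rightarrow> 'k) tensor"
  assumes alg: "k_algebra k K" and pairing: "perfect_pairing k (dual k K) K (\<lambda>\<phi> x. ev x \<phi>) C"
begin

sublocale perfect_pairing k "dual k K" K "\<lambda>\<phi> x. ev x \<phi>" C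
  by (rule pairing)

abbreviation "K' \<equiv> dual k K"

lemmas r = rules alg mult_closed[OF alg] ev_closed[OF K] ev_linear_left[OF K] ev_linear_right[OF K]

text \<open>
  The value of an element of \<open>K' \<otimes> K'\<close>, seen as a bilinear form on \<open>K\<close>.
\<close>

definition pair2 :: "'a \<Rightarrow> 'a \<Rightarrow> ('a \<Rightarrow> 'k, 'a \<Rightarrow> 'k) tensor \<Rightarrow> 'k"
  where "pair2 x y = tlift k K' K' (kmod k) (\<lambda>\<phi> \<psi>. ev x \<phi> \<otimes>\<^bsub>k\<^esub> ev y \<psi>)"

lemma pair2_linear: "x \<in> carrier K \<Longrightarrow> y \<in> carrier K \<Longrightarrow> linear_map k (tensor k K' K') (kmod k) (pair2 x y)"
  by (simp add: pair2_def r)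

lemma pair2_pure: "x \<in> carrier K \<Longrightarrow> y \<in> carrier K \<Longrightarrow> \<phi> \<in> carrier K' \<Longrightarrow> \<psi> \<in> carrier K' \<Longrightarrow>
  pair2 x y (pure k K' K' \<phi> \<psi>) = ev x \<phi> \<otimes>\<^bsub>k\<^esub> ev y \<psi>"
  by (simp add: pair2_def tlift_pure r)

lemma pair2_eqI:
  assumes t: "t \<in> carrier (tensor k K' K')" and t': "t' \<in> carrier (tensor k K' K')"
    and eq: "\<And>x y. x \<in> carrier K \<Longrightarrow> y \<in> carrier K \<Longrightarrow> pair2 x y t = pair2 x y t'"
  shows "t = t'"
proof -
  interpret F: perfect_pairing k K K' "\<lambda>x \<phi>. ev x \<phi>" "tflip k K K' C" by (rule flip)
  show ?thesis
  proof (rule F.rs_eqI[OF L t t'])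
    fix y assume y: "y \<in> carrier K"
    have *: "ev x (rs k K' K' (ev y) s) = pair2 x y s" if x: "x \<in> carrier K" and s: "s \<in> carrier (tensor k K' K')" for x s
      by (rule tensor_ext[OF L L module_kmod[OF cring] _ _ _ s])
        (simp_all add: r x y pair2_linear pair2_pure rs_pure lin_app[OF ev_linear_right[OF K _ lin_id]]
          linear_map_smult[OF ev_linear_right[OF K x lin_id]] kmult_comm)
    show "rs k K' K' (ev y) t = rs k K' K' (ev y) t'"
      by (rule dual_eqI[where k = k and K = K]) (use t t' y in \<open>simp_all add: * eq r\<close>)
  qed
qed

text \<open>
  In dual bases \<open>e\<^sub>i\<close> and \<open>f\<^sub>i\<close>, the coproduct of \<open>\<theta>\<close> is \<open>\<Sum>\<^sub>i\<^sub>j \<theta>(e\<^sub>i e\<^sub>j) f\<^sub>i \<otimes> f\<^sub>j\<close>.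
\<close>

lemma dual_comult_exists:
  assumes \<theta>: "\<theta> \<in> carrier K'"
  shows "\<exists>t\<in>carrier (tensor k K' K'). \<forall>x\<in>carrier K. \<forall>y\<in>carrier K. pair2 x y t = ev (x \<otimes>\<^bsub>K\<^esub> y) \<theta>"
proof (intro bexI ballI)
  let ?t = "tlift k K K' (tensor k K' K') (\<lambda>e f. tlift k K K' (tensor k K' K')
    (\<lambda>e' f'. ev (e \<otimes>\<^bsub>K\<^esub> e') \<theta> \<odot>\<^bsub>tensor k K' K'\<^esub> pure k K' K' f f') C) C"
  show "?t \<in> carrier (tensor k K' K')" by (simp add: r \<theta>)
  fix x y assume x: "x \<in> carrier K" and y: "y \<in> carrier K"
  have "pair2 x y ?t = tlift k K K' (kmod k) (\<lambda>e f. pair2 x y (tlift k K K' (tensor k K' K')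
    (\<lambda>e' f'. ev (e \<otimes>\<^bsub>K\<^esub> e') \<theta> \<odot>\<^bsub>tensor k K' K'\<^esub> pure k K' K' f f') C)) C"
    by (rule linear_tlift) (simp_all add: r \<theta> x y pair2_linear)
  also have "\<dots> = tlift k K K' (kmod k) (\<lambda>e f. ev ((ev x f \<odot>\<^bsub>K\<^esub> e) \<otimes>\<^bsub>K\<^esub> y) \<theta>) C"
  proof (rule tlift_cong[OF K L])
    fix e f assume ef: "e \<in> carrier K" "f \<in> carrier K'"
    have "pair2 x y (tlift k K K' (tensor k K' K') (\<lambda>e' f'. ev (e \<otimes>\<^bsub>K\<^esub> e') \<theta> \<odot>\<^bsub>tensor k K' K'\<^esub> pure k K' K' f f') C) =
      tlift k K K' (kmod k) (\<lambda>e' f'. pair2 x y (ev (e \<otimes>\<^bsub>K\<^esub> e') \<theta> \<odot>\<^bsub>tensor k K' K'\<^esub> pure k K' K' f f')) C"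
      by (rule linear_tlift) (simp_all add: r \<theta> x y ef pair2_linear)
    also have "\<dots> = tlift k K K' (kmod k) (\<lambda>e' f'. ev ((ev x f \<odot>\<^bsub>K\<^esub> e) \<otimes>\<^bsub>K\<^esub> (ev y f' \<odot>\<^bsub>K\<^esub> e')) \<theta>) C"
      by (rule tlift_cong[OF K L])
        (simp add: r \<theta> x y ef linear_map_smult[OF pair2_linear] pair2_pure k_algebra_smult_left[OF alg] k_algebra_smult_right[OF alg]
          smult_closed[OF K] linear_map_smult[OF dual_linear[OF \<theta>]] kmult_comm module.smult_assoc1[OF K, symmetric]
          cring.cring_simprules(11)[OF cring] cring.cring_simprules(14)[OF cring])
    also have "\<dots> = ev ((ev x f \<odot>\<^bsub>K\<^esub> e) \<otimes>\<^bsub>K\<^esub> tlift k K K' K (\<lambda>e' f'. ev y f' \<odot>\<^bsub>K\<^esub> e') C) \<theta>"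
      by (rule linear_tlift[symmetric, where L = "\<lambda>u. ev ((ev x f \<odot>\<^bsub>K\<^esub> e) \<otimes>\<^bsub>K\<^esub> u) \<theta>"])
        (simp_all add: r smult_closed[OF K] \<theta> x y ef)
    finally show "pair2 x y (tlift k K K' (tensor k K' K') (\<lambda>e' f'. ev (e \<otimes>\<^bsub>K\<^esub> e') \<theta> \<odot>\<^bsub>tensor k K' K'\<^esub> pure k K' K' f f') C) =
       ev ((ev x f \<odot>\<^bsub>K\<^esub> e) \<otimes>\<^bsub>K\<^esub> y) \<theta>"
      by (simp add: expand_K y)
  qed
  also have "\<dots> = ev (tlift k K K' K (\<lambda>e f. ev x f \<odot>\<^bsub>K\<^esub> e) C \<otimes>\<^bsub>K\<^esub> y) \<theta>"
    by (rule linear_tlift[symmetric, where L = "\<lambda>u. ev (u \<otimes>\<^bsub>K\<^esub> y) \<theta>"]) (simp_all add: r \<theta> x y)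
  finally show "pair2 x y ?t = ev (x \<otimes>\<^bsub>K\<^esub> y) \<theta>" by (simp add: expand_K x)
qed

lemma dual_comult:
  assumes \<theta>: "\<theta> \<in> carrier K'"
  shows dual_comult_closed: "comult K' \<theta> \<in> carrier (tensor k K' K')"
    and dual_comult_pair: "\<And>x y. x \<in> carrier K \<Longrightarrow> y \<in> carrier K \<Longrightarrow> pair2 x y (comult K' \<theta>) = ev (x \<otimes>\<^bsub>K\<^esub> y) \<theta>"
proof -
  have s: "same_module (dual k K) (dual_algebra k K)" by (simp add: same_module_def dual_def mk_bialg_def)
  have P: "t \<in> carrier (tensor k (dual_algebra k K) (dual_algebra k K)) \<and>
      (\<forall>x\<in>carrier K. \<forall>y\<in>carrier K.
        tlift k (dual_algebra k K) (dual_algebra k K) k (\<lambda>\<phi> \<psi>. \<phi> x \<otimes>\<^bsub>k\<^esub> \<psi> y) t = \<theta> (x \<otimes>\<^bsub>K\<^esub> y)) \<longleftrightarrow>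
    t \<in> carrier (tensor k K' K') \<and> (\<forall>x\<in>carrier K. \<forall>y\<in>carrier K. pair2 x y t = ev (x \<otimes>\<^bsub>K\<^esub> y) \<theta>)" for t
    using same_module_tensor[OF s s, of k] tlift_same[OF s s, of k "kmod k"]
    by (simp add: pair2_def tlift_kmod same_module_def ev_def)
  have "\<exists>!t. t \<in> carrier (tensor k K' K') \<and> (\<forall>x\<in>carrier K. \<forall>y\<in>carrier K. pair2 x y t = ev (x \<otimes>\<^bsub>K\<^esub> y) \<theta>)"
    using dual_comult_exists[OF \<theta>] pair2_eqI by (metis (no_types, lifting))
  from theI'[OF this]
  show "comult K' \<theta> \<in> carrier (tensor k K' K')" "\<And>x y. x \<in> carrier K \<Longrightarrow> y \<in> carrier K \<Longrightarrow> pair2 x y (comult K' \<theta>) = ev (x \<otimes>\<^bsub>K\<^esub> y) \<theta>"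
    unfolding dual_simps(7) dual_comult_def P by auto
qed

lemma dual_comult_linear: "linear_map k K' (tensor k K' K') (comult K')"
proof -
  interpret K': module k K' by (rule L)
  interpret T: module k "tensor k K' K'" by (rule module_tensor[OF L L])
  note e = linear_map_add[OF ev_linear_right[OF K _ lin_id]] linear_map_smult[OF ev_linear_right[OF K _ lin_id]]
  show ?thesis
    by (rule linear_mapI; (rule pair2_eqI)?)
      (simp_all add: dual_comult linear_map_add[OF pair2_linear] linear_map_smult[OF pair2_linear] r e)
qed

end

section \<open>Sweedler notation\<close>

lemma tlift_expand:
  assumes "module k V" "module k W" "module k Z" "linear_map k (tensor k V W) Z M" "t \<in> carrier (tensor k V W)"
  shows "M t = tlift k V W Z (\<lambda>v w. M (pure k V W v w)) t"
  by (rule tlift_unique[OF assms(1-3) _ assms(4) _ assms(5)])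
    (use assms in \<open>simp_all add: lin3 lin_comp[OF assms(4)]\<close>)

text \<open>
  Inside this locale, \<open>K'\<close> denotes the dual of \<open>H\<close>.
\<close>

locale fd_hopf =
  fixes k :: "('k, 'z) ring_scheme" and H :: "('k, 'h, 'm) bialg_scheme" and S :: "'h \<Rightarrow> 'h"
  assumes hopf: "hopf_algebra k H S" and fd: "finite_dimensional k H"
begin

lemma H_alg: "k_algebra k H"
  using hopf by (simp add: hopf_algebra_def bialgebra_def)

lemma H_mod: "module k H"
  using k_algebra_module[OF H_alg] .

sublocale dualizable k H "canonical_U k H"
  using H_alg canonical_pairing[OF H_mod fd] by (intro dualizable.intro)

abbreviation "U \<equiv> canonical_U k H"

lemma comult_H: "comult H \<in> alg_hom k H (tensor k H H)" "linear_map k H (tensor k H H) (comult H)"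
  "\<And>h. h \<in> carrier H \<Longrightarrow> comult H h \<in> carrier (tensor k H H)"
  using hopf linear_map_closed[OF alg_hom_linear[of "comult H" k H "tensor k H H"]]
  by (auto simp: hopf_algebra_def bialgebra_def alg_hom_linear)

lemma counit_H: "linear_map k H (kmod k) (counit H)" "\<And>h. h \<in> carrier H \<Longrightarrow> counit H h \<in> carrier k"
  "counit H \<one>\<^bsub>H\<^esub> = \<one>\<^bsub>k\<^esub>"
  "\<And>g h. g \<in> carrier H \<Longrightarrow> h \<in> carrier H \<Longrightarrow> counit H (g \<otimes>\<^bsub>H\<^esub> h) = counit H g \<otimes>\<^bsub>k\<^esub> counit H h"
proof -
  have e: "linear_map k H (kmod k) (counit H)" and e': "counit H \<in> ring_hom H k"
    using hopf by (simp_all add: hopf_algebra_def bialgebra_def linear_form_iff)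
  show "linear_map k H (kmod k) (counit H)" by (rule e)
  show "counit H h \<in> carrier k" if "h \<in> carrier H" for h using linear_map_closed[OF e that] by simp
  show "counit H \<one>\<^bsub>H\<^esub> = \<one>\<^bsub>k\<^esub>" using e' by (simp add: ring_hom_def)
  show "\<And>g h. g \<in> carrier H \<Longrightarrow> h \<in> carrier H \<Longrightarrow> counit H (g \<otimes>\<^bsub>H\<^esub> h) = counit H g \<otimes>\<^bsub>k\<^esub> counit H h"
    using e' by (simp add: ring_hom_def)
qed

lemma S_H: "linear_map k H H S" "\<And>h. h \<in> carrier H \<Longrightarrow> S h \<in> carrier H"
proof -
  have e: "linear_map k H H S" using hopf by (simp add: hopf_algebra_def)
  then show "linear_map k H H S" "\<And>h. h \<in> carrier H \<Longrightarrow> S h \<in> carrier H" by (auto dest: linear_map_closed)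
qed

lemmas hr = r L K smult_closed[OF K] smult_closed[OF L] one_closed[OF alg] comult_H(2,3) counit_H(1,2) S_H
  lin_comp[OF comult_H(2)] lin_comp[OF counit_H(1)] lin_comp[OF S_H(1)]

text \<open>
  Sweedler notation: \<open>sw Z F h\<close> is \<open>F h\<^sub>(\<^sub>1\<^sub>) h\<^sub>(\<^sub>2\<^sub>)\<close>.
\<close>

definition sw :: "('k, 'x, 'q) module_scheme \<Rightarrow> ('h \<Rightarrow> 'h \<Rightarrow> 'x) \<Rightarrow> 'h \<Rightarrow> 'x"
  where "sw Z F h = tlift k H H Z F (comult H h)"

lemma lin_sw:
  "module k Z \<Longrightarrow> bilinear_map k H H Z F \<Longrightarrow> linear_map k W H f \<Longrightarrow> linear_map k W Z (\<lambda>u. sw Z F (f u))"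
  unfolding sw_def by (simp add: hr)

lemma lin_sw_param:
  assumes "module k Z" "module k W" "\<And>u. u \<in> carrier W \<Longrightarrow> bilinear_map k H H Z (F u)"
    "\<And>a b. a \<in> carrier H \<Longrightarrow> b \<in> carrier H \<Longrightarrow> linear_map k W Z (\<lambda>u. F u a b)" "h \<in> carrier H"
  shows "linear_map k W Z (\<lambda>u. sw Z (F u) h)"
  unfolding sw_def using assms by (simp add: hr)

lemma sw_closed: "module k Z \<Longrightarrow> bilinear_map k H H Z F \<Longrightarrow> h \<in> carrier H \<Longrightarrow> sw Z F h \<in> carrier Z"
  unfolding sw_def by (simp add: hr)

lemma sw_cong: "(\<And>a b. a \<in> carrier H \<Longrightarrow> b \<in> carrier H \<Longrightarrow> F a b = G a b) \<Longrightarrow> sw Z F h = sw Z G h"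
  unfolding sw_def by (rule tlift_cong[OF K K])

lemma linear_sw:
  "module k Z \<Longrightarrow> module k Z' \<Longrightarrow> linear_map k Z Z' M \<Longrightarrow> bilinear_map k H H Z F \<Longrightarrow> h \<in> carrier H \<Longrightarrow>
    M (sw Z F h) = sw Z' (\<lambda>a b. M (F a b)) h"
  unfolding sw_def by (rule linear_tlift[OF K K]) (simp_all add: hr)

lemmas swr = hr lin_sw lin_sw_param sw_closed

text \<open>
  Apply the linear map on \<open>H \<otimes> (H \<otimes> H)\<close> that is induced by the trilinear \<open>F\<close> to both sides of
  coassociativity.
\<close>

lemma coassoc:
  assumes Z: "module k Z" and F: "\<And>a b. a \<in> carrier H \<Longrightarrow> b \<in> carrier H \<Longrightarrow> linear_map k H Z (\<lambda>c. F a b c)"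
    "\<And>a c. a \<in> carrier H \<Longrightarrow> c \<in> carrier H \<Longrightarrow> linear_map k H Z (\<lambda>b. F a b c)"
    "\<And>b c. b \<in> carrier H \<Longrightarrow> c \<in> carrier H \<Longrightarrow> linear_map k H Z (\<lambda>a. F a b c)"
    and h: "h \<in> carrier H"
  shows "sw Z (\<lambda>p q. sw Z (\<lambda>r s. F r s q) p) h = sw Z (\<lambda>p q. sw Z (\<lambda>r s. F p r s) q) h"
proof -
  let ?\<Lambda> = "tlift k H (tensor k H H) Z (\<lambda>a t. tlift k H H Z (F a) t)"
  have Fcl: "F a b c \<in> carrier Z" if "a \<in> carrier H" "b \<in> carrier H" "c \<in> carrier H" for a b c
    using linear_map_closed[OF F(1)] that by blast
  note r = swr Z F lin_app[OF F(1)] Fcl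
  have eq: "tassoc k H H H (tmap k H H (tensor k H H) H (comult H) (\<lambda>y. y) (comult H h)) =
        tmap k H H H (tensor k H H) (\<lambda>y. y) (comult H) (comult H h)"
    using hopf h by (simp add: hopf_algebra_def bialgebra_def)
  have 1: "?\<Lambda> (tassoc k H H H (tmap k H H (tensor k H H) H (comult H) (\<lambda>y. y) t)) =
    tlift k H H Z (\<lambda>p q. sw Z (\<lambda>r s. F r s q) p) t" if t: "t \<in> carrier (tensor k H H)" for t
  proof (rule tensor_ext[OF K K Z _ _ _ t])
    fix v w assume v: "v \<in> carrier H" and w: "w \<in> carrier H"
    have "?\<Lambda> (tassoc k H H H (pure k (tensor k H H) H u w)) = tlift k H H Z (\<lambda>r s. F r s w) u"
      if u: "u \<in> carrier (tensor k H H)" for u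
      by (rule tensor_ext[OF K K Z _ _ _ u]) (simp_all add: r w tlift_pure tassoc_pure)
    then show "?\<Lambda> (tassoc k H H H (tmap k H H (tensor k H H) H (comult H) (\<lambda>y. y) (pure k H H v w))) =
       tlift k H H Z (\<lambda>p q. sw Z (\<lambda>r s. F r s q) p) (pure k H H v w)"
      by (simp add: r v w tmap_pure tlift_pure sw_def)
  qed (simp_all add: r)
  have 2: "?\<Lambda> (tmap k H H H (tensor k H H) (\<lambda>y. y) (comult H) t) =
    tlift k H H Z (\<lambda>p q. sw Z (\<lambda>r s. F p r s) q) t" if t: "t \<in> carrier (tensor k H H)" for t
    by (rule tensor_ext[OF K K Z _ _ _ t]) (simp_all add: r tmap_pure tlift_pure, simp_all add: sw_def)
  show ?thesis
    using 1[OF comult_H(3)[OF h]] 2[OF comult_H(3)[OF h]] eq by (simp add: sw_def)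
qed

lemma sw_counit:
  assumes Z: "module k Z" and G: "linear_map k H Z G" and h: "h \<in> carrier H"
  shows sw_counit_left: "sw Z (\<lambda>p q. counit H p \<odot>\<^bsub>Z\<^esub> G q) h = G h"
    and sw_counit_right: "sw Z (\<lambda>p q. counit H q \<odot>\<^bsub>Z\<^esub> G p) h = G h"
proof -
  have eq: "sw H (\<lambda>p q. counit H p \<odot>\<^bsub>H\<^esub> q) h = h" "sw H (\<lambda>p q. counit H q \<odot>\<^bsub>H\<^esub> p) h = h"
    using hopf h by (simp_all add: hopf_algebra_def bialgebra_def sw_def)
  have "G (sw H (\<lambda>p q. counit H p \<odot>\<^bsub>H\<^esub> q) h) = sw Z (\<lambda>p q. G (counit H p \<odot>\<^bsub>H\<^esub> q)) h"
    by (rule linear_sw) (simp_all add: hr Z G h)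
  moreover have "\<dots> = sw Z (\<lambda>p q. counit H p \<odot>\<^bsub>Z\<^esub> G q) h"
    by (rule sw_cong) (simp add: linear_map_smult[OF G] counit_H)
  ultimately show "sw Z (\<lambda>p q. counit H p \<odot>\<^bsub>Z\<^esub> G q) h = G h" using eq by simp
  have "G (sw H (\<lambda>p q. counit H q \<odot>\<^bsub>H\<^esub> p) h) = sw Z (\<lambda>p q. G (counit H q \<odot>\<^bsub>H\<^esub> p)) h"
    by (rule linear_sw) (simp_all add: hr Z G h)
  moreover have "\<dots> = sw Z (\<lambda>p q. counit H q \<odot>\<^bsub>Z\<^esub> G p) h"
    by (rule sw_cong) (simp add: linear_map_smult[OF G] counit_H)
  ultimately show "sw Z (\<lambda>p q. counit H q \<odot>\<^bsub>Z\<^esub> G p) h = G h" using eq by simp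
qed

lemma sw_antipode:
  assumes Z: "module k Z" and G: "linear_map k H Z G" and h: "h \<in> carrier H"
  shows sw_antipode_left: "sw Z (\<lambda>p q. G (S p \<otimes>\<^bsub>H\<^esub> q)) h = counit H h \<odot>\<^bsub>Z\<^esub> G \<one>\<^bsub>H\<^esub>"
    and sw_antipode_right: "sw Z (\<lambda>p q. G (p \<otimes>\<^bsub>H\<^esub> S q)) h = counit H h \<odot>\<^bsub>Z\<^esub> G \<one>\<^bsub>H\<^esub>"
proof -
  have eq: "sw H (\<lambda>p q. S p \<otimes>\<^bsub>H\<^esub> q) h = counit H h \<odot>\<^bsub>H\<^esub> \<one>\<^bsub>H\<^esub>" "sw H (\<lambda>p q. p \<otimes>\<^bsub>H\<^esub> S q) h = counit H h \<odot>\<^bsub>H\<^esub> \<one>\<^bsub>H\<^esub>"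
    using hopf h by (simp_all add: hopf_algebra_def sw_def)
  have "sw Z (\<lambda>p q. G (S p \<otimes>\<^bsub>H\<^esub> q)) h = G (sw H (\<lambda>p q. S p \<otimes>\<^bsub>H\<^esub> q) h)"
    by (rule linear_sw[symmetric]) (simp_all add: hr Z G h)
  then show "sw Z (\<lambda>p q. G (S p \<otimes>\<^bsub>H\<^esub> q)) h = counit H h \<odot>\<^bsub>Z\<^esub> G \<one>\<^bsub>H\<^esub>"
    by (simp add: eq linear_map_smult[OF G] counit_H h one_closed[OF H_alg])
  have "sw Z (\<lambda>p q. G (p \<otimes>\<^bsub>H\<^esub> S q)) h = G (sw H (\<lambda>p q. p \<otimes>\<^bsub>H\<^esub> S q) h)"
    by (rule linear_sw[symmetric]) (simp_all add: hr Z G h)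
  then show "sw Z (\<lambda>p q. G (p \<otimes>\<^bsub>H\<^esub> S q)) h = counit H h \<odot>\<^bsub>Z\<^esub> G \<one>\<^bsub>H\<^esub>"
    by (simp add: eq linear_map_smult[OF G] counit_H h one_closed[OF H_alg])
qed

section \<open>The dual algebra and the evaluation pairing\<close>

lemma ev_mult: "x \<in> carrier H \<Longrightarrow> ev x (\<phi> \<otimes>\<^bsub>K'\<^esub> \<psi>) = sw (kmod k) (\<lambda>a b. ev a \<phi> \<otimes>\<^bsub>k\<^esub> ev b \<psi>) x"
  by (simp add: dual_simps(6) sw_def) (simp add: ev_def)

lemma ev_one: "x \<in> carrier H \<Longrightarrow> ev x \<one>\<^bsub>K'\<^esub> = counit H x"
  by (simp add: dual_simps(3) ev_def)

lemma dual_mult_closed: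
  assumes "\<phi> \<in> carrier K'" "\<psi> \<in> carrier K'"
  shows "\<phi> \<otimes>\<^bsub>K'\<^esub> \<psi> \<in> carrier K'"
proof -
  have "linear_map k H (kmod k) (\<lambda>x. sw (kmod k) (\<lambda>a b. ev a \<phi> \<otimes>\<^bsub>k\<^esub> ev b \<psi>) x)"
    using assms by (simp add: swr)
  from dual_carrierI'[OF K this] show ?thesis by (simp add: dual_simps(6) sw_def ev_def)
qed

lemma dual_one_closed: "\<one>\<^bsub>K'\<^esub> \<in> carrier K'"
  unfolding dual_simps(3) by (rule dual_carrierI'[OF K]) (simp add: hr)

lemma ev_add: "x \<in> carrier H \<Longrightarrow> \<phi> \<in> carrier K' \<Longrightarrow> \<psi> \<in> carrier K' \<Longrightarrow> ev x (\<phi> \<oplus>\<^bsub>K'\<^esub> \<psi>) = ev x \<phi> \<oplus>\<^bsub>k\<^esub> ev x \<psi>"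
  and ev_smult: "x \<in> carrier H \<Longrightarrow> \<phi> \<in> carrier K' \<Longrightarrow> c \<in> carrier k \<Longrightarrow> ev x (c \<odot>\<^bsub>K'\<^esub> \<phi>) = c \<otimes>\<^bsub>k\<^esub> ev x \<phi>"
  using linear_map_add[OF ev_linear_right[OF K _ lin_id]] linear_map_smult[OF ev_linear_right[OF K _ lin_id]] by simp_all

lemma dual_mult_linear:
  assumes \<psi>: "\<psi> \<in> carrier K'"
  shows "linear_map k K' K' (\<lambda>\<phi>. \<phi> \<otimes>\<^bsub>K'\<^esub> \<psi>)" and "linear_map k K' K' (\<lambda>\<phi>. \<psi> \<otimes>\<^bsub>K'\<^esub> \<phi>)"
proof -
  interpret K': module k K' by (rule L)
  have 1: "linear_map k K' (kmod k) (\<lambda>\<phi>. sw (kmod k) (\<lambda>a b. ev a \<phi> \<otimes>\<^bsub>k\<^esub> ev b \<psi>) x)"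
    "linear_map k K' (kmod k) (\<lambda>\<phi>. sw (kmod k) (\<lambda>a b. ev a \<psi> \<otimes>\<^bsub>k\<^esub> ev b \<phi>) x)" if "x \<in> carrier H" for x
    using that \<psi> by (simp_all add: swr)
  show "linear_map k K' K' (\<lambda>\<phi>. \<phi> \<otimes>\<^bsub>K'\<^esub> \<psi>)"
    by (rule linear_mapI; (rule dual_eqI[where k = k and K = H])?)
      (simp_all add: dual_mult_closed \<psi> ev_mult ev_add ev_smult linear_map_add[OF 1(1)] linear_map_smult[OF 1(1)])
  show "linear_map k K' K' (\<lambda>\<phi>. \<psi> \<otimes>\<^bsub>K'\<^esub> \<phi>)"
    by (rule linear_mapI; (rule dual_eqI[where k = k and K = H])?)
      (simp_all add: dual_mult_closed \<psi> ev_mult ev_add ev_smult linear_map_add[OF 1(2)] linear_map_smult[OF 1(2)])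
qed

text \<open>
  Associativity and unit laws are the coassociativity and the counit laws of \<open>H\<close>, evaluated.
\<close>

lemma dual_alg: "k_algebra k K'"
proof -
  interpret K': module k K' by (rule L)
  note lm = dual_mult_linear
  have assoc: "\<phi> \<otimes>\<^bsub>K'\<^esub> \<psi> \<otimes>\<^bsub>K'\<^esub> \<chi> = \<phi> \<otimes>\<^bsub>K'\<^esub> (\<psi> \<otimes>\<^bsub>K'\<^esub> \<chi>)"
    if c: "\<phi> \<in> carrier K'" "\<psi> \<in> carrier K'" "\<chi> \<in> carrier K'" for \<phi> \<psi> \<chi>
  proof (rule dual_eqI[where k = k and K = H])
    fix x assume x: "x \<in> carrier H"
    have "ev x (\<phi> \<otimes>\<^bsub>K'\<^esub> \<psi> \<otimes>\<^bsub>K'\<^esub> \<chi>) = sw (kmod k) (\<lambda>p q. sw (kmod k) (\<lambda>r s. ev r \<phi> \<otimes>\<^bsub>k\<^esub> ev s \<psi>) p \<otimes>\<^bsub>k\<^esub> ev q \<chi>) x"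
      using x c by (simp add: ev_mult) (rule sw_cong, simp add: ev_mult)
    also have "\<dots> = sw (kmod k) (\<lambda>p q. sw (kmod k) (\<lambda>r s. (ev r \<phi> \<otimes>\<^bsub>k\<^esub> ev s \<psi>) \<otimes>\<^bsub>k\<^esub> ev q \<chi>) p) x"
      by (rule sw_cong, rule linear_sw) (use c in \<open>simp_all add: swr\<close>)
    also have "\<dots> = sw (kmod k) (\<lambda>p q. sw (kmod k) (\<lambda>r s. (ev p \<phi> \<otimes>\<^bsub>k\<^esub> ev r \<psi>) \<otimes>\<^bsub>k\<^esub> ev s \<chi>) q) x"
      by (rule coassoc) (use x c in \<open>simp_all add: swr\<close>)
    also have "\<dots> = sw (kmod k) (\<lambda>p q. ev p \<phi> \<otimes>\<^bsub>k\<^esub> sw (kmod k) (\<lambda>r s. ev r \<psi> \<otimes>\<^bsub>k\<^esub> ev s \<chi>) q) x"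
    proof (rule sw_cong)
      fix p q assume pq: "p \<in> carrier H" "q \<in> carrier H"
      have "ev p \<phi> \<otimes>\<^bsub>k\<^esub> sw (kmod k) (\<lambda>r s. ev r \<psi> \<otimes>\<^bsub>k\<^esub> ev s \<chi>) q = sw (kmod k) (\<lambda>r s. ev p \<phi> \<otimes>\<^bsub>k\<^esub> (ev r \<psi> \<otimes>\<^bsub>k\<^esub> ev s \<chi>)) q"
        by (rule linear_sw) (use pq c in \<open>simp_all add: swr\<close>)
      also have "\<dots> = sw (kmod k) (\<lambda>r s. (ev p \<phi> \<otimes>\<^bsub>k\<^esub> ev r \<psi>) \<otimes>\<^bsub>k\<^esub> ev s \<chi>) q"
        by (rule sw_cong) (use pq c in \<open>simp_all add: swr cring.cring_simprules(11)[OF cring]\<close>)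
      finally show "sw (kmod k) (\<lambda>r s. (ev p \<phi> \<otimes>\<^bsub>k\<^esub> ev r \<psi>) \<otimes>\<^bsub>k\<^esub> ev s \<chi>) q = ev p \<phi> \<otimes>\<^bsub>k\<^esub> sw (kmod k) (\<lambda>r s. ev r \<psi> \<otimes>\<^bsub>k\<^esub> ev s \<chi>) q" ..
    qed
    also have "\<dots> = ev x (\<phi> \<otimes>\<^bsub>K'\<^esub> (\<psi> \<otimes>\<^bsub>K'\<^esub> \<chi>))"
      using x c by (simp add: ev_mult) (rule sw_cong, simp add: ev_mult)
    finally show "ev x (\<phi> \<otimes>\<^bsub>K'\<^esub> \<psi> \<otimes>\<^bsub>K'\<^esub> \<chi>) = ev x (\<phi> \<otimes>\<^bsub>K'\<^esub> (\<psi> \<otimes>\<^bsub>K'\<^esub> \<chi>))" .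
  qed (simp_all add: dual_mult_closed c)
  have one: "\<one>\<^bsub>K'\<^esub> \<otimes>\<^bsub>K'\<^esub> \<phi> = \<phi>" "\<phi> \<otimes>\<^bsub>K'\<^esub> \<one>\<^bsub>K'\<^esub> = \<phi>" if c: "\<phi> \<in> carrier K'" for \<phi>
  proof -
    have 1: "sw (kmod k) (\<lambda>p q. ev p \<one>\<^bsub>K'\<^esub> \<otimes>\<^bsub>k\<^esub> ev q \<phi>) x = ev x \<phi>" if x: "x \<in> carrier H" for x
    proof -
      have "sw (kmod k) (\<lambda>p q. ev p \<one>\<^bsub>K'\<^esub> \<otimes>\<^bsub>k\<^esub> ev q \<phi>) x = sw (kmod k) (\<lambda>p q. counit H p \<odot>\<^bsub>kmod k\<^esub> ev q \<phi>) x"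
        by (rule sw_cong) (simp add: ev_one)
      also have "\<dots> = ev x \<phi>" by (rule sw_counit_left) (use c x in \<open>simp_all add: swr\<close>)
      finally show ?thesis .
    qed
    have 2: "sw (kmod k) (\<lambda>p q. ev p \<phi> \<otimes>\<^bsub>k\<^esub> ev q \<one>\<^bsub>K'\<^esub>) x = ev x \<phi>" if x: "x \<in> carrier H" for x
    proof -
      have "sw (kmod k) (\<lambda>p q. ev p \<phi> \<otimes>\<^bsub>k\<^esub> ev q \<one>\<^bsub>K'\<^esub>) x = sw (kmod k) (\<lambda>p q. counit H q \<odot>\<^bsub>kmod k\<^esub> ev p \<phi>) x"
        by (rule sw_cong) (use c in \<open>simp add: ev_one kmult_comm[OF cring] hr\<close>)
      also have "\<dots> = ev x \<phi>" by (rule sw_counit_right) (use c x in \<open>simp_all add: swr\<close>)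
      finally show ?thesis .
    qed
    show "\<one>\<^bsub>K'\<^esub> \<otimes>\<^bsub>K'\<^esub> \<phi> = \<phi>" "\<phi> \<otimes>\<^bsub>K'\<^esub> \<one>\<^bsub>K'\<^esub> = \<phi>"
      by (rule dual_eqI[where k = k and K = H]; simp add: dual_mult_closed dual_one_closed c ev_mult 1 2)+
  qed
  have "ring K'"
    using linear_map_add[OF lm(1)] linear_map_add[OF lm(2)]
    by (intro ringI monoidI K'.abelian_group_axioms) (simp_all add: dual_mult_closed dual_one_closed assoc one)
  then show ?thesis
    using linear_map_smult[OF lm(1)] linear_map_smult[OF lm(2)] L by (simp add: k_algebra_def)
qed

text \<open>
  Here \<open>H\<close> plays the role of the dual of its dual, so that right coactions of \<open>K'\<close> correspond to
  left actions of \<open>H\<close>.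
\<close>

lemma evaluation_pairing: "bialgebra_pairing k H K' (\<lambda>h \<theta>. ev h \<theta>) (tflip k H K' U)"
proof (rule bialgebra_pairing.intro[OF flip], rule bialgebra_pairing_axioms.intro)
  show "k_algebra k K'" by (rule dual_alg)
  show "linear_map k K' (tensor k K' K') (comult K')" by (rule dual_comult_linear)
  show "ev (l \<otimes>\<^bsub>H\<^esub> l') t = tlift k K' K' (kmod k) (\<lambda>a b. ev l a \<otimes>\<^bsub>k\<^esub> ev l' b) (comult K' t)"
    if "l \<in> carrier H" "l' \<in> carrier H" "t \<in> carrier K'" for l l' t
    using dual_comult_pair[OF that(3,1,2)] by (simp add: pair2_def)
qed (simp_all add: hr mult_closed[OF alg] ev_one dual_simps(8) ev_mult[unfolded sw_def])

end

text \<open>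
  Substitution in a summation over a tensor.
\<close>

lemma tlift_tmap:
  assumes "module k V" "module k W" "module k V'" "module k W'" "module k Z" "bilinear_map k V' W' Z F"
    "linear_map k V V' f" "linear_map k W W' g" "t \<in> carrier (tensor k V W)"
  shows "tlift k V' W' Z F (tmap k V W V' W' f g t) = tlift k V W Z (\<lambda>v w. F (f v) (g w)) t"
proof -
  have "tlift k V' W' Z F (tmap k V W V' W' f g t) = tlift k V W Z (\<lambda>v w. tlift k V' W' Z F (pure k V' W' (f v) (g w))) t"
    unfolding tmap_def using assms by (intro linear_tlift) (simp_all add: lin3)
  also have "\<dots> = tlift k V W Z (\<lambda>v w. F (f v) (g w)) t"
    by (rule tlift_cong[OF assms(1,2)]) (simp add: tlift_pure assms linear_map_closed[OF assms(7)] linear_map_closed[OF assms(8)])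
  finally show ?thesis .
qed

lemma tlift_closed_k:
  "module k V \<Longrightarrow> module k W \<Longrightarrow> bilinear_map k V W (kmod k) f \<Longrightarrow> t \<in> carrier (tensor k V W) \<Longrightarrow>
    tlift k V W (kmod k) f t \<in> carrier k"
  using tlift_closed[of k V W "kmod k"] by (simp add: module_kmod module_cring)

context fd_hopf
begin

lemma sw_closed_k: "bilinear_map k H H (kmod k) F \<Longrightarrow> h \<in> carrier H \<Longrightarrow> sw (kmod k) F h \<in> carrier k"
  using sw_closed[of "kmod k"] by (simp add: module_kmod cring)

section \<open>The canonical element and its inverse\<close>

lemma linear_to_dual:
  assumes W: "module k W" and cl: "\<And>u. u \<in> carrier W \<Longrightarrow> f u \<in> carrier K'"
    and lin: "\<And>x. x \<in> carrier H \<Longrightarrow> linear_map k W (kmod k) (\<lambda>u. ev x (f u))"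
  shows "linear_map k W K' f"
proof -
  interpret K': module k K' by (rule L)
  interpret W: module k W by (rule W)
  show ?thesis
    by (rule linear_mapI; (rule dual_eqI[where k = k and K = H])?)
      (simp_all add: cl ev_add ev_smult linear_map_add[OF lin] linear_map_smult[OF lin])
qed

text \<open>
  The form \<open>\<omega>(p _ q)\<close>.  With these translates, all coproducts of forms can be avoided: what would be
  \<open>\<omega>\<^sub>(\<^sub>1\<^sub>)(p) \<omega>\<^sub>(\<^sub>3\<^sub>)(q) \<omega>\<^sub>(\<^sub>2\<^sub>)\<close> is \<open>tr p q \<omega>\<close>.
\<close>

definition tr :: "'h \<Rightarrow> 'h \<Rightarrow> ('h \<Rightarrow> 'k) \<Rightarrow> 'h \<Rightarrow> 'k"
  where "tr p q \<omega> = (\<lambda>g\<in>carrier H. ev ((p \<otimes>\<^bsub>H\<^esub> g) \<otimes>\<^bsub>H\<^esub> q) \<omega>)"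

lemma ev_tr: "g \<in> carrier H \<Longrightarrow> ev g (tr p q \<omega>) = ev ((p \<otimes>\<^bsub>H\<^esub> g) \<otimes>\<^bsub>H\<^esub> q) \<omega>"
  by (simp add: tr_def ev_def)

lemma tr_closed: "p \<in> carrier H \<Longrightarrow> q \<in> carrier H \<Longrightarrow> \<omega> \<in> carrier K' \<Longrightarrow> tr p q \<omega> \<in> carrier K'"
  unfolding tr_def by (rule dual_carrierI'[OF K]) (simp add: hr)

lemma lin_tr1: "module k W \<Longrightarrow> linear_map k W H f \<Longrightarrow> q \<in> carrier H \<Longrightarrow> \<omega> \<in> carrier K' \<Longrightarrow> linear_map k W K' (\<lambda>u. tr (f u) q \<omega>)"
  and lin_tr2: "module k W \<Longrightarrow> linear_map k W H f \<Longrightarrow> p \<in> carrier H \<Longrightarrow> \<omega> \<in> carrier K' \<Longrightarrow> linear_map k W K' (\<lambda>u. tr p (f u) \<omega>)"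
  and lin_tr3: "module k W \<Longrightarrow> linear_map k W K' f' \<Longrightarrow> p \<in> carrier H \<Longrightarrow> q \<in> carrier H \<Longrightarrow> linear_map k W K' (\<lambda>u. tr p q (f' u))"
  by (rule linear_to_dual; simp add: ev_tr tr_closed linear_map_closed[of k W _ f] linear_map_closed[of k W _ f'] hr)+

lemma H_assoc: "x \<in> carrier H \<Longrightarrow> y \<in> carrier H \<Longrightarrow> z \<in> carrier H \<Longrightarrow> (x \<otimes>\<^bsub>H\<^esub> y) \<otimes>\<^bsub>H\<^esub> z = x \<otimes>\<^bsub>H\<^esub> (y \<otimes>\<^bsub>H\<^esub> z)"
  and H_one: "x \<in> carrier H \<Longrightarrow> \<one>\<^bsub>H\<^esub> \<otimes>\<^bsub>H\<^esub> x = x" "x \<in> carrier H \<Longrightarrow> x \<otimes>\<^bsub>H\<^esub> \<one>\<^bsub>H\<^esub> = x"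
proof -
  interpret H: ring H using H_alg by (rule k_algebra_ring)
  show "x \<in> carrier H \<Longrightarrow> y \<in> carrier H \<Longrightarrow> z \<in> carrier H \<Longrightarrow> (x \<otimes>\<^bsub>H\<^esub> y) \<otimes>\<^bsub>H\<^esub> z = x \<otimes>\<^bsub>H\<^esub> (y \<otimes>\<^bsub>H\<^esub> z)"
    "x \<in> carrier H \<Longrightarrow> \<one>\<^bsub>H\<^esub> \<otimes>\<^bsub>H\<^esub> x = x" "x \<in> carrier H \<Longrightarrow> x \<otimes>\<^bsub>H\<^esub> \<one>\<^bsub>H\<^esub> = x"
    by (simp_all add: H.m_assoc)
qed

lemma tr_tr: "p \<in> carrier H \<Longrightarrow> q \<in> carrier H \<Longrightarrow> p' \<in> carrier H \<Longrightarrow> q' \<in> carrier H \<Longrightarrow> \<omega> \<in> carrier K' \<Longrightarrow>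
  tr p q (tr p' q' \<omega>) = tr (p' \<otimes>\<^bsub>H\<^esub> p) (q \<otimes>\<^bsub>H\<^esub> q') \<omega>"
  by (rule dual_eqI[where k = k and K = H]) (simp_all add: tr_closed mult_closed[OF alg] ev_tr H_assoc)

lemma tr_one: "\<omega> \<in> carrier K' \<Longrightarrow> tr \<one>\<^bsub>H\<^esub> \<one>\<^bsub>H\<^esub> \<omega> = \<omega>"
  by (rule dual_eqI[where k = k and K = H]) (simp_all add: tr_closed one_closed[OF alg] ev_tr H_one)

abbreviation "T0 \<equiv> tensor k H K'"

lemma T0_alg: "k_algebra k T0"
  by (simp add: k_algebra_tensor alg dual_alg)

lemmas kr = swr sw_closed_k tlift_closed_k dual_alg lin_tr1 lin_tr2 lin_tr3 tr_closed mult_closed[OF dual_alg] one_closed[OF dual_alg]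
  T0_alg mult_closed[OF T0_alg]

text \<open>
  The element \<open>(f \<otimes> id)(U)\<close>, which is \<open>U\<close> for the identity and \<open>U\<^sup>-\<^sup>1\<close> for the antipode.
\<close>

definition twist :: "('h \<Rightarrow> 'h) \<Rightarrow> ('h, 'h \<Rightarrow> 'k) tensor"
  where "twist f = tmap k H K' H K' f (\<lambda>\<theta>. \<theta>) U"

lemma twist_closed: "linear_map k H H f \<Longrightarrow> twist f \<in> carrier T0"
  unfolding twist_def using linear_map_closed[OF tmap_linear[OF K L K L _ lin_id] C] .

text \<open>
  \<open>U\<close> reproduces elements of \<open>H\<close>, and therefore the values of linear maps on \<open>H\<close>.
\<close>

lemma U_expand:
  assumes "module k Z" "linear_map k H Z G" "a \<in> carrier H"
  shows "tlift k H K' Z (\<lambda>e f. ev a f \<odot>\<^bsub>Z\<^esub> G e) U = G a"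
proof -
  have "G (tlift k H K' H (\<lambda>e f. ev a f \<odot>\<^bsub>H\<^esub> e) U) = tlift k H K' Z (\<lambda>e f. G (ev a f \<odot>\<^bsub>H\<^esub> e)) U"
    by (rule linear_tlift) (simp_all add: hr assms)
  also have "\<dots> = tlift k H K' Z (\<lambda>e f. ev a f \<odot>\<^bsub>Z\<^esub> G e) U"
    by (rule tlift_cong[OF K L]) (simp add: linear_map_smult[OF assms(2)] hr assms)
  finally show ?thesis by (simp add: expand_K assms)
qed

text \<open>
  The value of \<open>\<omega> \<otimes> h\<close> on an element of \<open>H \<otimes> K'\<close>.
\<close>

definition hpair :: "('h \<Rightarrow> 'k) \<Rightarrow> 'h \<Rightarrow> ('h, 'h \<Rightarrow> 'k) tensor \<Rightarrow> 'k"
  where "hpair \<omega> h z = tlift k H K' (kmod k) (\<lambda>g \<theta>. ev g \<omega> \<otimes>\<^bsub>k\<^esub> ev h \<theta>) z"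

lemma hpair_pure: "\<omega> \<in> carrier K' \<Longrightarrow> h \<in> carrier H \<Longrightarrow> g \<in> carrier H \<Longrightarrow> \<theta> \<in> carrier K' \<Longrightarrow>
  hpair \<omega> h (pure k H K' g \<theta>) = ev g \<omega> \<otimes>\<^bsub>k\<^esub> ev h \<theta>"
  by (simp add: hpair_def tlift_pure kr)

lemma lin_hpair:
  "\<omega> \<in> carrier K' \<Longrightarrow> h \<in> carrier H \<Longrightarrow> linear_map k W T0 f \<Longrightarrow> linear_map k W (kmod k) (\<lambda>u. hpair \<omega> h (f u))"
  by (simp add: hpair_def kr)

lemma lin_hpair1:
  "module k W \<Longrightarrow> linear_map k W K' f \<Longrightarrow> h \<in> carrier H \<Longrightarrow> z \<in> carrier T0 \<Longrightarrow> linear_map k W (kmod k) (\<lambda>u. hpair (f u) h z)"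
  using linear_map_closed[of k W K' f] by (simp add: hpair_def kr)

lemma lin_hpair2:
  "module k W \<Longrightarrow> linear_map k W H f \<Longrightarrow> \<omega> \<in> carrier K' \<Longrightarrow> z \<in> carrier T0 \<Longrightarrow> linear_map k W (kmod k) (\<lambda>u. hpair \<omega> (f u) z)"
  using linear_map_closed[of k W H f] by (simp add: hpair_def kr)

lemma hpair_closed: "\<omega> \<in> carrier K' \<Longrightarrow> h \<in> carrier H \<Longrightarrow> z \<in> carrier T0 \<Longrightarrow> hpair \<omega> h z \<in> carrier k"
  using linear_map_closed[OF lin_hpair[OF _ _ lin_id]] by simp

lemmas pr = kr lin_hpair lin_hpair1 lin_hpair2 hpair_closed

lemma hpair_eqI:
  assumes z: "z \<in> carrier T0" and z': "z' \<in> carrier T0"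
    and eq: "\<And>\<omega> h. \<omega> \<in> carrier K' \<Longrightarrow> h \<in> carrier H \<Longrightarrow> hpair \<omega> h z = hpair \<omega> h z'"
  shows "z = z'"
proof (rule ls_eqI[OF L z z'])
  fix \<omega> assume \<omega>: "\<omega> \<in> carrier K'"
  have *: "ev h (ls k H K' (\<lambda>x. ev x \<omega>) y) = hpair \<omega> h y" if h: "h \<in> carrier H" and y: "y \<in> carrier T0" for h y
    by (rule tensor_ext[OF K L module_kmod[OF cring] _ _ _ y]) (simp_all add: pr \<omega> h ls_pure hpair_pure ev_smult)
  show "ls k H K' (\<lambda>x. ev x \<omega>) z = ls k H K' (\<lambda>x. ev x \<omega>) z'"
    by (rule dual_eqI[where k = k and K = H]) (use z z' \<omega> in \<open>simp_all add: * eq pr\<close>)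
qed

lemma hpair_twist:
  assumes f: "linear_map k H H f" and \<omega>: "\<omega> \<in> carrier K'" and h: "h \<in> carrier H"
  shows "hpair \<omega> h (twist f) = ev (f h) \<omega>"
proof -
  note fl = lin_comp[OF f] linear_map_closed[OF f]
  have "hpair \<omega> h (twist f) = tlift k H K' (kmod k) (\<lambda>e \<theta>. ev (f e) \<omega> \<otimes>\<^bsub>k\<^esub> ev h \<theta>) U"
    unfolding hpair_def twist_def by (rule tlift_tmap) (simp_all add: pr \<omega> h f)
  also have "\<dots> = tlift k H K' (kmod k) (\<lambda>e \<theta>. ev h \<theta> \<odot>\<^bsub>kmod k\<^esub> ev (f e) \<omega>) U"
    by (rule tlift_cong[OF K L]) (simp add: pr \<omega> h fl kmult_comm[OF cring])
  also have "\<dots> = ev (f h) \<omega>"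
    by (rule U_expand) (simp_all add: pr \<omega> h fl)
  finally show ?thesis .
qed

text \<open>
  The second leg of the product is evaluated at \<open>h\<close> by means of \<open>\<Delta>(h)\<close>, and \<open>U\<close> turns the evaluation of
  its second leg at \<open>h\<^sub>(\<^sub>1\<^sub>)\<close> into the value \<open>f(h\<^sub>(\<^sub>1\<^sub>))\<close> of its first leg.
\<close>

lemma hpair_twist_left:
  assumes f: "linear_map k H H f" and \<omega>: "\<omega> \<in> carrier K'" and h: "h \<in> carrier H" and z: "z \<in> carrier T0"
  shows "hpair \<omega> h (twist f \<otimes>\<^bsub>T0\<^esub> z) = sw (kmod k) (\<lambda>a b. hpair (tr (f a) \<one>\<^bsub>H\<^esub> \<omega>) b z) h"
proof (rule tensor_ext[OF K L module_kmod[OF cring] _ _ _ z])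
  note fl = lin_comp[OF f] linear_map_closed[OF f] twist_closed[OF f]
  fix g \<theta> assume g: "g \<in> carrier H" and \<theta>: "\<theta> \<in> carrier K'"
  note ass = f fl \<omega> h g \<theta>
  have "hpair \<omega> h (twist f \<otimes>\<^bsub>T0\<^esub> pure k H K' g \<theta>) = tlift k H K' (kmod k)
    (\<lambda>e \<phi>. hpair \<omega> h (tmap k H K' H K' f (\<lambda>\<theta>. \<theta>) (pure k H K' e \<phi>) \<otimes>\<^bsub>T0\<^esub> pure k H K' g \<theta>)) U"
    unfolding twist_def by (rule tlift_expand[OF K L]) (simp_all add: pr ass)
  also have "\<dots> = tlift k H K' (kmod k)
    (\<lambda>e \<phi>. ev (f e \<otimes>\<^bsub>H\<^esub> g) \<omega> \<otimes>\<^bsub>k\<^esub> tlift k H H (kmod k) (\<lambda>a b. ev a \<phi> \<otimes>\<^bsub>k\<^esub> ev b \<theta>) (comult H h)) U"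
    by (rule tlift_cong[OF K L]) (simp add: pr ass tmap_pure tensor_mult_pure hpair_pure ev_mult sw_def)
  also have "\<dots> = tlift k H H (kmod k) (\<lambda>a b. ev (f a \<otimes>\<^bsub>H\<^esub> g) \<omega> \<otimes>\<^bsub>k\<^esub> ev b \<theta>) (comult H h)"
  proof (rule tensor_ext[OF K K module_kmod[OF cring] _ _ _ comult_H(3)[OF h]])
    fix a b assume ab: "a \<in> carrier H" "b \<in> carrier H"
    have "tlift k H K' (kmod k) (\<lambda>e \<phi>. ev (f e \<otimes>\<^bsub>H\<^esub> g) \<omega> \<otimes>\<^bsub>k\<^esub>
        tlift k H H (kmod k) (\<lambda>a b. ev a \<phi> \<otimes>\<^bsub>k\<^esub> ev b \<theta>) (pure k H H a b)) U =
      tlift k H K' (kmod k) (\<lambda>e \<phi>. ev a \<phi> \<odot>\<^bsub>kmod k\<^esub> (ev (f e \<otimes>\<^bsub>H\<^esub> g) \<omega> \<otimes>\<^bsub>k\<^esub> ev b \<theta>)) U"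
      by (rule tlift_cong[OF K L]) (simp add: pr ass ab tlift_pure cring.cring_simprules(11,14,24)[OF cring])
    also have "\<dots> = ev (f a \<otimes>\<^bsub>H\<^esub> g) \<omega> \<otimes>\<^bsub>k\<^esub> ev b \<theta>"
      by (rule U_expand) (simp_all add: pr ass ab)
    finally show "tlift k H K' (kmod k) (\<lambda>e \<phi>. ev (f e \<otimes>\<^bsub>H\<^esub> g) \<omega> \<otimes>\<^bsub>k\<^esub>
        tlift k H H (kmod k) (\<lambda>a b. ev a \<phi> \<otimes>\<^bsub>k\<^esub> ev b \<theta>) (pure k H H a b)) U =
      tlift k H H (kmod k) (\<lambda>a b. ev (f a \<otimes>\<^bsub>H\<^esub> g) \<omega> \<otimes>\<^bsub>k\<^esub> ev b \<theta>) (pure k H H a b)"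
      by (simp add: tlift_pure pr ass ab)
  qed (simp_all add: pr ass)
  also have "\<dots> = sw (kmod k) (\<lambda>a b. hpair (tr (f a) \<one>\<^bsub>H\<^esub> \<omega>) b (pure k H K' g \<theta>)) h"
    unfolding sw_def by (rule tlift_cong[OF K K]) (simp add: pr ass hpair_pure ev_tr H_one)
  finally show "hpair \<omega> h (twist f \<otimes>\<^bsub>T0\<^esub> pure k H K' g \<theta>) = sw (kmod k) (\<lambda>a b. hpair (tr (f a) \<one>\<^bsub>H\<^esub> \<omega>) b (pure k H K' g \<theta>)) h" .
qed (simp_all add: pr twist_closed lin_comp[OF f] linear_map_closed[OF f] f h \<omega>)

lemma hpair_twist_right:
  assumes f: "linear_map k H H f" and \<omega>: "\<omega> \<in> carrier K'" and h: "h \<in> carrier H" and z: "z \<in> carrier T0"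
  shows "hpair \<omega> h (z \<otimes>\<^bsub>T0\<^esub> twist f) = sw (kmod k) (\<lambda>a b. hpair (tr \<one>\<^bsub>H\<^esub> (f b) \<omega>) a z) h"
proof (rule tensor_ext[OF K L module_kmod[OF cring] _ _ _ z])
  note fl = lin_comp[OF f] linear_map_closed[OF f] twist_closed[OF f]
  fix g \<theta> assume g: "g \<in> carrier H" and \<theta>: "\<theta> \<in> carrier K'"
  note ass = f fl \<omega> h g \<theta>
  have "hpair \<omega> h (pure k H K' g \<theta> \<otimes>\<^bsub>T0\<^esub> twist f) = tlift k H K' (kmod k)
    (\<lambda>e \<phi>. hpair \<omega> h (pure k H K' g \<theta> \<otimes>\<^bsub>T0\<^esub> tmap k H K' H K' f (\<lambda>\<theta>. \<theta>) (pure k H K' e \<phi>))) U"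
    unfolding twist_def by (rule tlift_expand[OF K L]) (simp_all add: pr ass)
  also have "\<dots> = tlift k H K' (kmod k)
    (\<lambda>e \<phi>. ev (g \<otimes>\<^bsub>H\<^esub> f e) \<omega> \<otimes>\<^bsub>k\<^esub> tlift k H H (kmod k) (\<lambda>a b. ev a \<theta> \<otimes>\<^bsub>k\<^esub> ev b \<phi>) (comult H h)) U"
    by (rule tlift_cong[OF K L]) (simp add: pr ass tmap_pure tensor_mult_pure hpair_pure ev_mult sw_def)
  also have "\<dots> = tlift k H H (kmod k) (\<lambda>a b. ev (g \<otimes>\<^bsub>H\<^esub> f b) \<omega> \<otimes>\<^bsub>k\<^esub> ev a \<theta>) (comult H h)"
  proof (rule tensor_ext[OF K K module_kmod[OF cring] _ _ _ comult_H(3)[OF h]])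
    fix a b assume ab: "a \<in> carrier H" "b \<in> carrier H"
    have "tlift k H K' (kmod k) (\<lambda>e \<phi>. ev (g \<otimes>\<^bsub>H\<^esub> f e) \<omega> \<otimes>\<^bsub>k\<^esub>
        tlift k H H (kmod k) (\<lambda>a b. ev a \<theta> \<otimes>\<^bsub>k\<^esub> ev b \<phi>) (pure k H H a b)) U =
      tlift k H K' (kmod k) (\<lambda>e \<phi>. ev b \<phi> \<odot>\<^bsub>kmod k\<^esub> (ev (g \<otimes>\<^bsub>H\<^esub> f e) \<omega> \<otimes>\<^bsub>k\<^esub> ev a \<theta>)) U"
      by (rule tlift_cong[OF K L]) (simp add: pr ass ab tlift_pure cring.cring_simprules(11,14,24)[OF cring])
    also have "\<dots> = ev (g \<otimes>\<^bsub>H\<^esub> f b) \<omega> \<otimes>\<^bsub>k\<^esub> ev a \<theta>"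
      by (rule U_expand) (simp_all add: pr ass ab)
    finally show "tlift k H K' (kmod k) (\<lambda>e \<phi>. ev (g \<otimes>\<^bsub>H\<^esub> f e) \<omega> \<otimes>\<^bsub>k\<^esub>
        tlift k H H (kmod k) (\<lambda>a b. ev a \<theta> \<otimes>\<^bsub>k\<^esub> ev b \<phi>) (pure k H H a b)) U =
      tlift k H H (kmod k) (\<lambda>a b. ev (g \<otimes>\<^bsub>H\<^esub> f b) \<omega> \<otimes>\<^bsub>k\<^esub> ev a \<theta>) (pure k H H a b)"
      by (simp add: tlift_pure pr ass ab)
  qed (simp_all add: pr ass)
  also have "\<dots> = sw (kmod k) (\<lambda>a b. hpair (tr \<one>\<^bsub>H\<^esub> (f b) \<omega>) a (pure k H K' g \<theta>)) h"
    unfolding sw_def by (rule tlift_cong[OF K K]) (simp add: pr ass hpair_pure ev_tr H_one)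
  finally show "hpair \<omega> h (pure k H K' g \<theta> \<otimes>\<^bsub>T0\<^esub> twist f) = sw (kmod k) (\<lambda>a b. hpair (tr \<one>\<^bsub>H\<^esub> (f b) \<omega>) a (pure k H K' g \<theta>)) h" .
qed (simp_all add: pr twist_closed lin_comp[OF f] linear_map_closed[OF f] f h \<omega>)

lemma twist_id: "twist (\<lambda>x. x) = U"
  unfolding twist_def by (rule tensor_ext[OF K L module_tensor[OF K L] _ lin_id _ C]) (simp_all add: pr tmap_pure)

abbreviation "W \<equiv> twist S"

lemma W_closed: "W \<in> carrier T0"
  by (rule twist_closed[OF S_H(1)])

lemma hpair_one: "\<omega> \<in> carrier K' \<Longrightarrow> h \<in> carrier H \<Longrightarrow> hpair \<omega> h \<one>\<^bsub>T0\<^esub> = counit H h \<otimes>\<^bsub>k\<^esub> ev \<one>\<^bsub>H\<^esub> \<omega>"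
  by (simp add: tensor_one hpair_pure pr ev_one kmult_comm[OF cring])

text \<open>
  On \<open>\<omega> \<otimes> h\<close>, the product takes the value \<open>\<omega>(h\<^sub>(\<^sub>1\<^sub>) S(h\<^sub>(\<^sub>2\<^sub>)))\<close>.
\<close>

lemma U_W: "U \<otimes>\<^bsub>T0\<^esub> W = \<one>\<^bsub>T0\<^esub>"
proof (rule hpair_eqI)
  fix \<omega> h assume \<omega>: "\<omega> \<in> carrier K'" and h: "h \<in> carrier H"
  have "hpair \<omega> h (U \<otimes>\<^bsub>T0\<^esub> W) = sw (kmod k) (\<lambda>a b. hpair (tr a \<one>\<^bsub>H\<^esub> \<omega>) b W) h"
    using hpair_twist_left[OF lin_id \<omega> h W_closed] by (simp add: twist_id)
  also have "\<dots> = sw (kmod k) (\<lambda>a b. ev (a \<otimes>\<^bsub>H\<^esub> S b) \<omega>) h"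
    by (rule sw_cong) (simp add: hpair_twist[OF S_H(1)] pr \<omega> ev_tr H_one)
  also have "\<dots> = counit H h \<odot>\<^bsub>kmod k\<^esub> ev \<one>\<^bsub>H\<^esub> \<omega>"
    by (rule sw_antipode_right) (simp_all add: pr \<omega> h)
  finally show "hpair \<omega> h (U \<otimes>\<^bsub>T0\<^esub> W) = hpair \<omega> h \<one>\<^bsub>T0\<^esub>" by (simp add: hpair_one \<omega> h)
qed (simp_all add: pr W_closed one_closed[OF T0_alg])

lemma W_U: "W \<otimes>\<^bsub>T0\<^esub> U = \<one>\<^bsub>T0\<^esub>"
proof (rule hpair_eqI)
  fix \<omega> h assume \<omega>: "\<omega> \<in> carrier K'" and h: "h \<in> carrier H"
  have "hpair \<omega> h (W \<otimes>\<^bsub>T0\<^esub> U) = sw (kmod k) (\<lambda>a b. hpair (tr (S a) \<one>\<^bsub>H\<^esub> \<omega>) b (twist (\<lambda>x. x))) h"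
    using hpair_twist_left[OF S_H(1) \<omega> h C] by (simp add: twist_id)
  also have "\<dots> = sw (kmod k) (\<lambda>a b. ev (S a \<otimes>\<^bsub>H\<^esub> b) \<omega>) h"
    by (rule sw_cong) (simp add: hpair_twist[OF lin_id] pr \<omega> ev_tr H_one)
  also have "\<dots> = counit H h \<odot>\<^bsub>kmod k\<^esub> ev \<one>\<^bsub>H\<^esub> \<omega>"
    by (rule sw_antipode_left) (simp_all add: pr \<omega> h)
  finally show "hpair \<omega> h (W \<otimes>\<^bsub>T0\<^esub> U) = hpair \<omega> h \<one>\<^bsub>T0\<^esub>" by (simp add: hpair_one \<omega> h)
qed (simp_all add: pr W_closed one_closed[OF T0_alg])

lemma inv_U: "inv\<^bsub>T0\<^esub> U = W" and inv_W: "inv\<^bsub>T0\<^esub> W = U"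
proof -
  interpret T0: ring T0 using T0_alg by (rule k_algebra_ring)
  show "inv\<^bsub>T0\<^esub> U = W" "inv\<^bsub>T0\<^esub> W = U"
    using T0.inv_char[OF C W_closed U_W W_U] T0.inv_char[OF W_closed C W_U U_W] by simp_all
qed

text \<open>
  Conjugation with \<open>U\<^sup>-\<^sup>1\<close> is what puts the outer legs of \<open>h\<close> around the argument of the form.  The
  factor \<open>U\<close> on the right is evaluated first and splits off the last leg; therefore the sum is
  bracketed as \<open>(h\<^sub>(\<^sub>1\<^sub>) \<otimes> h\<^sub>(\<^sub>2\<^sub>)) \<otimes> h\<^sub>(\<^sub>3\<^sub>)\<close>.
\<close>

lemma hpair_Ad:
  assumes \<omega>: "\<omega> \<in> carrier K'" and h: "h \<in> carrier H" and z: "z \<in> carrier T0"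
  shows "hpair \<omega> h (Ad T0 W z) = sw (kmod k) (\<lambda>p q. sw (kmod k) (\<lambda>r s. hpair (tr (S r) q \<omega>) s z) p) h"
proof -
  have "hpair \<omega> h (Ad T0 W z) = sw (kmod k) (\<lambda>p q. hpair (tr \<one>\<^bsub>H\<^esub> q \<omega>) p (W \<otimes>\<^bsub>T0\<^esub> z)) h"
    unfolding Ad_def inv_W using hpair_twist_right[OF lin_id \<omega> h, of "W \<otimes>\<^bsub>T0\<^esub> z"] z
    by (simp add: twist_id mult_closed[OF T0_alg] W_closed)
  also have "\<dots> = sw (kmod k) (\<lambda>p q. sw (kmod k) (\<lambda>r s. hpair (tr (S r) q \<omega>) s z) p) h"
  proof (rule sw_cong)
    fix p q assume pq: "p \<in> carrier H" "q \<in> carrier H"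
    have "hpair (tr \<one>\<^bsub>H\<^esub> q \<omega>) p (W \<otimes>\<^bsub>T0\<^esub> z) = sw (kmod k) (\<lambda>r s. hpair (tr (S r) \<one>\<^bsub>H\<^esub> (tr \<one>\<^bsub>H\<^esub> q \<omega>)) s z) p"
      by (rule hpair_twist_left[OF S_H(1) _ _ z]) (simp_all add: pr pq \<omega>)
    also have "\<dots> = sw (kmod k) (\<lambda>r s. hpair (tr (S r) q \<omega>) s z) p"
      by (rule sw_cong) (simp add: tr_tr pr pq \<omega> H_one)
    finally show "hpair (tr \<one>\<^bsub>H\<^esub> q \<omega>) p (W \<otimes>\<^bsub>T0\<^esub> z) = sw (kmod k) (\<lambda>r s. hpair (tr (S r) q \<omega>) s z) p" .
  qed
  finally show ?thesis .
qed

end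

section \<open>Structures on the same module\<close>

lemma same_moduleD: "same_module V V' \<Longrightarrow> carrier V = carrier V'"
  by (simp add: same_module_def)

text \<open>
  In this way a tensor product with \<open>T\<^sub>M(H)\<close> is literally the one with \<open>H \<otimes> H'\<close>, where associativity
  isomorphisms and slices live.
\<close>

lemma tensor_eq:
  assumes "same_module V V'" "same_module W W'" "mult V = mult V'" "mult W = mult W'" "one V = one V'" "one W = one W'"
  shows "tensor k V W = tensor k V' W'"
proof -
  have "tclass k V W = tclass k V' W'"
    using tensor_rel_same[OF assms(1,2), of k] by (intro HOL.ext) (simp add: tclass_def)
  then show ?thesis
    using tensor_rel_same[OF assms(1,2), of k] pure_same[OF assms(1,2), of k] assms
    by (simp add: tensor_def same_module_def)
qed

lemma k_algebra_same:
  assumes "same_module V V'" "mult V = mult V'" "one V = one V'" "k_algebra k V"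
  shows "k_algebra k V'"
proof -
  interpret V: ring V using assms(4) by (rule k_algebra_ring)
  note m = same_module_module[OF assms(1) k_algebra_module[OF assms(4)]]
  interpret V': module k V' by (rule m)
  have e: "carrier V' = carrier V" "add V' = add V" "mult V' = mult V" "one V' = one V" "smult V' = smult V"
    using assms by (simp_all add: same_module_def)
  have "ring V'"
    by (intro ringI monoidI V'.abelian_group_axioms)
      (simp_all add: e V.m_assoc V.l_distr V.r_distr)
  then show ?thesis using m assms(4) by (simp add: k_algebra_def e)
qed

lemma rs_same: "same_module K K' \<Longrightarrow> rs k X K \<phi> = rs k X K' \<phi>"
  using tlift_same[of X X K K' k X] by (intro HOL.ext) (simp add: rs_def same_module_def[of X X])

lemma perfect_pairing_same:
  assumes sL: "same_module L L'" and sK: "same_module K K'" and pp: "perfect_pairing k L K p C"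
  shows "perfect_pairing k L' K' p C"
proof -
  interpret perfect_pairing k L K p C by (rule pp)
  note c = same_moduleD[OF sL, symmetric] same_moduleD[OF sK, symmetric]
  show ?thesis
  proof (rule perfect_pairing.intro)
    show "module k L'" "module k K'" using same_module_module sL sK L K by blast+
    show "bilinear_map k L' K' (kmod k) p"
      using p same_module_linear_map[OF sL, of "kmod k" "kmod k" k] same_module_linear_map[OF sK, of "kmod k" "kmod k" k]
      by (simp add: bilinear_map_def c same_module_def)
    show "C \<in> carrier (tensor k K' L')"
      using C same_moduleD[OF same_module_tensor[OF sK sL, of k]] by simp
    show "tlift k K' L' K' (\<lambda>e f. p f t \<odot>\<^bsub>K'\<^esub> e) C = t" if "t \<in> carrier K'" for t
      using expand_K[of t] that sK tlift_same[OF sK sL, of k K] tlift_same_range[OF sK, of k K' L']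
      by (simp add: c same_module_def)
    show "tlift k K' L' L' (\<lambda>e f. p l e \<odot>\<^bsub>L'\<^esub> f) C = l" if "l \<in> carrier L'" for l
      using expand_L[of l] that sL tlift_same[OF sK sL, of k L] tlift_same_range[OF sL, of k K' L']
      by (simp add: c same_module_def)
  qed
qed

section \<open>Tensor products and duals of perfect pairings\<close>

lemma tlift_tensor_copairing:
  assumes L1: "module k L1" and K1: "module k K1" and L2: "module k L2" and K2: "module k K2" and Z: "module k Z"
    and C1: "C1 \<in> carrier (tensor k K1 L1)" and C2: "C2 \<in> carrier (tensor k K2 L2)"
    and F: "bilinear_map k (tensor k K1 K2) (tensor k L1 L2) Z F"
  shows "tlift k (tensor k K1 K2) (tensor k L1 L2) Z F
    (tlift k K1 L1 (tensor k (tensor k K1 K2) (tensor k L1 L2)) (\<lambda>e f.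
      tlift k K2 L2 (tensor k (tensor k K1 K2) (tensor k L1 L2)) (\<lambda>e' f'.
        pure k (tensor k K1 K2) (tensor k L1 L2) (pure k K1 K2 e e') (pure k L1 L2 f f')) C2) C1) =
    tlift k K1 L1 Z (\<lambda>e f. tlift k K2 L2 Z (\<lambda>e' f'. F (pure k K1 K2 e e') (pure k L1 L2 f f')) C2) C1"
    (is "?M (tlift k K1 L1 ?KL (\<lambda>e f. ?G e f) C1) = _")
proof -
  note mL = module_tensor[OF L1 L2] and mK = module_tensor[OF K1 K2]
  note M = tlift_linear[OF mK mL Z F]
  note r = lin3 assms mL mK
  have "?M (tlift k K1 L1 ?KL (\<lambda>e f. ?G e f) C1) = tlift k K1 L1 Z (\<lambda>e f. ?M (?G e f)) C1"
    by (rule linear_tlift[OF K1 L1 _ Z M _ C1]) (simp_all add: r)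
  also have "\<dots> = tlift k K1 L1 Z (\<lambda>e f. tlift k K2 L2 Z (\<lambda>e' f'. F (pure k K1 K2 e e') (pure k L1 L2 f f')) C2) C1"
  proof (rule tlift_cong[OF K1 L1])
    fix e f assume ef: "e \<in> carrier K1" "f \<in> carrier L1"
    have "?M (?G e f) = tlift k K2 L2 Z (\<lambda>e' f'. ?M (pure k (tensor k K1 K2) (tensor k L1 L2) (pure k K1 K2 e e') (pure k L1 L2 f f'))) C2"
      by (rule linear_tlift[OF K2 L2 _ Z M _ C2]) (simp_all add: r ef)
    also have "\<dots> = tlift k K2 L2 Z (\<lambda>e' f'. F (pure k K1 K2 e e') (pure k L1 L2 f f')) C2"
      by (rule tlift_cong[OF K2 L2]) (simp add: tlift_pure r ef)
    finally show "?M (?G e f) = tlift k K2 L2 Z (\<lambda>e' f'. F (pure k K1 K2 e e') (pure k L1 L2 f f')) C2" .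
  qed
  finally show ?thesis .
qed

text \<open>
  The copairing is \<open>\<Sum>\<^sub>i\<^sub>j (e\<^sub>i \<otimes> e'\<^sub>j) \<otimes> (f\<^sub>i \<otimes> f'\<^sub>j)\<close>.  On pure tensors, both expansions split into those of the
  two factors.
\<close>

lemma tensor_pairing:
  assumes "perfect_pairing k L1 K1 p1 C1" "perfect_pairing k L2 K2 p2 C2"
  shows "perfect_pairing k (tensor k L1 L2) (tensor k K1 K2)
    (\<lambda>d t. tlift k L1 L2 (kmod k) (\<lambda>l1 l2. tlift k K1 K2 (kmod k) (\<lambda>t1 t2. p1 l1 t1 \<otimes>\<^bsub>k\<^esub> p2 l2 t2) t) d)
    (tlift k K1 L1 (tensor k (tensor k K1 K2) (tensor k L1 L2)) (\<lambda>e f.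
      tlift k K2 L2 (tensor k (tensor k K1 K2) (tensor k L1 L2)) (\<lambda>e' f'.
        pure k (tensor k K1 K2) (tensor k L1 L2) (pure k K1 K2 e e') (pure k L1 L2 f f')) C2) C1)"
    (is "perfect_pairing k ?L ?K ?p ?C")
proof -
  interpret P1: perfect_pairing k L1 K1 p1 C1 by fact
  interpret P2: perfect_pairing k L2 K2 p2 C2 by fact
  note r = P1.rules P2.rules tlift_closed_k
  note mL = module_tensor[OF P1.L P2.L] and mK = module_tensor[OF P1.K P2.K]
  note mkk = module_kmod[OF P1.cring]
  note s = smult_smult[OF mK] smult_smult[OF mL] kmult_comm[OF P1.cring] smult_closed[OF mK] smult_closed[OF mL]
    smult_closed[OF P1.K] smult_closed[OF P1.L] smult_closed[OF P2.K] smult_closed[OF P2.L] pure_smult_left pure_smult_right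
  have inner: "tlift k K1 K2 (kmod k) (\<lambda>t1 t2. p1 l1 t1 \<otimes>\<^bsub>k\<^esub> p2 l2 t2) t \<in> carrier k"
    if "l1 \<in> carrier L1" "l2 \<in> carrier L2" "t \<in> carrier ?K" for l1 l2 t
    using that by (simp add: r)
  have bil: "bilinear_map k ?L ?K (kmod k) ?p"
    by (simp add: r inner)
  have pcl: "?p d t \<in> carrier k" if "d \<in> carrier ?L" "t \<in> carrier ?K" for d t
    using bilinear_map_closed[OF bil that] by simp
  have pp: "?p (pure k L1 L2 l1 l2) (pure k K1 K2 t1 t2) = p1 l1 t1 \<otimes>\<^bsub>k\<^esub> p2 l2 t2"
    if "l1 \<in> carrier L1" "l2 \<in> carrier L2" "t1 \<in> carrier K1" "t2 \<in> carrier K2" for l1 l2 t1 t2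
    using that by (simp add: r inner tlift_pure)
  have Ccl: "?C \<in> carrier (tensor k ?K ?L)" by (simp add: r)
  note sum = tlift_tensor_copairing[OF P1.L P1.K P2.L P2.K _ P1.C P2.C]
  note plin = lin_comp[OF bilinear_map_left[OF bil]] lin_comp[OF bilinear_map_right[OF bil]]
    lin_app[OF bilinear_map_left[OF bil]] lin_app[OF bilinear_map_right[OF bil]]
  show ?thesis
  proof (rule perfect_pairing.intro[OF mL mK bil Ccl])
    fix t assume t: "t \<in> carrier ?K"
    have bF: "bilinear_map k ?K ?L ?K (\<lambda>e f. ?p f t \<odot>\<^bsub>?K\<^esub> e)"
      by (rule bilinear_mapI) (simp_all add: lin_smult_right lin_smult_left lin_id plin mK mL t pcl)
    have "tlift k ?K ?L ?K (\<lambda>e f. ?p f t \<odot>\<^bsub>?K\<^esub> e) ?C =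
      tlift k K1 L1 ?K (\<lambda>e f. tlift k K2 L2 ?K (\<lambda>e' f'. ?p (pure k L1 L2 f f') t \<odot>\<^bsub>?K\<^esub> pure k K1 K2 e e') C2) C1"
      by (rule sum[OF mK bF])
    also have "\<dots> = t"
    proof (rule tensor_ext[OF P1.K P2.K mK _ lin_id _ t])
      show "linear_map k ?K ?K (\<lambda>t. tlift k K1 L1 ?K (\<lambda>e f. tlift k K2 L2 ?K (\<lambda>e' f'. ?p (pure k L1 L2 f f') t \<odot>\<^bsub>?K\<^esub> pure k K1 K2 e e') C2) C1)"
        by (simp add: r inner)
      fix t1 t2 assume t12: "t1 \<in> carrier K1" "t2 \<in> carrier K2"
      have "tlift k K1 L1 ?K (\<lambda>e f. tlift k K2 L2 ?K (\<lambda>e' f'. ?p (pure k L1 L2 f f') (pure k K1 K2 t1 t2) \<odot>\<^bsub>?K\<^esub> pure k K1 K2 e e') C2) C1 =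
        tlift k K1 L1 ?K (\<lambda>e f. pure k K1 K2 (p1 f t1 \<odot>\<^bsub>K1\<^esub> e) t2) C1"
      proof (rule tlift_cong[OF P1.K P1.L])
        fix e f assume ef: "e \<in> carrier K1" "f \<in> carrier L1"
        have "tlift k K2 L2 ?K (\<lambda>e' f'. ?p (pure k L1 L2 f f') (pure k K1 K2 t1 t2) \<odot>\<^bsub>?K\<^esub> pure k K1 K2 e e') C2 =
          tlift k K2 L2 ?K (\<lambda>e' f'. pure k K1 K2 (p1 f t1 \<odot>\<^bsub>K1\<^esub> e) (p2 f' t2 \<odot>\<^bsub>K2\<^esub> e')) C2"
          by (rule tlift_cong[OF P2.K P2.L], subst pp) (simp_all add: ef t12 s P1.p_closed P2.p_closed P1.K P2.K pure_closed)
        also have "\<dots> = pure k K1 K2 (p1 f t1 \<odot>\<^bsub>K1\<^esub> e) (tlift k K2 L2 K2 (\<lambda>e' f'. p2 f' t2 \<odot>\<^bsub>K2\<^esub> e') C2)"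
          by (rule linear_tlift[symmetric]) (simp_all add: r s ef t12)
        finally show "tlift k K2 L2 ?K (\<lambda>e' f'. ?p (pure k L1 L2 f f') (pure k K1 K2 t1 t2) \<odot>\<^bsub>?K\<^esub> pure k K1 K2 e e') C2 =
          pure k K1 K2 (p1 f t1 \<odot>\<^bsub>K1\<^esub> e) t2" by (simp add: P2.expand_K t12)
      qed
      also have "\<dots> = pure k K1 K2 (tlift k K1 L1 K1 (\<lambda>e f. p1 f t1 \<odot>\<^bsub>K1\<^esub> e) C1) t2"
        by (rule linear_tlift[symmetric, where L = "\<lambda>u. pure k K1 K2 u t2"]) (simp_all add: r s t12)
      finally show "tlift k K1 L1 ?K (\<lambda>e f. tlift k K2 L2 ?K (\<lambda>e' f'. ?p (pure k L1 L2 f f') (pure k K1 K2 t1 t2) \<odot>\<^bsub>?K\<^esub> pure k K1 K2 e e') C2) C1 =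
        pure k K1 K2 t1 t2" by (simp add: P1.expand_K t12)
    qed
    finally show "tlift k ?K ?L ?K (\<lambda>e f. ?p f t \<odot>\<^bsub>?K\<^esub> e) ?C = t" .
  next
    fix l assume l: "l \<in> carrier ?L"
    have bF: "bilinear_map k ?K ?L ?L (\<lambda>e f. ?p l e \<odot>\<^bsub>?L\<^esub> f)"
      by (rule bilinear_mapI) (simp_all add: lin_smult_right lin_smult_left lin_id plin mK mL l pcl)
    have "tlift k ?K ?L ?L (\<lambda>e f. ?p l e \<odot>\<^bsub>?L\<^esub> f) ?C =
      tlift k K1 L1 ?L (\<lambda>e f. tlift k K2 L2 ?L (\<lambda>e' f'. ?p l (pure k K1 K2 e e') \<odot>\<^bsub>?L\<^esub> pure k L1 L2 f f') C2) C1"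
      by (rule sum[OF mL bF])
    also have "\<dots> = l"
    proof (rule tensor_ext[OF P1.L P2.L mL _ lin_id _ l])
      show "linear_map k ?L ?L (\<lambda>l. tlift k K1 L1 ?L (\<lambda>e f. tlift k K2 L2 ?L (\<lambda>e' f'. ?p l (pure k K1 K2 e e') \<odot>\<^bsub>?L\<^esub> pure k L1 L2 f f') C2) C1)"
        by (simp add: r inner)
      fix l1 l2 assume l12: "l1 \<in> carrier L1" "l2 \<in> carrier L2"
      have "tlift k K1 L1 ?L (\<lambda>e f. tlift k K2 L2 ?L (\<lambda>e' f'. ?p (pure k L1 L2 l1 l2) (pure k K1 K2 e e') \<odot>\<^bsub>?L\<^esub> pure k L1 L2 f f') C2) C1 =
        tlift k K1 L1 ?L (\<lambda>e f. pure k L1 L2 (p1 l1 e \<odot>\<^bsub>L1\<^esub> f) l2) C1"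
      proof (rule tlift_cong[OF P1.K P1.L])
        fix e f assume ef: "e \<in> carrier K1" "f \<in> carrier L1"
        have "tlift k K2 L2 ?L (\<lambda>e' f'. ?p (pure k L1 L2 l1 l2) (pure k K1 K2 e e') \<odot>\<^bsub>?L\<^esub> pure k L1 L2 f f') C2 =
          tlift k K2 L2 ?L (\<lambda>e' f'. pure k L1 L2 (p1 l1 e \<odot>\<^bsub>L1\<^esub> f) (p2 l2 e' \<odot>\<^bsub>L2\<^esub> f')) C2"
          by (rule tlift_cong[OF P2.K P2.L], subst pp) (simp_all add: ef l12 s P1.p_closed P2.p_closed P1.L P2.L pure_closed)
        also have "\<dots> = pure k L1 L2 (p1 l1 e \<odot>\<^bsub>L1\<^esub> f) (tlift k K2 L2 L2 (\<lambda>e' f'. p2 l2 e' \<odot>\<^bsub>L2\<^esub> f') C2)"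
          by (rule linear_tlift[symmetric]) (simp_all add: r s ef l12)
        finally show "tlift k K2 L2 ?L (\<lambda>e' f'. ?p (pure k L1 L2 l1 l2) (pure k K1 K2 e e') \<odot>\<^bsub>?L\<^esub> pure k L1 L2 f f') C2 =
          pure k L1 L2 (p1 l1 e \<odot>\<^bsub>L1\<^esub> f) l2" by (simp add: P2.expand_L l12)
      qed
      also have "\<dots> = pure k L1 L2 (tlift k K1 L1 L1 (\<lambda>e f. p1 l1 e \<odot>\<^bsub>L1\<^esub> f) C1) l2"
        by (rule linear_tlift[symmetric, where L = "\<lambda>u. pure k L1 L2 u l2"]) (simp_all add: r s l12)
      finally show "tlift k K1 L1 ?L (\<lambda>e f. tlift k K2 L2 ?L (\<lambda>e' f'. ?p (pure k L1 L2 l1 l2) (pure k K1 K2 e e') \<odot>\<^bsub>?L\<^esub> pure k L1 L2 f f') C2) C1 =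
        pure k L1 L2 l1 l2" by (simp add: P1.expand_L l12)
    qed
    finally show "tlift k ?K ?L ?L (\<lambda>e f. ?p l e \<odot>\<^bsub>?L\<^esub> f) ?C = l" .
  qed
qed

text \<open>
  Any space in perfect duality with \<open>K\<close> is the dual of \<open>K\<close>.
\<close>

lemma pairing_with_dual:
  assumes P: "perfect_pairing k L K p C"
  shows "perfect_pairing k (dual k K) K (\<lambda>\<phi> x. ev x \<phi>) (tmap k K L K (dual k K) (\<lambda>x. x) (\<lambda>l. \<lambda>t\<in>carrier K. p l t) C)"
    (is "perfect_pairing k ?K' K _ (tmap k K L K ?K' _ ?\<Phi> C)")
    and "bij_betw (\<lambda>l. \<lambda>t\<in>carrier K. p l t) (carrier L) (carrier (dual k K))"
    and "linear_map k L (dual k K) (\<lambda>l. \<lambda>t\<in>carrier K. p l t)"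
proof -
  interpret perfect_pairing k L K p C by (rule P)
  interpret K': module k ?K' by (rule module_dual[OF K])
  interpret L: module k L by (rule L)
  note K' = K'.module_axioms
  have \<Phi>cl: "?\<Phi> l \<in> carrier ?K'" if "l \<in> carrier L" for l
    by (rule dual_carrierI'[OF K p_linear[OF that]])
  have ev\<Phi>: "ev t (?\<Phi> l) = p l t" if "t \<in> carrier K" for t l
    using that by (simp add: ev_def)
  note evl = ev_linear_right[OF K _ lin_id]
  show \<Phi>: "linear_map k L ?K' ?\<Phi>"
    by (rule linear_mapI; (rule dual_eqI[where k = k and K = K])?)
      (simp_all del: restrict_apply add: \<Phi>cl ev\<Phi> linear_map_add[OF evl] linear_map_smult[OF evl] linear_map_add[OF bilinear_map_left[OF p]]
         linear_map_smult[OF bilinear_map_left[OF p]])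
  note r = rules K' \<Phi> \<Phi>cl lin_comp[OF \<Phi>] ev_linear_left[OF K] ev_linear_right[OF K] ev_closed[OF K] smult_closed[OF K'] smult_closed[OF K]
  show "bij_betw ?\<Phi> (carrier L) (carrier ?K')"
  proof (rule bij_betwI')
    fix l l' assume l: "l \<in> carrier L" "l' \<in> carrier L"
    show "(?\<Phi> l = ?\<Phi> l') = (l = l')"
    proof
      assume "?\<Phi> l = ?\<Phi> l'"
      then show "l = l'" using ev\<Phi> by (intro L_eqI[OF l]) metis
    qed simp
  next
    fix \<phi> assume \<phi>: "\<phi> \<in> carrier ?K'"
    obtain l where l: "l \<in> carrier L" "\<forall>t\<in>carrier K. p l t = ev t \<phi>"
      using represent[OF dual_linear[OF \<phi>]] by blast
    then have "\<phi> = ?\<Phi> l" using \<phi> by (intro dual_eqI[where k = k and K = K]) (simp_all add: \<Phi>cl ev\<Phi>)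
    with l show "\<exists>l\<in>carrier L. \<phi> = ?\<Phi> l" by blast
  qed (rule \<Phi>cl)
  show "perfect_pairing k ?K' K (\<lambda>\<phi> x. ev x \<phi>) (tmap k K L K ?K' (\<lambda>x. x) ?\<Phi> C)"
  proof (rule perfect_pairing.intro)
    show "module k ?K'" by (rule K')
    show "module k K" by (rule K)
    show "bilinear_map k ?K' K (kmod k) (\<lambda>\<phi> x. ev x \<phi>)" by (simp add: r)
    show "tmap k K L K ?K' (\<lambda>x. x) ?\<Phi> C \<in> carrier (tensor k K ?K')"
      using linear_map_closed[OF tmap_linear[OF K L K K' lin_id \<Phi>] C] .
  next
    fix t assume t: "t \<in> carrier K"
    have "tlift k K ?K' K (\<lambda>e f. ev t f \<odot>\<^bsub>K\<^esub> e) (tmap k K L K ?K' (\<lambda>x. x) ?\<Phi> C) = tlift k K L K (\<lambda>e l. ev t (?\<Phi> l) \<odot>\<^bsub>K\<^esub> e) C"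
      by (rule tlift_tmap[OF K L K K' K _ lin_id \<Phi> C]) (simp add: r t)
    also have "\<dots> = t" using t by (simp only: ev\<Phi>) (rule expand_K)
    finally show "tlift k K ?K' K (\<lambda>e f. ev t f \<odot>\<^bsub>K\<^esub> e) (tmap k K L K ?K' (\<lambda>x. x) ?\<Phi> C) = t" .
  next
    fix \<phi> assume \<phi>: "\<phi> \<in> carrier ?K'"
    have "tlift k K ?K' ?K' (\<lambda>e f. ev e \<phi> \<odot>\<^bsub>?K'\<^esub> f) (tmap k K L K ?K' (\<lambda>x. x) ?\<Phi> C) = tlift k K L ?K' (\<lambda>e l. ev e \<phi> \<odot>\<^bsub>?K'\<^esub> ?\<Phi> l) C"
      by (rule tlift_tmap[OF K L K K' K' _ lin_id \<Phi> C]) (simp add: r \<phi>)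
    also have "\<dots> = \<phi>"
    proof (rule dual_eqI[where k = k and K = K])
      show "tlift k K L ?K' (\<lambda>e l. ev e \<phi> \<odot>\<^bsub>?K'\<^esub> ?\<Phi> l) C \<in> carrier ?K'" by (simp add: r \<phi>)
      fix t assume t: "t \<in> carrier K"
      have "ev t (tlift k K L ?K' (\<lambda>e l. ev e \<phi> \<odot>\<^bsub>?K'\<^esub> ?\<Phi> l) C) = tlift k K L (kmod k) (\<lambda>e l. ev t (ev e \<phi> \<odot>\<^bsub>?K'\<^esub> ?\<Phi> l)) C"
        by (rule linear_tlift[where L = "ev t"]) (simp_all add: r t \<phi>)
      also have "\<dots> = tlift k K L (kmod k) (\<lambda>e l. ev (p l t \<odot>\<^bsub>K\<^esub> e) \<phi>) C"
        by (rule tlift_cong[OF K L])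
          (simp del: restrict_apply add: linear_map_smult[OF evl] linear_map_smult[OF dual_linear[OF \<phi>]] ev\<Phi> r t \<phi> kmult_comm[OF cring])
      also have "\<dots> = ev (tlift k K L K (\<lambda>e l. p l t \<odot>\<^bsub>K\<^esub> e) C) \<phi>"
        by (rule linear_tlift[symmetric]) (simp_all add: r t \<phi>)
      finally show "ev t (tlift k K L ?K' (\<lambda>e l. ev e \<phi> \<odot>\<^bsub>?K'\<^esub> ?\<Phi> l) C) = ev t \<phi>" by (simp add: expand_K t)
    qed (rule \<phi>)
    finally show "tlift k K ?K' ?K' (\<lambda>e f. ev e \<phi> \<odot>\<^bsub>?K'\<^esub> f) (tmap k K L K ?K' (\<lambda>x. x) ?\<Phi> C) = \<phi>" .
  qed
qed

section \<open>The duality between the double and its dual\<close>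

context fd_hopf
begin

abbreviation "T \<equiv> T_M k H"
abbreviation "E \<equiv> tensor k K' H"
abbreviation "D \<equiv> D_M k H"

lemma T_same: "same_module T0 T" and T_mult: "mult T0 = mult T" and T_one: "\<one>\<^bsub>T0\<^esub> = \<one>\<^bsub>T\<^esub>"
  by (simp_all add: same_module_def T_M_def mk_bialg_def)

lemma T_carrier: "carrier T = carrier T0"
  using T_same by (simp add: same_module_def)

lemma T_alg: "k_algebra k T"
  using k_algebra_same[OF T_same T_mult T_one T0_alg] .

lemma tensor_X_T: "tensor k X T = tensor k X T0"
  by (rule tensor_eq[symmetric]) (simp_all add: T_same T_mult T_one, simp add: same_module_def)

lemma tensor_T_T: "tensor k T T = tensor k T0 T0"
  by (rule tensor_eq[symmetric]) (simp_all add: T_same T_mult T_one)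

lemma E_mod: "module k E"
  by (simp add: kr)

lemma T0_mod: "module k T0"
  by (simp add: kr)

text \<open>
  The pairing of \<open>D\<^sub>M(H)\<close> with \<open>T\<^sub>M(H)\<close> is the tensor product of the two evaluation pairings between
  \<open>H\<close> and its dual.
\<close>

definition dpair :: "('h \<Rightarrow> 'k, 'h) tensor \<Rightarrow> ('h, 'h \<Rightarrow> 'k) tensor \<Rightarrow> 'k"
  where "dpair d t = tlift k K' H (kmod k) (\<lambda>\<omega> h. hpair \<omega> h t) d"

definition dcopair :: "(('h, 'h \<Rightarrow> 'k) tensor, ('h \<Rightarrow> 'k, 'h) tensor) tensor"
  where "dcopair = tlift k H K' (tensor k T0 E) (\<lambda>e f. tlift k K' H (tensor k T0 E)
    (\<lambda>e' f'. pure k T0 E (pure k H K' e e') (pure k K' H f f')) (tflip k H K' U)) U"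

lemma E_T0_pairing: "perfect_pairing k E T0 dpair dcopair"
  using tensor_pairing[OF pairing flip] unfolding dcopair_def dpair_def[abs_def] hpair_def[abs_def] .

lemma dpair_pure: "\<omega> \<in> carrier K' \<Longrightarrow> h \<in> carrier H \<Longrightarrow> t \<in> carrier T0 \<Longrightarrow> dpair (pure k K' H \<omega> h) t = hpair \<omega> h t"
  by (simp add: dpair_def tlift_pure pr)

lemma D_pairing_eq: "D_pairing k H = (\<lambda>d. \<lambda>t\<in>carrier T. dpair d t)"
  by (intro HOL.ext) (simp add: D_pairing_def dpair_def hpair_def[abs_def] tlift_kmod ev_def)

lemma E_T_pairing: "perfect_pairing k E T dpair dcopair"
  using perfect_pairing_same[OF _ T_same E_T0_pairing, of E] by (simp add: same_module_def)

lemma D_same: "same_module E D"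
  by (simp add: same_module_def D_M_def Let_def)

lemma D_T_pairing: "perfect_pairing k D T dpair dcopair"
  using perfect_pairing_same[OF D_same _ E_T_pairing, of T] by (simp add: same_module_def)

abbreviation "T' \<equiv> dual k T"

lemmas dual_T = pairing_with_dual[OF E_T_pairing, folded D_pairing_eq]

sublocale T: dualizable k T "tmap k T E T T' (\<lambda>x. x) (D_pairing k H) dcopair"
  using T_alg dual_T(1) by (rule dualizable.intro)

section \<open>The coproduct of \<open>T\<^sub>M(H)\<close>\<close>

lemma comult_cop: "comult (co_opposite k H) h = tflip k H H (comult H h)"
  by (simp add: co_opposite_def mk_bialg_def)

text \<open>
  The element \<open>z \<in> H \<otimes> K'\<close>, flipped, is put between the outer legs \<open>b\<close> and \<open>\<theta>\<close>.
\<close>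

definition T_insert :: "'h \<Rightarrow> ('h \<Rightarrow> 'k) \<Rightarrow> ('h, 'h \<Rightarrow> 'k) tensor \<Rightarrow> (('h, 'h \<Rightarrow> 'k) tensor, ('h, 'h \<Rightarrow> 'k) tensor) tensor"
  where "T_insert b \<theta> z = tunassoc k H K' T0 (pure k H (tensor k K' T0) b (tassoc k K' H K' (pure k (tensor k K' H) K' (tflip k H K' z) \<theta>)))"

text \<open>
  The part of the coproduct of \<open>T\<^sub>M(H)\<close> that rearranges the legs of
  \<open>\<Delta>\<^sup>c\<^sup>o(g) \<otimes> \<Delta>(\<theta>)\<close>.
\<close>

definition T_shuffle :: "(('h, 'h) tensor, ('h \<Rightarrow> 'k, 'h \<Rightarrow> 'k) tensor) tensor \<Rightarrow> (('h, 'h \<Rightarrow> 'k) tensor, ('h, 'h \<Rightarrow> 'k) tensor) tensor"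
  where "T_shuffle t1 = tunassoc k H K' T0
    (tmap k H (tensor k E K') H (tensor k K' T0) (\<lambda>y. y) (tassoc k K' H K')
      (tmap k H (tensor k T0 K') H (tensor k E K') (\<lambda>y. y) (tmap k T0 K' E K' (\<lambda>z. tflip k H K' (Ad T0 W z)) (\<lambda>y. y))
        (tmap k H (tensor k H (tensor k K' K')) H (tensor k T0 K') (\<lambda>y. y) (tunassoc k H K' K')
          (tassoc k H H (tensor k K' K') t1))))"

lemma T_comult_eq: "T_comult k H t = T_shuffle (tmap k H K' (tensor k H H) (tensor k K' K') (\<lambda>h. tflip k H H (comult H h)) (comult K') t)"
  by (simp add: T_comult_def Let_def T_shuffle_def inv_U comult_cop[abs_def])

lemma Ad_linear: "linear_map k U' T0 f \<Longrightarrow> linear_map k U' T0 (\<lambda>u. Ad T0 W (f u))"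
  unfolding Ad_def inv_W by (simp add: pr W_closed)

lemma Ad_closed: "z \<in> carrier T0 \<Longrightarrow> Ad T0 W z \<in> carrier T0"
  using linear_map_closed[OF Ad_linear[OF lin_id]] .

lemmas tr_rules = pr Ad_linear Ad_closed linear_map_closed[OF tflip_linear] linear_map_closed[OF tassoc_linear]
  linear_map_closed[OF tunassoc_linear] dual_comult_linear lin_comp[OF dual_comult_linear] dual_comult_closed

lemma T_shuffle_linear: "linear_map k (tensor k (tensor k H H) (tensor k K' K')) (tensor k T0 T0) T_shuffle"
  unfolding T_shuffle_def[abs_def] by (simp add: tr_rules)

lemma T_comult_linear: "linear_map k T0 (tensor k T0 T0) (T_comult k H)"
  unfolding T_comult_eq[abs_def] by (rule lin_comp[OF T_shuffle_linear]) (simp add: tr_rules)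

lemma T_shuffle_pure:
  assumes "a \<in> carrier H" "b \<in> carrier H" "\<theta> \<in> carrier K'" "\<theta>' \<in> carrier K'"
  shows "T_shuffle (pure k (tensor k H H) (tensor k K' K') (pure k H H b a) (pure k K' K' \<theta> \<theta>')) = T_insert b \<theta>' (Ad T0 W (pure k H K' a \<theta>))"
  unfolding T_shuffle_def T_insert_def by (simp add: tr_rules assms tassoc_pure tmap_pure tunassoc_pure)

text \<open>
  The value of \<open>(\<omega> \<otimes> h) \<otimes> (\<omega>' \<otimes> h')\<close> on an element of \<open>T\<^sub>M(H) \<otimes> T\<^sub>M(H)\<close>.
\<close>

definition pairT :: "('h \<Rightarrow> 'k) \<Rightarrow> 'h \<Rightarrow> ('h \<Rightarrow> 'k) \<Rightarrow> 'h \<Rightarrow> (('h, 'h \<Rightarrow> 'k) tensor, ('h, 'h \<Rightarrow> 'k) tensor) tensor \<Rightarrow> 'k"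
  where "pairT \<omega> h \<omega>' h' = tlift k T0 T0 (kmod k) (\<lambda>s s'. hpair \<omega> h s \<otimes>\<^bsub>k\<^esub> hpair \<omega>' h' s')"

lemma pairT_linear: "\<omega> \<in> carrier K' \<Longrightarrow> h \<in> carrier H \<Longrightarrow> \<omega>' \<in> carrier K' \<Longrightarrow> h' \<in> carrier H \<Longrightarrow>
  linear_map k (tensor k T0 T0) (kmod k) (pairT \<omega> h \<omega>' h')"
  by (simp add: pairT_def pr)

lemma pairT_T_insert:
  assumes as: "\<omega> \<in> carrier K'" "h \<in> carrier H" "\<omega>' \<in> carrier K'" "h' \<in> carrier H" "b \<in> carrier H" "\<theta> \<in> carrier K'"
    and z: "z \<in> carrier T0"
  shows "pairT \<omega> h \<omega>' h' (T_insert b \<theta> z) = (ev b \<omega> \<otimes>\<^bsub>k\<^esub> ev h' \<theta>) \<otimes>\<^bsub>k\<^esub> hpair \<omega>' h z"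
proof (rule tensor_ext[OF K L module_kmod[OF cring] _ _ _ z])
  show "linear_map k T0 (kmod k) (\<lambda>z. pairT \<omega> h \<omega>' h' (T_insert b \<theta> z))"
    unfolding T_insert_def by (rule lin_comp[OF pairT_linear[OF as(1-4)]]) (simp add: tr_rules as)
  fix c \<psi> assume c: "c \<in> carrier H" "\<psi> \<in> carrier K'"
  show "pairT \<omega> h \<omega>' h' (T_insert b \<theta> (pure k H K' c \<psi>)) = (ev b \<omega> \<otimes>\<^bsub>k\<^esub> ev h' \<theta>) \<otimes>\<^bsub>k\<^esub> hpair \<omega>' h (pure k H K' c \<psi>)"
    unfolding T_insert_def pairT_def
    by (simp add: tr_rules as c tflip_pure tassoc_pure tunassoc_pure tlift_pure hpair_pure cring.cring_simprules(11,14,24)[OF cring])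
qed (simp add: tr_rules as)

text \<open>
  The inner legs of \<open>\<Delta>\<^sup>c\<^sup>o(g) \<otimes> \<Delta>(\<theta>)\<close> are \<open>g\<^sub>(\<^sub>1\<^sub>)\<close> and \<open>\<theta>\<^sub>(\<^sub>1\<^sub>)\<close>.  They meet \<open>\<omega>'\<close> and \<open>h\<close>, and the conjugation
  yields \<open>\<omega>'(S(h\<^sub>(\<^sub>1\<^sub>)) g\<^sub>(\<^sub>1\<^sub>) h\<^sub>(\<^sub>3\<^sub>)) \<theta>\<^sub>(\<^sub>1\<^sub>)(h\<^sub>(\<^sub>2\<^sub>))\<close>.  The outer legs contribute \<open>\<omega>(g\<^sub>(\<^sub>2\<^sub>)) \<theta>\<^sub>(\<^sub>2\<^sub>)(h')\<close>, and the
  sums over the legs of \<open>g\<close> and \<open>\<theta>\<close> become a product of forms and a product in \<open>H\<close>.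
\<close>

lemma pairT_comult:
  assumes as: "\<omega> \<in> carrier K'" "h \<in> carrier H" "\<omega>' \<in> carrier K'" "h' \<in> carrier H" and t: "t \<in> carrier T0"
  shows "pairT \<omega> h \<omega>' h' (T_comult k H t) =
    sw (kmod k) (\<lambda>p q. sw (kmod k) (\<lambda>r s. hpair (tr (S r) q \<omega>' \<otimes>\<^bsub>K'\<^esub> \<omega>) (s \<otimes>\<^bsub>H\<^esub> h') t) p) h"
proof (rule tensor_ext[OF K L module_kmod[OF cring] _ _ _ t])
  note mk = module_kmod[OF cring]
  note PT = pairT_linear[OF as]
  note rl = tr_rules as lin_comp[OF PT] lin_comp[OF T_shuffle_linear]
  show "linear_map k T0 (kmod k) (\<lambda>t. pairT \<omega> h \<omega>' h' (T_comult k H t))"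
    by (rule lin_comp[OF PT T_comult_linear])
  show "linear_map k T0 (kmod k)
     (\<lambda>t. sw (kmod k) (\<lambda>p q. sw (kmod k) (\<lambda>r s. hpair (tr (S r) q \<omega>' \<otimes>\<^bsub>K'\<^esub> \<omega>) (s \<otimes>\<^bsub>H\<^esub> h') t) p) h)"
    by (simp add: rl)
  fix g \<theta> assume g: "g \<in> carrier H" and \<theta>: "\<theta> \<in> carrier K'"
  \<comment> \<open>With \<open>\<Delta>(g)\<close> and \<open>\<Delta>(\<theta>)\<close> replaced by arbitrary tensors \<open>u\<close> and \<open>v\<close>, both sides are bilinear.\<close>
  let ?R = "\<lambda>u v. sw (kmod k) (\<lambda>p q. sw (kmod k) (\<lambda>r s.
    tlift k H H (kmod k) (\<lambda>a b. ev a (tr (S r) q \<omega>') \<otimes>\<^bsub>k\<^esub> ev b \<omega>) u \<otimes>\<^bsub>k\<^esub> pair2 s h' v) p) h"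
  have p2: "linear_map k W2 (kmod k) (\<lambda>u. pair2 (f u) y v)" 
    if "linear_map k W2 H f" "y \<in> carrier H" "v \<in> carrier (tensor k K' K')" "module k W2" for W2 :: "('k, 'h, 'm) bialg_scheme" and f y v
    using that linear_map_closed[OF that(1)] by (simp add: pair2_def pr)
  have p2c: "pair2 x y v \<in> carrier k" if "x \<in> carrier H" "y \<in> carrier H" "v \<in> carrier (tensor k K' K')" for x y v
    using linear_map_closed[OF pair2_linear[OF that(1,2)] that(3)] by simp
  have main: "pairT \<omega> h \<omega>' h' (T_shuffle (pure k (tensor k H H) (tensor k K' K') (tflip k H H u) v)) = ?R u v"
    if u: "u \<in> carrier (tensor k H H)" and v: "v \<in> carrier (tensor k K' K')" for u v
  proof (rule tensor_ext[OF K K mk _ _ _ u])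
    show "linear_map k (tensor k H H) (kmod k) (\<lambda>u. pairT \<omega> h \<omega>' h' (T_shuffle (pure k (tensor k H H) (tensor k K' K') (tflip k H H u) v)))"
      by (simp add: rl v)
    show "linear_map k (tensor k H H) (kmod k) (\<lambda>u. ?R u v)"
      by (simp add: rl v p2 p2c)
    fix a b assume ab: "a \<in> carrier H" "b \<in> carrier H"
    show "pairT \<omega> h \<omega>' h' (T_shuffle (pure k (tensor k H H) (tensor k K' K') (tflip k H H (pure k H H a b)) v)) = ?R (pure k H H a b) v"
    proof (rule tensor_ext[OF L L mk _ _ _ v])
      show "linear_map k (tensor k K' K') (kmod k) (\<lambda>v. pairT \<omega> h \<omega>' h' (T_shuffle (pure k (tensor k H H) (tensor k K' K') (tflip k H H (pure k H H a b)) v)))"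
        by (simp add: rl ab)
      show "linear_map k (tensor k K' K') (kmod k) (\<lambda>v. ?R (pure k H H a b) v)"
        by (simp add: rl ab p2 p2c pair2_linear)
      fix \<phi> \<psi> assume ps: "\<phi> \<in> carrier K'" "\<psi> \<in> carrier K'"
      let ?c = "ev b \<omega> \<otimes>\<^bsub>k\<^esub> ev h' \<psi>"
      have c: "?c \<in> carrier k" by (simp add: rl ab ps)
      have "pairT \<omega> h \<omega>' h' (T_shuffle (pure k (tensor k H H) (tensor k K' K') (tflip k H H (pure k H H a b)) (pure k K' K' \<phi> \<psi>))) =
        ?c \<otimes>\<^bsub>k\<^esub> sw (kmod k) (\<lambda>p q. sw (kmod k) (\<lambda>r s. hpair (tr (S r) q \<omega>') s (pure k H K' a \<phi>)) p) h"
        by (simp add: tflip_pure T_shuffle_pure pairT_T_insert hpair_Ad ab ps as Ad_closed pure_closed K)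
      also have "\<dots> = sw (kmod k) (\<lambda>p q. ?c \<otimes>\<^bsub>k\<^esub> sw (kmod k) (\<lambda>r s. hpair (tr (S r) q \<omega>') s (pure k H K' a \<phi>)) p) h"
        by (rule linear_sw) (simp_all add: rl ab ps c)
      also have "\<dots> = sw (kmod k) (\<lambda>p q. sw (kmod k) (\<lambda>r s. ?c \<otimes>\<^bsub>k\<^esub> hpair (tr (S r) q \<omega>') s (pure k H K' a \<phi>)) p) h"
        by (rule sw_cong, rule linear_sw) (simp_all add: rl ab ps c)
      also have "\<dots> = ?R (pure k H H a b) (pure k K' K' \<phi> \<psi>)"
        by (rule sw_cong, rule sw_cong)
          (simp add: rl ab ps tlift_pure hpair_pure pair2_pure cring.cring_simprules(11,14,24)[OF cring])
      finally show "pairT \<omega> h \<omega>' h' (T_shuffle (pure k (tensor k H H) (tensor k K' K') (tflip k H H (pure k H H a b)) (pure k K' K' \<phi> \<psi>))) =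
        ?R (pure k H H a b) (pure k K' K' \<phi> \<psi>)" .
    qed
  qed
  have "pairT \<omega> h \<omega>' h' (T_comult k H (pure k H K' g \<theta>)) = ?R (comult H g) (comult K' \<theta>)"
    unfolding T_comult_eq by (subst tmap_pure) (simp_all add: rl g \<theta> main)
  also have "\<dots> = sw (kmod k) (\<lambda>p q. sw (kmod k) (\<lambda>r s. hpair (tr (S r) q \<omega>' \<otimes>\<^bsub>K'\<^esub> \<omega>) (s \<otimes>\<^bsub>H\<^esub> h') (pure k H K' g \<theta>)) p) h"
    by (rule sw_cong, rule sw_cong) (simp add: rl g \<theta> hpair_pure ev_mult dual_comult_pair sw_def)
  finally show "pairT \<omega> h \<omega>' h' (T_comult k H (pure k H K' g \<theta>)) =
    sw (kmod k) (\<lambda>p q. sw (kmod k) (\<lambda>r s. hpair (tr (S r) q \<omega>' \<otimes>\<^bsub>K'\<^esub> \<omega>) (s \<otimes>\<^bsub>H\<^esub> h') (pure k H K' g \<theta>)) p) h" .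
qed

section \<open>The product of the double\<close>

lemma T_comult: "comult T = T_comult k H"
  by (simp add: T_M_def mk_bialg_def)

lemma T_comult_linear': "linear_map k T (tensor k T T) (comult T)"
  unfolding tensor_T_T T_comult
  using T_comult_linear same_module_linear_map[OF T_same, of "tensor k T0 T0" "tensor k T0 T0" k] by (simp add: same_module_def)

lemma T_counit: "counit T = tlift k H K' (kmod k) (\<lambda>g \<theta>. counit H g \<otimes>\<^bsub>k\<^esub> ev \<one>\<^bsub>H\<^esub> \<theta>)"
  by (simp add: T_M_def mk_bialg_def dual_simps(8) tlift_kmod)

lemma T_counit_linear: "linear_map k T (kmod k) (counit T)"
proof -
  have "linear_map k T0 (kmod k) (counit T)" by (simp add: T_counit pr)
  then show ?thesis using same_module_linear_map[OF T_same, of "kmod k" "kmod k" k] by (simp add: same_module_def)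
qed

lemma dual_T_mult_closed:
  assumes "\<phi> \<in> carrier T'" "\<psi> \<in> carrier T'"
  shows "\<phi> \<otimes>\<^bsub>T'\<^esub> \<psi> \<in> carrier T'"
proof -
  have "linear_map k T (kmod k) (\<lambda>x. tlift k T T (kmod k) (\<lambda>a b. ev a \<phi> \<otimes>\<^bsub>k\<^esub> ev b \<psi>) (comult T x))"
    using assms by (simp add: T.r T_comult_linear' lin_app[OF T_comult_linear'])
  from dual_carrierI'[OF T.K this] show ?thesis by (simp add: dual_simps(6) ev_def)
qed

lemma dual_T_one_closed: "\<one>\<^bsub>T'\<^esub> \<in> carrier T'"
  unfolding dual_simps(3) by (rule dual_carrierI'[OF T.K T_counit_linear])

abbreviation "\<Phi> \<equiv> D_pairing k H"
abbreviation "\<Psi> \<equiv> the_inv_into (carrier E) \<Phi>"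

lemma \<Psi>: "\<phi> \<in> carrier T' \<Longrightarrow> \<Psi> \<phi> \<in> carrier E" "\<phi> \<in> carrier T' \<Longrightarrow> \<Phi> (\<Psi> \<phi>) = \<phi>"
  using bij_betwE[OF bij_betw_the_inv_into[OF dual_T(2)]] f_the_inv_into_f_bij_betw[OF dual_T(2)] by auto

lemma \<Psi>_linear: "linear_map k T' E \<Psi>"
proof -
  interpret E: module k E by (rule E_mod)
  interpret T': module k T' by (rule T.L)
  note P = dual_T(3)
  have inj: "x = y" if "x \<in> carrier E" "y \<in> carrier E" "\<Phi> x = \<Phi> y" for x y
    using dual_T(2) that by (auto simp: bij_betw_def inj_on_def)
  show ?thesis
    by (rule linear_mapI; (rule inj)?) (simp_all add: \<Psi> linear_map_add[OF P] linear_map_smult[OF P])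
qed

lemma D_simps: "carrier D = carrier E" "d \<otimes>\<^bsub>D\<^esub> d' = \<Psi> (\<Phi> d \<otimes>\<^bsub>T'\<^esub> \<Phi> d')" "\<one>\<^bsub>D\<^esub> = \<Psi> \<one>\<^bsub>T'\<^esub>"
  "comult D d = tmap k T' T' E E \<Psi> \<Psi> (comult T' (\<Phi> d))" "counit D d = counit T' (\<Phi> d)"
  by (simp_all add: D_M_def Let_def)

lemma ev_\<Phi>: "t \<in> carrier T \<Longrightarrow> ev t (\<Phi> d) = dpair d t"
  by (simp add: D_pairing_eq ev_def)

lemma \<Phi>_closed: "d \<in> carrier E \<Longrightarrow> \<Phi> d \<in> carrier T'"
  using linear_map_closed[OF dual_T(3)] .

text \<open>
  The structure of \<open>D\<^sub>M(H)\<close> is transported from the dual of \<open>T\<^sub>M(H)\<close> along the pairing, and there all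
  adjointness relations hold by construction.
\<close>

lemma D_pairing_bialgebra: "bialgebra_pairing k D T dpair dcopair"
proof (rule bialgebra_pairing.intro[OF D_T_pairing], rule bialgebra_pairing_axioms.intro)
  show "k_algebra k T" by (rule T_alg)
  show "linear_map k T (tensor k T T) (comult T)" by (rule T_comult_linear')
  have tDD: "carrier (tensor k D D) = carrier (tensor k E E)"
    using same_module_tensor[OF D_same D_same, of k] by (simp add: same_module_def)
  note cc = T.dual_comult_closed T.dual_comult_pair
  show cl: "l \<otimes>\<^bsub>D\<^esub> l' \<in> carrier D" if "l \<in> carrier D" "l' \<in> carrier D" for l l'
    using that by (simp add: D_simps \<Psi> dual_T_mult_closed \<Phi>_closed)
  show "\<one>\<^bsub>D\<^esub> \<in> carrier D" by (simp add: D_simps \<Psi> dual_T_one_closed)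
  show "comult D l \<in> carrier (tensor k D D)" if "l \<in> carrier D" for l
    unfolding tDD D_simps
    using linear_map_closed[OF tmap_linear[OF T.L T.L E_mod E_mod \<Psi>_linear \<Psi>_linear] cc(1)[OF \<Phi>_closed]] that
    by (simp add: D_simps)
  show "dpair (l \<otimes>\<^bsub>D\<^esub> l') t = tlift k T T (kmod k) (\<lambda>a b. dpair l a \<otimes>\<^bsub>k\<^esub> dpair l' b) (comult T t)"
    if "l \<in> carrier D" "l' \<in> carrier D" "t \<in> carrier T" for l l' t
  proof -
    have "dpair (l \<otimes>\<^bsub>D\<^esub> l') t = ev t (\<Phi> l \<otimes>\<^bsub>T'\<^esub> \<Phi> l')"
      using that by (simp add: ev_\<Phi>[symmetric] D_simps \<Psi> dual_T_mult_closed \<Phi>_closed)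
    also have "\<dots> = tlift k T T (kmod k) (\<lambda>a b. ev a (\<Phi> l) \<otimes>\<^bsub>k\<^esub> ev b (\<Phi> l')) (comult T t)"
      using that by (simp add: dual_simps(6)) (simp add: ev_def)
    also have "\<dots> = tlift k T T (kmod k) (\<lambda>a b. dpair l a \<otimes>\<^bsub>k\<^esub> dpair l' b) (comult T t)"
      by (rule tlift_cong[OF T.K T.K]) (simp add: ev_\<Phi>)
    finally show ?thesis .
  qed
  show "dpair \<one>\<^bsub>D\<^esub> t = counit T t" if "t \<in> carrier T" for t
    using that by (simp add: ev_\<Phi>[symmetric] D_simps \<Psi> dual_T_one_closed) (simp add: dual_simps(3) ev_def)
  show "dpair l \<one>\<^bsub>T\<^esub> = counit D l" if "l \<in> carrier D" for l
    using that by (simp add: ev_\<Phi>[symmetric] D_simps dual_simps(8) one_closed[OF T_alg])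
  show "tlift k D D (kmod k) (\<lambda>a b. dpair a t \<otimes>\<^bsub>k\<^esub> dpair b s) (comult D l) = dpair l (t \<otimes>\<^bsub>T\<^esub> s)"
    if "l \<in> carrier D" "t \<in> carrier T" "s \<in> carrier T" for l t s
  proof -
    interpret ET: perfect_pairing k E T dpair dcopair by (rule E_T_pairing)
    have lE: "l \<in> carrier E" using that by (simp add: D_simps)
    have "tlift k D D (kmod k) (\<lambda>a b. dpair a t \<otimes>\<^bsub>k\<^esub> dpair b s) (comult D l) =
      tlift k E E (kmod k) (\<lambda>a b. dpair a t \<otimes>\<^bsub>k\<^esub> dpair b s) (tmap k T' T' E E \<Psi> \<Psi> (comult T' (\<Phi> l)))"
      by (simp add: D_simps tlift_same[OF D_same D_same])
    also have "\<dots> = tlift k T' T' (kmod k) (\<lambda>\<phi> \<psi>. dpair (\<Psi> \<phi>) t \<otimes>\<^bsub>k\<^esub> dpair (\<Psi> \<psi>) s) (comult T' (\<Phi> l))"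
      by (rule tlift_tmap[OF T.L T.L E_mod E_mod module_kmod[OF cring] _ \<Psi>_linear \<Psi>_linear cc(1)])
        (simp_all add: ET.rules that \<Phi>_closed lE)
    also have "\<dots> = T.pair2 t s (comult T' (\<Phi> l))"
      unfolding T.pair2_def
      by (rule tlift_cong[OF T.L T.L]) (simp add: ev_\<Phi>[symmetric] \<Psi> that)
    also have "\<dots> = dpair l (t \<otimes>\<^bsub>T\<^esub> s)"
      using that by (simp add: cc(2) \<Phi>_closed lE ev_\<Phi> mult_closed[OF T_alg])
    finally show ?thesis .
  qed
qed

text \<open>
  Majid's formula for the product of the double, from the coproduct to which it is dual.
\<close>

lemma D_mult_pure:
  assumes as: "\<omega> \<in> carrier K'" "h \<in> carrier H" "\<omega>' \<in> carrier K'" "h' \<in> carrier H"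
  shows "pure k K' H \<omega> h \<otimes>\<^bsub>D\<^esub> pure k K' H \<omega>' h' =
    sw E (\<lambda>p q. sw E (\<lambda>r s. pure k K' H (tr (S r) q \<omega>' \<otimes>\<^bsub>K'\<^esub> \<omega>) (s \<otimes>\<^bsub>H\<^esub> h')) p) h"
proof -
  interpret BP: bialgebra_pairing k D T dpair dcopair by (rule D_pairing_bialgebra)
  interpret ET0: perfect_pairing k E T0 dpair dcopair by (rule E_T0_pairing)
  let ?R = "sw E (\<lambda>p q. sw E (\<lambda>r s. pure k K' H (tr (S r) q \<omega>' \<otimes>\<^bsub>K'\<^esub> \<omega>) (s \<otimes>\<^bsub>H\<^esub> h')) p) h"
  have cl: "pure k K' H \<omega> h \<in> carrier D" "pure k K' H \<omega>' h' \<in> carrier D" by (simp_all add: D_simps pure_closed as)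
  have Rcl: "?R \<in> carrier E" by (simp add: pr as)
  show ?thesis
  proof (rule ET0.L_eqI)
    show "pure k K' H \<omega> h \<otimes>\<^bsub>D\<^esub> pure k K' H \<omega>' h' \<in> carrier E"
      using BP.mult_L[OF cl] by (simp add: D_simps(1))
    show "?R \<in> carrier E" by (rule Rcl)
    fix t assume t: "t \<in> carrier T0"
    have lt: "linear_map k E (kmod k) (\<lambda>d. dpair d t)" using ET0.lin_p_left[OF lin_id t] .
    have "dpair (pure k K' H \<omega> h \<otimes>\<^bsub>D\<^esub> pure k K' H \<omega>' h') t =
      tlift k T0 T0 (kmod k) (\<lambda>a b. dpair (pure k K' H \<omega> h) a \<otimes>\<^bsub>k\<^esub> dpair (pure k K' H \<omega>' h') b) (T_comult k H t)"
      using BP.p_mult[OF cl, of t] t tlift_same[OF T_same T_same, of k "kmod k"] by (simp add: T_carrier T_comult)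
    also have "\<dots> = pairT \<omega> h \<omega>' h' (T_comult k H t)"
      unfolding pairT_def by (rule tlift_cong[OF T0_mod T0_mod]) (simp add: dpair_pure as)
    also have "\<dots> = sw (kmod k) (\<lambda>p q. sw (kmod k) (\<lambda>r s. dpair (pure k K' H (tr (S r) q \<omega>' \<otimes>\<^bsub>K'\<^esub> \<omega>) (s \<otimes>\<^bsub>H\<^esub> h')) t) p) h"
      unfolding pairT_comult[OF as t] by (rule sw_cong, rule sw_cong) (simp add: dpair_pure pr as t)
    also have "\<dots> = sw (kmod k) (\<lambda>p q. dpair (sw E (\<lambda>r s. pure k K' H (tr (S r) q \<omega>' \<otimes>\<^bsub>K'\<^esub> \<omega>) (s \<otimes>\<^bsub>H\<^esub> h')) p) t) h"
      by (rule sw_cong, rule linear_sw[symmetric, OF E_mod _ lt]) (simp_all add: pr as)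
    also have "\<dots> = dpair ?R t"
      by (rule linear_sw[symmetric, OF E_mod _ lt]) (simp_all add: pr as)
    finally show "dpair (pure k K' H \<omega> h \<otimes>\<^bsub>D\<^esub> pure k K' H \<omega>' h') t = dpair ?R t" .
  qed
qed

end

context fd_hopf
begin

text \<open>
  The two dualities to which the correspondence between coactions and actions will be applied.
\<close>

sublocale HP: bialgebra_pairing k H K' "\<lambda>h \<theta>. ev h \<theta>" "tflip k H K' U"
  by (rule evaluation_pairing)

sublocale DP: bialgebra_pairing k D T dpair dcopair
  by (rule D_pairing_bialgebra)

section \<open>The Yetter-Drinfeld condition for operators\<close>

text \<open>
  The Yetter-Drinfeld condition for operators \<open>a\<^sub>\<omega>\<close> and \<open>b\<^sub>h\<close>; both conditions for coactions and
  actions will be reduced to it.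
\<close>

definition yd_op :: "('k, 'x, 'q) module_scheme \<Rightarrow> (('h \<Rightarrow> 'k) \<Rightarrow> 'x \<Rightarrow> 'x) \<Rightarrow> ('h \<Rightarrow> 'x \<Rightarrow> 'x) \<Rightarrow> 'x \<Rightarrow> bool"
  where "yd_op X a b x \<longleftrightarrow> (\<forall>h\<in>carrier H. \<forall>\<omega>\<in>carrier K'.
    sw X (\<lambda>p q. b q (a (tr p \<one>\<^bsub>H\<^esub> \<omega>) x)) h = sw X (\<lambda>p q. a (tr \<one>\<^bsub>H\<^esub> q \<omega>) (b p x)) h)"

text \<open>
  From left to right, apply the condition to \<open>h\<^sub>(\<^sub>2\<^sub>) \<otimes> h\<^sub>(\<^sub>3\<^sub>)\<close> and the form \<open>\<omega>(S(h\<^sub>(\<^sub>1\<^sub>)) _)\<close>; then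
  \<open>S(h\<^sub>(\<^sub>1\<^sub>)) h\<^sub>(\<^sub>2\<^sub>)\<close> cancels.  From right to left, apply the commutation rule to \<open>h\<^sub>(\<^sub>2\<^sub>)\<close> and the form
  \<open>\<omega>(h\<^sub>(\<^sub>1\<^sub>) _)\<close>; then \<open>h\<^sub>(\<^sub>1\<^sub>) S(h\<^sub>(\<^sub>2\<^sub>))\<close> cancels.  The commutation rule has the bracketing
  that comes out of the product of the double.
\<close>

lemma yd_op_iff:
  assumes X: "module k X" and a: "bilinear_map k K' X X a" and b: "bilinear_map k H X X b" and x: "x \<in> carrier X"
  shows "yd_op X a b x \<longleftrightarrow> (\<forall>h\<in>carrier H. \<forall>\<omega>\<in>carrier K'.
    b h (a \<omega> x) = sw X (\<lambda>p q. sw X (\<lambda>r s. a (tr (S r) q \<omega>) (b s x)) p) h)"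
    (is "_ \<longleftrightarrow> (\<forall>h\<in>_. \<forall>\<omega>\<in>_. b h (a \<omega> x) = ?R h \<omega>)")
proof -
  note acl = bilinear_map_closed[OF a] and bcl = bilinear_map_closed[OF b]
  note rl = pr X x acl bcl lin_comp[OF bilinear_map_left[OF a]] lin_comp[OF bilinear_map_right[OF a]]
    lin_comp[OF bilinear_map_left[OF b]] lin_comp[OF bilinear_map_right[OF b]]
    lin_app[OF bilinear_map_left[OF a]] lin_app[OF bilinear_map_right[OF a]]
    lin_app[OF bilinear_map_left[OF b]] lin_app[OF bilinear_map_right[OF b]]
  have R: "?R h \<omega> = sw X (\<lambda>p q. sw X (\<lambda>r s. a (tr (S p) s \<omega>) (b r x)) q) h"
    if "h \<in> carrier H" "\<omega> \<in> carrier K'" for h \<omega>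
    by (rule coassoc[where F = "\<lambda>p r s. a (tr (S p) s \<omega>) (b r x)"]) (simp_all add: rl that)
  show ?thesis
  proof (intro iffI ballI)
    fix h \<omega> assume Y: "yd_op X a b x" and h: "h \<in> carrier H" and \<omega>: "\<omega> \<in> carrier K'"
    have "?R h \<omega> = sw X (\<lambda>p q. sw X (\<lambda>r s. b s (a (tr (S p \<otimes>\<^bsub>H\<^esub> r) \<one>\<^bsub>H\<^esub> \<omega>) x)) q) h"
      unfolding R[OF h \<omega>]
    proof (rule sw_cong)
      fix p q assume pq: "p \<in> carrier H" "q \<in> carrier H"
      have "sw X (\<lambda>r s. a (tr (S p) s \<omega>) (b r x)) q = sw X (\<lambda>r s. a (tr \<one>\<^bsub>H\<^esub> s (tr (S p) \<one>\<^bsub>H\<^esub> \<omega>)) (b r x)) q"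
        by (rule sw_cong) (simp add: tr_tr rl pq \<omega> H_one)
      also have "\<dots> = sw X (\<lambda>r s. b s (a (tr r \<one>\<^bsub>H\<^esub> (tr (S p) \<one>\<^bsub>H\<^esub> \<omega>)) x)) q"
        using Y pq \<omega> by (simp add: yd_op_def tr_closed S_H one_closed[OF alg])
      also have "\<dots> = sw X (\<lambda>r s. b s (a (tr (S p \<otimes>\<^bsub>H\<^esub> r) \<one>\<^bsub>H\<^esub> \<omega>) x)) q"
        by (rule sw_cong) (simp add: tr_tr rl pq \<omega> H_one)
      finally show "sw X (\<lambda>r s. a (tr (S p) s \<omega>) (b r x)) q = sw X (\<lambda>r s. b s (a (tr (S p \<otimes>\<^bsub>H\<^esub> r) \<one>\<^bsub>H\<^esub> \<omega>) x)) q" .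
    qed
    also have "\<dots> = sw X (\<lambda>p q. sw X (\<lambda>r s. b q (a (tr (S r \<otimes>\<^bsub>H\<^esub> s) \<one>\<^bsub>H\<^esub> \<omega>) x)) p) h"
      by (rule coassoc[symmetric, where F = "\<lambda>p r s. b s (a (tr (S p \<otimes>\<^bsub>H\<^esub> r) \<one>\<^bsub>H\<^esub> \<omega>) x)"]) (simp_all add: rl h \<omega>)
    also have "\<dots> = sw X (\<lambda>p q. counit H p \<odot>\<^bsub>X\<^esub> b q (a \<omega> x)) h"
    proof (rule sw_cong)
      fix p q assume pq: "p \<in> carrier H" "q \<in> carrier H"
      show "sw X (\<lambda>r s. b q (a (tr (S r \<otimes>\<^bsub>H\<^esub> s) \<one>\<^bsub>H\<^esub> \<omega>) x)) p = counit H p \<odot>\<^bsub>X\<^esub> b q (a \<omega> x)"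
        using sw_antipode_left[OF X, of "\<lambda>u. b q (a (tr u \<one>\<^bsub>H\<^esub> \<omega>) x)" p] pq \<omega> by (simp add: rl tr_one)
    qed
    also have "\<dots> = b h (a \<omega> x)"
      by (rule sw_counit_left) (simp_all add: rl h \<omega>)
    finally show "b h (a \<omega> x) = ?R h \<omega>" ..
  next
    assume *: "\<forall>h\<in>carrier H. \<forall>\<omega>\<in>carrier K'. b h (a \<omega> x) = ?R h \<omega>"
    then have Y2: "b h (a \<omega> x) = sw X (\<lambda>p q. sw X (\<lambda>r s. a (tr (S p) s \<omega>) (b r x)) q) h"
      if "h \<in> carrier H" "\<omega> \<in> carrier K'" for h \<omega> using R that by simp
    show "yd_op X a b x" unfolding yd_op_def
    proof (intro ballI)
      fix h \<omega> assume h: "h \<in> carrier H" and \<omega>: "\<omega> \<in> carrier K'"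
      \<comment> \<open>For fixed \<open>t\<close>, this is linear in \<open>z\<close>, and the antipode axiom is applied to it.\<close>
      let ?G = "\<lambda>z t. sw X (\<lambda>u v. a (tr z v \<omega>) (b u x)) t"
      have "sw X (\<lambda>p q. b q (a (tr p \<one>\<^bsub>H\<^esub> \<omega>) x)) h = sw X (\<lambda>p q. sw X (\<lambda>r s. ?G (p \<otimes>\<^bsub>H\<^esub> S r) s) q) h"
      proof (rule sw_cong)
        fix p q assume pq: "p \<in> carrier H" "q \<in> carrier H"
        show "b q (a (tr p \<one>\<^bsub>H\<^esub> \<omega>) x) = sw X (\<lambda>r s. ?G (p \<otimes>\<^bsub>H\<^esub> S r) s) q"
          using pq \<omega> by (simp add: Y2 tr_closed one_closed[OF alg])
            (rule sw_cong, rule sw_cong, simp add: tr_tr rl H_one)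
      qed
      also have "\<dots> = sw X (\<lambda>p q. sw X (\<lambda>r s. ?G (r \<otimes>\<^bsub>H\<^esub> S s) q) p) h"
        by (rule coassoc[symmetric, where F = "\<lambda>p r s. ?G (p \<otimes>\<^bsub>H\<^esub> S r) s"]) (simp_all add: rl h \<omega>)
      also have "\<dots> = sw X (\<lambda>p q. counit H p \<odot>\<^bsub>X\<^esub> ?G \<one>\<^bsub>H\<^esub> q) h"
      proof (rule sw_cong)
        fix p q assume pq: "p \<in> carrier H" "q \<in> carrier H"
        show "sw X (\<lambda>r s. ?G (r \<otimes>\<^bsub>H\<^esub> S s) q) p = counit H p \<odot>\<^bsub>X\<^esub> ?G \<one>\<^bsub>H\<^esub> q"
          by (rule sw_antipode_right) (simp_all add: rl pq \<omega>)
      qed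
      also have "\<dots> = ?G \<one>\<^bsub>H\<^esub> h"
        by (rule sw_counit_left) (simp_all add: rl h \<omega>)
      finally show "sw X (\<lambda>p q. b q (a (tr p \<one>\<^bsub>H\<^esub> \<omega>) x)) h = sw X (\<lambda>p q. a (tr \<one>\<^bsub>H\<^esub> q \<omega>) (b p x)) h" .
    qed
  qed
qed

lemma yd_op_cong:
  assumes "bilinear_map k K' X X a" "bilinear_map k H X X b" "x \<in> carrier X"
    "\<And>h x. h \<in> carrier H \<Longrightarrow> x \<in> carrier X \<Longrightarrow> b' h x = b h x"
  shows "yd_op X a b' x \<longleftrightarrow> yd_op X a b x"
proof -
  have "sw X (\<lambda>p q. b' q (a (tr p \<one>\<^bsub>H\<^esub> \<omega>) x)) h = sw X (\<lambda>p q. b q (a (tr p \<one>\<^bsub>H\<^esub> \<omega>) x)) h"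
    "sw X (\<lambda>p q. a (tr \<one>\<^bsub>H\<^esub> q \<omega>) (b' p x)) h = sw X (\<lambda>p q. a (tr \<one>\<^bsub>H\<^esub> q \<omega>) (b p x)) h"
    if "\<omega> \<in> carrier K'" for \<omega> h
    by (rule sw_cong; simp add: assms bilinear_map_closed[OF assms(1)] tr_closed that one_closed[OF alg])+
  then show ?thesis by (simp add: yd_op_def)
qed

text \<open>
  The operators \<open>a\<^sub>\<omega>\<close> of a left coaction of \<open>H\<close> and \<open>b\<^sub>h\<close> of a right coaction of its dual.
\<close>

definition lact :: "('k, 'x, 'q) module_scheme \<Rightarrow> ('x \<Rightarrow> ('h, 'x) tensor) \<Rightarrow> ('h \<Rightarrow> 'k) \<Rightarrow> 'x \<Rightarrow> 'x"
  where "lact X \<alpha> \<omega> x = ls k H X (\<lambda>g. ev g \<omega>) (\<alpha> x)"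

definition ract :: "('k, 'x, 'q) module_scheme \<Rightarrow> ('x \<Rightarrow> ('x, 'h \<Rightarrow> 'k) tensor) \<Rightarrow> 'h \<Rightarrow> 'x \<Rightarrow> 'x"
  where "ract X \<beta> h x = rs k X K' (\<lambda>\<theta>. ev h \<theta>) (\<beta> x)"

lemma lact_bilinear:
  assumes "module k X" "linear_map k X (tensor k H X) \<alpha>"
  shows "bilinear_map k K' X X (lact X \<alpha>)"
  unfolding lact_def[abs_def] using assms by (simp add: pr lin_comp[OF assms(2)] linear_map_closed[OF assms(2)])

lemma ract_bilinear:
  assumes "module k X" "linear_map k X (tensor k X K') \<beta>"
  shows "bilinear_map k H X X (ract X \<beta>)"
  unfolding ract_def[abs_def] using assms by (simp add: pr lin_comp[OF assms(2)] linear_map_closed[OF assms(2)])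

section \<open>Left Yetter-Drinfeld modules\<close>

text \<open>
  Slicing the first leg by \<open>\<omega>\<close> turns multiplication by \<open>h\<^sub>(\<^sub>1\<^sub>)\<close> from the left or by \<open>h\<^sub>(\<^sub>2\<^sub>)\<close> from the right
  into a translation of \<open>\<omega>\<close>.
\<close>

lemma yd_condition_iff:
  assumes X: "module k X" and act: "bilinear_map k H X X act" and \<alpha>: "linear_map k X (tensor k H X) \<alpha>"
  shows "yd_condition k H X act \<alpha> \<longleftrightarrow> (\<forall>x\<in>carrier X. yd_op X (lact X \<alpha>) act x)"
proof -
  note acl = bilinear_map_closed[OF act]
  note rl = pr X acl lin_comp[OF bilinear_map_left[OF act]] lin_comp[OF bilinear_map_right[OF act]]
    lin_app[OF bilinear_map_left[OF act]] lin_app[OF bilinear_map_right[OF act]]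
    lin_comp[OF \<alpha>] lin_app[OF \<alpha>] linear_map_closed[OF \<alpha>]
  let ?HX = "tensor k H X"
  let ?A = "\<lambda>h x. sw ?HX (\<lambda>p q. tmap k H X H X (\<lambda>z. p \<otimes>\<^bsub>H\<^esub> z) (act q) (\<alpha> x)) h"
  let ?B = "\<lambda>h x. sw ?HX (\<lambda>p q. tmap k H X H X (\<lambda>z. z \<otimes>\<^bsub>H\<^esub> q) (\<lambda>y. y) (\<alpha> (act p x))) h"
  have bA: "bilinear_map k H H ?HX (\<lambda>p q. tmap k H X H X (\<lambda>z. p \<otimes>\<^bsub>H\<^esub> z) (act q) (\<alpha> x))"
    and bB: "bilinear_map k H H ?HX (\<lambda>p q. tmap k H X H X (\<lambda>z. z \<otimes>\<^bsub>H\<^esub> q) (\<lambda>y. y) (\<alpha> (act p x)))"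
    if "x \<in> carrier X" for x
    unfolding tmap_def by (simp_all add: rl that)
  have lsl: "linear_map k ?HX X (ls k H X (\<lambda>g. ev g \<omega>))" if "\<omega> \<in> carrier K'" for \<omega>
    using ls_linear[OF X K dual_linear[OF that]] .
  have A: "ls k H X (\<lambda>g. ev g \<omega>) (?A h x) = sw X (\<lambda>p q. act q (lact X \<alpha> (tr p \<one>\<^bsub>H\<^esub> \<omega>) x)) h"
    if h: "h \<in> carrier H" and x: "x \<in> carrier X" and \<omega>: "\<omega> \<in> carrier K'" for h x \<omega>
  proof -
    have "ls k H X (\<lambda>g. ev g \<omega>) (?A h x) = sw X (\<lambda>p q. ls k H X (\<lambda>g. ev g \<omega>) (tmap k H X H X (\<lambda>z. p \<otimes>\<^bsub>H\<^esub> z) (act q) (\<alpha> x))) h"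
      by (rule linear_sw[OF module_tensor[OF K X] X lsl[OF \<omega>] bA[OF x] h])
    also have "\<dots> = sw X (\<lambda>p q. act q (lact X \<alpha> (tr p \<one>\<^bsub>H\<^esub> \<omega>) x)) h"
    proof (rule sw_cong)
      fix p q assume pq: "p \<in> carrier H" "q \<in> carrier H"
      have "ls k H X (\<lambda>g. ev g \<omega>) (tmap k H X H X (\<lambda>z. p \<otimes>\<^bsub>H\<^esub> z) (act q) y) = act q (ls k H X (\<lambda>g. ev g (tr p \<one>\<^bsub>H\<^esub> \<omega>)) y)"
        if y: "y \<in> carrier ?HX" for y
        by (rule tensor_ext[OF K X X _ _ _ y])
          (simp_all add: rl pq \<omega> tmap_pure ls_pure ev_tr H_one linear_map_smult[OF bilinear_map_right[OF act]])
      then show "ls k H X (\<lambda>g. ev g \<omega>) (tmap k H X H X (\<lambda>z. p \<otimes>\<^bsub>H\<^esub> z) (act q) (\<alpha> x)) = act q (lact X \<alpha> (tr p \<one>\<^bsub>H\<^esub> \<omega>) x)"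
        using x by (simp add: lact_def rl)
    qed
    finally show ?thesis .
  qed
  have B: "ls k H X (\<lambda>g. ev g \<omega>) (?B h x) = sw X (\<lambda>p q. lact X \<alpha> (tr \<one>\<^bsub>H\<^esub> q \<omega>) (act p x)) h"
    if h: "h \<in> carrier H" and x: "x \<in> carrier X" and \<omega>: "\<omega> \<in> carrier K'" for h x \<omega>
  proof -
    have "ls k H X (\<lambda>g. ev g \<omega>) (?B h x) = sw X (\<lambda>p q. ls k H X (\<lambda>g. ev g \<omega>) (tmap k H X H X (\<lambda>z. z \<otimes>\<^bsub>H\<^esub> q) (\<lambda>y. y) (\<alpha> (act p x)))) h"
      by (rule linear_sw[OF module_tensor[OF K X] X lsl[OF \<omega>] bB[OF x] h])
    also have "\<dots> = sw X (\<lambda>p q. lact X \<alpha> (tr \<one>\<^bsub>H\<^esub> q \<omega>) (act p x)) h"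
    proof (rule sw_cong)
      fix p q assume pq: "p \<in> carrier H" "q \<in> carrier H"
      have "ls k H X (\<lambda>g. ev g \<omega>) (tmap k H X H X (\<lambda>z. z \<otimes>\<^bsub>H\<^esub> q) (\<lambda>y. y) y) = ls k H X (\<lambda>g. ev g (tr \<one>\<^bsub>H\<^esub> q \<omega>)) y"
        if y: "y \<in> carrier ?HX" for y
        by (rule tensor_ext[OF K X X _ _ _ y])
          (simp_all add: rl pq \<omega> tmap_pure ls_pure ev_tr H_one)
      then show "ls k H X (\<lambda>g. ev g \<omega>) (tmap k H X H X (\<lambda>z. z \<otimes>\<^bsub>H\<^esub> q) (\<lambda>y. y) (\<alpha> (act p x))) = lact X \<alpha> (tr \<one>\<^bsub>H\<^esub> q \<omega>) (act p x)"
        using x pq by (simp add: lact_def rl)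
    qed
    finally show ?thesis .
  qed
  have eq: "?A h x = ?B h x \<longleftrightarrow> (\<forall>\<omega>\<in>carrier K'. ls k H X (\<lambda>g. ev g \<omega>) (?A h x) = ls k H X (\<lambda>g. ev g \<omega>) (?B h x))"
    if h: "h \<in> carrier H" and x: "x \<in> carrier X" for h x
    using ls_eqI[OF X sw_closed[OF module_tensor[OF K X] bA[OF x] h] sw_closed[OF module_tensor[OF K X] bB[OF x] h]]
    by (metis (no_types, lifting))
  have "yd_condition k H X act \<alpha> \<longleftrightarrow> (\<forall>h\<in>carrier H. \<forall>x\<in>carrier X. ?A h x = ?B h x)"
    by (simp add: yd_condition_def sw_def)
  also have "\<dots> \<longleftrightarrow> (\<forall>x\<in>carrier X. yd_op X (lact X \<alpha>) act x)"
    using A B eq by (simp add: yd_op_def) blast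
  finally show ?thesis .
qed

section \<open>Left-right Yetter-Drinfeld modules\<close>

text \<open>
  The slice \<open>\<omega> \<otimes> id \<otimes> h\<close> of an element of \<open>H \<otimes> (X \<otimes> K')\<close>.
\<close>

definition triple :: "('k, 'x, 'q) module_scheme \<Rightarrow> ('h \<Rightarrow> 'k) \<Rightarrow> 'h \<Rightarrow> ('h, ('x, 'h \<Rightarrow> 'k) tensor) tensor \<Rightarrow> 'x"
  where "triple X \<omega> h z = rs k X K' (\<lambda>\<theta>. ev h \<theta>) (ls k H (tensor k X K') (\<lambda>g. ev g \<omega>) z)"

context
  fixes X :: "('k, 'x, 'q) module_scheme"
  assumes Xa: "k_algebra k X"
begin

lemma X_mod: "module k X"
  using Xa by (rule k_algebra_module)

abbreviation "XK \<equiv> tensor k X K'"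
abbreviation "HXK \<equiv> tensor k H XK"

lemma XK_alg: "k_algebra k XK" and HXK_alg: "k_algebra k HXK"
  by (simp_all add: k_algebra_tensor Xa alg dual_alg)

lemmas xr = pr X_mod Xa XK_alg HXK_alg smult_closed[OF X_mod] mult_closed[OF Xa] one_closed[OF Xa] one_closed[OF XK_alg]
  mult_closed[OF XK_alg] mult_closed[OF HXK_alg]

lemma triple_linear: "\<omega> \<in> carrier K' \<Longrightarrow> h \<in> carrier H \<Longrightarrow> linear_map k W2 HXK f \<Longrightarrow> linear_map k W2 X (\<lambda>u. triple X \<omega> h (f u))"
  by (simp add: triple_def xr)

lemma triple_linear1: "module k W2 \<Longrightarrow> linear_map k W2 K' f \<Longrightarrow> h \<in> carrier H \<Longrightarrow> z \<in> carrier HXK \<Longrightarrow> linear_map k W2 X (\<lambda>u. triple X (f u) h z)"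
  using linear_map_closed[of k W2 K' f] by (simp add: triple_def xr)

lemma triple_linear2: "module k W2 \<Longrightarrow> linear_map k W2 H f \<Longrightarrow> \<omega> \<in> carrier K' \<Longrightarrow> z \<in> carrier HXK \<Longrightarrow> linear_map k W2 X (\<lambda>u. triple X \<omega> (f u) z)"
  using linear_map_closed[of k W2 H f] by (simp add: triple_def xr)

lemma triple_pure: "\<omega> \<in> carrier K' \<Longrightarrow> h \<in> carrier H \<Longrightarrow> g \<in> carrier H \<Longrightarrow> x \<in> carrier X \<Longrightarrow> \<theta> \<in> carrier K' \<Longrightarrow>
  triple X \<omega> h (pure k H XK g (pure k X K' x \<theta>)) = (ev g \<omega> \<otimes>\<^bsub>k\<^esub> ev h \<theta>) \<odot>\<^bsub>X\<^esub> x"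
  by (simp add: triple_def xr ls_pure rs_pure linear_map_smult[OF rs_linear] smult_smult[OF X_mod])

lemma triple_eqI:
  assumes "z \<in> carrier HXK" "z' \<in> carrier HXK" "\<And>\<omega> h. \<omega> \<in> carrier K' \<Longrightarrow> h \<in> carrier H \<Longrightarrow> triple X \<omega> h z = triple X \<omega> h z'"
  shows "z = z'"
  by (rule ls_eqI[of XK], (use assms in \<open>simp add: xr\<close>)+, rule HP.rs_eqI[OF X_mod])
    (use assms in \<open>simp_all add: xr triple_def\<close>)

text \<open>
  The map \<open>g \<otimes> \<theta> \<mapsto> g \<otimes> x \<otimes> \<theta>\<close>.  It sends \<open>U\<close> to \<open>U\<^sub>1\<^sub>3\<close> if \<open>x\<close> is the unit.
\<close>

definition ins :: "'x \<Rightarrow> ('h, 'h \<Rightarrow> 'k) tensor \<Rightarrow> ('h, ('x, 'h \<Rightarrow> 'k) tensor) tensor"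
  where "ins x = tlift k H K' HXK (\<lambda>h \<theta>. pure k H XK h (pure k X K' x \<theta>))"

lemma ins_linear: "x \<in> carrier X \<Longrightarrow> linear_map k T0 HXK (ins x)"
  unfolding ins_def by (rule tlift_linear) (simp_all add: xr)

lemma ins_pure: "x \<in> carrier X \<Longrightarrow> h \<in> carrier H \<Longrightarrow> \<theta> \<in> carrier K' \<Longrightarrow>
  ins x (pure k H K' h \<theta>) = pure k H XK h (pure k X K' x \<theta>)"
  unfolding ins_def by (rule tlift_pure) (simp_all add: xr)

lemma triple_ins:
  assumes "\<omega> \<in> carrier K'" "h \<in> carrier H" "x \<in> carrier X" and t: "t \<in> carrier T0"
  shows "triple X \<omega> h (ins x t) = hpair \<omega> h t \<odot>\<^bsub>X\<^esub> x"
  by (rule tensor_ext[OF K L X_mod triple_linear[OF assms(1,2) ins_linear[OF assms(3)]] _ _ t])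
    (use assms in \<open>simp_all add: xr ins_pure triple_pure hpair_pure\<close>)

lemma X_ring: "x \<in> carrier X \<Longrightarrow> \<one>\<^bsub>X\<^esub> \<otimes>\<^bsub>X\<^esub> x = x" "x \<in> carrier X \<Longrightarrow> x \<otimes>\<^bsub>X\<^esub> \<one>\<^bsub>X\<^esub> = x"
proof -
  interpret X: ring X using Xa by (rule k_algebra_ring)
  show "x \<in> carrier X \<Longrightarrow> \<one>\<^bsub>X\<^esub> \<otimes>\<^bsub>X\<^esub> x = x" "x \<in> carrier X \<Longrightarrow> x \<otimes>\<^bsub>X\<^esub> \<one>\<^bsub>X\<^esub> = x" by simp_all
qed

lemma ins_mult:
  assumes s: "s \<in> carrier T0" and t: "t \<in> carrier T0" and x: "x \<in> carrier X"
  shows "ins \<one>\<^bsub>X\<^esub> s \<otimes>\<^bsub>HXK\<^esub> ins x t = ins x (s \<otimes>\<^bsub>T0\<^esub> t)" and "ins x s \<otimes>\<^bsub>HXK\<^esub> ins \<one>\<^bsub>X\<^esub> t = ins x (s \<otimes>\<^bsub>T0\<^esub> t)"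
proof -
  note I = ins_linear[OF x] ins_linear[OF one_closed[OF Xa]]
  note r = xr x I lin_comp[OF I(1)] lin_comp[OF I(2)] linear_map_closed[OF I(1)] linear_map_closed[OF I(2)]
  have 1: "ins \<one>\<^bsub>X\<^esub> (pure k H K' g \<phi>) \<otimes>\<^bsub>HXK\<^esub> ins x t = ins x (pure k H K' g \<phi> \<otimes>\<^bsub>T0\<^esub> t)"
    "ins x (pure k H K' g \<phi>) \<otimes>\<^bsub>HXK\<^esub> ins \<one>\<^bsub>X\<^esub> t = ins x (pure k H K' g \<phi> \<otimes>\<^bsub>T0\<^esub> t)"
    if "g \<in> carrier H" "\<phi> \<in> carrier K'" for g \<phi>
    by (rule tensor_ext[OF K L k_algebra_module[OF HXK_alg] _ _ _ t]; simp add: r that ins_pure tensor_mult_pure X_ring)+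
  show "ins \<one>\<^bsub>X\<^esub> s \<otimes>\<^bsub>HXK\<^esub> ins x t = ins x (s \<otimes>\<^bsub>T0\<^esub> t)" "ins x s \<otimes>\<^bsub>HXK\<^esub> ins \<one>\<^bsub>X\<^esub> t = ins x (s \<otimes>\<^bsub>T0\<^esub> t)"
    by (rule tensor_ext[OF K L k_algebra_module[OF HXK_alg] _ _ _ s]; simp add: r t 1)+
qed

abbreviation "emb \<equiv> ins \<one>\<^bsub>X\<^esub>"

lemma emb_U_inv: "emb U \<in> carrier HXK" "inv\<^bsub>HXK\<^esub> (emb U) = emb W" "emb W \<in> carrier HXK"
  "emb W \<otimes>\<^bsub>HXK\<^esub> emb U = \<one>\<^bsub>HXK\<^esub>" "emb U \<otimes>\<^bsub>HXK\<^esub> emb W = \<one>\<^bsub>HXK\<^esub>"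
proof -
  interpret A: ring HXK using HXK_alg by (rule k_algebra_ring)
  note o = one_closed[OF Xa]
  note cl = linear_map_closed[OF ins_linear[OF o] C] linear_map_closed[OF ins_linear[OF o] W_closed]
  have "emb \<one>\<^bsub>T0\<^esub> = \<one>\<^bsub>HXK\<^esub>" by (simp add: tensor_one ins_pure xr)
  then have 1: "emb W \<otimes>\<^bsub>HXK\<^esub> emb U = \<one>\<^bsub>HXK\<^esub>" "emb U \<otimes>\<^bsub>HXK\<^esub> emb W = \<one>\<^bsub>HXK\<^esub>"
    by (simp_all add: ins_mult C W_closed o U_W W_U)
  show "emb U \<in> carrier HXK" "inv\<^bsub>HXK\<^esub> (emb U) = emb W" "emb W \<in> carrier HXK"
    "emb W \<otimes>\<^bsub>HXK\<^esub> emb U = \<one>\<^bsub>HXK\<^esub>" "emb U \<otimes>\<^bsub>HXK\<^esub> emb W = \<one>\<^bsub>HXK\<^esub>"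
    using cl 1 A.inv_char[OF cl 1(2,1)] by simp_all
qed

text \<open>
  Since \<open>U\<^sub>1\<^sub>3\<close> is invertible, the inverse in the conjugation can be moved to the other side.
\<close>

lemma Ad_emb_U_iff:
  assumes l: "l \<in> carrier HXK" and r: "r \<in> carrier HXK"
  shows "l = Ad HXK (emb U) r \<longleftrightarrow> l \<otimes>\<^bsub>HXK\<^esub> emb U = emb U \<otimes>\<^bsub>HXK\<^esub> r"
proof -
  interpret A: ring HXK using HXK_alg by (rule k_algebra_ring)
  note e = emb_U_inv
  show ?thesis
  proof
    assume "l = Ad HXK (emb U) r"
    then show "l \<otimes>\<^bsub>HXK\<^esub> emb U = emb U \<otimes>\<^bsub>HXK\<^esub> r"
      using e l r by (simp add: Ad_def A.m_assoc)
  next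
    assume "l \<otimes>\<^bsub>HXK\<^esub> emb U = emb U \<otimes>\<^bsub>HXK\<^esub> r"
    then have "Ad HXK (emb U) r = l \<otimes>\<^bsub>HXK\<^esub> emb U \<otimes>\<^bsub>HXK\<^esub> emb W" by (simp add: Ad_def e(2))
    then show "l = Ad HXK (emb U) r" using e l by (simp add: A.m_assoc)
  qed
qed

lemmas trr = xr triple_linear triple_linear1 triple_linear2 emb_U_inv(1)

text \<open>
  Elements of the form \<open>g \<otimes> x \<otimes> \<theta>\<close> come from \<open>H \<otimes> K'\<close>, where products with \<open>U\<close> have been evaluated.
\<close>

lemma triple_emb_U:
  assumes \<omega>: "\<omega> \<in> carrier K'" and h: "h \<in> carrier H" and z: "z \<in> carrier HXK"
  shows "triple X \<omega> h (emb U \<otimes>\<^bsub>HXK\<^esub> z) = sw X (\<lambda>a b. triple X (tr a \<one>\<^bsub>H\<^esub> \<omega>) b z) h" (is "?l z = ?l' z")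
    and "triple X \<omega> h (z \<otimes>\<^bsub>HXK\<^esub> emb U) = sw X (\<lambda>a b. triple X (tr \<one>\<^bsub>H\<^esub> b \<omega>) a z) h" (is "?r z = ?r' z")
proof -
  have *: "?l (ins x t) = ?l' (ins x t)" "?r (ins x t) = ?r' (ins x t)"
    if x: "x \<in> carrier X" and t: "t \<in> carrier T0" for x t
  proof -
    have m: "M \<odot>\<^bsub>X\<^esub> x = sw X (\<lambda>a b. F a b \<odot>\<^bsub>X\<^esub> x) h"
      if "M = sw (kmod k) F h" "bilinear_map k H H (kmod k) F" for F M
      unfolding that(1) by (rule linear_sw[OF module_kmod[OF cring] X_mod _ that(2) h]) (simp add: xr x)
    have "?l (ins x t) = sw X (\<lambda>a b. hpair (tr a \<one>\<^bsub>H\<^esub> \<omega>) b t \<odot>\<^bsub>X\<^esub> x) h"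
      using m[OF hpair_twist_left[OF lin_id \<omega> h t]] by (simp add: ins_mult triple_ins twist_id xr x t \<omega> h)
    also have "\<dots> = ?l' (ins x t)" by (rule sw_cong) (simp add: triple_ins xr x t \<omega>)
    finally show "?l (ins x t) = ?l' (ins x t)" .
    have "?r (ins x t) = sw X (\<lambda>a b. hpair (tr \<one>\<^bsub>H\<^esub> b \<omega>) a t \<odot>\<^bsub>X\<^esub> x) h"
      using m[OF hpair_twist_right[OF lin_id \<omega> h t]] by (simp add: ins_mult triple_ins twist_id xr x t \<omega> h)
    also have "\<dots> = ?r' (ins x t)" by (rule sw_cong) (simp add: triple_ins xr x t \<omega>)
    finally show "?r (ins x t) = ?r' (ins x t)" .
  qed
  show "?l z = ?l' z" "?r z = ?r' z"
    by (rule tensor_ext_right[OF K X_mod L X_mod _ _ _ z];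
      simp add: trr h \<omega> *[OF _ pure_closed, unfolded ins_pure] ins_pure[symmetric] *)+
qed

text \<open>
  In the form \<open>(\<alpha> \<otimes> id)\<beta>(x) U\<^sub>1\<^sub>3 = U\<^sub>1\<^sub>3 (id \<otimes> \<beta>)\<alpha>(x)\<close>, the slice of the condition at \<open>\<omega> \<otimes> h\<close> is the
  condition for operators.
\<close>

lemma yd_lr_condition_iff:
  assumes \<alpha>: "linear_map k X (tensor k H X) \<alpha>" and \<beta>: "linear_map k X (tensor k X K') \<beta>"
  shows "yd_lr_condition k H X \<alpha> \<beta> \<longleftrightarrow> (\<forall>x\<in>carrier X. yd_op X (lact X \<alpha>) (ract X \<beta>) x)"
proof -
  note rl = trr lin_comp[OF \<alpha>] lin_app[OF \<alpha>] linear_map_closed[OF \<alpha>] lin_comp[OF \<beta>] lin_app[OF \<beta>] linear_map_closed[OF \<beta>]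
    linear_map_closed[OF tassoc_linear] linear_map_closed[OF tmap_linear] lin_app[OF rs_linear] lin_comp[OF rs_linear]
  let ?l = "\<lambda>x. tassoc k H X K' (tmap k X K' (tensor k H X) K' \<alpha> (\<lambda>y. y) (\<beta> x))"
  let ?r = "\<lambda>x. tmap k H X H XK (\<lambda>y. y) \<beta> (\<alpha> x)"
  have cl: "?l x \<in> carrier HXK" "?r x \<in> carrier HXK" if "x \<in> carrier X" for x
    using that by (simp_all add: rl)
  have l: "triple X \<omega> h (?l x) = lact X \<alpha> \<omega> (ract X \<beta> h x)"
    if \<omega>: "\<omega> \<in> carrier K'" and h: "h \<in> carrier H" and x: "x \<in> carrier X" for \<omega> h x
  proof -
    have "triple X \<omega> h (tassoc k H X K' (tmap k X K' (tensor k H X) K' \<alpha> (\<lambda>y. y) z)) = ls k H X (\<lambda>g. ev g \<omega>) (\<alpha> (rs k X K' (\<lambda>\<theta>. ev h \<theta>) z))"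
      if z: "z \<in> carrier XK" for z
    proof (rule tensor_ext[OF X_mod L X_mod _ _ _ z])
      fix y \<theta> assume y: "y \<in> carrier X" and \<theta>: "\<theta> \<in> carrier K'"
      have "triple X \<omega> h (tassoc k H X K' (pure k (tensor k H X) K' u \<theta>)) = ev h \<theta> \<odot>\<^bsub>X\<^esub> ls k H X (\<lambda>g. ev g \<omega>) u"
        if u: "u \<in> carrier (tensor k H X)" for u
        by (rule tensor_ext[OF K X_mod X_mod _ _ _ u])
          (simp_all add: rl \<omega> h \<theta> tassoc_pure triple_pure ls_pure smult_smult[OF X_mod] kmult_comm)
      then show "triple X \<omega> h (tassoc k H X K' (tmap k X K' (tensor k H X) K' \<alpha> (\<lambda>y. y) (pure k X K' y \<theta>))) =
         ls k H X (\<lambda>g. ev g \<omega>) (\<alpha> (rs k X K' (\<lambda>\<theta>. ev h \<theta>) (pure k X K' y \<theta>)))"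
        using y \<theta> \<omega> h by (simp add: rl \<alpha> tmap_pure rs_pure linear_map_smult[OF \<alpha>] linear_map_smult[OF ls_linear])
    qed (simp_all add: rl \<alpha> \<omega> h)
    then show ?thesis using x by (simp add: lact_def ract_def rl)
  qed
  have r: "triple X \<omega> h (?r x) = ract X \<beta> h (lact X \<alpha> \<omega> x)"
    if \<omega>: "\<omega> \<in> carrier K'" and h: "h \<in> carrier H" and x: "x \<in> carrier X" for \<omega> h x
  proof -
    have "triple X \<omega> h (tmap k H X H XK (\<lambda>y. y) \<beta> z) = rs k X K' (\<lambda>\<theta>. ev h \<theta>) (\<beta> (ls k H X (\<lambda>g. ev g \<omega>) z))"
      if z: "z \<in> carrier (tensor k H X)" for z
      by (rule tensor_ext[OF K X_mod X_mod _ _ _ z])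
        (simp_all add: rl \<beta> \<omega> h tmap_pure ls_pure triple_def linear_map_smult[OF \<beta>] linear_map_smult[OF rs_linear])
    then show ?thesis using x by (simp add: lact_def ract_def rl)
  qed
  have "yd_lr_condition k H X \<alpha> \<beta> \<longleftrightarrow> (\<forall>x\<in>carrier X. ?l x = Ad HXK (emb U) (?r x))"
    by (simp add: yd_lr_condition_def Let_def ins_def)
  also have "\<dots> \<longleftrightarrow> (\<forall>x\<in>carrier X. ?l x \<otimes>\<^bsub>HXK\<^esub> emb U = emb U \<otimes>\<^bsub>HXK\<^esub> ?r x)"
    using Ad_emb_U_iff cl by simp
  also have "\<dots> \<longleftrightarrow> (\<forall>x\<in>carrier X. \<forall>\<omega>\<in>carrier K'. \<forall>h\<in>carrier H.
    triple X \<omega> h (?l x \<otimes>\<^bsub>HXK\<^esub> emb U) = triple X \<omega> h (emb U \<otimes>\<^bsub>HXK\<^esub> ?r x))"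
    using triple_eqI mult_closed[OF HXK_alg] cl emb_U_inv(1) by (metis (no_types, lifting))
  also have "\<dots> \<longleftrightarrow> (\<forall>x\<in>carrier X. yd_op X (lact X \<alpha>) (ract X \<beta>) x)"
  proof -
    have "triple X \<omega> h (?l x \<otimes>\<^bsub>HXK\<^esub> emb U) = sw X (\<lambda>p q. lact X \<alpha> (tr \<one>\<^bsub>H\<^esub> q \<omega>) (ract X \<beta> p x)) h"
      "triple X \<omega> h (emb U \<otimes>\<^bsub>HXK\<^esub> ?r x) = sw X (\<lambda>p q. ract X \<beta> q (lact X \<alpha> (tr p \<one>\<^bsub>H\<^esub> \<omega>) x)) h"
      if "x \<in> carrier X" "\<omega> \<in> carrier K'" "h \<in> carrier H" for x \<omega> h
      using that by (simp_all add: triple_emb_U cl)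
        (rule sw_cong, simp add: l r tr_closed one_closed[OF alg])+
    then show ?thesis unfolding yd_op_def by (metis (no_types, lifting))
  qed
  finally show ?thesis .
qed

end

end

text \<open>
  Bilinearity of the product of \<open>L\<close> is inherited from the coproduct of \<open>K\<close> through the pairing.
\<close>

lemma (in bialgebra_pairing) mult_L_linear:
  assumes l: "l \<in> carrier L"
  shows "linear_map k L L (\<lambda>l'. l \<otimes>\<^bsub>L\<^esub> l')" and "linear_map k L L (\<lambda>l'. l' \<otimes>\<^bsub>L\<^esub> l)"
proof -
  interpret M: module k L by (rule L)
  note pl = linear_map_add[OF bilinear_map_left[OF p]] linear_map_smult[OF bilinear_map_left[OF p]]
  have 1: "linear_map k L (kmod k) (\<lambda>l'. tlift k K K (kmod k) (\<lambda>a b. p l a \<otimes>\<^bsub>k\<^esub> p l' b) (comult K t))"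
    "linear_map k L (kmod k) (\<lambda>l'. tlift k K K (kmod k) (\<lambda>a b. p l' a \<otimes>\<^bsub>k\<^esub> p l b) (comult K t))" if "t \<in> carrier K" for t
    using linear_map_closed[OF comult_K that] l by (simp_all add: rules)
  have 2: "linear_map k L (kmod k) (\<lambda>l'. p (l \<otimes>\<^bsub>L\<^esub> l') t)" "linear_map k L (kmod k) (\<lambda>l'. p (l' \<otimes>\<^bsub>L\<^esub> l) t)" if "t \<in> carrier K" for t
    by (subst linear_map_cong[OF L p_mult]; use that l 1[OF that] in simp)+
  show "linear_map k L L (\<lambda>l'. l \<otimes>\<^bsub>L\<^esub> l')"
    by (rule linear_mapI; (rule L_eqI)?)
      (simp_all add: mult_L l pl linear_map_add[OF 2(1)] linear_map_smult[OF 2(1)])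
  show "linear_map k L L (\<lambda>l'. l' \<otimes>\<^bsub>L\<^esub> l)"
    by (rule linear_mapI; (rule L_eqI)?)
      (simp_all add: mult_L l pl linear_map_add[OF 2(2)] linear_map_smult[OF 2(2)])
qed

lemma left_coactionD:
  assumes "left_coaction k K X \<alpha>"
  shows "\<alpha> \<in> alg_hom k X (tensor k K X)" "linear_map k X (tensor k K X) \<alpha>" "\<alpha> \<in> extensional (carrier X)"
    "\<And>x. x \<in> carrier X \<Longrightarrow> \<alpha> x \<in> carrier (tensor k K X)"
  using assms linear_map_closed[OF alg_hom_linear[of \<alpha> k X "tensor k K X"]] by (auto simp: left_coaction_def alg_hom_linear)

lemma alg_hom_restrict:
  assumes X: "k_algebra k X" and f: "f \<in> alg_hom k X Y"
  shows "(\<lambda>x\<in>carrier X. f x) \<in> alg_hom k X Y"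
proof (rule alg_homI)
  interpret X: ring X using X by (rule k_algebra_ring)
  show "linear_map k X Y (\<lambda>x\<in>carrier X. f x)"
    using alg_hom_linear[OF f] by (subst linear_map_cong[OF k_algebra_module[OF X], where g = f]) simp_all
qed (use X in \<open>simp_all add: alg_hom_one[OF f] alg_hom_mult[OF f] mult_closed[OF X] one_closed[OF X]\<close>)

context fd_hopf
begin

sublocale ET0: perfect_pairing k E T0 dpair dcopair
  by (rule E_T0_pairing)

lemma rs_T: "rs k X T \<phi> = rs k X T0 \<phi>"
  using rs_same[OF T_same, of k X \<phi>] by simp

lemma D_carrier: "carrier D = carrier E"
  by (rule D_simps(1))

lemma linear_D_D: "linear_map k D D f \<longleftrightarrow> linear_map k E E f" 
  using same_module_linear_map[OF D_same D_same, of k f] by simp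

lemma D_mult_linear:
  "d \<in> carrier E \<Longrightarrow> linear_map k E E (\<lambda>d'. d \<otimes>\<^bsub>D\<^esub> d')" "d \<in> carrier E \<Longrightarrow> linear_map k E E (\<lambda>d'. d' \<otimes>\<^bsub>D\<^esub> d)"
  using DP.mult_L_linear[unfolded linear_D_D D_carrier] by blast+

lemma D_one: "\<one>\<^bsub>D\<^esub> = pure k K' H \<one>\<^bsub>K'\<^esub> \<one>\<^bsub>H\<^esub>"
proof (rule ET0.L_eqI)
  show "\<one>\<^bsub>D\<^esub> \<in> carrier E" using DP.one_L by (simp add: D_carrier)
  show "pure k K' H \<one>\<^bsub>K'\<^esub> \<one>\<^bsub>H\<^esub> \<in> carrier E" by (simp add: pr)
  fix t assume t: "t \<in> carrier T0"
  have "dpair \<one>\<^bsub>D\<^esub> t = counit T t" using DP.p_one t by (simp add: T_carrier)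
  also have "\<dots> = dpair (pure k K' H \<one>\<^bsub>K'\<^esub> \<one>\<^bsub>H\<^esub>) t"
    using t by (simp add: dpair_pure pr T_counit hpair_def) (rule tlift_cong[OF K L], simp add: ev_one)
  finally show "dpair \<one>\<^bsub>D\<^esub> t = dpair (pure k K' H \<one>\<^bsub>K'\<^esub> \<one>\<^bsub>H\<^esub>) t" .
qed

section \<open>The two factors of the double\<close>

lemma comult_one: "sw Z F \<one>\<^bsub>H\<^esub> = F \<one>\<^bsub>H\<^esub> \<one>\<^bsub>H\<^esub>" if "module k Z" "bilinear_map k H H Z F"
  using that by (simp add: sw_def alg_hom_one[OF comult_H(1)] tensor_one tlift_pure pr)

lemma S_one: "S \<one>\<^bsub>H\<^esub> = \<one>\<^bsub>H\<^esub>"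
proof -
  interpret M: module k H by (rule K)
  have "sw H (\<lambda>p q. S p \<otimes>\<^bsub>H\<^esub> q) \<one>\<^bsub>H\<^esub> = counit H \<one>\<^bsub>H\<^esub> \<odot>\<^bsub>H\<^esub> \<one>\<^bsub>H\<^esub>"
    by (rule sw_antipode_left) (simp_all add: pr)
  then show ?thesis by (simp add: comult_one pr counit_H(3) H_one)
qed

text \<open>
  Apply the counit to the antipode axiom.
\<close>

lemma counit_S: 
  assumes h: "h \<in> carrier H"
  shows "counit H (S h) = counit H h"
proof -
  interpret R: cring k by (rule cring)
  have "counit H h = sw (kmod k) (\<lambda>p q. counit H (S p \<otimes>\<^bsub>H\<^esub> q)) h"
    using sw_antipode_left[OF module_kmod[OF cring] counit_H(1) h] h by (simp add: counit_H)
  also have "\<dots> = sw (kmod k) (\<lambda>p q. counit H q \<odot>\<^bsub>kmod k\<^esub> counit H (S p)) h"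
    by (rule sw_cong) (simp add: counit_H S_H R.m_comm)
  also have "\<dots> = counit H (S h)"
    by (rule sw_counit_right) (simp_all add: pr h)
  finally show ?thesis ..
qed

lemma tr_unit:
  assumes "p \<in> carrier H" "q \<in> carrier H"
  shows "tr p q \<one>\<^bsub>K'\<^esub> = (counit H p \<otimes>\<^bsub>k\<^esub> counit H q) \<odot>\<^bsub>K'\<^esub> \<one>\<^bsub>K'\<^esub>"
proof -
  interpret R: cring k by (rule cring)
  show ?thesis
    by (rule dual_eqI[where k = k and K = H])
      (use assms in \<open>simp_all add: pr ev_tr ev_smult ev_one counit_H R.m_ac\<close>)
qed

lemma K'_ring: "\<omega> \<in> carrier K' \<Longrightarrow> \<one>\<^bsub>K'\<^esub> \<otimes>\<^bsub>K'\<^esub> \<omega> = \<omega>" "\<omega> \<in> carrier K' \<Longrightarrow> \<omega> \<otimes>\<^bsub>K'\<^esub> \<one>\<^bsub>K'\<^esub> = \<omega>"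
proof -
  interpret K': ring K' using dual_alg by (rule k_algebra_ring)
  show "\<omega> \<in> carrier K' \<Longrightarrow> \<one>\<^bsub>K'\<^esub> \<otimes>\<^bsub>K'\<^esub> \<omega> = \<omega>" "\<omega> \<in> carrier K' \<Longrightarrow> \<omega> \<otimes>\<^bsub>K'\<^esub> \<one>\<^bsub>K'\<^esub> = \<omega>" by simp_all
qed

text \<open>
  The next three lemmas describe how the factors of the double sit inside it: \<open>\<omega> \<mapsto> \<omega> \<bowtie> 1\<close> reverses
  products, \<open>h \<mapsto> 1 \<bowtie> h\<close> preserves them, and products in the wrong order are rewritten by the rule
  that the Yetter-Drinfeld condition gives for operators.
\<close>

lemma D_mult_unit_left:
  assumes "\<omega> \<in> carrier K'" "\<omega>' \<in> carrier K'" "h' \<in> carrier H"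
  shows "pure k K' H \<omega> \<one>\<^bsub>H\<^esub> \<otimes>\<^bsub>D\<^esub> pure k K' H \<omega>' h' = pure k K' H (\<omega>' \<otimes>\<^bsub>K'\<^esub> \<omega>) h'"
  using assms by (simp add: D_mult_pure pr comult_one S_one tr_one H_one)

lemma D_mult_H:
  assumes h: "h \<in> carrier H" "h' \<in> carrier H"
  shows "pure k K' H \<one>\<^bsub>K'\<^esub> h \<otimes>\<^bsub>D\<^esub> pure k K' H \<one>\<^bsub>K'\<^esub> h' = pure k K' H \<one>\<^bsub>K'\<^esub> (h \<otimes>\<^bsub>H\<^esub> h')"
proof -
  note E = E_mod
  let ?e = "\<lambda>x. pure k K' H \<one>\<^bsub>K'\<^esub> (x \<otimes>\<^bsub>H\<^esub> h')"
  have "pure k K' H \<one>\<^bsub>K'\<^esub> h \<otimes>\<^bsub>D\<^esub> pure k K' H \<one>\<^bsub>K'\<^esub> h' =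
    sw E (\<lambda>p q. sw E (\<lambda>r s. pure k K' H (tr (S r) q \<one>\<^bsub>K'\<^esub> \<otimes>\<^bsub>K'\<^esub> \<one>\<^bsub>K'\<^esub>) (s \<otimes>\<^bsub>H\<^esub> h')) p) h"
    by (rule D_mult_pure) (simp_all add: pr h)
  also have "\<dots> = sw E (\<lambda>p q. counit H q \<odot>\<^bsub>E\<^esub> ?e p) h"
  proof (rule sw_cong)
    fix p q assume pq: "p \<in> carrier H" "q \<in> carrier H"
    have "sw E (\<lambda>r s. pure k K' H (tr (S r) q \<one>\<^bsub>K'\<^esub> \<otimes>\<^bsub>K'\<^esub> \<one>\<^bsub>K'\<^esub>) (s \<otimes>\<^bsub>H\<^esub> h')) p =
      sw E (\<lambda>r s. counit H r \<odot>\<^bsub>E\<^esub> (counit H q \<odot>\<^bsub>E\<^esub> ?e s)) p"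
      by (rule sw_cong) (simp add: pr pq h tr_unit K'_ring counit_S pure_smult_left smult_smult[OF E])
    also have "\<dots> = counit H q \<odot>\<^bsub>E\<^esub> ?e p"
      by (rule sw_counit_left[OF E, where G = "\<lambda>s. counit H q \<odot>\<^bsub>E\<^esub> ?e s"]) (simp_all add: pr pq h)
    finally show "sw E (\<lambda>r s. pure k K' H (tr (S r) q \<one>\<^bsub>K'\<^esub> \<otimes>\<^bsub>K'\<^esub> \<one>\<^bsub>K'\<^esub>) (s \<otimes>\<^bsub>H\<^esub> h')) p = counit H q \<odot>\<^bsub>E\<^esub> ?e p" .
  qed
  also have "\<dots> = ?e h"
    by (rule sw_counit_right[OF E, where G = ?e]) (simp_all add: pr h)
  finally show ?thesis .
qed

lemma D_mult_cross:
  assumes "h \<in> carrier H" "\<omega> \<in> carrier K'"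
  shows "pure k K' H \<one>\<^bsub>K'\<^esub> h \<otimes>\<^bsub>D\<^esub> pure k K' H \<omega> \<one>\<^bsub>H\<^esub> = sw E (\<lambda>p q. sw E (\<lambda>r s. pure k K' H (tr (S r) q \<omega>) s) p) h"
  using assms
  by (simp add: D_mult_pure pr) (rule sw_cong, rule sw_cong, simp add: pr K'_ring H_one)

section \<open>Comodule algebras of \<open>T\<^sub>M(H)\<close>\<close>

definition gamma :: "('k, 'x, 'q) module_scheme \<Rightarrow> ('x \<Rightarrow> ('h, 'x) tensor) \<Rightarrow> ('x \<Rightarrow> ('x, 'h \<Rightarrow> 'k) tensor) \<Rightarrow> 'x \<Rightarrow> ('x, ('h, 'h \<Rightarrow> 'k) tensor) tensor"
  where "gamma X \<alpha> \<beta> = (\<lambda>x\<in>carrier X. tassoc k X H K' (tmap k X K' (tensor k X H) K' (\<lambda>y. tflip k H X (\<alpha> y)) (\<lambda>\<theta>. \<theta>) (\<beta> x)))"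

text \<open>
  The operators \<open>c\<close> of a coaction of \<open>T\<^sub>M(H)\<close>, indexed by the elements of the double.
\<close>

definition cact :: "('k, 'x, 'q) module_scheme \<Rightarrow> ('x \<Rightarrow> ('x, ('h, 'h \<Rightarrow> 'k) tensor) tensor) \<Rightarrow> ('h \<Rightarrow> 'k, 'h) tensor \<Rightarrow> 'x \<Rightarrow> 'x"
  where "cact X \<gamma> d x = rs k X T0 (dpair d) (\<gamma> x)"

lemma cact_bilinear:
  assumes X: "module k X" and \<gamma>: "linear_map k X (tensor k X T0) \<gamma>"
  shows "bilinear_map k E X X (cact X \<gamma>)"
  unfolding cact_def[abs_def] by (simp add: ET0.rules X lin_comp[OF \<gamma>] lin_app[OF \<gamma>] linear_map_closed[OF \<gamma>])

lemma left_coaction_iff: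
  assumes X: "module k X" and \<alpha>: "linear_map k X (tensor k H X) \<alpha>"
  shows "(\<forall>x\<in>carrier X.
      tassoc k H H X (tmap k H X (tensor k H H) X (comult H) (\<lambda>y. y) (\<alpha> x)) =
        tmap k H X H (tensor k H X) (\<lambda>y. y) \<alpha> (\<alpha> x) \<and>
      tlift k H X X (\<lambda>h y. counit H h \<odot>\<^bsub>X\<^esub> y) (\<alpha> x) = x) \<longleftrightarrow>
    (\<forall>x\<in>carrier X. (\<forall>\<omega>\<in>carrier K'. \<forall>\<omega>'\<in>carrier K'. lact X \<alpha> \<omega>' (lact X \<alpha> \<omega> x) = lact X \<alpha> (\<omega> \<otimes>\<^bsub>K'\<^esub> \<omega>') x) \<and>
      lact X \<alpha> \<one>\<^bsub>K'\<^esub> x = x)"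
proof -
  have 1: "lact X \<alpha> \<one>\<^bsub>K'\<^esub> x = tlift k H X X (\<lambda>h y. counit H h \<odot>\<^bsub>X\<^esub> y) (\<alpha> x)" for x
    unfolding lact_def ls_def by (rule tlift_cong[OF K X]) (simp add: ev_one)
  have 2: "tassoc k H H X (tmap k H X (tensor k H H) X (comult H) (\<lambda>y. y) (\<alpha> x)) = tmap k H X H (tensor k H X) (\<lambda>y. y) \<alpha> (\<alpha> x) \<longleftrightarrow>
    (\<forall>\<omega>\<in>carrier K'. \<forall>\<omega>'\<in>carrier K'. lact X \<alpha> \<omega>' (lact X \<alpha> \<omega> x) = lact X \<alpha> (\<omega> \<otimes>\<^bsub>K'\<^esub> \<omega>') x)" if x: "x \<in> carrier X" for x
    unfolding lact_def
    by (rule left_coassoc_iff[OF X \<alpha> comult_H(2) _ _ x]) (simp_all add: pr ev_mult sw_def)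
  show ?thesis using 1 2 by auto
qed

lemma right_coaction_iff:
  assumes Xa: "k_algebra k X" and \<beta>: "linear_map k X (tensor k X K') \<beta>"
  shows "(\<forall>x\<in>carrier X.
      tassoc k X K' K' (tmap k X K' (tensor k X K') K' \<beta> (\<lambda>y. y) (\<beta> x)) =
        tmap k X K' X (tensor k K' K') (\<lambda>y. y) (comult K') (\<beta> x) \<and>
      tlift k X K' X (\<lambda>y h. counit K' h \<odot>\<^bsub>X\<^esub> y) (\<beta> x) = x) \<longleftrightarrow>
    (\<forall>x\<in>carrier X. (\<forall>h\<in>carrier H. \<forall>h'\<in>carrier H. ract X \<beta> h (ract X \<beta> h' x) = ract X \<beta> (h \<otimes>\<^bsub>H\<^esub> h') x) \<and>
      ract X \<beta> \<one>\<^bsub>H\<^esub> x = x)"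
  using HP.coaction_iff[OF Xa \<beta>] by (simp add: ract_def)

lemma T_coaction_iff:
  assumes Xa: "k_algebra k X" and \<gamma>: "linear_map k X (tensor k X T0) \<gamma>"
  shows "(\<forall>x\<in>carrier X.
      tassoc k X T T (tmap k X T (tensor k X T) T \<gamma> (\<lambda>y. y) (\<gamma> x)) =
        tmap k X T X (tensor k T T) (\<lambda>y. y) (comult T) (\<gamma> x) \<and>
      tlift k X T X (\<lambda>y h. counit T h \<odot>\<^bsub>X\<^esub> y) (\<gamma> x) = x) \<longleftrightarrow>
    (\<forall>x\<in>carrier X. (\<forall>d\<in>carrier E. \<forall>d'\<in>carrier E. cact X \<gamma> d (cact X \<gamma> d' x) = cact X \<gamma> (d \<otimes>\<^bsub>D\<^esub> d') x) \<and>
      cact X \<gamma> \<one>\<^bsub>D\<^esub> x = x)"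
  using DP.coaction_iff[OF Xa, unfolded tensor_X_T rs_T D_carrier, OF \<gamma>] by (simp add: cact_def tensor_X_T)

text \<open>
  Slicing \<open>(\<Sigma>\<alpha> \<otimes> id)\<beta>\<close> at \<open>\<omega> \<otimes> h\<close> gives \<open>a\<^sub>\<omega> b\<^sub>h\<close>.
\<close>

lemma cact_gamma:
  assumes X: "module k X" and \<alpha>: "linear_map k X (tensor k H X) \<alpha>" and \<beta>: "linear_map k X (tensor k X K') \<beta>"
    and \<omega>: "\<omega> \<in> carrier K'" and h: "h \<in> carrier H" and x: "x \<in> carrier X"
  shows "cact X (gamma X \<alpha> \<beta>) (pure k K' H \<omega> h) x = lact X \<alpha> \<omega> (ract X \<beta> h x)"
proof -
  let ?XK = "tensor k X K'" and ?d = "pure k K' H \<omega> h"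
  note rl = pr X ET0.rules lin_comp[OF \<alpha>] lin_app[OF \<alpha>] linear_map_closed[OF \<alpha>] lin_comp[OF \<beta>] lin_app[OF \<beta>] linear_map_closed[OF \<beta>]
    linear_map_closed[OF tassoc_linear] linear_map_closed[OF tmap_linear] linear_map_closed[OF tflip_linear]
    lin_app[OF rs_linear] lin_comp[OF rs_linear]
  have "rs k X T0 (dpair ?d) (tassoc k X H K' (tmap k X K' (tensor k X H) K' (\<lambda>y. tflip k H X (\<alpha> y)) (\<lambda>\<theta>. \<theta>) z)) =
    ls k H X (\<lambda>g. ev g \<omega>) (\<alpha> (rs k X K' (\<lambda>\<theta>. ev h \<theta>) z))" if z: "z \<in> carrier ?XK" for z
  proof (rule tensor_ext[OF X L X _ _ _ z])
    fix y \<theta> assume y: "y \<in> carrier X" and \<theta>: "\<theta> \<in> carrier K'"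
    have "rs k X T0 (dpair ?d) (tassoc k X H K' (pure k (tensor k X H) K' (tflip k H X u) \<theta>)) = ev h \<theta> \<odot>\<^bsub>X\<^esub> ls k H X (\<lambda>g. ev g \<omega>) u"
      if u: "u \<in> carrier (tensor k H X)" for u
      by (rule tensor_ext[OF K X X _ _ _ u])
        (simp_all add: rl \<omega> h \<theta> tflip_pure tassoc_pure rs_pure dpair_pure hpair_pure ls_pure smult_smult[OF X] kmult_comm)
    then show "rs k X T0 (dpair ?d) (tassoc k X H K' (tmap k X K' (tensor k X H) K' (\<lambda>y. tflip k H X (\<alpha> y)) (\<lambda>\<theta>. \<theta>) (pure k X K' y \<theta>))) =
      ls k H X (\<lambda>g. ev g \<omega>) (\<alpha> (rs k X K' (\<lambda>\<theta>. ev h \<theta>) (pure k X K' y \<theta>)))"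
      using y \<theta> \<omega> h by (simp add: rl \<alpha> tmap_pure rs_pure linear_map_smult[OF \<alpha>] linear_map_smult[OF ls_linear])
  qed (simp_all add: rl \<omega> h)
  then show ?thesis using x by (simp add: cact_def gamma_def lact_def ract_def rl)
qed

lemma gamma_alg_hom:
  assumes Xa: "k_algebra k X" and \<alpha>: "\<alpha> \<in> alg_hom k X (tensor k H X)" and \<beta>: "\<beta> \<in> alg_hom k X (tensor k X K')"
  shows "gamma X \<alpha> \<beta> \<in> alg_hom k X (tensor k X T0)"
  unfolding gamma_def
  by (rule alg_hom_restrict[OF Xa], rule alg_hom_comp[OF tassoc_alg_hom[OF Xa alg dual_alg]], rule alg_hom_comp[OF _ \<beta>],
      rule tmap_alg_hom[OF Xa dual_alg k_algebra_tensor[OF Xa alg] dual_alg _ alg_hom_id],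
      rule alg_hom_comp[OF tflip_alg_hom[OF alg Xa] \<alpha>])

text \<open>
  Coassociativity says that \<open>c\<close> is multiplicative on the double.  By bilinearity it suffices to
  consider \<open>\<omega> \<bowtie> h\<close> and \<open>\<omega>' \<bowtie> h'\<close>, and there \<open>a\<^sub>\<omega> b\<^sub>h a\<^sub>\<omega>\<^sub>' b\<^sub>h\<^sub>'\<close> is brought into the order of the product
  of the double by the commutation rule.
\<close>

lemma gamma_coaction:
  assumes Xa: "k_algebra k X" and \<alpha>: "left_coaction k H X \<alpha>" and \<beta>: "right_coaction k K' X \<beta>"
    and yd: "yd_lr_condition k H X \<alpha> \<beta>"
  shows "right_coaction k T X (gamma X \<alpha> \<beta>)"
proof -
  let ?\<gamma> = "gamma X \<alpha> \<beta>"
  note X = k_algebra_module[OF Xa]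
  note a = left_coactionD[OF \<alpha>] and b = HP.right_coactionD[OF \<beta>]
  note ah = gamma_alg_hom[OF Xa a(1) b(1)]
  note gl = alg_hom_linear[OF ah]
  note La = lact_bilinear[OF X a(2)] and Ra = ract_bilinear[OF X b(2)]
  note cb = cact_bilinear[OF X gl]
  note Lc = \<alpha>[unfolded left_coaction_def left_coaction_iff[OF X a(2)], THEN conjunct2, THEN conjunct2]
  note Rc = \<beta>[unfolded right_coaction_def right_coaction_iff[OF Xa b(2)], THEN conjunct2, THEN conjunct2]
  have Y: "ract X \<beta> h (lact X \<alpha> \<omega> x) = sw X (\<lambda>p q. sw X (\<lambda>r s. lact X \<alpha> (tr (S r) q \<omega>) (ract X \<beta> s x)) p) h"
    if "h \<in> carrier H" "\<omega> \<in> carrier K'" "x \<in> carrier X" for h \<omega> x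
    using yd that yd_op_iff[OF X La Ra] by (simp add: yd_lr_condition_iff[OF Xa a(2) b(2)])
  note lcl = bilinear_map_closed[OF La] and rcl = bilinear_map_closed[OF Ra] and ccl = bilinear_map_closed[OF cb]
  note cg = cact_gamma[OF X a(2) b(2)]
  note rl = pr X lcl rcl lin_comp[OF bilinear_map_left[OF La]] lin_comp[OF bilinear_map_right[OF La]]
    lin_comp[OF bilinear_map_left[OF Ra]] lin_comp[OF bilinear_map_right[OF Ra]]
    lin_app[OF bilinear_map_left[OF La]] lin_app[OF bilinear_map_right[OF La]]
    lin_app[OF bilinear_map_left[OF Ra]] lin_app[OF bilinear_map_right[OF Ra]]
  \<comment> \<open>The rule for \<open>b\<^sub>h a\<^sub>\<omega>\<^sub>'\<close> is used at the point \<open>b\<^sub>h\<^sub>' x\<close>.\<close>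
  have pures: "cact X ?\<gamma> (pure k K' H \<omega> h) (cact X ?\<gamma> (pure k K' H \<omega>' h') x) = cact X ?\<gamma> (pure k K' H \<omega> h \<otimes>\<^bsub>D\<^esub> pure k K' H \<omega>' h') x"
    if \<omega>: "\<omega> \<in> carrier K'" "\<omega>' \<in> carrier K'" and h: "h \<in> carrier H" "h' \<in> carrier H" and x: "x \<in> carrier X" for \<omega> h \<omega>' h' x
  proof -
    let ?y = "ract X \<beta> h' x"
    have y: "?y \<in> carrier X" using h x by (simp add: rcl)
    note cx = bilinear_map_left[OF cb x]
    have "cact X ?\<gamma> (pure k K' H \<omega> h \<otimes>\<^bsub>D\<^esub> pure k K' H \<omega>' h') x =
      sw X (\<lambda>p q. cact X ?\<gamma> (sw E (\<lambda>r s. pure k K' H (tr (S r) q \<omega>' \<otimes>\<^bsub>K'\<^esub> \<omega>) (s \<otimes>\<^bsub>H\<^esub> h')) p) x) h"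
      unfolding D_mult_pure[OF \<omega>(1) h(1) \<omega>(2) h(2)]
      by (rule linear_sw[OF E_mod X cx]) (simp_all add: rl \<omega> h)
    also have "\<dots> = sw X (\<lambda>p q. sw X (\<lambda>r s. cact X ?\<gamma> (pure k K' H (tr (S r) q \<omega>' \<otimes>\<^bsub>K'\<^esub> \<omega>) (s \<otimes>\<^bsub>H\<^esub> h')) x) p) h"
      by (rule sw_cong, rule linear_sw[OF E_mod X cx]) (simp_all add: rl \<omega> h)
    also have "\<dots> = sw X (\<lambda>p q. sw X (\<lambda>r s. lact X \<alpha> \<omega> (lact X \<alpha> (tr (S r) q \<omega>') (ract X \<beta> s ?y))) p) h"
    proof (rule sw_cong, rule sw_cong)
      fix p q r s assume pqrs: "p \<in> carrier H" "q \<in> carrier H" "r \<in> carrier H" "s \<in> carrier H"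
      have "lact X \<alpha> (tr (S r) q \<omega>' \<otimes>\<^bsub>K'\<^esub> \<omega>) z = lact X \<alpha> \<omega> (lact X \<alpha> (tr (S r) q \<omega>') z)" if "z \<in> carrier X" for z
        using Lc that pqrs \<omega> by (simp add: rl)
      moreover have "ract X \<beta> (s \<otimes>\<^bsub>H\<^esub> h') x = ract X \<beta> s ?y" using Rc pqrs h x by simp
      ultimately show "cact X ?\<gamma> (pure k K' H (tr (S r) q \<omega>' \<otimes>\<^bsub>K'\<^esub> \<omega>) (s \<otimes>\<^bsub>H\<^esub> h')) x = lact X \<alpha> \<omega> (lact X \<alpha> (tr (S r) q \<omega>') (ract X \<beta> s ?y))"
        using pqrs \<omega> h x y by (simp add: cg rl)
    qed
    also have "\<dots> = sw X (\<lambda>p q. lact X \<alpha> \<omega> (sw X (\<lambda>r s. lact X \<alpha> (tr (S r) q \<omega>') (ract X \<beta> s ?y)) p)) h"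
      by (rule sw_cong, rule linear_sw[OF X X bilinear_map_right[OF La \<omega>(1)], symmetric]) (simp_all add: rl \<omega> h y)
    also have "\<dots> = lact X \<alpha> \<omega> (sw X (\<lambda>p q. sw X (\<lambda>r s. lact X \<alpha> (tr (S r) q \<omega>') (ract X \<beta> s ?y)) p) h)"
      by (rule linear_sw[OF X X bilinear_map_right[OF La \<omega>(1)], symmetric]) (simp_all add: rl \<omega> h y)
    also have "\<dots> = cact X ?\<gamma> (pure k K' H \<omega> h) (cact X ?\<gamma> (pure k K' H \<omega>' h') x)"
      using \<omega> h x y by (simp add: cg Y rl)
    finally show ?thesis ..
  qed
  have mult: "cact X ?\<gamma> d (cact X ?\<gamma> d' x) = cact X ?\<gamma> (d \<otimes>\<^bsub>D\<^esub> d') x"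
    if d: "d \<in> carrier E" "d' \<in> carrier E" and x: "x \<in> carrier X" for d d' x
  proof (rule tensor_ext[OF L K X _ _ _ d(1)])
    note cl = bilinear_map_left[OF cb]
    show "linear_map k E X (\<lambda>d. cact X ?\<gamma> d (cact X ?\<gamma> d' x))" using cl ccl d x by blast
    show "linear_map k E X (\<lambda>d. cact X ?\<gamma> (d \<otimes>\<^bsub>D\<^esub> d') x)"
      using lin_comp[OF cl[OF x] D_mult_linear(2)[OF d(2)]] .
    fix \<omega> h assume wh: "\<omega> \<in> carrier K'" "h \<in> carrier H"
    have p: "pure k K' H \<omega> h \<in> carrier E" using wh by (rule pure_closed)
    show "cact X ?\<gamma> (pure k K' H \<omega> h) (cact X ?\<gamma> d' x) = cact X ?\<gamma> (pure k K' H \<omega> h \<otimes>\<^bsub>D\<^esub> d') x"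
    proof (rule tensor_ext[OF L K X _ _ _ d(2)])
      show "linear_map k E X (\<lambda>d'. cact X ?\<gamma> (pure k K' H \<omega> h) (cact X ?\<gamma> d' x))"
        using lin_comp[OF bilinear_map_right[OF cb p] cl[OF x]] .
      show "linear_map k E X (\<lambda>d'. cact X ?\<gamma> (pure k K' H \<omega> h \<otimes>\<^bsub>D\<^esub> d') x)"
        using lin_comp[OF cl[OF x] D_mult_linear(1)[OF p]] .
    qed (use pures wh x in blast)
  qed
  have one: "cact X ?\<gamma> \<one>\<^bsub>D\<^esub> x = x" if "x \<in> carrier X" for x
    using that Lc Rc by (simp add: D_one cg rl)
  show ?thesis
    unfolding right_coaction_def T_coaction_iff[OF Xa gl]
    using ah mult one by (simp add: tensor_X_T) (simp add: gamma_def)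
qed

text \<open>
  From \<open>a\<^sub>\<omega> b\<^sub>h\<close> the factors are recovered by inserting units, because \<open>b\<^sub>1\<close> and \<open>a\<^sub>\<epsilon>\<close> are identities.
\<close>

lemma gamma_inj:
  assumes Xa: "k_algebra k X" and \<alpha>: "left_coaction k H X \<alpha>" "left_coaction k H X \<alpha>'"
    and \<beta>: "right_coaction k K' X \<beta>" "right_coaction k K' X \<beta>'" and eq: "gamma X \<alpha> \<beta> = gamma X \<alpha>' \<beta>'"
  shows "\<alpha> = \<alpha>' \<and> \<beta> = \<beta>'"
proof -
  note X = k_algebra_module[OF Xa]
  note a = left_coactionD[OF \<alpha>(1)] and b = HP.right_coactionD[OF \<beta>(1)]
  note a' = left_coactionD[OF \<alpha>(2)] and b' = HP.right_coactionD[OF \<beta>(2)]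
  note Lc = \<alpha>(1)[unfolded left_coaction_def left_coaction_iff[OF X a(2)], THEN conjunct2, THEN conjunct2]
  note Rc = \<beta>(1)[unfolded right_coaction_def right_coaction_iff[OF Xa b(2)], THEN conjunct2, THEN conjunct2]
  note Lc' = \<alpha>(2)[unfolded left_coaction_def left_coaction_iff[OF X a'(2)], THEN conjunct2, THEN conjunct2]
  note Rc' = \<beta>(2)[unfolded right_coaction_def right_coaction_iff[OF Xa b'(2)], THEN conjunct2, THEN conjunct2]
  note Ra = bilinear_map_closed[OF ract_bilinear[OF X b(2)]] and Ra' = bilinear_map_closed[OF ract_bilinear[OF X b'(2)]]
  have cross: "lact X \<alpha> \<omega> (ract X \<beta> h x) = lact X \<alpha>' \<omega> (ract X \<beta>' h x)" if "\<omega> \<in> carrier K'" "h \<in> carrier H" "x \<in> carrier X" for \<omega> h x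
    using cact_gamma[OF X a(2) b(2) that] cact_gamma[OF X a'(2) b'(2) that] by (simp add: eq)
  have l: "lact X \<alpha> \<omega> x = lact X \<alpha>' \<omega> x" if "\<omega> \<in> carrier K'" "x \<in> carrier X" for \<omega> x
    using cross[OF that(1) one_closed[OF alg] that(2)] Rc Rc' that(2) by simp
  have r: "ract X \<beta> h x = ract X \<beta>' h x" if "h \<in> carrier H" "x \<in> carrier X" for h x
    using cross[OF one_closed[OF dual_alg] that] Lc Lc' that Ra Ra' by simp
  have "\<alpha> = \<alpha>'"
  proof (rule extensionalityI[OF a(3) a'(3)])
    fix x assume x: "x \<in> carrier X"
    show "\<alpha> x = \<alpha>' x" by (rule ls_eqI[OF X a(4)[OF x] a'(4)[OF x]]) (use l[OF _ x] in \<open>simp add: lact_def\<close>)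
  qed
  moreover have "\<beta> = \<beta>'"
  proof (rule extensionalityI[OF b(3) b'(3)])
    fix x assume x: "x \<in> carrier X"
    show "\<beta> x = \<beta>' x" by (rule HP.rs_eqI[OF X b(4)[OF x] b'(4)[OF x]]) (use r[OF _ x] in \<open>simp add: ract_def\<close>)
  qed
  ultimately show ?thesis ..
qed

text \<open>
  The algebra homomorphisms \<open>id \<otimes> \<epsilon>\<close> and \<open>\<epsilon> \<otimes> id\<close> on \<open>T\<^sub>M(H)\<close>, through which \<open>\<alpha>\<close> and \<open>\<beta>\<close> are extracted
  from \<open>\<gamma>\<close>.
\<close>

definition proj1 :: "('h, 'h \<Rightarrow> 'k) tensor \<Rightarrow> 'h"
  where "proj1 = tlift k H K' H (\<lambda>g \<theta>. ev \<one>\<^bsub>H\<^esub> \<theta> \<odot>\<^bsub>H\<^esub> g)"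

definition proj2 :: "('h, 'h \<Rightarrow> 'k) tensor \<Rightarrow> 'h \<Rightarrow> 'k"
  where "proj2 = tlift k H K' K' (\<lambda>g \<theta>. counit H g \<odot>\<^bsub>K'\<^esub> \<theta>)"

lemma proj_pure: "g \<in> carrier H \<Longrightarrow> \<theta> \<in> carrier K' \<Longrightarrow> proj1 (pure k H K' g \<theta>) = ev \<one>\<^bsub>H\<^esub> \<theta> \<odot>\<^bsub>H\<^esub> g"
  "g \<in> carrier H \<Longrightarrow> \<theta> \<in> carrier K' \<Longrightarrow> proj2 (pure k H K' g \<theta>) = counit H g \<odot>\<^bsub>K'\<^esub> \<theta>"
  unfolding proj1_def proj2_def by (simp_all add: tlift_pure pr)

lemma proj_linear: "linear_map k T0 H proj1" "linear_map k T0 K' proj2"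
  unfolding proj1_def proj2_def by (simp_all add: pr)

lemma proj_alg_hom: "proj1 \<in> alg_hom k T0 H" "proj2 \<in> alg_hom k T0 K'"
proof -
  interpret R: cring k by (rule cring)
  interpret HM: module k H by (rule K)
  interpret KM: module k K' by (rule L)
  have e1: "ev \<one>\<^bsub>H\<^esub> (\<phi> \<otimes>\<^bsub>K'\<^esub> \<psi>) = ev \<one>\<^bsub>H\<^esub> \<phi> \<otimes>\<^bsub>k\<^esub> ev \<one>\<^bsub>H\<^esub> \<psi>" if "\<phi> \<in> carrier K'" "\<psi> \<in> carrier K'" for \<phi> \<psi>
    using that by (simp add: ev_mult pr comult_one)
  show "proj1 \<in> alg_hom k T0 H"
    by (rule alg_hom_tensorI[OF alg dual_alg alg proj_linear(1)])
      (simp_all add: proj_pure pr e1 ev_one counit_H(3) k_algebra_smult_left[OF alg] k_algebra_smult_right[OF alg] smult_smult[OF K] R.m_comm)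
  show "proj2 \<in> alg_hom k T0 K'"
    by (rule alg_hom_tensorI[OF alg dual_alg dual_alg proj_linear(2)])
      (simp_all add: proj_pure pr counit_H(3,4) k_algebra_smult_left[OF dual_alg] k_algebra_smult_right[OF dual_alg] smult_smult[OF L] R.m_comm)
qed

lemma hpair_proj:
  assumes t: "t \<in> carrier T0"
  shows "\<omega> \<in> carrier K' \<Longrightarrow> ev (proj1 t) \<omega> = hpair \<omega> \<one>\<^bsub>H\<^esub> t" and "h \<in> carrier H \<Longrightarrow> ev h (proj2 t) = hpair \<one>\<^bsub>K'\<^esub> h t"
proof -
  note mk = module_kmod[OF cring]
  show "ev (proj1 t) \<omega> = hpair \<omega> \<one>\<^bsub>H\<^esub> t" if \<omega>: "\<omega> \<in> carrier K'"
    by (rule tensor_ext[OF K L mk _ _ _ t])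
      (simp_all add: pr \<omega> lin_comp[OF proj_linear(1)] lin_app[OF proj_linear(1)] proj_pure hpair_pure linear_map_smult[OF dual_linear[OF \<omega>]] kmult_comm[OF cring])
  show "ev h (proj2 t) = hpair \<one>\<^bsub>K'\<^esub> h t" if h: "h \<in> carrier H"
    by (rule tensor_ext[OF K L mk _ _ _ t])
      (simp_all add: pr h lin_comp[OF proj_linear(2)] lin_app[OF proj_linear(2)] proj_pure hpair_pure ev_smult ev_one)
qed

text \<open>
  Put \<open>\<alpha> = \<Sigma>(id \<otimes> id \<otimes> \<epsilon>)\<gamma>\<close> and \<open>\<beta> = (id \<otimes> \<epsilon> \<otimes> id)\<gamma>\<close>; these are algebra homomorphisms because \<open>\<gamma>\<close> is.
  Their operators are those of \<open>\<omega> \<bowtie> 1\<close> and \<open>1 \<bowtie> h\<close>, so that all other requirements are instances of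
  the multiplication rules of the double.
\<close>

lemma gamma_surj:
  assumes Xa: "k_algebra k X" and \<gamma>: "right_coaction k T X \<gamma>"
  shows "\<exists>\<alpha> \<beta>. left_coaction k H X \<alpha> \<and> right_coaction k K' X \<beta> \<and> yd_lr_condition k H X \<alpha> \<beta> \<and> gamma X \<alpha> \<beta> = \<gamma>"
proof -
  note X = k_algebra_module[OF Xa]
  note g = DP.right_coactionD[OF \<gamma>, unfolded tensor_X_T]
  note cb = cact_bilinear[OF X g(2)]
  note ccl = bilinear_map_closed[OF cb]
  note Tc = \<gamma>[unfolded right_coaction_def T_coaction_iff[OF Xa g(2)], THEN conjunct2, THEN conjunct2]
  have cm: "cact X \<gamma> d (cact X \<gamma> d' x) = cact X \<gamma> (d \<otimes>\<^bsub>D\<^esub> d') x" if "d \<in> carrier E" "d' \<in> carrier E" "x \<in> carrier X" for d d' x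
    using Tc that by blast
  have c1: "cact X \<gamma> (pure k K' H \<one>\<^bsub>K'\<^esub> \<one>\<^bsub>H\<^esub>) x = x" if "x \<in> carrier X" for x
    using Tc that by (simp add: D_one)
  define \<alpha> where "\<alpha> = (\<lambda>x\<in>carrier X. tflip k X H (tmap k X T0 X H (\<lambda>y. y) proj1 (\<gamma> x)))"
  define \<beta> where "\<beta> = (\<lambda>x\<in>carrier X. tmap k X T0 X K' (\<lambda>y. y) proj2 (\<gamma> x))"
  have ah: "\<alpha> \<in> alg_hom k X (tensor k H X)"
    unfolding \<alpha>_def
    by (rule alg_hom_restrict[OF Xa], rule alg_hom_comp[OF tflip_alg_hom[OF Xa alg]], rule alg_hom_comp[OF _ g(1)],
      rule tmap_alg_hom[OF Xa T0_alg Xa alg alg_hom_id proj_alg_hom(1)])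
  have bh: "\<beta> \<in> alg_hom k X (tensor k X K')"
    unfolding \<beta>_def
    by (rule alg_hom_restrict[OF Xa], rule alg_hom_comp[OF _ g(1)],
      rule tmap_alg_hom[OF Xa T0_alg Xa dual_alg alg_hom_id proj_alg_hom(2)])
  note al = alg_hom_linear[OF ah] and bl = alg_hom_linear[OF bh]
  note rl = pr X ET0.rules proj_linear lin_comp[OF proj_linear(1)] lin_comp[OF proj_linear(2)] lin_app[OF proj_linear(1)] lin_app[OF proj_linear(2)]
    linear_map_closed[OF proj_linear(1)] linear_map_closed[OF proj_linear(2)]
  have la: "lact X \<alpha> \<omega> x = cact X \<gamma> (pure k K' H \<omega> \<one>\<^bsub>H\<^esub>) x" if \<omega>: "\<omega> \<in> carrier K'" and x: "x \<in> carrier X" for \<omega> x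
  proof -
    have "ls k H X (\<lambda>g. ev g \<omega>) (tflip k X H (tmap k X T0 X H (\<lambda>y. y) proj1 z)) = rs k X T0 (dpair (pure k K' H \<omega> \<one>\<^bsub>H\<^esub>)) z"
      if z: "z \<in> carrier (tensor k X T0)" for z
      by (rule tensor_ext[OF X T0_mod X _ _ _ z])
        (simp_all add: rl \<omega> tmap_pure tflip_pure ls_pure rs_pure dpair_pure hpair_proj)
    then show ?thesis using x g(4)[OF x] by (simp add: lact_def cact_def \<alpha>_def)
  qed
  have ra: "ract X \<beta> h x = cact X \<gamma> (pure k K' H \<one>\<^bsub>K'\<^esub> h) x" if h: "h \<in> carrier H" and x: "x \<in> carrier X" for h x
  proof -
    have "rs k X K' (\<lambda>\<theta>. ev h \<theta>) (tmap k X T0 X K' (\<lambda>y. y) proj2 z) = rs k X T0 (dpair (pure k K' H \<one>\<^bsub>K'\<^esub> h)) z"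
      if z: "z \<in> carrier (tensor k X T0)" for z
      by (rule tensor_ext[OF X T0_mod X _ _ _ z])
        (simp_all add: rl h tmap_pure rs_pure dpair_pure hpair_proj)
    then show ?thesis using x g(4)[OF x] by (simp add: ract_def cact_def \<beta>_def)
  qed
  note p = pure_closed[of _ K' _ H]
  note u = one_closed[OF alg] one_closed[OF dual_alg]
  have lr: "cact X \<gamma> (pure k K' H \<omega> h) x = lact X \<alpha> \<omega> (ract X \<beta> h x)"
    if "\<omega> \<in> carrier K'" "h \<in> carrier H" "x \<in> carrier X" for \<omega> h x
    using that by (simp add: la ra ccl p u cm D_mult_unit_left K'_ring)
  have "left_coaction k H X \<alpha>"
    unfolding left_coaction_def left_coaction_iff[OF X al]
    using ah by (simp add: la ccl p u cm c1 mult_closed[OF dual_alg] D_mult_unit_left) (simp add: \<alpha>_def)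
  moreover have "right_coaction k K' X \<beta>"
    unfolding right_coaction_def right_coaction_iff[OF Xa bl]
    using bh by (simp add: ra ccl p u cm c1 mult_closed[OF alg] D_mult_H) (simp add: \<beta>_def)
  moreover have "yd_lr_condition k H X \<alpha> \<beta>"
    unfolding yd_lr_condition_iff[OF Xa al bl]
  proof
    fix x assume x: "x \<in> carrier X"
    note cx = bilinear_map_left[OF cb x]
    show "yd_op X (lact X \<alpha>) (ract X \<beta>) x"
      unfolding yd_op_iff[OF X lact_bilinear[OF X al] ract_bilinear[OF X bl] x]
    proof (intro ballI)
      fix h \<omega> assume h: "h \<in> carrier H" and \<omega>: "\<omega> \<in> carrier K'"
      have "ract X \<beta> h (lact X \<alpha> \<omega> x) = cact X \<gamma> (sw E (\<lambda>p q. sw E (\<lambda>r s. pure k K' H (tr (S r) q \<omega>) s) p) h) x"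
        using h \<omega> x by (simp add: la ra ccl p u cm D_mult_cross)
      also have "\<dots> = sw X (\<lambda>p q. cact X \<gamma> (sw E (\<lambda>r s. pure k K' H (tr (S r) q \<omega>) s) p) x) h"
        by (rule linear_sw[OF E_mod X cx]) (simp_all add: pr \<omega> h)
      also have "\<dots> = sw X (\<lambda>p q. sw X (\<lambda>r s. cact X \<gamma> (pure k K' H (tr (S r) q \<omega>) s) x) p) h"
        by (rule sw_cong, rule linear_sw[OF E_mod X cx]) (simp_all add: pr \<omega> h)
      also have "\<dots> = sw X (\<lambda>p q. sw X (\<lambda>r s. lact X \<alpha> (tr (S r) q \<omega>) (ract X \<beta> s x)) p) h"
        by (rule sw_cong, rule sw_cong) (simp add: lr pr \<omega> x)
      finally show "ract X \<beta> h (lact X \<alpha> \<omega> x) = sw X (\<lambda>p q. sw X (\<lambda>r s. lact X \<alpha> (tr (S r) q \<omega>) (ract X \<beta> s x)) p) h" .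
    qed
  qed
  moreover have "gamma X \<alpha> \<beta> = \<gamma>"
  proof (rule extensionalityI[of _ "carrier X"])
    show "gamma X \<alpha> \<beta> \<in> extensional (carrier X)" by (simp add: gamma_def)
    show "\<gamma> \<in> extensional (carrier X)" by (rule g(3))
    fix x assume x: "x \<in> carrier X"
    note gl = alg_hom_linear[OF gamma_alg_hom[OF Xa ah bh]]
    show "gamma X \<alpha> \<beta> x = \<gamma> x"
    proof (rule ET0.rs_eqI[OF X linear_map_closed[OF gl x] g(4)[OF x]])
      fix d assume d: "d \<in> carrier E"
      have "cact X (gamma X \<alpha> \<beta>) d x = cact X \<gamma> d x"
        by (rule tensor_ext[OF L K X bilinear_map_left[OF cact_bilinear[OF X gl] x] bilinear_map_left[OF cb x] _ d])
          (simp add: cact_gamma[OF X al bl _ _ x] lr x)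
      then show "rs k X T0 (dpair d) (gamma X \<alpha> \<beta> x) = rs k X T0 (dpair d) (\<gamma> x)" by (simp add: cact_def)
    qed
  qed
  ultimately show ?thesis by blast
qed

end

section \<open>Equivalences that are the identity on morphisms\<close>

lemma alg_cat_simps:
  "Obj (alg_cat k Ob P) = Ob"
  "Hom (alg_cat k Ob P) A B = {f \<in> alg_hom k (fst A) (fst B). f \<in> extensional (carrier (fst A)) \<and> P A B f}"
  "Idt (alg_cat k Ob P) A = (\<lambda>x\<in>carrier (fst A). x)"
  "Cmp (alg_cat k Ob P) A B C g f = compose (carrier (fst A)) g f"
  by (simp_all add: alg_cat_def)

lemma category_alg_cat:
  assumes alg: "\<And>A. A \<in> Ob \<Longrightarrow> k_algebra k (fst A)"
    and id: "\<And>A. A \<in> Ob \<Longrightarrow> P A A (\<lambda>x\<in>carrier (fst A). x)"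
    and comp: "\<And>A B C f g. A \<in> Ob \<Longrightarrow> B \<in> Ob \<Longrightarrow> C \<in> Ob \<Longrightarrow> f \<in> alg_hom k (fst A) (fst B) \<Longrightarrow> g \<in> alg_hom k (fst B) (fst C) \<Longrightarrow>
      P A B f \<Longrightarrow> P B C g \<Longrightarrow> P A C (compose (carrier (fst A)) g f)"
  shows "category (alg_cat k Ob P)"
proof -
  have fcl: "f x \<in> carrier B" if "f \<in> alg_hom k A B" "x \<in> carrier A" for f A B x
    using linear_map_closed[OF alg_hom_linear[OF that(1)] that(2)] .
  have 1: "(\<lambda>x\<in>carrier (fst A). x) \<in> alg_hom k (fst A) (fst A)" if "A \<in> Ob" for A
    using alg_hom_restrict[OF alg[OF that] alg_hom_id] .
  have 2: "compose (carrier (fst A)) g f \<in> alg_hom k (fst A) (fst C)"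
    if "A \<in> Ob" "f \<in> alg_hom k (fst A) (fst B)" "g \<in> alg_hom k (fst B) (fst C)" for A B C f g
    unfolding compose_def using alg_hom_restrict[OF alg[OF that(1)] alg_hom_comp[OF that(3,2)]] .
  show ?thesis
    unfolding category_def alg_cat_simps
  proof (intro conjI ballI)
    fix A assume A: "A \<in> Ob"
    show "(\<lambda>x\<in>carrier (fst A). x) \<in> {f \<in> alg_hom k (fst A) (fst A). f \<in> extensional (carrier (fst A)) \<and> P A A f}"
      using 1[OF A] id[OF A] by simp
    fix B assume B: "B \<in> Ob"
    { fix f assume f: "f \<in> {f \<in> alg_hom k (fst A) (fst B). f \<in> extensional (carrier (fst A)) \<and> P A B f}"
      then have fx: "f \<in> extensional (carrier (fst A))" and fc: "\<And>x. x \<in> carrier (fst A) \<Longrightarrow> f x \<in> carrier (fst B)"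
        using fcl by auto
      show "compose (carrier (fst A)) f (\<lambda>x\<in>carrier (fst A). x) = f"
        by (rule extensionalityI[OF compose_extensional fx]) (simp add: compose_def)
      show "compose (carrier (fst A)) (\<lambda>x\<in>carrier (fst B). x) f = f"
        by (rule extensionalityI[OF compose_extensional fx]) (simp add: compose_def fc) }
    fix C assume C: "C \<in> Ob"
    { fix f g assume "f \<in> {f \<in> alg_hom k (fst A) (fst B). f \<in> extensional (carrier (fst A)) \<and> P A B f}"
        "g \<in> {f \<in> alg_hom k (fst B) (fst C). f \<in> extensional (carrier (fst B)) \<and> P B C f}"
      then show "compose (carrier (fst A)) g f \<in> {f \<in> alg_hom k (fst A) (fst C). f \<in> extensional (carrier (fst A)) \<and> P A C f}"
        using 2[OF A, of f B g C] comp[OF A B C, of f g] by (simp add: compose_extensional) }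
    fix D f g h
    assume "f \<in> {f \<in> alg_hom k (fst A) (fst B). f \<in> extensional (carrier (fst A)) \<and> P A B f}"
    then have "f \<in> carrier (fst A) \<rightarrow> carrier (fst B)" using fcl by auto
    then show "compose (carrier (fst A)) (compose (carrier (fst B)) h g) f = compose (carrier (fst A)) h (compose (carrier (fst A)) g f)"
      by (rule compose_assoc[symmetric])
  qed
qed

lemma identity_iso: "category C \<Longrightarrow> A \<in> Obj C \<Longrightarrow> is_iso C A A (Idt C A)"
  unfolding category_def is_iso_def by blast

lemma identity_natural: "category C \<Longrightarrow> A \<in> Obj C \<Longrightarrow> B \<in> Obj C \<Longrightarrow> f \<in> Hom C A B \<Longrightarrow>
  Cmp C A A B f (Idt C A) = Cmp C A B B (Idt C B) f"
  unfolding category_def by metis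

text \<open>
  If an assignment is bijective on objects and does not change the underlying algebras and the sets
  of morphisms, then its inverse is a functor and all composites are identities.  That the source is
  a category follows from the target.
\<close>

lemma alg_cat_equivalence:
  assumes bij: "bij_betw \<phi> Ob Ob'" and fst: "\<And>A. A \<in> Ob \<Longrightarrow> fst (\<phi> A) = fst A"
    and hom: "\<And>A B f. A \<in> Ob \<Longrightarrow> B \<in> Ob \<Longrightarrow> f \<in> alg_hom k (fst A) (fst B) \<Longrightarrow> P' (\<phi> A) (\<phi> B) f \<longleftrightarrow> P A B f"
    and cat: "category (alg_cat k Ob' P')"
  shows "equivalence_of_categories (alg_cat k Ob P) (alg_cat k Ob' P') (identical_on_morphisms \<phi>)"
proof -
  let ?C = "alg_cat k Ob P" and ?D = "alg_cat k Ob' P'"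
  have ob: "\<phi> A \<in> Ob'" if "A \<in> Ob" for A using bij that by (auto simp: bij_betw_def)
  have H: "Hom ?D (\<phi> A) (\<phi> B) = Hom ?C A B" if "A \<in> Ob" "B \<in> Ob" for A B
    using hom[OF that] fst that by (auto simp: alg_cat_simps)
  have I: "Idt ?D (\<phi> A) = Idt ?C A" if "A \<in> Ob" for A using fst that by (simp add: alg_cat_simps)
  have M: "Cmp ?D (\<phi> A) B' C' g f = Cmp ?C A B C g f" if "A \<in> Ob" for A B C B' C' f g using fst that by (simp add: alg_cat_simps)
  note O = alg_cat_simps(1)
  have catC: "category ?C"
    unfolding category_def O
  proof (intro conjI ballI)
    note d = cat[unfolded category_def O]
    fix A assume A: "A \<in> Ob"
    show "Idt ?C A \<in> Hom ?C A A" using d ob[OF A] H[OF A A] I[OF A] by metis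
    fix B assume B: "B \<in> Ob"
    { fix f assume f: "f \<in> Hom ?C A B"
      show "Cmp ?C A A B f (Idt ?C A) = f" "Cmp ?C A B B (Idt ?C B) f = f"
        using d ob[OF A] ob[OF B] f unfolding H[OF A B, symmetric] I[OF A, symmetric] I[OF B, symmetric]
          M[OF A, of "\<phi> A" "\<phi> B" _ _ A B, symmetric] M[OF A, of "\<phi> B" "\<phi> B" _ _ B B, symmetric] by blast+ }
    fix C assume C: "C \<in> Ob"
    { fix f g assume "f \<in> Hom ?C A B" "g \<in> Hom ?C B C"
      then show "Cmp ?C A B C g f \<in> Hom ?C A C"
        using d ob[OF A] ob[OF B] ob[OF C] unfolding H[OF A B, symmetric] H[OF B C, symmetric] H[OF A C, symmetric]
          M[OF A, of "\<phi> B" "\<phi> C" _ _ B C, symmetric] by blast }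
    fix E f g h assume E: "E \<in> Ob" and "f \<in> Hom ?C A B" "g \<in> Hom ?C B C" "h \<in> Hom ?C C E"
    then have "Cmp ?D (\<phi> A) (\<phi> B) (\<phi> E) (Cmp ?D (\<phi> B) (\<phi> C) (\<phi> E) h g) f = Cmp ?D (\<phi> A) (\<phi> C) (\<phi> E) h (Cmp ?D (\<phi> A) (\<phi> B) (\<phi> C) g f)"
      using d ob[OF A] ob[OF B] ob[OF C] ob[OF E] unfolding H[OF A B, symmetric] H[OF B C, symmetric] H[OF C E, symmetric] by blast
    then show "Cmp ?C A B E (Cmp ?C B C E h g) f = Cmp ?C A C E h (Cmp ?C A B C g f)"
      using fst A B by (simp add: alg_cat_simps)
  qed
  define \<psi> where "\<psi> = the_inv_into Ob \<phi>"
  have \<psi>: "\<psi> A \<in> Ob" "\<phi> (\<psi> A) = A" if "A \<in> Ob'" for A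
    using bij_betwE[OF bij_betw_the_inv_into[OF bij]] f_the_inv_into_f_bij_betw[OF bij] that by (auto simp: \<psi>_def)
  have \<psi>\<phi>: "\<psi> (\<phi> A) = A" if "A \<in> Ob" for A
    using bij that by (simp add: \<psi>_def bij_betw_def the_inv_into_f_f)
  have H': "Hom ?C (\<psi> A) (\<psi> B) = Hom ?D A B" if "A \<in> Ob'" "B \<in> Ob'" for A B
    using H[OF \<psi>(1)[OF that(1)] \<psi>(1)[OF that(2)]] that by (simp add: \<psi>)
  have fst': "fst (\<psi> A) = fst A" if "A \<in> Ob'" for A using fst[OF \<psi>(1)[OF that]] that by (simp add: \<psi>)
  show ?thesis
    unfolding equivalence_of_categories_def
  proof (intro conjI exI catC cat)
    let ?F = "identical_on_morphisms \<phi>" and ?G = "identical_on_morphisms \<psi>"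
    have f: "fob ?F A = \<phi> A" "fmor ?F A B f = f" "fob ?G A' = \<psi> A'" "fmor ?G A' B' f = f" for A B f A' B'
      by (simp_all add: identical_on_morphisms_def)
    show "is_functor ?C ?D ?F"
      unfolding is_functor_def O f using ob H I M by (simp add: fst alg_cat_simps(4))
    show "is_functor ?D ?C ?G"
      unfolding is_functor_def O f using \<psi> H' fst' by (simp add: alg_cat_simps(3,4))
    show "natural_iso ?C ?C id_func (comp_func ?G ?F) (Idt ?C)"
      unfolding natural_iso_def O
      using identity_iso[OF catC] identity_natural[OF catC] by (simp add: id_func_def comp_func_def f \<psi>\<phi> O)
    show "natural_iso ?D ?D (comp_func ?F ?G) id_func (Idt ?D)"
      unfolding natural_iso_def O
      using identity_iso[OF cat] identity_natural[OF cat] by (simp add: id_func_def comp_func_def f \<psi> O)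
  qed
qed

section \<open>The four functors on morphisms\<close>

context fd_hopf
begin

lemma left_colinear_iff:
  fixes X Y :: "('k, 'x) module"
  assumes X: "module k X" and Y: "module k Y" and \<alpha>: "linear_map k X (tensor k H X) \<alpha>" and \<alpha>': "linear_map k Y (tensor k H Y) \<alpha>'"
    and f: "linear_map k X Y f"
  shows "left_colinear k H X Y \<alpha> \<alpha>' f \<longleftrightarrow> (\<forall>x\<in>carrier X. \<forall>\<omega>\<in>carrier K'. f (lact X \<alpha> \<omega> x) = lact Y \<alpha>' \<omega> (f x))"
proof -
  note fcl = linear_map_closed[OF f] and acl = linear_map_closed[OF \<alpha>] and a'cl = linear_map_closed[OF \<alpha>']
  have sl: "ls k H Y (\<lambda>g. ev g \<omega>) (tmap k H X H Y (\<lambda>y. y) f z) = f (ls k H X (\<lambda>g. ev g \<omega>) z)"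
    if "\<omega> \<in> carrier K'" "z \<in> carrier (tensor k H X)" for \<omega> z
    by (rule tensor_ext[OF K X Y _ _ _ that(2)])
      (simp_all add: pr lin_comp[OF f] lin_app[OF f] X Y that(1) tmap_pure f fcl ls_pure linear_map_smult[OF f])
  have "\<alpha>' (f x) = tmap k H X H Y (\<lambda>y. y) f (\<alpha> x) \<longleftrightarrow> (\<forall>\<omega>\<in>carrier K'. f (lact X \<alpha> \<omega> x) = lact Y \<alpha>' \<omega> (f x))"
    if x: "x \<in> carrier X" for x
  proof -
    have "tmap k H X H Y (\<lambda>y. y) f (\<alpha> x) \<in> carrier (tensor k H Y)"
      using linear_map_closed[OF tmap_linear] X Y K f lin_id acl[OF x] by blast
    then have "\<alpha>' (f x) = tmap k H X H Y (\<lambda>y. y) f (\<alpha> x) \<longleftrightarrow>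
      (\<forall>\<omega>\<in>carrier K'. ls k H Y (\<lambda>g. ev g \<omega>) (\<alpha>' (f x)) = ls k H Y (\<lambda>g. ev g \<omega>) (tmap k H X H Y (\<lambda>y. y) f (\<alpha> x)))"
      by (metis ls_eqI[OF Y a'cl[OF fcl[OF x]]])
    then show ?thesis using sl[OF _ acl[OF x]] unfolding lact_def by metis
  qed
  then show ?thesis by (simp add: left_colinear_def)
qed

lemma right_colinear_iff:
  fixes X Y :: "('k, 'x) module"
  assumes X: "module k X" and Y: "module k Y" and \<beta>: "right_coaction k K' X \<beta>" and \<beta>': "right_coaction k K' Y \<beta>'"
    and f: "linear_map k X Y f"
  shows "right_colinear k K' X Y \<beta> \<beta>' f \<longleftrightarrow> (\<forall>x\<in>carrier X. \<forall>h\<in>carrier H. f (ract X \<beta> h x) = ract Y \<beta>' h (f x))"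
  unfolding HP.colinear_iff_equivariant[OF assms] equivariant_def HP.slice_action_def ract_def
  using linear_map_closed[OF f] by auto

lemma T_colinear_iff:
  fixes X Y :: "('k, 'x) module"
  assumes X: "module k X" and Y: "module k Y" and \<gamma>: "right_coaction k T X \<gamma>" and \<gamma>': "right_coaction k T Y \<gamma>'"
    and f: "linear_map k X Y f"
  shows "right_colinear k T X Y \<gamma> \<gamma>' f \<longleftrightarrow> (\<forall>x\<in>carrier X. \<forall>d\<in>carrier E. f (cact X \<gamma> d x) = cact Y \<gamma>' d (f x))"
  unfolding DP.colinear_iff_equivariant[OF assms] equivariant_def DP.slice_action_def cact_def rs_T D_carrier
  using linear_map_closed[OF f] by auto

text \<open>
  For operators: \<open>f\<close> commutes with all \<open>a\<^sub>\<omega> b\<^sub>h\<close> exactly when it commutes with all \<open>a\<^sub>\<omega>\<close> and all \<open>b\<^sub>h\<close>, as one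
  sees by inserting units.
\<close>

lemma gamma_colinear_iff:
  fixes X Y :: "('k, 'x) module"
  assumes Xa: "k_algebra k X" and Ya: "k_algebra k Y"
    and \<alpha>: "left_coaction k H X \<alpha>" and \<beta>: "right_coaction k K' X \<beta>" and yd: "yd_lr_condition k H X \<alpha> \<beta>"
    and \<alpha>': "left_coaction k H Y \<alpha>'" and \<beta>': "right_coaction k K' Y \<beta>'" and yd': "yd_lr_condition k H Y \<alpha>' \<beta>'"
    and f: "linear_map k X Y f"
  shows "right_colinear k T X Y (gamma X \<alpha> \<beta>) (gamma Y \<alpha>' \<beta>') f \<longleftrightarrow>
    left_colinear k H X Y \<alpha> \<alpha>' f \<and> right_colinear k K' X Y \<beta> \<beta>' f"
proof -
  note X = k_algebra_module[OF Xa] and Y = k_algebra_module[OF Ya]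
  note a = left_coactionD[OF \<alpha>] and b = HP.right_coactionD[OF \<beta>]
  note a' = left_coactionD[OF \<alpha>'] and b' = HP.right_coactionD[OF \<beta>']
  note Lc = \<alpha>[unfolded left_coaction_def left_coaction_iff[OF X a(2)], THEN conjunct2, THEN conjunct2]
  note Rc = \<beta>[unfolded right_coaction_def right_coaction_iff[OF Xa b(2)], THEN conjunct2, THEN conjunct2]
  note Lc' = \<alpha>'[unfolded left_coaction_def left_coaction_iff[OF Y a'(2)], THEN conjunct2, THEN conjunct2]
  note Rc' = \<beta>'[unfolded right_coaction_def right_coaction_iff[OF Ya b'(2)], THEN conjunct2, THEN conjunct2]
  note Ra = bilinear_map_closed[OF ract_bilinear[OF X b(2)]] and Ra' = bilinear_map_closed[OF ract_bilinear[OF Y b'(2)]]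
  note cg = cact_gamma[OF X a(2) b(2)] and cg' = cact_gamma[OF Y a'(2) b'(2)]
  note G = gamma_coaction[OF Xa \<alpha> \<beta> yd] and G' = gamma_coaction[OF Ya \<alpha>' \<beta>' yd']
  note gl = alg_hom_linear[OF gamma_alg_hom[OF Xa a(1) b(1)]] and gl' = alg_hom_linear[OF gamma_alg_hom[OF Ya a'(1) b'(1)]]
  note cb = cact_bilinear[OF X gl] and cb' = cact_bilinear[OF Y gl']
  note fcl = linear_map_closed[OF f] and u = one_closed[OF alg] one_closed[OF dual_alg]
  show ?thesis
    unfolding T_colinear_iff[OF X Y G G' f] left_colinear_iff[OF X Y a(2) a'(2) f] right_colinear_iff[OF X Y \<beta> \<beta>' f]
  proof (intro iffI conjI ballI)
    assume *: "\<forall>x\<in>carrier X. \<forall>d\<in>carrier E. f (cact X (gamma X \<alpha> \<beta>) d x) = cact Y (gamma Y \<alpha>' \<beta>') d (f x)"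
    have c: "f (lact X \<alpha> \<omega> (ract X \<beta> h x)) = lact Y \<alpha>' \<omega> (ract Y \<beta>' h (f x))"
      if "\<omega> \<in> carrier K'" "h \<in> carrier H" "x \<in> carrier X" for \<omega> h x
      using *[rule_format, OF that(3) pure_closed[OF that(1,2)]] that by (simp add: cg cg' fcl)
    show "f (lact X \<alpha> \<omega> x) = lact Y \<alpha>' \<omega> (f x)" if "x \<in> carrier X" "\<omega> \<in> carrier K'" for x \<omega>
      using c[OF that(2) u(1) that(1)] Rc Rc' fcl that by simp
    show "f (ract X \<beta> h x) = ract Y \<beta>' h (f x)" if "x \<in> carrier X" "h \<in> carrier H" for x h
      using c[OF u(2) that(2,1)] Lc Lc' fcl Ra Ra' that by simp
  next
    fix x d
    assume *: "(\<forall>x\<in>carrier X. \<forall>\<omega>\<in>carrier K'. f (lact X \<alpha> \<omega> x) = lact Y \<alpha>' \<omega> (f x)) \<and>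
       (\<forall>x\<in>carrier X. \<forall>h\<in>carrier H. f (ract X \<beta> h x) = ract Y \<beta>' h (f x))"
      and x: "x \<in> carrier X" and d: "d \<in> carrier E"
    show "f (cact X (gamma X \<alpha> \<beta>) d x) = cact Y (gamma Y \<alpha>' \<beta>') d (f x)"
      by (rule tensor_ext[OF L K Y lin_comp[OF f bilinear_map_left[OF cb x]] bilinear_map_left[OF cb' fcl[OF x]] _ d])
        (use * x in \<open>simp add: cg cg' fcl Ra Ra'\<close>)
  qed
qed

section \<open>The four functors on objects\<close>

lemma ComodAlg_to_ModAlg_object:
  fixes X :: "('k, 'x) module"
  assumes "k_algebra k X"
  shows "(\<lambda>d\<in>carrier D. \<lambda>x\<in>carrier X. induced_action k T X \<gamma> (D_pairing k H d) x) = DP.slice_action X \<gamma>"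
proof -
  have "induced_action k T X \<gamma> (D_pairing k H d) x = rs k X T (dpair d) (\<gamma> x)" for d x
    unfolding induced_action_def rs_def
    by (rule tlift_cong[OF k_algebra_module[OF assms] T.K]) (simp add: D_pairing_eq)
  then show ?thesis unfolding DP.slice_action_def by simp
qed

lemma YD_lr_to_YD_object:
  "(\<lambda>h\<in>carrier H. \<lambda>x\<in>carrier X. tlift k X K' X (\<lambda>y \<theta>. \<theta> h \<odot>\<^bsub>X\<^esub> y) (\<beta> x)) = HP.slice_action X \<beta>"
  unfolding HP.slice_action_def rs_def by (simp add: ev_def)

lemma slice_action_ract: "h \<in> carrier H \<Longrightarrow> x \<in> carrier X \<Longrightarrow> HP.slice_action X \<beta> h x = ract X \<beta> h x"
  by (simp add: HP.slice_action_def ract_def)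

text \<open>
  Both actions of \<open>\<omega> \<bowtie> h\<close> are \<open>a\<^sub>\<omega> b\<^sub>h\<close>.
\<close>

lemma square_object:
  fixes X :: "('k, 'x) module"
  assumes Xa: "k_algebra k X" and \<alpha>: "left_coaction k H X \<alpha>" and \<beta>: "right_coaction k K' X \<beta>"
  shows "(\<lambda>d\<in>carrier D. \<lambda>x\<in>carrier X. tlift k K' H X
      (\<lambda>\<omega> h. tlift k H X X (\<lambda>g y. \<omega> g \<odot>\<^bsub>X\<^esub> y) (\<alpha> (HP.slice_action X \<beta> h x))) d) =
    DP.slice_action X (gamma X \<alpha> \<beta>)"
proof -
  note X = k_algebra_module[OF Xa]
  note a = left_coactionD[OF \<alpha>] and b = HP.right_coactionD[OF \<beta>]
  note cb = cact_bilinear[OF X alg_hom_linear[OF gamma_alg_hom[OF Xa a(1) b(1)]]]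
  have "tlift k K' H X (\<lambda>\<omega> h. tlift k H X X (\<lambda>g y. \<omega> g \<odot>\<^bsub>X\<^esub> y) (\<alpha> (HP.slice_action X \<beta> h x))) d =
    rs k X T (dpair d) (gamma X \<alpha> \<beta> x)" if d: "d \<in> carrier E" and x: "x \<in> carrier X" for d x
  proof -
    have "rs k X T (dpair d) (gamma X \<alpha> \<beta> x) = tlift k K' H X (\<lambda>\<omega> h. cact X (gamma X \<alpha> \<beta>) (pure k K' H \<omega> h) x) d"
      using tlift_expand[OF L K X bilinear_map_left[OF cb x] d] by (simp add: cact_def rs_T)
    also have "\<dots> = tlift k K' H X (\<lambda>\<omega> h. tlift k H X X (\<lambda>g y. \<omega> g \<odot>\<^bsub>X\<^esub> y) (\<alpha> (HP.slice_action X \<beta> h x))) d"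
      by (rule tlift_cong[OF L K]) (simp add: cact_gamma[OF X a(2) b(2)] x slice_action_ract lact_def ls_def, simp add: ev_def)
    finally show ?thesis ..
  qed
  then show ?thesis
    unfolding DP.slice_action_def D_carrier by (intro restrict_ext) (simp add: fun_eq_iff)
qed

text \<open>
  The objects of the four categories, in the notation of the locale.
\<close>

definition lr_objects :: "('k, 'h, 'x) yd_lr_obj set"
  where "lr_objects = {(X, \<alpha>, \<beta>). k_algebra k X \<and> left_coaction k H X \<alpha> \<and> right_coaction k K' X \<beta> \<and> yd_lr_condition k H X \<alpha> \<beta>}"

definition yd_objects :: "('k, 'h, 'x) yd_obj set"
  where "yd_objects = {(X, act, \<alpha>). k_algebra k X \<and> left_action k H X act \<and> left_coaction k H X \<alpha> \<and> yd_condition k H X act \<alpha>}"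

definition comod_objects :: "('k, ('h, 'h \<Rightarrow> 'k) tensor, 'x) comod_obj set"
  where "comod_objects = {(X, \<gamma>). k_algebra k X \<and> right_coaction k T X \<gamma>}"

definition mod_objects :: "('k, ('h \<Rightarrow> 'k, 'h) tensor, 'x) mod_obj set"
  where "mod_objects = {(X, act). k_algebra k X \<and> left_action k D X act}"

lemma yd_condition_slice_action_iff:
  assumes Xa: "k_algebra k X" and \<alpha>: "left_coaction k H X \<alpha>" and \<beta>: "right_coaction k K' X \<beta>"
  shows "yd_condition k H X (HP.slice_action X \<beta>) \<alpha> \<longleftrightarrow> yd_lr_condition k H X \<alpha> \<beta>"
proof -
  note X = k_algebra_module[OF Xa]
  note a = left_coactionD[OF \<alpha>] and b = HP.right_coactionD[OF \<beta>]
  have bil: "bilinear_map k H X X (HP.slice_action X \<beta>)"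
    using HP.slice_action_left_action[OF Xa \<beta>] by (simp add: left_action_def)
  show ?thesis
    unfolding yd_condition_iff[OF X bil a(2)] yd_lr_condition_iff[OF Xa a(2) b(2)]
    using yd_op_cong[OF lact_bilinear[OF X a(2)] ract_bilinear[OF X b(2)] _ slice_action_ract[of _ _ X \<beta>]] by blast
qed

lemma bij_gamma: "bij_betw (\<lambda>(X, \<alpha>, \<beta>). (X, gamma X \<alpha> \<beta>)) lr_objects (comod_objects :: ('k, ('h, 'h \<Rightarrow> 'k) tensor, 'x) comod_obj set)"
proof (rule bij_betwI')
  fix A B :: "('k, 'h, 'x) yd_lr_obj" assume "A \<in> lr_objects" "B \<in> lr_objects"
  then show "((case A of (X, \<alpha>, \<beta>) \<Rightarrow> (X, gamma X \<alpha> \<beta>)) = (case B of (X, \<alpha>, \<beta>) \<Rightarrow> (X, gamma X \<alpha> \<beta>))) = (A = B)"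
    by (auto simp: lr_objects_def dest!: gamma_inj[rotated 5])
next
  fix A :: "('k, 'h, 'x) yd_lr_obj" assume "A \<in> lr_objects"
  then show "(case A of (X, \<alpha>, \<beta>) \<Rightarrow> (X, gamma X \<alpha> \<beta>)) \<in> comod_objects"
    using gamma_coaction by (auto simp: lr_objects_def comod_objects_def)
next
  fix B :: "('k, ('h, 'h \<Rightarrow> 'k) tensor, 'x) comod_obj" assume "B \<in> comod_objects"
  then obtain X \<gamma> where B: "B = (X, \<gamma>)" "k_algebra k X" "right_coaction k T X \<gamma>" by (auto simp: comod_objects_def)
  from gamma_surj[OF B(2,3)] obtain \<alpha> \<beta> where
    "left_coaction k H X \<alpha>" "right_coaction k K' X \<beta>" "yd_lr_condition k H X \<alpha> \<beta>" "gamma X \<alpha> \<beta> = \<gamma>" by blast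
  then show "\<exists>A\<in>lr_objects. B = (case A of (X, \<alpha>, \<beta>) \<Rightarrow> (X, gamma X \<alpha> \<beta>))"
    using B by (intro bexI[of _ "(X, \<alpha>, \<beta>)"]) (auto simp: lr_objects_def)
qed

lemma bij_slice_D: "bij_betw (\<lambda>(X, \<gamma>). (X, DP.slice_action X \<gamma>)) comod_objects (mod_objects :: ('k, ('h \<Rightarrow> 'k, 'h) tensor, 'x) mod_obj set)"
proof (rule bij_betwI')
  fix A B :: "('k, ('h, 'h \<Rightarrow> 'k) tensor, 'x) comod_obj" assume "A \<in> comod_objects" "B \<in> comod_objects"
  then show "((case A of (X, \<gamma>) \<Rightarrow> (X, DP.slice_action X \<gamma>)) = (case B of (X, \<gamma>) \<Rightarrow> (X, DP.slice_action X \<gamma>))) = (A = B)"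
    by (auto simp: comod_objects_def dest!: DP.slice_action_inj[OF k_algebra_module, rotated 3])
next
  fix A :: "('k, ('h, 'h \<Rightarrow> 'k) tensor, 'x) comod_obj" assume "A \<in> comod_objects"
  then show "(case A of (X, \<gamma>) \<Rightarrow> (X, DP.slice_action X \<gamma>)) \<in> mod_objects"
    using DP.slice_action_left_action by (auto simp: comod_objects_def mod_objects_def)
next
  fix B :: "('k, ('h \<Rightarrow> 'k, 'h) tensor, 'x) mod_obj" assume "B \<in> mod_objects"
  then obtain X act where B: "B = (X, act)" "k_algebra k X" "left_action k D X act" by (auto simp: mod_objects_def)
  from DP.slice_action_surj[OF B(2,3)] obtain \<gamma> where "right_coaction k T X \<gamma>" "DP.slice_action X \<gamma> = act" by blast
  then show "\<exists>A\<in>comod_objects. B = (case A of (X, \<gamma>) \<Rightarrow> (X, DP.slice_action X \<gamma>))"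
    using B by (intro bexI[of _ "(X, \<gamma>)"]) (auto simp: comod_objects_def)
qed

lemma bij_slice_H: "bij_betw (\<lambda>(X, \<alpha>, \<beta>). (X, HP.slice_action X \<beta>, \<alpha>)) lr_objects (yd_objects :: ('k, 'h, 'x) yd_obj set)"
proof (rule bij_betwI')
  fix A B :: "('k, 'h, 'x) yd_lr_obj" assume "A \<in> lr_objects" "B \<in> lr_objects"
  then show "((case A of (X, \<alpha>, \<beta>) \<Rightarrow> (X, HP.slice_action X \<beta>, \<alpha>)) = (case B of (X, \<alpha>, \<beta>) \<Rightarrow> (X, HP.slice_action X \<beta>, \<alpha>))) = (A = B)"
    by (auto simp: lr_objects_def dest!: HP.slice_action_inj[OF k_algebra_module, rotated 3])
next
  fix A :: "('k, 'h, 'x) yd_lr_obj" assume "A \<in> lr_objects"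
  then show "(case A of (X, \<alpha>, \<beta>) \<Rightarrow> (X, HP.slice_action X \<beta>, \<alpha>)) \<in> yd_objects"
    using HP.slice_action_left_action by (auto simp: lr_objects_def yd_objects_def yd_condition_slice_action_iff)
next
  fix B :: "('k, 'h, 'x) yd_obj" assume "B \<in> yd_objects"
  then obtain X act \<alpha> where B: "B = (X, act, \<alpha>)" "k_algebra k X" "left_action k H X act" "left_coaction k H X \<alpha>" "yd_condition k H X act \<alpha>"
    by (auto simp: yd_objects_def)
  from HP.slice_action_surj[OF B(2,3)] obtain \<beta> where "right_coaction k K' X \<beta>" "HP.slice_action X \<beta> = act" by blast
  then show "\<exists>A\<in>lr_objects. B = (case A of (X, \<alpha>, \<beta>) \<Rightarrow> (X, HP.slice_action X \<beta>, \<alpha>))"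
    using B yd_condition_slice_action_iff[OF B(2,4)] by (intro bexI[of _ "(X, \<alpha>, \<beta>)"]) (auto simp: lr_objects_def)
qed

section \<open>The square of equivalences\<close>

text \<open>
  The maps on objects of the four functors.
\<close>

abbreviation F_gamma :: "('k, 'h, 'x) yd_lr_obj \<Rightarrow> ('k, ('h, 'h \<Rightarrow> 'k) tensor, 'x) comod_obj"
  where "F_gamma \<equiv> \<lambda>(X, \<alpha>, \<beta>). (X, \<lambda>x\<in>carrier X. tassoc k X H (dual k H)
      (tmap k X (dual k H) (tensor k X H) (dual k H) (\<lambda>y. tflip k H X (\<alpha> y)) (\<lambda>\<theta>. \<theta>) (\<beta> x)))"

abbreviation F_D :: "('k, ('h, 'h \<Rightarrow> 'k) tensor, 'x) comod_obj \<Rightarrow> ('k, ('h \<Rightarrow> 'k, 'h) tensor, 'x) mod_obj"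
  where "F_D \<equiv> \<lambda>(X, \<gamma>). (X, \<lambda>d\<in>carrier (D_M k H). \<lambda>x\<in>carrier X. induced_action k (T_M k H) X \<gamma> (D_pairing k H d) x)"

abbreviation F_H :: "('k, 'h, 'x) yd_lr_obj \<Rightarrow> ('k, 'h, 'x) yd_obj"
  where "F_H \<equiv> \<lambda>(X, \<alpha>, \<beta>). (X, \<lambda>h\<in>carrier H. \<lambda>x\<in>carrier X. tlift k X (dual k H) X (\<lambda>y \<theta>. \<theta> h \<odot>\<^bsub>X\<^esub> y) (\<beta> x), \<alpha>)"

abbreviation F_E :: "('k, 'h, 'x) yd_obj \<Rightarrow> ('k, ('h \<Rightarrow> 'k, 'h) tensor, 'x) mod_obj"
  where "F_E \<equiv> \<lambda>(X, act, \<alpha>). (X, \<lambda>d\<in>carrier (D_M k H). \<lambda>x\<in>carrier X.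
      tlift k (dual k H) H X (\<lambda>\<omega> h. tlift k H X X (\<lambda>g y. \<omega> g \<odot>\<^bsub>X\<^esub> y) (\<alpha> (act h x))) d)"

lemma F_gamma_eq: "F_gamma (X, \<alpha>, \<beta>) = (X, gamma X \<alpha> \<beta>)"
  by (simp add: gamma_def)

lemma F_D_eq: "(X, \<gamma>) \<in> comod_objects \<Longrightarrow> F_D (X, \<gamma>) = (X, DP.slice_action X \<gamma>)"
  by (simp add: comod_objects_def ComodAlg_to_ModAlg_object)

lemma F_H_eq: "F_H (X, \<alpha>, \<beta>) = (X, HP.slice_action X \<beta>, \<alpha>)"
  by (simp only: prod.case YD_lr_to_YD_object)

lemma F_gamma_bij: "bij_betw F_gamma lr_objects comod_objects"
  using bij_gamma by (subst bij_betw_cong[where g = "\<lambda>(X, \<alpha>, \<beta>). (X, gamma X \<alpha> \<beta>)"]) (auto simp: gamma_def)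

lemma F_D_bij: "bij_betw F_D comod_objects mod_objects"
proof -
  have "F_D A = (case A of (X, \<gamma>) \<Rightarrow> (X, DP.slice_action X \<gamma>))" if "A \<in> comod_objects" for A
    using that by (cases A) (simp only: F_D_eq, simp only: prod.case)
  then show ?thesis by (rule iffD2[OF bij_betw_cong bij_slice_D])
qed

lemma F_H_bij: "bij_betw F_H lr_objects yd_objects"
  using bij_slice_H by (simp only: YD_lr_to_YD_object)

lemma square:
  assumes "A \<in> lr_objects"
  shows "F_D (F_gamma A) = F_E (F_H A)"
proof -
  obtain X \<alpha> \<beta> where A: "A = (X, \<alpha>, \<beta>)" by (cases A)
  then have a: "k_algebra k X" "left_coaction k H X \<alpha>" "right_coaction k K' X \<beta>" "yd_lr_condition k H X \<alpha> \<beta>"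
    using assms by (auto simp: lr_objects_def)
  have "F_D (F_gamma A) = (X, DP.slice_action X (gamma X \<alpha> \<beta>))"
    unfolding A F_gamma_eq by (rule F_D_eq) (simp add: comod_objects_def a gamma_coaction[OF a])
  also have "\<dots> = F_E (F_H A)"
    unfolding A F_H_eq by (simp only: prod.case square_object[OF a(1-3)])
  finally show ?thesis .
qed

text \<open>
  The remaining side of the square is bijective because the other three are.
\<close>

lemma F_E_bij: "bij_betw F_E yd_objects (mod_objects :: ('k, ('h \<Rightarrow> 'k, 'h) tensor, 'x) mod_obj set)"
proof -
  have "bij_betw (F_D \<circ> F_gamma) lr_objects (mod_objects :: ('k, ('h \<Rightarrow> 'k, 'h) tensor, 'x) mod_obj set)"
    using bij_betw_trans[OF F_gamma_bij F_D_bij] .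
  then have "bij_betw (F_E \<circ> F_H) lr_objects (mod_objects :: ('k, ('h \<Rightarrow> 'k, 'h) tensor, 'x) mod_obj set)"
    by (subst bij_betw_cong[where g = "F_D \<circ> F_gamma"]) (auto simp only: square o_apply)
  then show ?thesis using bij_betw_comp_iff[OF F_H_bij] by blast
qed

abbreviation P_lr :: "('k, 'h, 'x) yd_lr_obj \<Rightarrow> ('k, 'h, 'x) yd_lr_obj \<Rightarrow> ('x \<Rightarrow> 'x) \<Rightarrow> bool"
  where "P_lr \<equiv> \<lambda>(X, \<alpha>, \<beta>) (X', \<alpha>', \<beta>') f. left_colinear k H X X' \<alpha> \<alpha>' f \<and> right_colinear k (dual k H) X X' \<beta> \<beta>' f"

abbreviation P_yd :: "('k, 'h, 'x) yd_obj \<Rightarrow> ('k, 'h, 'x) yd_obj \<Rightarrow> ('x \<Rightarrow> 'x) \<Rightarrow> bool"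
  where "P_yd \<equiv> \<lambda>(X, act, \<alpha>) (X', act', \<alpha>') f. equivariant H X act act' f \<and> left_colinear k H X X' \<alpha> \<alpha>' f"

abbreviation P_comod :: "('k, ('h, 'h \<Rightarrow> 'k) tensor, 'x) comod_obj \<Rightarrow> ('k, ('h, 'h \<Rightarrow> 'k) tensor, 'x) comod_obj \<Rightarrow> ('x \<Rightarrow> 'x) \<Rightarrow> bool"
  where "P_comod \<equiv> \<lambda>(X, \<gamma>) (X', \<gamma>') f. right_colinear k T X X' \<gamma> \<gamma>' f"

abbreviation P_mod :: "('k, ('h \<Rightarrow> 'k, 'h) tensor, 'x) mod_obj \<Rightarrow> ('k, ('h \<Rightarrow> 'k, 'h) tensor, 'x) mod_obj \<Rightarrow> ('x \<Rightarrow> 'x) \<Rightarrow> bool"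
  where "P_mod \<equiv> \<lambda>(X, act) (X', act') f. equivariant D X act act' f"

lemma F_gamma_hom:
  assumes "A \<in> lr_objects" "B \<in> lr_objects" "f \<in> alg_hom k (fst A) (fst B)"
  shows "P_comod (F_gamma A) (F_gamma B) f \<longleftrightarrow> P_lr A B f"
proof -
  obtain X \<alpha> \<beta> where A: "A = (X, \<alpha>, \<beta>)" by (cases A)
  obtain Y \<alpha>' \<beta>' where B: "B = (Y, \<alpha>', \<beta>')" by (cases B)
  have "linear_map k X Y f" using assms(3) A B by (simp add: alg_hom_linear)
  then show ?thesis
    unfolding A B F_gamma_eq unfolding prod.case
    using assms A B by (intro gamma_colinear_iff) (auto simp: lr_objects_def)
qed

lemma F_D_hom:
  assumes "A \<in> comod_objects" "B \<in> comod_objects" "f \<in> alg_hom k (fst A) (fst B)"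
  shows "P_mod (F_D A) (F_D B) f \<longleftrightarrow> P_comod A B f"
proof -
  obtain X \<gamma> where A: "A = (X, \<gamma>)" by (cases A)
  obtain Y \<gamma>' where B: "B = (Y, \<gamma>')" by (cases B)
  have "linear_map k X Y f" using assms(3) A B by (simp add: alg_hom_linear)
  then show ?thesis
    unfolding A B F_D_eq[OF assms(1)[unfolded A]] F_D_eq[OF assms(2)[unfolded B]] unfolding prod.case
    using assms A B k_algebra_module by (intro DP.colinear_iff_equivariant[symmetric]) (auto simp: comod_objects_def)
qed

lemma F_H_hom:
  assumes "A \<in> lr_objects" "B \<in> lr_objects" "f \<in> alg_hom k (fst A) (fst B)"
  shows "P_yd (F_H A) (F_H B) f \<longleftrightarrow> P_lr A B f"
proof -
  obtain X \<alpha> \<beta> where A: "A = (X, \<alpha>, \<beta>)" by (cases A)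
  obtain Y \<alpha>' \<beta>' where B: "B = (Y, \<alpha>', \<beta>')" by (cases B)
  have f: "linear_map k X Y f" using assms(3) A B by (simp add: alg_hom_linear)
  have "right_colinear k K' X Y \<beta> \<beta>' f \<longleftrightarrow> equivariant H X (HP.slice_action X \<beta>) (HP.slice_action Y \<beta>') f"
    using assms A B f k_algebra_module by (intro HP.colinear_iff_equivariant) (auto simp: lr_objects_def)
  then show ?thesis unfolding A B F_H_eq unfolding prod.case by blast
qed

lemma F_fst: "fst (F_gamma A) = fst A" "fst (F_D B) = fst B" "fst (F_H A) = fst A" "fst (F_E C) = fst C"
  by (simp_all add: case_prod_beta)

lemma F_E_hom:
  assumes "A \<in> yd_objects" "B \<in> yd_objects" "f \<in> alg_hom k (fst A) (fst B)"
  shows "P_mod (F_E A) (F_E B) f \<longleftrightarrow> P_yd A B f"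
proof -
  obtain A' where A': "A' \<in> lr_objects" "A = F_H A'" using assms(1) unfolding bij_betw_imp_surj_on[OF F_H_bij, symmetric] by blast
  obtain B' where B': "B' \<in> lr_objects" "B = F_H B'" using assms(2) unfolding bij_betw_imp_surj_on[OF F_H_bij, symmetric] by blast
  have f: "f \<in> alg_hom k (fst A') (fst B')" using assms(3) unfolding A'(2) B'(2) F_fst .
  have g: "F_gamma A' \<in> comod_objects" "F_gamma B' \<in> comod_objects"
    by (rule bspec[OF bij_betwE[OF F_gamma_bij] A'(1)], rule bspec[OF bij_betwE[OF F_gamma_bij] B'(1)])
  have fg: "f \<in> alg_hom k (fst (F_gamma A')) (fst (F_gamma B'))" using f unfolding F_fst .
  show ?thesis
    unfolding A'(2) B'(2) square[OF A'(1), symmetric] square[OF B'(1), symmetric]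
    using F_D_hom[OF g fg] F_gamma_hom[OF A'(1) B'(1) f] F_H_hom[OF A'(1) B'(1) f] by blast
qed

lemma category_mod: "category (alg_cat k (mod_objects :: ('k, ('h \<Rightarrow> 'k, 'h) tensor, 'x) mod_obj set) P_mod)"
proof (rule category_alg_cat)
  show "k_algebra k (fst A)" if "A \<in> mod_objects" for A :: "('k, ('h \<Rightarrow> 'k, 'h) tensor, 'x) mod_obj"
    using that by (auto simp: mod_objects_def)
  show "P_mod A A (\<lambda>x\<in>carrier (fst A). x)" if "A \<in> mod_objects" for A :: "('k, ('h \<Rightarrow> 'k, 'h) tensor, 'x) mod_obj"
    using that by (auto simp: mod_objects_def equivariant_def left_action_def PiE_def Pi_def)
  show "P_mod A C (compose (carrier (fst A)) g f)"
    if "A \<in> mod_objects" "B \<in> mod_objects" "C \<in> mod_objects" "f \<in> alg_hom k (fst A) (fst B)" "g \<in> alg_hom k (fst B) (fst C)"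
      "P_mod A B f" "P_mod B C g" for A B C :: "('k, ('h \<Rightarrow> 'k, 'h) tensor, 'x) mod_obj" and f g
  proof -
    obtain X a where A: "A = (X, a)" by (cases A)
    obtain Y b where B: "B = (Y, b)" by (cases B)
    obtain Z c where C: "C = (Z, c)" by (cases C)
    have f: "f x \<in> carrier Y" if "x \<in> carrier X" for x
      using linear_map_closed[OF alg_hom_linear[OF \<open>f \<in> alg_hom k (fst A) (fst B)\<close>]] that by (simp add: A B)
    have a: "a h x \<in> carrier X" if "h \<in> carrier D" "x \<in> carrier X" for h x
      using \<open>A \<in> mod_objects\<close> that by (auto simp: A mod_objects_def left_action_def PiE_def Pi_def)
    show ?thesis using that f a by (simp add: A B C equivariant_def compose_def)
  qed
qed

lemma category_of_equivalence: "equivalence_of_categories C D' F \<Longrightarrow> category C"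
  by (simp add: equivalence_of_categories_def)

theorem square_of_equivalences:
  "equivalence_of_categories (YD_lr TYPE('x) k H) (ComodAlg TYPE('x) k (T_M k H)) (YD_lr_to_ComodAlg k H) \<and>
   equivalence_of_categories (ComodAlg TYPE('x) k (T_M k H)) (ModAlg TYPE('x) k (D_M k H)) (ComodAlg_to_ModAlg k H) \<and>
   equivalence_of_categories (YD_lr TYPE('x) k H) (YD TYPE('x) k H) (YD_lr_to_YD k H) \<and>
   equivalence_of_categories (YD TYPE('x) k H) (ModAlg TYPE('x) k (D_M k H)) (YD_to_ModAlg k H) \<and>
   func_eq_on (YD_lr TYPE('x) k H)
     (comp_func (ComodAlg_to_ModAlg k H) (YD_lr_to_ComodAlg k H))
     (comp_func (YD_to_ModAlg k H) (YD_lr_to_YD k H))"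
proof -
  have lr: "YD_lr TYPE('x) k H = alg_cat k lr_objects P_lr" by (simp add: YD_lr_def lr_objects_def)
  have yd: "YD TYPE('x) k H = alg_cat k yd_objects P_yd" by (simp add: YD_def yd_objects_def)
  have co: "ComodAlg TYPE('x) k T = alg_cat k comod_objects P_comod" by (simp add: ComodAlg_def comod_objects_def)
  have mo: "ModAlg TYPE('x) k D = alg_cat k mod_objects P_mod" by (simp add: ModAlg_def mod_objects_def)
  have DM: "equivalence_of_categories (alg_cat k comod_objects P_comod) (alg_cat k (mod_objects :: ('k, ('h \<Rightarrow> 'k, 'h) tensor, 'x) mod_obj set) P_mod)
    (identical_on_morphisms F_D)"
    by (rule alg_cat_equivalence[OF F_D_bij F_fst(2) F_D_hom category_mod])
  have GA: "equivalence_of_categories (alg_cat k lr_objects P_lr) (alg_cat k (comod_objects :: ('k, ('h, 'h \<Rightarrow> 'k) tensor, 'x) comod_obj set) P_comod)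
    (identical_on_morphisms F_gamma)"
    by (rule alg_cat_equivalence[OF F_gamma_bij F_fst(1) F_gamma_hom category_of_equivalence[OF DM]])
  have EM: "equivalence_of_categories (alg_cat k yd_objects P_yd) (alg_cat k (mod_objects :: ('k, ('h \<Rightarrow> 'k, 'h) tensor, 'x) mod_obj set) P_mod)
    (identical_on_morphisms F_E)"
    by (rule alg_cat_equivalence[OF F_E_bij F_fst(4) F_E_hom category_mod])
  have HM: "equivalence_of_categories (alg_cat k lr_objects P_lr) (alg_cat k (yd_objects :: ('k, 'h, 'x) yd_obj set) P_yd)
    (identical_on_morphisms F_H)"
    by (rule alg_cat_equivalence[OF F_H_bij F_fst(3) F_H_hom category_of_equivalence[OF EM]])
  show ?thesis
    unfolding lr yd co mo YD_lr_to_ComodAlg_def ComodAlg_to_ModAlg_def YD_lr_to_YD_def YD_to_ModAlg_def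
  proof (intro conjI GA DM HM EM)
    show "func_eq_on (alg_cat k (lr_objects :: ('k, 'h, 'x) yd_lr_obj set) P_lr)
      (comp_func (identical_on_morphisms F_D) (identical_on_morphisms F_gamma))
      (comp_func (identical_on_morphisms F_E) (identical_on_morphisms F_H))"
      unfolding func_eq_on_def comp_func_def identical_on_morphisms_def alg_cat_simps(1) func.select_convs
      by (intro conjI ballI HOL.refl) (rule square)
  qed
qed

end

theorem proposition5p3:
  fixes k :: "'k ring" and H :: "('k, 'h) bialg" and S :: "'h \<Rightarrow> 'h"
  assumes "field k" and "hopf_algebra k H S" and "finite_dimensional k H"
  shows "equivalence_of_categories (YD_lr TYPE('x) k H) (ComodAlg TYPE('x) k (T_M k H))
           (YD_lr_to_ComodAlg k H) \<and>
         equivalence_of_categories (ComodAlg TYPE('x) k (T_M k H)) (ModAlg TYPE('x) k (D_M k H))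
           (ComodAlg_to_ModAlg k H) \<and>
         equivalence_of_categories (YD_lr TYPE('x) k H) (YD TYPE('x) k H) (YD_lr_to_YD k H) \<and>
         equivalence_of_categories (YD TYPE('x) k H) (ModAlg TYPE('x) k (D_M k H))
           (YD_to_ModAlg k H) \<and>
         func_eq_on (YD_lr TYPE('x) k H)
           (comp_func (ComodAlg_to_ModAlg k H) (YD_lr_to_ComodAlg k H))
           (comp_func (YD_to_ModAlg k H) (YD_lr_to_YD k H))"
proof -
  interpret fd_hopf k H S using assms(2,3) by (rule fd_hopf.intro)
  show ?thesis by (rule square_of_equivalences)
qed

end
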